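(* Let $L$ be a ternary $\mathbb{Z}$-lattice representing $1$. Then $L$ is strongly $s$-regular if and only if $r(n^2,L)=r(n^2,\mathrm{gen}(L))$ for every integer $n$.
   Context: A ternary $\mathbb{Z}$-lattice is a positive definite $\mathbb{Z}$-lattice $L$ of rank $3$ with quadratic map $Q$ and bilinear form $B$, non-classic integral (the ideal generated by $Q(L)$ is $\mathbb{Z}$). $dL$ is the determinant of a Gram matrix; $4dL\in\mathbb{Z}$; for odd $p$, $\left(\frac{\pm dL}{p}\right):=\left(\frac{\pm4dL}{p}\right)$. $r(n,L)=\#\{x\in L:Q(x)=n\}$. For the genus $\mathrm{gen}(L)$ with isometry classes $[L']$, let $o(L')$ be the order of the isometry group of $L'$, $w(L)=\sum_{[L']\in\mathrm{gen}(L)}1/o(L')$ and $r(n,\mathrm{gen}(L))=\frac{1}{w(L)}\sum_{[L']\in\mathrm{gen}(L)}\frac{r(n,L')}{o(L')}$. Let $S$ be the set of $2$ and the odd primes dividing $4dL$. $L$ is strongly $s$-regular if it represents the square of some positive integer and for every positive integer $n=n_1n_2$ (prime factors of $n_1$ in $S$, $n_2$ coprime to all primes of $S$), $r(n_1^2n_2^2,L)=r(n_1^2,L)\prod_{p\notin S}h_p(dL,\mathrm{ord}_p(n))$ with $h_p(dL,\lambda)=\frac{p^{\lambda+1}-1}{p-1}-\left(\frac{-dL}{p}\right)\frac{p^{\lambda}-1}{p-1}$. *)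

theory Defs
  imports "HOL-Analysis.Determinants" "HOL-Number_Theory.Number_Theory"
begin

text \<open>
  A ternary lattice is given by the Gram matrix \<open>M\<close> of a basis: it is the standard lattice
  \<open>\<int>\<^sup>3\<close> inside the quadratic space \<open>\<rat>\<^sup>3\<close> with bilinear form \<open>B(x, y) = x\<^sup>T M y\<close> and \<open>Q(x) = B(x, x)\<close>.
\<close>

definition std_lattice :: "(rat ^ 3) set" where
  "std_lattice = {x. \<forall>i. x $ i \<in> \<int>}"

definition bilin :: "rat ^ 3 ^ 3 \<Rightarrow> rat ^ 3 \<Rightarrow> rat ^ 3 \<Rightarrow> rat" where
  "bilin M x y = (\<Sum>i\<in>UNIV. \<Sum>j\<in>UNIV. M $ i $ j * x $ i * y $ j)"

definition quad :: "rat ^ 3 ^ 3 \<Rightarrow> rat ^ 3 \<Rightarrow> rat" where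
  "quad M x = bilin M x x"

text \<open>The last conjunct says that the \<open>\<int>\<close>-submodule of \<open>\<rat>\<close> generated by \<open>Q(L)\<close> is \<open>\<int>\<close>.\<close>

definition ternary_lattice :: "rat ^ 3 ^ 3 \<Rightarrow> bool" where
  "ternary_lattice M \<longleftrightarrow>
     transpose M = M \<and>
     (\<forall>x. x \<noteq> 0 \<longrightarrow> quad M x > 0) \<and>
     Modules.module.span (\<lambda>(k::int) (q::rat). of_int k * q) (quad M ` std_lattice) = \<int>"

definition rep_num :: "int \<Rightarrow> rat ^ 3 ^ 3 \<Rightarrow> nat" where
  "rep_num n M = card {x \<in> std_lattice. quad M x = of_int n}"

definition represents :: "rat ^ 3 ^ 3 \<Rightarrow> int \<Rightarrow> bool" where
  "represents M n \<longleftrightarrow> (\<exists>x\<in>std_lattice. quad M x = of_int n)"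

subsection \<open>Isometries\<close>

definition space_isometry :: "rat ^ 3 ^ 3 \<Rightarrow> rat ^ 3 ^ 3 \<Rightarrow> (rat ^ 3 \<Rightarrow> rat ^ 3) \<Rightarrow> bool" where
  "space_isometry M N \<sigma> \<longleftrightarrow>
     Vector_Spaces.linear (*s) (*s) \<sigma> \<and> bij \<sigma> \<and> (\<forall>x y. bilin N (\<sigma> x) (\<sigma> y) = bilin M x y)"

definition lattice_isometry :: "rat ^ 3 ^ 3 \<Rightarrow> rat ^ 3 ^ 3 \<Rightarrow> (rat ^ 3 \<Rightarrow> rat ^ 3) \<Rightarrow> bool" where
  "lattice_isometry M N \<sigma> \<longleftrightarrow> space_isometry M N \<sigma> \<and> \<sigma> ` std_lattice = std_lattice"

definition isometric :: "rat ^ 3 ^ 3 \<Rightarrow> rat ^ 3 ^ 3 \<Rightarrow> bool" where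
  "isometric M N \<longleftrightarrow> (\<exists>\<sigma>. lattice_isometry M N \<sigma>)"

definition isom_order :: "rat ^ 3 ^ 3 \<Rightarrow> nat" where
  "isom_order M = card {\<sigma>. lattice_isometry M M \<sigma>}"

subsection \<open>The p-adic integers and local isometry\<close>

text \<open>\<open>\<int>\<^sub>p\<close> as the inverse limit of the rings \<open>\<int>/p\<^sup>k\<int>\<close>, residues being represented in \<open>{0..<p\<^sup>k}\<close>.\<close>

definition padic_int :: "nat \<Rightarrow> (nat \<Rightarrow> int) ring" where
  "padic_int p =
     \<lparr>carrier = {a. \<forall>k. a k \<in> {0..<int p ^ k} \<and> a (Suc k) mod int p ^ k = a k},
      mult = (\<lambda>a b k. (a k * b k) mod int p ^ k),
      one = (\<lambda>k. 1 mod int p ^ k),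
      zero = (\<lambda>k. 0),
      add = (\<lambda>a b k. (a k + b k) mod int p ^ k)\<rparr>"

definition padic_of_int :: "nat \<Rightarrow> int \<Rightarrow> (nat \<Rightarrow> int)" where
  "padic_of_int p c = (\<lambda>k. c mod int p ^ k)"

definition padic_lattice :: "nat \<Rightarrow> ((nat \<Rightarrow> int) ^ 3) set" where
  "padic_lattice p = {x. \<forall>i. x $ i \<in> carrier (padic_int p)}"

text \<open>
  The form \<open>2B\<close> on \<open>L\<^sub>p = \<int>\<^sub>p \<otimes> L\<close>: for a non-classic integral lattice \<open>2M\<close> has integer entries (see
  \<open>two_gram_int\<close> below), so \<open>2B\<close> takes values in \<open>\<int>\<^sub>p\<close>, and preserving \<open>2B\<close> is preserving \<open>B\<close>.
\<close>

definition padic_bilin2 ::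
    "nat \<Rightarrow> rat ^ 3 ^ 3 \<Rightarrow> (nat \<Rightarrow> int) ^ 3 \<Rightarrow> (nat \<Rightarrow> int) ^ 3 \<Rightarrow> (nat \<Rightarrow> int)" where
  "padic_bilin2 p M x y =
     (\<Oplus>\<^bsub>padic_int p\<^esub>i\<in>UNIV. \<Oplus>\<^bsub>padic_int p\<^esub>j\<in>UNIV.
        padic_of_int p \<lfloor>2 * M $ i $ j\<rfloor> \<otimes>\<^bsub>padic_int p\<^esub> x $ i \<otimes>\<^bsub>padic_int p\<^esub> y $ j)"

definition padic_isometric :: "nat \<Rightarrow> rat ^ 3 ^ 3 \<Rightarrow> rat ^ 3 ^ 3 \<Rightarrow> bool" where
  "padic_isometric p M N \<longleftrightarrow>
     (\<exists>\<sigma>. bij_betw \<sigma> (padic_lattice p) (padic_lattice p) \<and>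
       (\<forall>x\<in>padic_lattice p. \<forall>y\<in>padic_lattice p.
          \<sigma> (\<chi> i. x $ i \<oplus>\<^bsub>padic_int p\<^esub> y $ i) = (\<chi> i. \<sigma> x $ i \<oplus>\<^bsub>padic_int p\<^esub> \<sigma> y $ i)) \<and>
       (\<forall>c\<in>carrier (padic_int p). \<forall>x\<in>padic_lattice p.
          \<sigma> (\<chi> i. c \<otimes>\<^bsub>padic_int p\<^esub> x $ i) = (\<chi> i. c \<otimes>\<^bsub>padic_int p\<^esub> \<sigma> x $ i)) \<and>
       (\<forall>x\<in>padic_lattice p. \<forall>y\<in>padic_lattice p.
          padic_bilin2 p N (\<sigma> x) (\<sigma> y) = padic_bilin2 p M x y))"

subsection \<open>The genus\<close>

text \<open>
  As usual, the genus of \<open>L\<close> consists of the lattices on the quadratic space \<open>\<rat>L\<close> that are isometric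
  to \<open>L\<close> at every prime; a lattice with Gram matrix \<open>N\<close> lives on \<open>\<rat>L\<close> up to isometry iff the spaces
  of \<open>M\<close> and \<open>N\<close> are isometric.
\<close>

definition genus :: "rat ^ 3 ^ 3 \<Rightarrow> (rat ^ 3 ^ 3) set" where
  "genus M = {N. ternary_lattice N \<and> (\<exists>\<sigma>. space_isometry M N \<sigma>) \<and>
                 (\<forall>p. prime p \<longrightarrow> padic_isometric p M N)}"

definition genus_classes :: "rat ^ 3 ^ 3 \<Rightarrow> (rat ^ 3 ^ 3) set set" where
  "genus_classes M = genus M // {(N, N'). N \<in> genus M \<and> N' \<in> genus M \<and> isometric N N'}"

definition class_rep :: "(rat ^ 3 ^ 3) set \<Rightarrow> rat ^ 3 ^ 3" where
  "class_rep C = (SOME N. N \<in> C)"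

definition genus_mass :: "rat ^ 3 ^ 3 \<Rightarrow> rat" where
  "genus_mass M = (\<Sum>C\<in>genus_classes M. 1 / of_nat (isom_order (class_rep C)))"

definition genus_rep_num :: "int \<Rightarrow> rat ^ 3 ^ 3 \<Rightarrow> rat" where
  "genus_rep_num n M =
     1 / genus_mass M *
     (\<Sum>C\<in>genus_classes M. of_nat (rep_num n (class_rep C)) / of_nat (isom_order (class_rep C)))"

subsection \<open>Strong s-regularity\<close>

text \<open>The integer \<open>4dL\<close>; see \<open>four_disc_eq\<close> below for its integrality.\<close>

definition four_disc :: "rat ^ 3 ^ 3 \<Rightarrow> int" where
  "four_disc M = \<lfloor>4 * det M\<rfloor>"

definition bad_primes :: "rat ^ 3 ^ 3 \<Rightarrow> nat set" where
  "bad_primes M = {p. prime p \<and> (p = 2 \<or> int p dvd four_disc M)}"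

definition h_factor :: "rat ^ 3 ^ 3 \<Rightarrow> nat \<Rightarrow> nat \<Rightarrow> rat" where
  "h_factor M p l =
     (of_nat p ^ (l + 1) - 1) / (of_nat p - 1)
     - of_int (Legendre (- four_disc M) (int p)) * ((of_nat p ^ l - 1) / (of_nat p - 1))"

text \<open>
  Primes not dividing \<open>n\<close> contribute the factor \<open>h_factor M p 0 = 1\<close>, so the product over all primes
  outside the bad set is the finite product below.
\<close>

definition strongly_s_regular :: "rat ^ 3 ^ 3 \<Rightarrow> bool" where
  "strongly_s_regular M \<longleftrightarrow>
     (\<exists>m::int. m > 0 \<and> represents M (m ^ 2)) \<and>
     (\<forall>n n1 n2 :: nat. n > 0 \<longrightarrow> n = n1 * n2 \<longrightarrow>
        prime_factors n1 \<subseteq> bad_primes M \<longrightarrow> (\<forall>p\<in>bad_primes M. coprime n2 p) \<longrightarrow>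
        of_nat (rep_num (int n1 ^ 2 * int n2 ^ 2) M) =
          of_nat (rep_num (int n1 ^ 2) M) *
          (\<Prod>p\<in>prime_factors n - bad_primes M. h_factor M p (multiplicity p n)))"

subsection \<open>Well-definedness of the integral and p-adic data\<close>

lemma module_rat_int: "Modules.module (\<lambda>(k::int) (q::rat). of_int k * q)"
  by unfold_locales (auto simp: algebra_simps)

lemma quad_Ints:
  assumes "ternary_lattice M" "x \<in> std_lattice"
  shows "quad M x \<in> \<int>"
  using assms Modules.module.span_base[OF module_rat_int, of "quad M x" "quad M ` std_lattice"]
  by (auto simp: ternary_lattice_def)

lemma quad_expand:
  "quad M x = M$1$1 * x$1 * x$1 + M$1$2 * x$1 * x$2 + M$1$3 * x$1 * x$3
            + M$2$1 * x$2 * x$1 + M$2$2 * x$2 * x$2 + M$2$3 * x$2 * x$3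
            + M$3$1 * x$3 * x$1 + M$3$2 * x$3 * x$2 + M$3$3 * x$3 * x$3"
  by (simp add: quad_def bilin_def sum_3)

lemma gram_sym:
  assumes "ternary_lattice M"
  shows "M $ i $ j = M $ j $ i"
proof -
  have "M $ i $ j = transpose M $ i $ j"
    using assms by (simp add: ternary_lattice_def)
  then show ?thesis by (simp add: transpose_def)
qed

lemma gram_diag_int:
  assumes "ternary_lattice M"
  shows "M $ i $ i \<in> \<int>"
proof -
  have "quad M (axis i 1) \<in> \<int>"
    by (rule quad_Ints[OF assms]) (auto simp: std_lattice_def axis_def)
  moreover have "quad M (axis i 1) = M $ i $ i"
    using exhaust_3[of i] by (auto simp: quad_expand axis_def)
  ultimately show ?thesis by simp
qed

lemma two_gram_int:
  assumes "ternary_lattice M"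
  shows "2 * M $ i $ j \<in> \<int>"
proof (cases "i = j")
  case True
  then show ?thesis using gram_diag_int[OF assms, of i] by auto
next
  case False
  let ?x = "axis i 1 + axis j 1 :: rat ^ 3"
  have "quad M ?x \<in> \<int>"
    by (rule quad_Ints[OF assms]) (auto simp: std_lattice_def axis_def)
  moreover have "quad M ?x = M $ i $ i + M $ j $ j + 2 * M $ i $ j"
    using False exhaust_3[of i] exhaust_3[of j] gram_sym[OF assms, of i j]
    by (auto simp: quad_expand axis_def)
  ultimately have "M $ i $ i + M $ j $ j + 2 * M $ i $ j \<in> \<int>" by simp
  moreover have "M $ i $ i + M $ j $ j \<in> \<int>"
    using gram_diag_int[OF assms] by auto
  ultimately show ?thesis
    using Ints_diff[of "M $ i $ i + M $ j $ j + 2 * M $ i $ j" "M $ i $ i + M $ j $ j"] by simp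
qed

lemma four_disc_eq:
  assumes "ternary_lattice M"
  shows "of_int (four_disc M) = 4 * det M"
proof -
  obtain a b c where abc: "M$1$1 = of_int a" "M$2$2 = of_int b" "M$3$3 = of_int c"
    using gram_diag_int[OF assms] by (metis Ints_cases)
  obtain d e f where def: "2 * M$1$2 = of_int d" "2 * M$1$3 = of_int e" "2 * M$2$3 = of_int f"
    using two_gram_int[OF assms] by (metis Ints_cases)
  have hd: "M$1$2 = of_int d / 2" "M$1$3 = of_int e / 2" "M$2$3 = of_int f / 2"
    using def by auto
  have "4 * det M = of_int (4*a*b*c + d*e*f - a*f*f - b*e*e - c*d*d)"
    unfolding det_3 gram_sym[OF assms, of 2 1] gram_sym[OF assms, of 3 1] gram_sym[OF assms, of 3 2]
    by (simp add: abc hd field_simps)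
  then show ?thesis unfolding four_disc_def by simp
qed

lemma padic_memI:
  assumes "p > 0" "\<And>k. a k = b k mod int p ^ k" "\<And>k. b (Suc k) mod int p ^ k = b k mod int p ^ k"
  shows "a \<in> carrier (padic_int p)"
proof -
  have "b (Suc k) mod (int p * int p ^ k) mod int p ^ k = b k mod int p ^ k" for k
    using assms(3)[of k] by (metis dvd_triv_right mod_mod_cancel)
  then show ?thesis using assms(1,2) by (auto simp: padic_int_def)
qed

lemma padic_memD:
  assumes "a \<in> carrier (padic_int p)"
  shows "a k mod int p ^ k = a k" "a (Suc k) mod int p ^ k = a k mod int p ^ k"
proof -
  have "0 \<le> a k" "a k < int p ^ k" "a (Suc k) mod int p ^ k = a k"
    using assms by (auto simp: padic_int_def)
  then show "a k mod int p ^ k = a k" "a (Suc k) mod int p ^ k = a k mod int p ^ k"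
    by auto
qed

lemma padic_int_cring:
  assumes p: "p > 0"
  shows "Ring.cring (padic_int p)"
proof (rule cringI)
  let ?R = "padic_int p"
  have add: "a \<oplus>\<^bsub>?R\<^esub> b = (\<lambda>k. (a k + b k) mod int p ^ k)"
    and mult: "a \<otimes>\<^bsub>?R\<^esub> b = (\<lambda>k. (a k * b k) mod int p ^ k)"
    and zero: "\<zero>\<^bsub>?R\<^esub> = (\<lambda>k. 0)" and one: "\<one>\<^bsub>?R\<^esub> = (\<lambda>k. 1 mod int p ^ k)" for a b
    by (simp_all add: padic_int_def)
  have add_closed: "a \<oplus>\<^bsub>?R\<^esub> b \<in> carrier ?R" if "a \<in> carrier ?R" "b \<in> carrier ?R" for a b
    by (rule padic_memI[OF p, where b = "\<lambda>k. a k + b k"])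
      (auto simp: add intro: mod_add_cong padic_memD that)
  have mult_closed: "a \<otimes>\<^bsub>?R\<^esub> b \<in> carrier ?R" if "a \<in> carrier ?R" "b \<in> carrier ?R" for a b
    by (rule padic_memI[OF p, where b = "\<lambda>k. a k * b k"])
      (auto simp: mult intro: mod_mult_cong padic_memD that)
  have zero_closed: "\<zero>\<^bsub>?R\<^esub> \<in> carrier ?R"
    by (rule padic_memI[OF p, where b = "\<lambda>k. 0"]) (auto simp: zero)
  have one_closed: "\<one>\<^bsub>?R\<^esub> \<in> carrier ?R"
    by (rule padic_memI[OF p, where b = "\<lambda>k. 1"]) (auto simp: one)
  show "abelian_group ?R"
  proof (rule abelian_groupI)
    fix x assume x: "x \<in> carrier ?R"
    let ?y = "\<lambda>k. (- x k) mod int p ^ k"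
    have "?y \<in> carrier ?R"
      by (rule padic_memI[OF p, where b = "\<lambda>k. - x k"])
        (auto intro: mod_minus_cong padic_memD[OF x])
    moreover have "?y \<oplus>\<^bsub>?R\<^esub> x = \<zero>\<^bsub>?R\<^esub>"
      by (auto simp: add zero mod_add_left_eq)
    ultimately show "\<exists>y\<in>carrier ?R. y \<oplus>\<^bsub>?R\<^esub> x = \<zero>\<^bsub>?R\<^esub>" by blast
  qed (auto simp: add_closed zero_closed, auto simp: add zero mod_add_left_eq mod_add_right_eq
        algebra_simps padic_memD)
  show "Group.comm_monoid ?R"
    by (rule comm_monoidI)
      (auto simp: mult_closed one_closed, auto simp: mult one mod_mult_left_eq mod_mult_right_eq
        algebra_simps padic_memD)
  show "(x \<oplus>\<^bsub>?R\<^esub> y) \<otimes>\<^bsub>?R\<^esub> z = x \<otimes>\<^bsub>?R\<^esub> z \<oplus>\<^bsub>?R\<^esub> y \<otimes>\<^bsub>?R\<^esub> z"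
    if "x \<in> carrier ?R" "y \<in> carrier ?R" "z \<in> carrier ?R" for x y z
    unfolding add mult by (rule ext) (metis distrib_right mod_add_eq mod_mult_left_eq)
qed

lemma padic_of_int_closed: "p > 0 \<Longrightarrow> padic_of_int p c \<in> carrier (padic_int p)"
  by (rule padic_memI[where b = "\<lambda>k. c"]) (auto simp: padic_of_int_def)

end

theory Submission
  imports Defs
begin

text \<open>
  For a prime \<open>p\<close> outside \<open>S\<close> every lattice in the genus has \<open>p + 1\<close> neighbours at \<open>p\<close>, one for each
  isotropic line modulo \<open>p\<close>. Counting the neighbours that contain a given vector gives the Hecke relation
  \<open>\<Sum>\<^sub>L r(m\<^sup>2, L) = r(p\<^sup>2m\<^sup>2) + (-dL/p) r(m\<^sup>2)\<close> for \<open>p\<close> prime to \<open>m\<close>, with last term \<open>p r(m\<^sup>2/p\<^sup>2)\<close> if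
  \<open>p\<close> divides \<open>m\<close>. The neighbour operator is self-adjoint for the weights \<open>1/o(L)\<close>, so the averages
  \<open>r(m\<^sup>2, gen(L))\<close> satisfy the recursion that defines the product of the
  \<open>h\<^sub>p\<close>. Hence equality with the averages implies strong s-regularity.

  Conversely, strong s-regularity says that evaluation at the class of \<open>L\<close> is invariant under the lazy
  random walks along neighbours, on the span of the functions \<open>r(n\<^sub>1\<^sup>2k\<^sup>2, \<cdot>)\<close> with \<open>k\<close> prime to \<open>S\<close>. The walk
  connects all classes and therefore converges to the average, so \<open>r(n\<^sup>2, L)\<close> is the average.
  Connectedness comes from weak approximation for rational isometries at the primes of \<open>S\<close>: these
  are adjusted one prime at a time by reflections in vectors close to \<open>v\<^sub>0\<close> at the earlier primes, where
  \<open>Q(v\<^sub>0) = 1\<close>, which is where the representation of \<open>1\<close> is used.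
\<close>

subsection \<open>Forms, integral matrices and isometries\<close>

text \<open>No single prime is claimed to give a connected or aperiodic walk. Steps along several
  primes are therefore concatenated, and each step stays put with weight 1/2. Strong s-regularity
  gives invariance at one class only, the class of L. This suffices: the span is stable, so the
  value at L and the mean stay fixed along the walk while the oscillation of the function tends to
  0. The number p + 1 is the eigenvalue of the neighbour operator on constants and also the sum of
  the characteristic roots 1 and p of the recursion for \<open>h_factor\<close>; this is why the two
  recursions agree. The obstacle is connectedness: neighbours at primes outside S link a class to L
  only through a rational isometry that is integral at S. Correcting an isometry at a new prime must
  not spoil the earlier ones. A vector congruent to a lattice vector of norm 1 modulo q has norm a
  unit at q, also for q = 2, so its reflection is integral at q. No p-adic field is built: a p-adic
  isometry is used through integral vectors whose Gram matrix is correct modulo p^n, and limits are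
  expressed by divisibility of rational numbers.\<close>

lemma bilin_add_left: "bilin M (x + y) z = bilin M x z + bilin M y z"
  by (simp add: bilin_def algebra_simps sum.distrib)

lemma bilin_add_right: "bilin M z (x + y) = bilin M z x + bilin M z y"
  by (simp add: bilin_def algebra_simps sum.distrib)

lemma bilin_scale_left: "bilin M (c *s x) y = c * bilin M x y"
  by (simp add: bilin_def sum_distrib_left algebra_simps)

lemma bilin_scale_right: "bilin M x (c *s y) = c * bilin M x y"
  by (simp add: bilin_def sum_distrib_left algebra_simps)

lemma bilin_diff_left: "bilin M (x - y) z = bilin M x z - bilin M y z"
  by (simp add: bilin_def algebra_simps sum_subtractf)

lemma bilin_diff_right: "bilin M z (x - y) = bilin M z x - bilin M z y"
  by (simp add: bilin_def algebra_simps sum_subtractf)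

lemma bilin_zero [simp]: "bilin M 0 y = 0" "bilin M x 0 = 0"
  by (simp_all add: bilin_def)

lemmas bilin_linear = bilin_add_left bilin_add_right bilin_scale_left bilin_scale_right
  bilin_diff_left bilin_diff_right

lemma bilin_commute:
  assumes "transpose M = M"
  shows "bilin M x y = bilin M y x"
proof -
  have *: "M $ i $ j = M $ j $ i" for i j
  proof -
    have "transpose M $ i $ j = M $ j $ i" by (simp add: transpose_def)
    then show ?thesis by (simp add: assms)
  qed
  have "(\<Sum>i\<in>UNIV. \<Sum>j\<in>UNIV. M $ i $ j * x $ i * y $ j) =
        (\<Sum>j\<in>UNIV. \<Sum>i\<in>UNIV. M $ i $ j * x $ i * y $ j)" by (rule sum.swap)
  also have "\<dots> = (\<Sum>j\<in>UNIV. \<Sum>i\<in>UNIV. M $ j $ i * y $ j * x $ i)"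
    by (intro sum.cong refl) (subst *, simp only: mult_ac)
  finally show ?thesis by (simp only: bilin_def)
qed

lemma bilin_axis: "bilin M (axis i 1) (axis j 1) = M $ i $ j"
  by (simp add: bilin_def axis_def if_distrib[of "\<lambda>x. _ * x"] if_distrib[of "\<lambda>x. x * _"]
      cong: if_cong)

lemma bilin_eq_imp_matrix_eq:
  assumes "\<And>x y. bilin M x y = bilin N x y"
  shows "M = N"
  using assms[of "axis _ 1" "axis _ 1"] by (simp add: bilin_axis vec_eq_iff)

definition gram :: "rat ^ 3 ^ 3 \<Rightarrow> rat ^ 3 ^ 3 \<Rightarrow> rat ^ 3 ^ 3" where
  "gram M A = transpose A ** M ** A"

lemma bilin_inner: "bilin M x y = (\<Sum>i\<in>UNIV. x $ i * (M *v y) $ i)"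
  by (simp add: bilin_def matrix_vector_mult_def sum_distrib_left algebra_simps)

lemma inner_transpose:
  fixes A :: "rat ^ 3 ^ 3"
  shows "(\<Sum>i\<in>UNIV. x $ i * (transpose A *v y) $ i) = (\<Sum>i\<in>UNIV. (A *v x) $ i * y $ i)"
  by (simp add: matrix_vector_mult_def transpose_def sum_distrib_left sum_distrib_right
      algebra_simps) (rule sum.swap)

lemma bilin_gram: "bilin (gram M A) x y = bilin M (A *v x) (A *v y)"
  unfolding bilin_inner gram_def
  by (simp add: matrix_vector_mul_assoc[symmetric] inner_transpose del: transpose_matrix_vector)

lemma quad_gram: "quad (gram M A) x = quad M (A *v x)"
  by (simp add: quad_def bilin_gram)

lemma transpose_gram: "transpose M = M \<Longrightarrow> transpose (gram M A) = gram M A"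
  by (simp add: gram_def matrix_transpose_mul matrix_mul_assoc)

lemma det_gram: "det (gram M A) = det A ^ 2 * det M"
  by (simp add: gram_def det_mul power2_eq_square)

lemma gram_gram: "gram (gram M A) B = gram M (A ** B)"
  by (simp add: gram_def matrix_transpose_mul matrix_mul_assoc)

definition int_mat :: "rat ^ 3 ^ 3 \<Rightarrow> bool" where
  "int_mat A \<longleftrightarrow> (\<forall>i j. A $ i $ j \<in> \<int>)"

lemma std_lattice_add: "x \<in> std_lattice \<Longrightarrow> y \<in> std_lattice \<Longrightarrow> x + y \<in> std_lattice"
  by (auto simp: std_lattice_def)

lemma std_lattice_scale: "c \<in> \<int> \<Longrightarrow> x \<in> std_lattice \<Longrightarrow> c *s x \<in> std_lattice"
  by (auto simp: std_lattice_def)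

lemma std_lattice_axis [simp]: "axis i 1 \<in> std_lattice"
  by (auto simp: std_lattice_def axis_def)

lemma std_lattice_zero [simp]: "0 \<in> std_lattice"
  by (auto simp: std_lattice_def)

lemma int_mat_std: "int_mat A \<Longrightarrow> x \<in> std_lattice \<Longrightarrow> A *v x \<in> std_lattice"
  by (auto simp: int_mat_def std_lattice_def matrix_vector_mult_def)

lemma matrix_axis: "(A *v axis j 1) $ i = (A :: rat ^ 3 ^ 3) $ i $ j"
  by (simp add: matrix_vector_mult_def axis_def if_distrib[of "\<lambda>x. _ * x"] cong: if_cong)

lemma int_mat_iff: "int_mat A \<longleftrightarrow> (\<forall>x\<in>std_lattice. A *v x \<in> std_lattice)"
proof
  assume *: "\<forall>x\<in>std_lattice. A *v x \<in> std_lattice"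
  have "A $ i $ j \<in> \<int>" for i j
  proof -
    have "(A *v axis j 1) $ i \<in> \<int>" using * std_lattice_axis[of j] unfolding std_lattice_def by blast
    then show ?thesis by (simp only: matrix_axis)
  qed
  then show "int_mat A" by (auto simp: int_mat_def)
qed (auto simp: int_mat_std)

lemma int_mat_mult: "int_mat A \<Longrightarrow> int_mat B \<Longrightarrow> int_mat (A ** B)"
  by (auto simp: int_mat_iff matrix_vector_mul_assoc[symmetric])

lemma int_mat_det: "int_mat A \<Longrightarrow> det A \<in> \<int>"
  unfolding det_3 int_mat_def by (intro Ints_add Ints_diff Ints_mult) auto

lemma std_lattice_expand:
  fixes x :: "rat ^ 3"
  shows "x = x $ 1 *s axis 1 1 + x $ 2 *s axis 2 1 + x $ 3 *s axis 3 1"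
  by (simp add: vec_eq_iff forall_3 axis_def)

text \<open>Cramer's rule: each numerator is the determinant of an integral matrix, so the factor
  \<open>det A\<close> clears all denominators. If \<open>det A = 0\<close> the right-hand side
  vanishes and \<open>x = 0\<close> serves.\<close>

lemma int_mat_solve:
  assumes "int_mat A" "b \<in> std_lattice"
  shows "\<exists>x\<in>std_lattice. A *v x = det A *s b"
proof (cases "det A = 0")
  case True
  then show ?thesis by (intro bexI[of _ 0]) auto
next
  case False
  define x :: "rat ^ 3" where
    "x = (\<chi> k. det (\<chi> i j. if j = k then b $ i else A $ i $ j))"
  have "int_mat (\<chi> i j. if j = k then b $ i else A $ i $ j)" for k
    using assms by (auto simp: int_mat_def std_lattice_def)
  then have x: "x \<in> std_lattice"
    by (auto simp: x_def std_lattice_def intro: int_mat_det)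
  have "A *v (\<chi> k. x $ k / det A) = b"
    unfolding cramer[OF False] by (simp add: x_def)
  moreover have "x = det A *s (\<chi> k. x $ k / det A)"
    using False by (simp add: vec_eq_iff)
  ultimately have "A *v x = det A *s b"
    by (metis vector_scalar_commute)
  with x show ?thesis by blast
qed

text \<open>Solving with right-hand side \<open>det A *s b\<close> instead of \<open>b\<close> turns
  the factor of \<open>int_mat_solve\<close> into \<open>det A ^ 2 = 1\<close>.\<close>

lemma int_mat_unimodular_image:
  assumes "int_mat A" "det A ^ 2 = 1"
  shows "(*v) A ` std_lattice = std_lattice"
proof
  show "(*v) A ` std_lattice \<subseteq> std_lattice" using int_mat_std[OF assms(1)] by auto
  show "std_lattice \<subseteq> (*v) A ` std_lattice"
  proof
    fix b assume b: "b \<in> std_lattice"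
    have "det A *s b \<in> std_lattice"
      using b by (intro std_lattice_scale int_mat_det assms)
    then obtain x where "x \<in> std_lattice" "A *v x = det A *s (det A *s b)"
      using int_mat_solve[OF assms(1)] by blast
    moreover have "det A *s (det A *s b) = b"
      using assms(2) by (simp add: power2_eq_square vec_eq_iff mult.assoc[symmetric])
    ultimately show "b \<in> (*v) A ` std_lattice" by force
  qed
qed

lemma space_isometry_matrix:
  assumes "space_isometry M N \<sigma>"
  obtains A where "\<sigma> = (*v) A" "gram N A = M"
proof
  have *: "\<sigma> x = matrix \<sigma> *v x" for x
    using assms matrix_works[of \<sigma> x] by (simp add: space_isometry_def)
  show "\<sigma> = (*v) (matrix \<sigma>)" using * by auto
  show "gram N (matrix \<sigma>) = M"
  proof (rule bilin_eq_imp_matrix_eq)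
    fix x y
    have "bilin N (\<sigma> x) (\<sigma> y) = bilin M x y" using assms unfolding space_isometry_def by blast
    then show "bilin (gram N (matrix \<sigma>)) x y = bilin M x y" by (simp only: bilin_gram *[of x] *[of y])
  qed
qed

lemma matrix_space_isometry:
  assumes "gram N A = M" "det M \<noteq> 0"
  shows "space_isometry M N ((*v) A)"
proof -
  have "det A \<noteq> 0" using assms det_gram[of N A] by auto
  then have "invertible A" by (simp add: invertible_det_nz)
  then have "bij ((*v) A)"
    by (simp add: invertible_eq_bij)
  then show ?thesis
    unfolding space_isometry_def using assms(1)
    by (auto simp: bilin_gram[symmetric] matrix_vector_mul_linear_gen)
qed

lemma space_isometry_id: "space_isometry M M (\<lambda>x. x)"
  by (simp add: space_isometry_def vec.linear_ident bij_betw_def)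

lemma space_isometry_comp:
  assumes "space_isometry M N \<sigma>" "space_isometry N P \<tau>"
  shows "space_isometry M P (\<lambda>x. \<tau> (\<sigma> x))"
  using assms bij_comp[of \<sigma> \<tau>] Vector_Spaces.linear_compose[of "(*s)" "(*s)" \<sigma> "(*s)" \<tau>]
  by (auto simp: space_isometry_def o_def)

abbreviation finv :: "('a \<Rightarrow> 'b) \<Rightarrow> 'b \<Rightarrow> 'a" where
  "finv \<equiv> inv_into UNIV"

lemma space_isometry_bilin: "space_isometry M N \<sigma> \<Longrightarrow> bilin N (\<sigma> x) (\<sigma> y) = bilin M x y"
  by (simp add: space_isometry_def)

lemma space_isometry_quad: "space_isometry M N \<sigma> \<Longrightarrow> quad N (\<sigma> x) = quad M x"
  by (simp add: space_isometry_def quad_def)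

lemma space_isometry_add: "space_isometry M N \<sigma> \<Longrightarrow> \<sigma> (x + y) = \<sigma> x + \<sigma> y"
  by (auto simp: space_isometry_def intro: vec.linear_add)

lemma space_isometry_scale: "space_isometry M N \<sigma> \<Longrightarrow> \<sigma> (c *s x) = c *s \<sigma> x"
  by (auto simp: space_isometry_def intro: vec.linear_scale)

lemma space_isometry_inj: "space_isometry M N \<sigma> \<Longrightarrow> inj \<sigma>"
  by (simp add: space_isometry_def bij_is_inj)

lemma space_isometry_inv_simps:
  assumes "space_isometry M N \<sigma>"
  shows "\<sigma> (finv \<sigma> x) = x" "finv \<sigma> (\<sigma> x) = x"
  using assms by (simp_all add: space_isometry_def bij_is_surj surj_f_inv_f bij_is_inj)

lemma space_isometry_inv:
  assumes "space_isometry M N \<sigma>"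
  shows "space_isometry N M (finv \<sigma>)"
proof -
  note [simp] = space_isometry_inv_simps[OF assms]
  note inj = injD[OF space_isometry_inj[OF assms]]
  have "finv \<sigma> (x + y) = finv \<sigma> x + finv \<sigma> y" for x y
    by (rule inj) (simp add: space_isometry_add[OF assms])
  moreover have "finv \<sigma> (c *s x) = c *s finv \<sigma> x" for c x
    by (rule inj) (simp add: space_isometry_scale[OF assms])
  ultimately have "Vector_Spaces.linear (*s) (*s) (finv \<sigma>)"
    by (simp add: Vector_Spaces.linear_iff vec.vector_space_axioms)
  moreover have "bilin M (finv \<sigma> x) (finv \<sigma> y) = bilin N x y" for x y
    using space_isometry_bilin[OF assms, of "finv \<sigma> x" "finv \<sigma> y"] by simp
  moreover have "bij (finv \<sigma>)" using assms by (simp add: space_isometry_def bij_imp_bij_inv)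
  ultimately show ?thesis by (simp add: space_isometry_def)
qed

text \<open>The index of the image is the absolute value of \<open>det A\<close>, and comparing
  discriminants gives \<open>det A ^ 2 = 1\<close>. Inclusions between lattices of equal determinant
  are turned into equalities by this argument.\<close>

lemma isometry_into_imp_onto:
  assumes "space_isometry M N \<sigma>" "det M = det N" "det N \<noteq> 0"
    "\<And>x. x \<in> std_lattice \<Longrightarrow> \<sigma> x \<in> std_lattice"
  shows "\<sigma> ` std_lattice = std_lattice"
proof -
  obtain A where A: "\<sigma> = (*v) A" "gram N A = M" using space_isometry_matrix[OF assms(1)] .
  have "int_mat A" using assms(4) by (simp add: int_mat_iff A)
  moreover have "det A ^ 2 = 1" using det_gram[of N A] A assms(2,3) by simp
  ultimately show ?thesis unfolding A using int_mat_unimodular_image by blast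
qed

lemma lattice_isometry_id: "lattice_isometry M M (\<lambda>x. x)"
  by (simp add: lattice_isometry_def space_isometry_id)

lemma lattice_isometry_comp:
  assumes "lattice_isometry M N \<sigma>" "lattice_isometry N P \<tau>"
  shows "lattice_isometry M P (\<lambda>x. \<tau> (\<sigma> x))"
  using assms space_isometry_comp[of M N \<sigma> P \<tau>]
  by (simp add: lattice_isometry_def image_image[symmetric])

lemma lattice_isometry_inv:
  assumes "lattice_isometry M N \<sigma>"
  shows "lattice_isometry N M (finv \<sigma>)"
proof -
  have s: "space_isometry M N \<sigma>" and "\<sigma> ` std_lattice = std_lattice"
    using assms by (auto simp: lattice_isometry_def)
  then have "finv \<sigma> ` std_lattice = std_lattice"
    by (metis space_isometry_inj image_inv_f_f)
  then show ?thesis using space_isometry_inv[OF s] by (simp add: lattice_isometry_def)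
qed

lemma isometric_refl: "isometric M M"
  using lattice_isometry_id isometric_def by blast

lemma isometric_sym: "isometric M N \<Longrightarrow> isometric N M"
  using lattice_isometry_inv isometric_def by blast

lemma isometric_trans: "isometric M N \<Longrightarrow> isometric N P \<Longrightarrow> isometric M P"
  unfolding isometric_def using lattice_isometry_comp by blast

lemma rep_num_isometric:
  assumes "isometric M N"
  shows "rep_num n M = rep_num n N"
proof -
  obtain \<sigma> where s: "space_isometry M N \<sigma>" "\<sigma> ` std_lattice = std_lattice"
    using assms by (auto simp: isometric_def lattice_isometry_def)
  have "{x \<in> std_lattice. quad N x = of_int n} = \<sigma> ` {x \<in> std_lattice. quad M x = of_int n}"
  proof
    show "{x \<in> std_lattice. quad N x = of_int n} \<subseteq> \<sigma> ` {x \<in> std_lattice. quad M x = of_int n}"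
    proof
      fix y assume y: "y \<in> {x \<in> std_lattice. quad N x = of_int n}"
      then obtain x where "x \<in> std_lattice" "y = \<sigma> x" using s(2) by blast
      with y show "y \<in> \<sigma> ` {x \<in> std_lattice. quad M x = of_int n}"
        by (simp add: space_isometry_quad[OF s(1)])
    qed
  qed (use s(2) space_isometry_quad[OF s(1)] in auto)
  then show ?thesis unfolding rep_num_def
    by (simp add: card_image[OF inj_on_subset[OF space_isometry_inj[OF s(1)] subset_UNIV]])
qed

section \<open>Sylvester's inequalities, coordinate bounds, and finiteness of sets of vectors and
  isometries\<close>

subsection \<open>Positive definite integral forms\<close>

lemma ternary_sym: "ternary_lattice M \<Longrightarrow> transpose M = M"
  by (simp add: ternary_lattice_def)

lemma ternary_pos: "ternary_lattice M \<Longrightarrow> x \<noteq> 0 \<Longrightarrow> quad M x > 0"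
  by (simp add: ternary_lattice_def)

lemma ternary_quad_eq_0: "ternary_lattice M \<Longrightarrow> quad M x = 0 \<longleftrightarrow> x = 0"
  using ternary_pos[of M x] by (cases "x = 0") (auto simp: quad_def)

lemma ternary_minors_pos:
  assumes "ternary_lattice M"
  shows "M $ 1 $ 1 > 0" "M $ 1 $ 1 * M $ 2 $ 2 - M $ 1 $ 2 ^ 2 > 0" "det M > 0"
proof -
  note sym = gram_sym[OF assms, of 2 1] gram_sym[OF assms, of 3 1] gram_sym[OF assms, of 3 2]
  note pos = ternary_pos[OF assms]
  show a: "M $ 1 $ 1 > 0"
    using pos[of "axis 1 1"] by (simp add: quad_def bilin_axis)
  \<comment> \<open>Orthogonal to the first basis vector.\<close>
  define v :: "rat ^ 3" where "v = vector [- M $ 1 $ 2, M $ 1 $ 1, 0]"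
  have "v $ 2 \<noteq> 0" using a by (simp add: v_def)
  then have "quad M v > 0" by (intro pos) auto
  also have "quad M v = M $ 1 $ 1 * (M $ 1 $ 1 * M $ 2 $ 2 - M $ 1 $ 2 ^ 2)"
    by (simp add: quad_expand v_def sym power2_eq_square algebra_simps)
  finally show b: "M $ 1 $ 1 * M $ 2 $ 2 - M $ 1 $ 2 ^ 2 > 0"
    using a by (simp add: zero_less_mult_iff)
  \<comment> \<open>The cross product of the first two rows of \<open>M\<close>, hence orthogonal to
    the first two basis vectors.\<close>
  define w :: "rat ^ 3" where
    "w = vector [M $ 1 $ 2 * M $ 2 $ 3 - M $ 1 $ 3 * M $ 2 $ 2,
                 M $ 1 $ 3 * M $ 1 $ 2 - M $ 1 $ 1 * M $ 2 $ 3,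
                 M $ 1 $ 1 * M $ 2 $ 2 - M $ 1 $ 2 ^ 2]"
  have "w $ 3 \<noteq> 0" using b by (simp add: w_def)
  then have "quad M w > 0" by (intro pos) auto
  also have "quad M w = (M $ 1 $ 1 * M $ 2 $ 2 - M $ 1 $ 2 ^ 2) * det M"
    by (simp add: quad_expand w_def sym det_3 power2_eq_square algebra_simps)
  finally show "det M > 0" using b by (simp add: zero_less_mult_iff)
qed

lemma ternary_cauchy_schwarz:
  assumes "ternary_lattice M"
  shows "bilin M x y ^ 2 \<le> quad M x * quad M y"
proof (cases "y = 0")
  case False
  note comm = bilin_commute[OF ternary_sym[OF assms], of y x]
  let ?z = "quad M y *s x - bilin M x y *s y"
  have "quad M ?z \<ge> 0" using ternary_pos[OF assms, of ?z] by (cases "?z = 0") (auto simp: quad_def)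
  also have "quad M ?z = quad M y * (quad M x * quad M y - bilin M x y ^ 2)"
    by (simp add: quad_def bilin_linear comm power2_eq_square algebra_simps)
  finally show ?thesis using ternary_pos[OF assms False] by (simp add: zero_le_mult_iff)
qed (simp add: quad_def)

text \<open>The k-th coordinate is the product with the k-th vector \<open>y k\<close> of the dual
  basis, so Cauchy-Schwarz bounds it by \<open>quad M (y k) * quad M x\<close>.\<close>

lemma ternary_coord_bound:
  assumes "ternary_lattice M"
  obtains C where "C > 0" "\<And>x k. (x $ k) ^ 2 \<le> C * quad M x"
proof -
  have "invertible M" using ternary_minors_pos(3)[OF assms] by (simp add: invertible_det_nz)
  then obtain M' where inv: "M ** M' = mat 1" by (auto simp: invertible_def)
  define y where "y k = M' *v axis k 1" for k :: 3
  have y: "bilin M x (y k) = x $ k" for x k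
    unfolding bilin_inner y_def
    by (simp add: matrix_vector_mul_assoc inv axis_def if_distrib[of "\<lambda>x. _ * x"] cong: if_cong)
  have *: "(x $ k) ^ 2 \<le> quad M (y k) * quad M x" for x k
    using ternary_cauchy_schwarz[OF assms, of x "y k"] by (simp add: y mult.commute)
  have ge: "quad M x \<ge> 0" for x
    using ternary_pos[OF assms, of x] by (cases "x = 0") (auto simp: quad_def)
  define C where "C = 1 + (\<Sum>k\<in>UNIV. quad M (y k))"
  have "quad M (y k) \<le> C" for k
    using member_le_sum[of k UNIV "\<lambda>k. quad M (y k)"] ge by (simp add: C_def)
  then have "(x $ k) ^ 2 \<le> C * quad M x" for x k
    using * ge by (meson mult_right_mono order_trans)
  moreover have "C > 0" using ge by (simp add: C_def sum_nonneg add_pos_nonneg)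
  ultimately show ?thesis using that by blast
qed

lemma finite_bounded_vectors: "finite {x \<in> std_lattice. \<forall>k. \<bar>x $ k\<bar> \<le> of_int B}"
proof -
  let ?I = "of_int ` {-B..B} :: rat set"
  have "{x \<in> std_lattice. \<forall>k. \<bar>x $ k\<bar> \<le> of_int B} \<subseteq> (\<lambda>(a, b, c). vector [a, b, c]) ` (?I \<times> ?I \<times> ?I)"
  proof
    fix x :: "rat ^ 3" assume x: "x \<in> {x \<in> std_lattice. \<forall>k. \<bar>x $ k\<bar> \<le> of_int B}"
    have "x $ k \<in> ?I" for k
    proof -
      have "x $ k \<in> \<int>" and b: "\<bar>x $ k\<bar> \<le> of_int B" using x by (auto simp: std_lattice_def)
      then obtain z where z: "x $ k = of_int z" by (auto elim: Ints_cases)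
      with b have "of_int \<bar>z\<bar> \<le> (of_int B :: rat)" by simp
      then have "\<bar>z\<bar> \<le> B" by (simp only: of_int_le_iff)
      then show ?thesis using z by (intro image_eqI[of _ _ z]) auto
    qed
    moreover have "x = vector [x $ 1, x $ 2, x $ 3]" by (simp add: vec_eq_iff forall_3)
    ultimately show "x \<in> (\<lambda>(a, b, c). vector [a, b, c]) ` (?I \<times> ?I \<times> ?I)"
      by (intro image_eqI[of _ _ "(x $ 1, x $ 2, x $ 3)"]) auto
  qed
  then show ?thesis by (rule finite_subset) auto
qed

lemma finite_quad_le:
  assumes "ternary_lattice M"
  shows "finite {x \<in> std_lattice. quad M x \<le> c}"
proof -
  obtain C where C: "C > 0" "\<And>x k. (x $ k) ^ 2 \<le> C * quad M x"
    using ternary_coord_bound[OF assms] by blast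
  define B where "B = max 1 \<lceil>C * c\<rceil>"
  have "\<bar>x $ k\<bar> \<le> of_int B" if "quad M x \<le> c" for x k
  proof (rule ccontr)
    assume "\<not> \<bar>x $ k\<bar> \<le> of_int B"
    then have *: "of_int B < \<bar>x $ k\<bar>" by simp
    have B1: "(1::rat) \<le> of_int B" by (simp add: B_def of_int_max)
    have "(x $ k) ^ 2 \<le> C * c" using C(2)[of x k] that C(1) by (meson mult_left_mono less_imp_le order_trans)
    also have "\<dots> \<le> of_int B" by (simp add: B_def of_int_max le_max_iff_disj)
    also have "\<dots> < \<bar>x $ k\<bar>" by (rule *)
    also have "\<bar>x $ k\<bar> \<le> \<bar>x $ k\<bar> * \<bar>x $ k\<bar>"
      using * B1 mult_left_mono[of 1 "\<bar>x $ k\<bar>" "\<bar>x $ k\<bar>"] by linarith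
    finally show False by (simp add: power2_eq_square)
  qed
  then show ?thesis by (intro finite_subset[OF _ finite_bounded_vectors[of B]]) auto
qed

lemma finite_rep: "ternary_lattice M \<Longrightarrow> finite {x \<in> std_lattice. quad M x = c}"
  by (rule finite_subset[OF _ finite_quad_le[of M c]]) auto

lemma space_isometry_expand:
  assumes "space_isometry M N \<sigma>"
  shows "\<sigma> x = x $ 1 *s \<sigma> (axis 1 1) + x $ 2 *s \<sigma> (axis 2 1) + x $ 3 *s \<sigma> (axis 3 1)"
  by (subst std_lattice_expand[of x])
    (simp only: space_isometry_add[OF assms] space_isometry_scale[OF assms])

text \<open>An isometry is determined by the images of the basis vectors, and \<open>k\<close> times
  such an image is one of the finitely many lattice vectors of a prescribed norm. The factor
  \<open>k\<close> admits bounded denominators: 1 for automorphisms, p for neighbours.\<close>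

lemma finite_bounded_isometries:
  assumes "ternary_lattice M" "k \<noteq> 0"
  shows "finite {\<sigma>. space_isometry N M \<sigma> \<and> (\<forall>x\<in>std_lattice. k *s \<sigma> x \<in> std_lattice)}"
    (is "finite ?S")
proof -
  define F where "F = (\<Union>i. {x \<in> std_lattice. quad M x = k ^ 2 * quad N (axis i 1)})"
  have "finite F" unfolding F_def using finite_rep[OF assms(1)] by auto
  moreover have "inj_on (\<lambda>\<sigma>. (k *s \<sigma> (axis 1 1), k *s \<sigma> (axis 2 1), k *s \<sigma> (axis 3 1))) ?S"
  proof (rule inj_onI)
    fix \<sigma> \<tau> assume *: "\<sigma> \<in> ?S" "\<tau> \<in> ?S"
      "(k *s \<sigma> (axis 1 1), k *s \<sigma> (axis 2 1), k *s \<sigma> (axis 3 1)) =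
       (k *s \<tau> (axis 1 1), k *s \<tau> (axis 2 1), k *s \<tau> (axis 3 1))"
    then have eq: "\<sigma> (axis i 1) = \<tau> (axis i 1)" for i
      using assms(2) exhaust_3[of i] by auto
    have iso: "space_isometry N M \<sigma>" "space_isometry N M \<tau>" using * by auto
    show "\<sigma> = \<tau>"
    proof
      fix x
      show "\<sigma> x = \<tau> x"
        unfolding space_isometry_expand[OF iso(1), of x] space_isometry_expand[OF iso(2), of x] eq ..
    qed
  qed
  moreover have "(\<lambda>\<sigma>. (k *s \<sigma> (axis 1 1), k *s \<sigma> (axis 2 1), k *s \<sigma> (axis 3 1))) ` ?S \<subseteq> F \<times> F \<times> F"
  proof -
    have "k *s \<sigma> (axis i 1) \<in> F" if "\<sigma> \<in> ?S" for \<sigma> i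
    proof -
      have "quad M (k *s \<sigma> (axis i 1)) = k ^ 2 * quad N (axis i 1)"
        using that space_isometry_quad[of N M \<sigma> "axis i 1"]
        by (simp add: quad_def bilin_linear power2_eq_square)
      then show ?thesis using that by (auto simp: F_def)
    qed
    then show ?thesis by auto
  qed
  ultimately show ?thesis by (intro inj_on_finite[of _ ?S "F \<times> F \<times> F"]) auto
qed

lemma finite_lattice_isometries:
  assumes "ternary_lattice M"
  shows "finite {\<sigma>. lattice_isometry N M \<sigma>}"
  by (rule finite_subset[OF _ finite_bounded_isometries[OF assms, of 1 N]])
    (auto simp: lattice_isometry_def)

lemma isom_order_pos: "ternary_lattice M \<Longrightarrow> isom_order M > 0"
  using finite_lattice_isometries[of M M] lattice_isometry_id[of M]
  by (auto simp: isom_order_def card_gt_0_iff)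

text \<open>A proper ideal of the integers lies in a prime ideal. The primewise form of the
  condition is the one that an isometry with denominator prime to q transports; see
  \<open>genus_transfer\<close>.\<close>

lemma ternary_lattice_iff:
  "ternary_lattice M \<longleftrightarrow> transpose M = M \<and> (\<forall>x. x \<noteq> 0 \<longrightarrow> quad M x > 0) \<and>
     (\<forall>x\<in>std_lattice. quad M x \<in> \<int>) \<and>
     (\<forall>q::nat. prime q \<longrightarrow> (\<exists>x\<in>std_lattice. quad M x \<notin> range (\<lambda>k. of_int (int q * k))))"
    (is "_ \<longleftrightarrow> _ \<and> _ \<and> ?int \<and> ?prim")
proof -
  let ?s = "\<lambda>(k::int) (q::rat). of_int k * q"
  let ?span = "Modules.module.span ?s (quad M ` std_lattice)"
  have "?span = \<int> \<longleftrightarrow> ?int \<and> ?prim"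
  proof
    assume span: "?span = \<int>"
    then have int: ?int using Modules.module.span_base[OF module_rat_int] by auto
    have "\<exists>x\<in>std_lattice. quad M x \<notin> range (\<lambda>k. of_int (int q * k))" if q: "prime q" for q :: nat
    proof (rule ccontr)
      assume "\<not> ?thesis"
      then have "quad M ` std_lattice \<subseteq> range (\<lambda>k. of_int (int q * k))" by auto
      moreover have "Modules.module.subspace ?s (range (\<lambda>k. of_int (int q * k)))"
        unfolding Modules.module.subspace_def[OF module_rat_int]
      proof safe
        show "0 \<in> range (\<lambda>k. of_int (int q * k) :: rat)" by (rule image_eqI[of _ _ 0]) auto
        fix a b c :: int
        show "of_int (int q * a) + of_int (int q * b) \<in> range (\<lambda>k. of_int (int q * k) :: rat)"
          by (rule image_eqI[of _ _ "a + b"]) (auto simp: algebra_simps)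
        show "of_int c * of_int (int q * a) \<in> range (\<lambda>k. of_int (int q * k) :: rat)"
          by (rule image_eqI[of _ _ "c * a"]) (auto simp: algebra_simps)
      qed
      ultimately have "?span \<subseteq> range (\<lambda>k. of_int (int q * k))"
        by (rule Modules.module.span_minimal[OF module_rat_int])
      then have "(1::rat) \<in> range (\<lambda>k. of_int (int q * k))" unfolding span using Ints_1 by blast
      then obtain k where "(1::rat) = of_int (int q * k)" by blast
      then have "int q * k = 1" by (metis of_int_eq_1_iff)
      then have "int q dvd 1" by (metis dvd_triv_left)
      then show False using q by (simp add: prime_nat_iff)
    qed
    with int show "?int \<and> ?prim" by blast
  next
    assume A: "?int \<and> ?prim"
    define I where "I = {k::int. of_int k \<in> ?span}"
    have sub: "Modules.module.subspace ?s ?span" by (rule Modules.module.subspace_span[OF module_rat_int])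
    have I0: "0 \<in> I" and Iadd: "a \<in> I \<Longrightarrow> b \<in> I \<Longrightarrow> a + b \<in> I" and Imult: "a \<in> I \<Longrightarrow> c * a \<in> I" for a b c
      using sub unfolding Modules.module.subspace_def[OF module_rat_int] I_def by auto
    have val: "\<exists>z\<in>I. quad M x = of_int z" if "x \<in> std_lattice" for x
      using that A Modules.module.span_base[OF module_rat_int, of "quad M x" "quad M ` std_lattice"]
      by (auto simp: I_def elim!: Ints_cases)
    have "\<exists>z\<in>I. z \<noteq> 0"
    proof -
      obtain x where x: "x \<in> std_lattice" "quad M x \<notin> range (\<lambda>k. of_int (int 2 * k))"
        using A two_is_prime_nat by blast
      obtain z where z: "z \<in> I" "quad M x = of_int z" using val x(1) by blast
      have "z \<noteq> 0" using x(2) z(2) by (auto intro: image_eqI[of _ _ 0])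
      with z show ?thesis by blast
    qed
    then obtain z where z: "z \<in> I" "z \<noteq> 0" by blast
    \<comment> \<open>The set \<open>I\<close> is an ideal of the integers. Its least positive
      element \<open>g\<close> divides every member, and a prime factor of \<open>g\<close> would
      divide all values of the form.\<close>
    have "nat \<bar>z\<bar> > 0 \<and> int (nat \<bar>z\<bar>) \<in> I" using z Imult[of z "sgn z"] by (auto simp: sgn_mult_abs abs_if split: if_splits)
    then obtain g where g: "g > 0 \<and> int g \<in> I" and gmin: "\<And>m. m < g \<Longrightarrow> \<not> (m > 0 \<and> int m \<in> I)"
      using exists_least_iff[of "\<lambda>g. g > 0 \<and> int g \<in> I"] by blast
    have gdvd: "int g dvd k" if "k \<in> I" for k
    proof -
      have "k mod int g = k + (- (k div int g)) * int g" by (simp add: minus_div_mult_eq_mod[symmetric])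
      then have "k mod int g \<in> I" using that g Iadd Imult by metis
      moreover have "0 \<le> k mod int g" "k mod int g < int g" using g by auto
      ultimately have "k mod int g = 0" using gmin[of "nat (k mod int g)"] by (cases "k mod int g = 0") (auto simp: nat_less_iff)
      then show ?thesis by auto
    qed
    have "g = 1"
    proof (rule ccontr)
      assume "g \<noteq> 1"
      then obtain q where q: "prime q" "q dvd g" using prime_factor_nat by blast
      obtain x where x: "x \<in> std_lattice" "quad M x \<notin> range (\<lambda>k. of_int (int q * k))"
        using A q(1) by blast
      obtain z where z: "z \<in> I" "quad M x = of_int z" using val x(1) by blast
      have "int q dvd z" using gdvd[OF z(1)] q(2) by (meson dvd_trans int_dvd_int_iff)
      then show False using x(2) z(2) by (auto elim!: dvdE)
    qed
    then have 1: "1 \<in> I" using g by simp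
    show "?span = \<int>"
    proof
      have "Modules.module.subspace ?s \<int>"
        unfolding Modules.module.subspace_def[OF module_rat_int] by auto
      then show "?span \<subseteq> \<int>"
        using A by (intro Modules.module.span_minimal[OF module_rat_int]) auto
      show "\<int> \<subseteq> ?span" using Imult[OF 1] by (auto simp: I_def elim!: Ints_cases)
    qed
  qed
  then show ?thesis by (simp add: ternary_lattice_def)
qed

section \<open>Square roots and roots of quadratic and linear congruences over the field with p
  elements\<close>

subsection \<open>Counting modulo an odd prime\<close>

lemma int_dvd_diffD: "p dvd a - b \<Longrightarrow> p dvd b \<Longrightarrow> p dvd a" for a b p :: int
  using dvd_add[of p "a - b" b] by simp

lemma int_dvd_diffD1: "p dvd a - b \<Longrightarrow> p dvd a \<Longrightarrow> p dvd b" for a b p :: int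
  using dvd_diff[of p a "a - b"] by simp

lemma Legendre_cong: "[a = b] (mod p) \<Longrightarrow> Legendre a p = Legendre b p"
proof -
  assume ab: "[a = b] (mod p)"
  have "[a = 0] (mod p) \<longleftrightarrow> [b = 0] (mod p)" "QuadRes p a \<longleftrightarrow> QuadRes p b"
    using ab unfolding QuadRes_def by (blast intro: cong_trans cong_sym)+
  then show ?thesis by (simp add: Legendre_def)
qed

lemma QuadRes_mult_square_iff:
  fixes k :: int
  assumes "prime p" "\<not> p dvd k"
  shows "QuadRes p (a * k ^ 2) \<longleftrightarrow> QuadRes p a"
proof
  assume "QuadRes p a"
  then obtain y where "[y ^ 2 = a] (mod p)" by (auto simp: QuadRes_def)
  then have "[(y * k) ^ 2 = a * k ^ 2] (mod p)" by (simp add: power_mult_distrib cong_scalar_right)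
  then show "QuadRes p (a * k ^ 2)" unfolding QuadRes_def by blast
next
  assume "QuadRes p (a * k ^ 2)"
  then obtain y where y: "[y ^ 2 = a * k ^ 2] (mod p)" by (auto simp: QuadRes_def)
  have "coprime k p" using assms by (metis coprime_commute prime_imp_coprime)
  then obtain j where j: "[k * j = 1] (mod p)" using cong_solve_coprime_int by blast
  have "[(y * j) ^ 2 = a * (k * j) ^ 2] (mod p)"
    using cong_scalar_right[OF y, of "j ^ 2"] by (simp add: power_mult_distrib mult.assoc)
  also have "[a * (k * j) ^ 2 = a * 1 ^ 2] (mod p)" by (intro cong_scalar_left cong_pow j)
  finally show "QuadRes p a" unfolding QuadRes_def by auto
qed

lemma Legendre_mult_square:
  fixes k :: int
  assumes "prime p" "\<not> p dvd k"
  shows "Legendre (a * k ^ 2) p = Legendre a p"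
proof -
  have "[a * k ^ 2 = 0] (mod p) \<longleftrightarrow> [a = 0] (mod p)"
    using assms by (auto simp: cong_0_iff prime_dvd_mult_iff prime_dvd_power_iff)
  then show ?thesis using QuadRes_mult_square_iff[OF assms] by (simp add: Legendre_def)
qed

lemma inverse_mod_prime:
  fixes p k :: int
  assumes "prime p" "\<not> p dvd k"
  obtains j where "[k * j = 1] (mod p)"
proof -
  have "coprime k p" using assms by (metis coprime_commute prime_imp_coprime)
  then show ?thesis using cong_solve_coprime_int that by blast
qed

lemma odd_prime_not_dvd_2:
  fixes p :: int
  assumes "prime p" "odd p"
  shows "\<not> p dvd 2"
proof
  assume "p dvd 2"
  then have "p \<le> 2" by (rule zdvd_imp_le) simp
  then have "p = 2" using prime_ge_2_int[OF assms(1)] by simp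
  then show False using assms(2) by simp
qed

lemma eq_if_dvd_diff:
  fixes p :: int
  assumes "p dvd a - b" "a \<in> {0..<p}" "b \<in> {0..<p}"
  shows "a = b"
  using assms by (metis atLeastLessThan_iff mod_eq_dvd_iff mod_pos_pos_trivial)

lemma card_square_roots:
  fixes p :: int
  assumes p: "prime p" "odd p"
  shows "int (card {s\<in>{0..<p}. p dvd s ^ 2 - a}) = 1 + Legendre a p"
proof (cases "p dvd a")
  case True
  have "{s\<in>{0..<p}. p dvd s ^ 2 - a} = {0}"
  proof (intro equalityI subsetI)
    fix s assume s: "s \<in> {s\<in>{0..<p}. p dvd s ^ 2 - a}"
    then have "p dvd s ^ 2" using True int_dvd_diffD[of p "s ^ 2" a] by simp
    then have "p dvd s - 0" using p by (simp add: prime_dvd_power_iff)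
    then show "s \<in> {0}" using s p eq_if_dvd_diff[of p s 0] by (auto dest: prime_gt_0_int)
  qed (use True p prime_gt_0_int in auto)
  then show ?thesis using True by (simp add: Legendre_def cong_0_iff)
next
  case False
  show ?thesis
  proof (cases "QuadRes p a")
    case True
    then obtain y where "[y ^ 2 = a] (mod p)" by (auto simp: QuadRes_def)
    then have y: "p dvd y ^ 2 - a" by (simp add: cong_iff_dvd_diff)
    define r where "r = y mod p"
    have "p > 0" using p prime_gt_0_int by blast
    then have r: "r \<in> {0..<p}" by (simp add: r_def)
    have "[r ^ 2 = y ^ 2] (mod p)" unfolding r_def by (intro cong_pow) simp
    then have ra: "p dvd r ^ 2 - a" using y by (metis cong_iff_dvd_diff cong_trans)
    have r0: "\<not> p dvd r"
    proof
      assume "p dvd r"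
      then have "p dvd r ^ 2" by (simp add: power2_eq_square)
      then show False using ra False by (metis dvd_diff diff_diff_eq2 add_diff_cancel_left' int_dvd_diffD)
    qed
    then have "r \<noteq> 0" by auto
    have rr: "r \<noteq> p - r" using p(2) by presburger
    have "{s\<in>{0..<p}. p dvd s ^ 2 - a} = {r, p - r}"
    proof (intro equalityI subsetI)
      fix s assume s: "s \<in> {s\<in>{0..<p}. p dvd s ^ 2 - a}"
      have "p dvd (s ^ 2 - a) - (r ^ 2 - a)" by (rule dvd_diff) (use s ra in auto)
      also have "(s ^ 2 - a) - (r ^ 2 - a) = (s - r) * (s + r)" by (simp add: power2_eq_square algebra_simps)
      finally have "p dvd s - r \<or> p dvd s + r" using p by (simp add: prime_dvd_mult_iff)
      moreover have "p dvd s - (p - r)" if "p dvd s + r" using that by (metis dvd_diff dvd_refl diff_diff_eq2 add.commute add_diff_eq)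
      ultimately show "s \<in> {r, p - r}"
        using eq_if_dvd_diff[of p s r] eq_if_dvd_diff[of p s "p - r"] s r \<open>r \<noteq> 0\<close> by auto
    next
      fix s assume "s \<in> {r, p - r}"
      moreover have "(p - r) ^ 2 - a = p * (p - 2 * r) + (r ^ 2 - a)" by (simp add: power2_eq_square algebra_simps)
      then have "p dvd (p - r) ^ 2 - a" using ra by (metis dvd_add dvd_triv_left)
      ultimately show "s \<in> {s\<in>{0..<p}. p dvd s ^ 2 - a}" using ra r \<open>r \<noteq> 0\<close> by auto
    qed
    then show ?thesis using rr True False by (simp add: Legendre_def cong_0_iff)
  next
    case nq: False
    then have "{s\<in>{0..<p}. p dvd s ^ 2 - a} = {}" by (auto simp: QuadRes_def cong_iff_dvd_diff)
    then show ?thesis using nq False by (simp only: Legendre_def cong_0_iff) simp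
  qed
qed

lemma bij_betw_affine_mod:
  fixes p :: int
  assumes p: "prime p" and k: "\<not> p dvd k"
  shows "bij_betw (\<lambda>z. (k * z + c) mod p) {0..<p} {0..<p}"
proof -
  have "p > 0" using p prime_gt_0_int by blast
  have "inj_on (\<lambda>z. (k * z + c) mod p) {0..<p}"
  proof (rule inj_onI)
    fix x y assume xy: "x \<in> {0..<p}" "y \<in> {0..<p}" "(k * x + c) mod p = (k * y + c) mod p"
    then have "p dvd k * (x - y)" by (simp add: mod_eq_dvd_iff algebra_simps)
    then have "p dvd x - y" using k p by (simp add: prime_dvd_mult_iff)
    then show "x = y" using xy eq_if_dvd_diff by blast
  qed
  moreover have "(\<lambda>z. (k * z + c) mod p) ` {0..<p} \<subseteq> {0..<p}" using \<open>p > 0\<close> by auto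
  ultimately show ?thesis
    by (simp add: bij_betw_def endo_inj_surj)
qed

lemma card_affine_preimage:
  fixes p :: int
  assumes p: "prime p" and k: "\<not> p dvd k"
    and P: "\<And>z. P z \<longleftrightarrow> R ((k * z + c) mod p)"
  shows "card {z\<in>{0..<p}. P z} = card {s\<in>{0..<p}. R s}"
proof -
  note b = bij_betw_affine_mod[OF p k, of c]
  have "bij_betw (\<lambda>z. (k * z + c) mod p) {z\<in>{0..<p}. P z} {s\<in>{0..<p}. R s}"
    unfolding bij_betw_def
  proof
    show "inj_on (\<lambda>z. (k * z + c) mod p) {z\<in>{0..<p}. P z}"
      using b by (auto simp: bij_betw_def intro: inj_on_subset)
    have im: "(\<lambda>z. (k * z + c) mod p) ` {0..<p} = {0..<p}" using b by (simp add: bij_betw_def)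
    show "(\<lambda>z. (k * z + c) mod p) ` {z\<in>{0..<p}. P z} = {s\<in>{0..<p}. R s}"
    proof (intro equalityI subsetI)
      fix s assume s: "s \<in> {s\<in>{0..<p}. R s}"
      then obtain z where "z \<in> {0..<p}" "s = (k * z + c) mod p" using im by blast
      then show "s \<in> (\<lambda>z. (k * z + c) mod p) ` {z\<in>{0..<p}. P z}" using s P by auto
    qed (use P im in auto)
  qed
  then show ?thesis by (rule bij_betw_same_card)
qed

text \<open>Multiplication by \<open>4 * a\<close> completes the square, and the substitution
  \<open>z\<close> to \<open>2 * a * z + b\<close> permutes the residues, so the roots correspond to
  the square roots of the discriminant.\<close>

lemma card_quadratic_roots:
  fixes p :: int
  assumes p: "prime p" "odd p" and a: "\<not> p dvd a"
  shows "int (card {z\<in>{0..<p}. p dvd a * z ^ 2 + b * z + c}) = 1 + Legendre (b ^ 2 - 4 * a * c) p"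
proof -
  have p2: "\<not> p dvd 2" by (rule odd_prime_not_dvd_2[OF p])
  then have p4: "\<not> p dvd 4 * a" using p a by (metis prime_dvd_mult_iff mult_2 numeral_Bit0 mult.assoc)
  have p2a: "\<not> p dvd 2 * a" using p2 p a by (simp add: prime_dvd_mult_iff)
  have "p dvd a * z ^ 2 + b * z + c \<longleftrightarrow> p dvd ((2 * a * z + b) mod p) ^ 2 - (b ^ 2 - 4 * a * c)" for z
  proof -
    have "p dvd a * z ^ 2 + b * z + c \<longleftrightarrow> p dvd 4 * a * (a * z ^ 2 + b * z + c)"
      using p p4 by (simp add: prime_dvd_mult_iff)
    also have "4 * a * (a * z ^ 2 + b * z + c) = (2 * a * z + b) ^ 2 - (b ^ 2 - 4 * a * c)"
      by (simp add: power2_eq_square algebra_simps)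
    also have "p dvd \<dots> \<longleftrightarrow> p dvd ((2 * a * z + b) mod p) ^ 2 - (b ^ 2 - 4 * a * c)"
      by (metis mod_eq_dvd_iff power_mod)
    finally show ?thesis .
  qed
  then have "card {z\<in>{0..<p}. p dvd a * z ^ 2 + b * z + c} = card {s\<in>{0..<p}. p dvd s ^ 2 - (b ^ 2 - 4 * a * c)}"
    by (intro card_affine_preimage[OF p(1) p2a])
  then show ?thesis using card_square_roots[OF p] by simp
qed

lemma card_linear_roots:
  fixes p :: int
  assumes p: "prime p" and b: "\<not> p dvd b"
  shows "card {z\<in>{0..<p}. p dvd b * z + c} = 1"
proof -
  have "card {z\<in>{0..<p}. p dvd b * z + c} = card {s\<in>{0..<p}. s = 0}"
    by (intro card_affine_preimage[OF p b]) (simp add: mod_eq_0_iff_dvd)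
  also have "{s\<in>{0..<p}. s = 0} = {0}" using p prime_gt_0_int by auto
  finally show ?thesis by simp
qed

lemma inj_on_square_half:
  fixes p :: int
  assumes p: "prime p" "odd p" and a: "\<not> p dvd a"
  shows "inj_on (\<lambda>x. (a * x ^ 2 + c) mod p) {0..(p - 1) div 2}"
proof (rule inj_onI)
  fix x y assume xy: "x \<in> {0..(p - 1) div 2}" "y \<in> {0..(p - 1) div 2}"
    "(a * x ^ 2 + c) mod p = (a * y ^ 2 + c) mod p"
  then have "p dvd (a * x ^ 2 + c) - (a * y ^ 2 + c)" by (simp only: mod_eq_dvd_iff)
  also have "\<dots> = a * ((x - y) * (x + y))" by (simp add: power2_eq_square algebra_simps)
  finally have "p dvd x - y \<or> p dvd x + y" using a p by (simp add: prime_dvd_mult_iff)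
  moreover have "x \<in> {0..<p}" "y \<in> {0..<p}" using xy p(2) prime_gt_0_int[OF p(1)] by auto
  moreover have "x + y \<in> {0..<p}" using xy p(2) prime_gt_0_int[OF p(1)] by (auto elim!: oddE)
  ultimately show "x = y" using eq_if_dvd_diff[of p x y] eq_if_dvd_diff[of p "x + y" 0] xy by auto
qed

text \<open>Pigeonhole: \<open>a * x ^ 2\<close> and \<open>- b * y ^ 2 - c\<close> each take (p +
  1)/2 residues while x and y run through 0, ..., (p - 1)/2, so the two sets of values meet.\<close>

lemma binary_form_represents:
  fixes p :: int
  assumes p: "prime p" "odd p" and a: "\<not> p dvd a" and b: "\<not> p dvd b"
  obtains x y where "p dvd a * x ^ 2 + b * y ^ 2 + c"
proof -
  let ?S = "{0..(p - 1) div 2}"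
  define A where "A = (\<lambda>x. (a * x ^ 2 + 0) mod p) ` ?S"
  define B where "B = (\<lambda>y. (- b * y ^ 2 + - c) mod p) ` ?S"
  have p0: "p > 0" using p prime_gt_0_int by blast
  have "card A = card ?S" unfolding A_def by (intro card_image inj_on_square_half p a)
  moreover have "card B = card ?S" unfolding B_def using b by (intro card_image inj_on_square_half p) simp
  moreover have "2 * card ?S = nat p + 1" using p(2) p0 by (auto elim!: oddE simp: nat_add_distrib)
  moreover have "A \<union> B \<subseteq> {0..<p}" using p0 by (auto simp: A_def B_def)
  then have "card (A \<union> B) \<le> nat p" by (metis card_mono finite_atLeastLessThan_int card_atLeastLessThan_int diff_zero)
  ultimately have "A \<inter> B \<noteq> {}"
    using card_Un_disjoint[of A B] by (auto simp: A_def B_def)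
  then obtain x y where "(a * x ^ 2 + 0) mod p = (- b * y ^ 2 + - c) mod p"
    unfolding A_def B_def by blast
  then have "p dvd (a * x ^ 2 + 0) - (- b * y ^ 2 + - c)" by (simp only: mod_eq_dvd_iff)
  then show ?thesis using that[of x y] by (simp add: algebra_simps)
qed

section \<open>The conic of isotropic lines of a nondegenerate ternary form over the field with p
  elements\<close>

subsection \<open>Ternary forms modulo an odd prime\<close>

text \<open>Congruence of vectors is written \<open>vdvd p (x - y)\<close>; for a prime p, the
  negation of \<open>vdvd p w\<close> says that w spans a line over the residue field.\<close>

definition vdvd :: "int \<Rightarrow> int ^ 3 \<Rightarrow> bool" where
  "vdvd p x \<longleftrightarrow> (\<forall>i. p dvd x $ i)"

text \<open>The adjugate of \<open>H\<close> maps \<open>H *v x\<close> to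
  \<open>det H *s x\<close>; the three identities are its rows written out.\<close>

lemma vdvd_solve:
  fixes H :: "int ^ 3 ^ 3"
  assumes p: "prime p" and d: "\<not> p dvd det H" and x: "vdvd p (H *v x)"
  shows "vdvd p x"
proof -
  define b where "b = H *v x"
  have b: "p dvd b $ i" for i using x by (simp add: b_def vdvd_def)
  have e: "b $ i = H $ i $ 1 * x $ 1 + H $ i $ 2 * x $ 2 + H $ i $ 3 * x $ 3" for i
    by (simp add: b_def matrix_vector_mult_def sum_3)
  have "det H * x $ 1 = (H$2$2 * H$3$3 - H$2$3 * H$3$2) * b $ 1 - (H$1$2 * H$3$3 - H$1$3 * H$3$2) * b $ 2
      + (H$1$2 * H$2$3 - H$1$3 * H$2$2) * b $ 3"
    by (simp add: e det_3 algebra_simps)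
  then have 1: "p dvd det H * x $ 1" using b by simp
  have "det H * x $ 2 = - (H$2$1 * H$3$3 - H$2$3 * H$3$1) * b $ 1 + (H$1$1 * H$3$3 - H$1$3 * H$3$1) * b $ 2
      - (H$1$1 * H$2$3 - H$1$3 * H$2$1) * b $ 3"
    by (simp add: e det_3 algebra_simps)
  then have 2: "p dvd det H * x $ 2" using b by simp
  have "det H * x $ 3 = (H$2$1 * H$3$2 - H$2$2 * H$3$1) * b $ 1 - (H$1$1 * H$3$2 - H$1$2 * H$3$1) * b $ 2
      + (H$1$1 * H$2$2 - H$1$2 * H$2$1) * b $ 3"
    by (simp add: e det_3 algebra_simps)
  then have 3: "p dvd det H * x $ 3" using b by simp
  show ?thesis using 1 2 3 p d by (auto simp: vdvd_def forall_3 prime_dvd_mult_iff)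
qed

definition bform :: "int ^ 3 ^ 3 \<Rightarrow> int ^ 3 \<Rightarrow> int ^ 3 \<Rightarrow> int" where
  "bform G x y = (\<Sum>i\<in>UNIV. x $ i * (G *v y) $ i)"

lemma int_matrix_scale: "A *v (c *s x) = c *s (A *v x)" for A :: "int ^ 3 ^ 3"
  by (simp add: vec_eq_iff matrix_vector_mult_def sum_distrib_left mult_ac)

lemma bform_linear:
  "bform G (x + y) z = bform G x z + bform G y z" "bform G z (x + y) = bform G z x + bform G z y"
  "bform G (x - y) z = bform G x z - bform G y z" "bform G z (x - y) = bform G z x - bform G z y"
  "bform G (c *s x) z = c * bform G x z" "bform G z (c *s x) = c * bform G z x"
  by (simp_all add: bform_def matrix_vector_right_distrib matrix_vector_mult_diff_distrib
      int_matrix_scale sum.distrib sum_subtractf sum_distrib_left algebra_simps)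

lemma bform_axis: "bform G (axis i 1) x = (G *v x) $ i"
  by (simp add: bform_def axis_def if_distrib[of "\<lambda>x. x * _"] cong: if_cong)

lemma bform_expand: "bform G x y = (\<Sum>i\<in>UNIV. \<Sum>j\<in>UNIV. G $ i $ j * x $ i * y $ j)"
  by (simp add: bform_def matrix_vector_mult_def sum_distrib_left algebra_simps)

lemma bform_vdvd: "vdvd p x \<Longrightarrow> p dvd bform G y x"
  by (auto simp: bform_expand vdvd_def intro!: dvd_sum)

lemma vdvd_diff: "vdvd p x \<Longrightarrow> vdvd p y \<Longrightarrow> vdvd p (x - y)"
  by (simp add: vdvd_def)

lemma vdvd_scale: "vdvd p x \<Longrightarrow> vdvd p (c *s x)"
  by (simp add: vdvd_def)

lemma gram_det:
  fixes R :: "int ^ 3 ^ 3"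
  shows "det R ^ 2 * det G = det (\<chi> i j. bform G (R $ i) (R $ j))"
proof -
  have "(R ** (G ** transpose R)) $ i $ j = bform G (R $ i) (R $ j)" for i j
    by (simp add: bform_def matrix_matrix_mult_def matrix_vector_mult_def transpose_def)
  then have "R ** (G ** transpose R) = (\<chi> i j. bform G (R $ i) (R $ j))"
    by (simp add: vec_eq_iff)
  from arg_cong[OF this, of det] show ?thesis
    by (simp add: det_mul power2_eq_square mult_ac)
qed

locale good_prime_form =
  fixes G :: "int ^ 3 ^ 3" and p :: int
  assumes sym: "transpose G = G" and p: "prime p" "odd p" and disc: "\<not> p dvd det G"
begin

abbreviation "\<beta> \<equiv> bform G"

lemma p_pos: "p > 0" using p prime_gt_0_int by blast

lemma not_dvd_2: "\<not> p dvd 2"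
  by (rule odd_prime_not_dvd_2[OF p])

lemma beta_commute: "\<beta> x y = \<beta> y x"
proof -
  have "G $ i $ j = G $ j $ i" for i j
    using arg_cong[OF sym, of "\<lambda>G. G $ j $ i"] by (simp add: transpose_def)
  then show ?thesis unfolding bform_def matrix_vector_mult_def
    by (simp add: sum_3 algebra_simps)
qed

lemma nondegenerate:
  assumes "\<And>t. p dvd \<beta> t x"
  shows "vdvd p x"
proof (rule vdvd_solve[OF p(1) disc])
  have "p dvd (G *v x) $ i" for i using assms[of "axis i 1"] by (simp only: bform_axis)
  then show "vdvd p (G *v x)" by (simp add: vdvd_def)
qed

lemma dual_vector:
  assumes "\<not> vdvd p x"
  obtains t where "p dvd \<beta> t x - 1"
proof -
  obtain t where "\<not> p dvd \<beta> t x" using nondegenerate assms by blast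
  then obtain j where "[\<beta> t x * j = 1] (mod p)" using inverse_mod_prime[OF p(1)] by blast
  then have "p dvd \<beta> (j *s t) x - 1" by (simp add: bform_linear cong_iff_dvd_diff mult.commute)
  then show ?thesis using that by blast
qed

lemma minors_imp_parallel:
  assumes w: "\<not> vdvd p w" and minors: "\<And>i j. p dvd w $ i * u $ j - w $ j * u $ i"
  shows "\<exists>c. vdvd p (u - c *s w)"
proof -
  obtain i where "\<not> p dvd w $ i" using w by (auto simp: vdvd_def)
  then obtain k where "[w $ i * k = 1] (mod p)" using inverse_mod_prime[OF p(1)] by blast
  then have k: "p dvd w $ i * k - 1" by (simp add: cong_iff_dvd_diff)
  have "p dvd (u - (k * u $ i) *s w) $ j" for j
  proof -
    have "(u - (k * u $ i) *s w) $ j = k * (w $ i * u $ j - w $ j * u $ i) - (w $ i * k - 1) * u $ j"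
      by (simp add: algebra_simps)
    then show ?thesis using k minors[of i j] by simp
  qed
  then show ?thesis by (auto simp: vdvd_def)
qed

lemma det_axis_imp_minors:
  assumes "\<And>k. p dvd det (vector [w, u, axis k 1] :: int ^ 3 ^ 3)"
  shows "p dvd w $ i * u $ j - w $ j * u $ i"
proof -
  have "p dvd w $ 2 * u $ 3 - w $ 3 * u $ 2" "p dvd w $ 3 * u $ 1 - w $ 1 * u $ 3"
    "p dvd w $ 1 * u $ 2 - w $ 2 * u $ 1"
    using assms[of 1] assms[of 2] assms[of 3] by (simp_all add: det_3 axis_def algebra_simps)
  moreover have "w $ 2 * u $ 1 - w $ 1 * u $ 2 = - (w $ 1 * u $ 2 - w $ 2 * u $ 1)"
    "w $ 3 * u $ 2 - w $ 2 * u $ 3 = - (w $ 2 * u $ 3 - w $ 3 * u $ 2)"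
    "w $ 1 * u $ 3 - w $ 3 * u $ 1 = - (w $ 3 * u $ 1 - w $ 1 * u $ 3)" by auto
  ultimately show ?thesis
    using exhaust_3[of i] exhaust_3[of j] by (metis dvd_0_right dvd_minus_iff right_minus_eq mult.commute)
qed

text \<open>A nondegenerate ternary space contains no totally isotropic plane. Modulo p the Gram
  matrix of w, u and any basis vector has a zero block of size two, so its determinant vanishes.
  Hence so does \<open>det ?R\<close>, and all two-by-two minors of w and u are divisible by
  p.\<close>

lemma isotropic_parallel:
  assumes w: "\<not> vdvd p w" and 0: "p dvd \<beta> w w" "p dvd \<beta> u w" "p dvd \<beta> u u"
  shows "\<exists>c. vdvd p (u - c *s w)"
proof (rule minors_imp_parallel[OF w], rule det_axis_imp_minors)
  fix k :: 3
  let ?R = "vector [w, u, axis k 1] :: int ^ 3 ^ 3"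
  have "p dvd det (\<chi> i j. \<beta> (?R $ i) (?R $ j))"
    unfolding det_3 using 0 beta_commute[of w u] by (simp add: dvd_add dvd_diff)
  then have "p dvd det ?R ^ 2 * det G" by (simp only: gram_det)
  then show "p dvd det ?R" using p disc by (simp add: prime_dvd_mult_iff prime_dvd_power_iff)
qed

text \<open>Orthogonalisation cleared of denominators. If p divides \<open>a\<close> or
  \<open>b\<close>, then \<open>e1\<close> or \<open>e2\<close> is isotropic. Otherwise the binary
  part represents \<open>- c\<close> modulo p, and the third coordinate \<open>a * b\<close> shows
  that the resulting vector is nonzero modulo p.\<close>

lemma isotropic_exists: "\<exists>w. \<not> vdvd p w \<and> p dvd \<beta> w w"
proof -
  define e1 :: "int ^ 3" where "e1 = axis 1 1"
  define a where "a = \<beta> e1 e1"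
  define e2 where "e2 = a *s axis 2 1 - \<beta> (axis 2 1) e1 *s e1"
  define b where "b = \<beta> e2 e2"
  define f :: "int ^ 3" where "f = axis 3 1"
  define e3 where "e3 = (a * b) *s f - (b * \<beta> f e1) *s e1 - (a * \<beta> f e2) *s e2"
  define c where "c = \<beta> e3 e3"
  have n1: "\<not> vdvd p e1" using p by (auto simp: vdvd_def e1_def axis_def dest: spec[of _ 1])
  have coord: "e2 $ 2 = a" "e2 $ 3 = 0" "e3 $ 3 = a * b" "e1 $ 3 = 0"
    by (simp_all add: e1_def e2_def e3_def f_def axis_def)
  show ?thesis
  proof (cases "p dvd a \<or> p dvd b")
    case True
    moreover have "\<not> vdvd p e2" if "\<not> p dvd a" using that coord by (auto simp: vdvd_def)
    ultimately show ?thesis using n1 by (auto simp: a_def b_def)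
  next
    case False
    then obtain x y where xy: "p dvd a * x ^ 2 + b * y ^ 2 + c"
      using binary_form_represents[OF p, of a b c] by blast
    have o12: "\<beta> e1 e2 = 0" "\<beta> e2 e1 = 0"
      using beta_commute[of e1 e2] by (simp_all add: e2_def bform_linear a_def)
    have o: "\<beta> e3 e1 = 0" "\<beta> e3 e2 = 0" "\<beta> e1 e3 = 0" "\<beta> e2 e3 = 0"
      using beta_commute[of e1 e3] beta_commute[of e2 e3]
      by (simp_all add: e3_def bform_linear o12 a_def b_def)
    let ?w = "x *s e1 + y *s e2 + e3"
    have "\<beta> ?w ?w = a * x ^ 2 + b * y ^ 2 + c"
      by (simp add: bform_linear o o12 a_def[symmetric] b_def[symmetric] c_def[symmetric] power2_eq_square algebra_simps)
    moreover have "\<not> p dvd ?w $ 3" using False p by (simp add: coord prime_dvd_mult_iff)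
    ultimately show ?thesis using xy by (metis vdvd_def)
  qed
qed

end

text \<open>Divisibility by an explicit certificate: at each use the coefficients are supplied by
  hand and the identity is checked by ring normalisation. Six slots cover the longest certificate;
  the others are filled with 0.\<close>

lemma dvd_lincomb:
  fixes d :: int
  assumes "d dvd a1" "d dvd a2" "d dvd a3" "d dvd a4" "d dvd a5" "d dvd a6"
    and "E = x1 * a1 + x2 * a2 + x3 * a3 + x4 * a4 + x5 * a5 + x6 * a6"
  shows "d dvd E"
  unfolding assms(7) using assms(1-6) by (intro dvd_add dvd_mult)

context good_prime_form
begin

text \<open>One Newton step. Adding \<open>(p * s) *s t\<close> with \<beta> t w congruent to 1
  changes \<beta> w w = p q by 2 p s modulo p^2, so s = - q / 2 is required; \<open>h\<close> is the
  inverse of 2 modulo p.\<close>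

lemma isotropic_lift:
  assumes w: "\<not> vdvd p w" "p dvd \<beta> w w"
  obtains w' where "vdvd p (w' - w)" "\<not> vdvd p w'" "p ^ 2 dvd \<beta> w' w'"
proof -
  obtain t where t: "p dvd \<beta> t w - 1" using dual_vector[OF w(1)] .
  obtain h where "[2 * h = 1] (mod p)" using inverse_mod_prime[OF p(1) not_dvd_2] .
  then obtain h' where h: "2 * h = 1 + p * h'" by (metis cong_iff_lin cong_sym)
  obtain t' where t': "\<beta> t w = 1 + p * t'" using t by (metis dvdE diff_add_cancel add.commute)
  obtain q where q: "\<beta> w w = p * q" using w(2) by (rule dvdE)
  define w' where "w' = w + (p * (- h * q)) *s t"
  have "\<beta> w' w' = p * q + 2 * (p * (- h * q)) * (1 + p * t') + (p * (- h * q)) ^ 2 * \<beta> t t"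
    using beta_commute[of w t] by (simp add: w'_def bform_linear q t' power2_eq_square algebra_simps)
  also have "\<dots> = p * q * (1 - 2 * h) + p ^ 2 * (- 2 * h * q * t' + (h * q) ^ 2 * \<beta> t t)"
    by (simp add: power2_eq_square algebra_simps)
  also have "1 - 2 * h = - p * h'" using h by simp
  also have "p * q * (- p * h') + p ^ 2 * (- 2 * h * q * t' + (h * q) ^ 2 * \<beta> t t) =
      p ^ 2 * (- q * h' - 2 * h * q * t' + (h * q) ^ 2 * \<beta> t t)"
    by (simp add: power2_eq_square algebra_simps)
  finally have "p ^ 2 dvd \<beta> w' w'" by simp
  moreover have "vdvd p (w' - w)" by (simp add: w'_def vdvd_def)
  moreover have "\<not> vdvd p w'" using w(1) \<open>vdvd p (w' - w)\<close> vdvd_diff[of p w' "w' - w"] by auto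
  ultimately show ?thesis using that by blast
qed

text \<open>
  Modulo \<open>p\<close> the form is \<open>2XY + vZ\<^sup>2\<close> in a suitable basis \<open>e, f, g\<close>; comparing determinants gives \<open>v\<close>.
\<close>

lemma hyperbolic_basis:
  obtains e f g v \<delta> where
    "\<not> vdvd p e" "p dvd \<beta> e e" "p dvd \<beta> f f" "p dvd \<beta> e f - 1" "p dvd \<beta> g e" "p dvd \<beta> g f"
    "v = \<beta> g g" "\<not> p dvd v" "\<not> p dvd \<delta>" "p dvd v + \<delta> ^ 2 * det G"
    "\<And>x. p dvd \<beta> x e \<Longrightarrow> p dvd \<beta> x f \<Longrightarrow> p dvd \<beta> x g \<Longrightarrow> vdvd p x"
proof -
  obtain e where e: "\<not> vdvd p e" "p dvd \<beta> e e" using isotropic_exists by blast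
  obtain f0 where f0: "p dvd \<beta> f0 e - 1" using dual_vector[OF e(1)] .
  obtain h where "[2 * h = 1] (mod p)" using inverse_mod_prime[OF p(1) not_dvd_2] .
  then have h: "p dvd 2 * h - 1" by (simp add: cong_iff_dvd_diff)
  \<comment> \<open>Moving along \<open>e\<close> changes the norm of \<open>f0\<close> by twice the
    coefficient modulo p, so half the norm of \<open>f0\<close> is subtracted to make
    \<open>f\<close> isotropic.\<close>
  define f where "f = f0 - (h * \<beta> f0 f0) *s e"
  have fe: "p dvd \<beta> f e - 1"
  proof -
    show ?thesis
      by (rule dvd_lincomb[OF f0 e(2) dvd_0_right dvd_0_right dvd_0_right dvd_0_right,
            where ?x1.0 = "1" and ?x2.0 = "- h * \<beta> f0 f0" and ?x3.0 = "0" and ?x4.0 = "0" and ?x5.0 = "0" and ?x6.0 = "0"])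
        (simp add: f_def bform_linear)
  qed
  have ff: "p dvd \<beta> f f"
  proof -
    show ?thesis
      by (rule dvd_lincomb[OF h f0 e(2) dvd_0_right dvd_0_right dvd_0_right,
            where ?x1.0 = "- \<beta> f0 f0" and ?x2.0 = "- 2 * h * \<beta> f0 f0" and ?x3.0 = "(h * \<beta> f0 f0) ^ 2" and ?x4.0 = "0" and ?x5.0 = "0" and ?x6.0 = "0"])
        (use beta_commute[of e f0] in \<open>simp add: f_def bform_linear power2_eq_square algebra_simps\<close>)
  qed
  have ef: "p dvd \<beta> e f - 1" using fe beta_commute by simp
  have "\<exists>k. \<not> p dvd det (vector [e, f, axis k 1] :: int ^ 3 ^ 3)"
  proof (rule ccontr)
    assume "\<not> ?thesis"
    then have "\<exists>c. vdvd p (f - c *s e)"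
      by (intro minors_imp_parallel[OF e(1)] det_axis_imp_minors) auto
    then obtain c where "vdvd p (f - c *s e)" by blast
    from bform_vdvd[OF this, of G e] have "p dvd \<beta> e f - c * \<beta> e e" by (simp add: bform_linear)
    then have "p dvd \<beta> e f" using e(2) by (metis dvd_diff_right_iff dvd_mult int_dvd_diffD)
    then have "p dvd 1" using ef by (metis int_dvd_diffD1)
    then show False using p by (simp add: prime_int_iff)
  qed
  then obtain k where k: "\<not> p dvd det (vector [e, f, axis k 1] :: int ^ 3 ^ 3)" by blast
  define a where "a = (axis k 1 :: int ^ 3)"
  \<comment> \<open>The projection of \<open>a\<close> to the orthogonal complement of the
    hyperbolic plane spanned by \<open>e\<close> and \<open>f\<close>. It leaves the determinant
    with \<open>e\<close> and \<open>f\<close> unchanged.\<close>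
  define g where "g = a - \<beta> a f *s e - \<beta> a e *s f"
  define R :: "int ^ 3 ^ 3" where "R = vector [e, f, g]"
  have detR: "det R = det (vector [e, f, axis k 1] :: int ^ 3 ^ 3)"
    by (simp add: R_def g_def a_def[symmetric] det_3 algebra_simps)
  have ge: "p dvd \<beta> g e"
  proof -
    show ?thesis
      by (rule dvd_lincomb[OF fe e(2) dvd_0_right dvd_0_right dvd_0_right dvd_0_right,
            where ?x1.0 = "- \<beta> a e" and ?x2.0 = "- \<beta> a f" and ?x3.0 = "0" and ?x4.0 = "0" and ?x5.0 = "0" and ?x6.0 = "0"])
        (simp add: g_def bform_linear algebra_simps)
  qed
  have gf: "p dvd \<beta> g f"
  proof -
    show ?thesis
      by (rule dvd_lincomb[OF ef ff dvd_0_right dvd_0_right dvd_0_right dvd_0_right,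
            where ?x1.0 = "- \<beta> a f" and ?x2.0 = "- \<beta> a e" and ?x3.0 = "0" and ?x4.0 = "0" and ?x5.0 = "0" and ?x6.0 = "0"])
        (simp add: g_def bform_linear algebra_simps)
  qed
  define v where "v = \<beta> g g"
  \<comment> \<open>The hyperbolic plane has determinant -1, so the Gram determinant of e, f, g is
    \<open>- v\<close> modulo p.\<close>
  have vd: "p dvd v + det R ^ 2 * det G"
  proof -
    have "det R ^ 2 * det G = \<beta> e e * (\<beta> f f * v - \<beta> f g * \<beta> g f) - \<beta> e f * (\<beta> f e * v - \<beta> f g * \<beta> g e)
        + \<beta> e g * (\<beta> f e * \<beta> g f - \<beta> f f * \<beta> g e)"
      unfolding gram_det by (simp add: R_def det_3 v_def algebra_simps)
    then have eq: "v + det R ^ 2 * det G = - \<beta> f e * v * (\<beta> e f - 1) + - v * (\<beta> f e - 1)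
        + (\<beta> f f * v - \<beta> f g * \<beta> g f) * \<beta> e e + (\<beta> e f * \<beta> f g - \<beta> e g * \<beta> f f) * \<beta> g e + (\<beta> e g * \<beta> f e) * \<beta> g f + 0 * 0"
      by (simp add: algebra_simps)
    show ?thesis by (rule dvd_lincomb[OF ef fe e(2) ge gf dvd_0_right eq])
  qed
  have dR: "\<not> p dvd det R" using k detR by simp
  have v: "\<not> p dvd v"
  proof
    assume "p dvd v"
    then have "p dvd det R ^ 2 * det G" using vd by (metis dvd_add_right_iff)
    then show False using dR disc p by (simp add: prime_dvd_mult_iff prime_dvd_power_iff)
  qed
  have "vdvd p x" if "p dvd \<beta> x e" "p dvd \<beta> x f" "p dvd \<beta> x g" for x
  proof -
    have "(R *v (G *v x)) $ i = \<beta> (R $ i) x" for i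
      by (simp add: bform_def matrix_vector_mult_def)
    then have "vdvd p ((R ** G) *v x)"
      using that beta_commute[of x]
      by (simp add: vdvd_def forall_3 matrix_vector_mul_assoc[symmetric] R_def)
    moreover have "\<not> p dvd det (R ** G)" using dR disc p by (simp add: det_mul prime_dvd_mult_iff)
    ultimately show ?thesis using vdvd_solve[OF p(1)] by blast
  qed
  then show ?thesis using that[of e f g v "det R"] e ff ef ge gf v vd dR v_def by blast
qed

text \<open>The conic has a point, so it is parametrised by the projective line: z < p gives the
  line of - (v/2) z^2 e + f + z g, and z = p stands for the point at infinity, the line of e. The
  product \<beta> y (W z) is a polynomial of degree at most 2 in z whose discriminant is
  \<open>- 2 * det G * n\<close> up to a square, and it has 1 + Legendre symbol roots on the
  projective line.\<close>

theorem isotropic_lines: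
  obtains W where
    "\<And>z. z \<in> {0..p} \<Longrightarrow> \<not> vdvd p (W z) \<and> p dvd \<beta> (W z) (W z)"
    "\<And>w. \<not> vdvd p w \<Longrightarrow> p dvd \<beta> w w \<Longrightarrow> \<exists>z\<in>{0..p}. \<exists>c. vdvd p (w - c *s W z)"
    "\<And>z z' c. z \<in> {0..p} \<Longrightarrow> z' \<in> {0..p} \<Longrightarrow> vdvd p (W z - c *s W z') \<Longrightarrow> z = z'"
    "\<And>y n. \<not> vdvd p y \<Longrightarrow> \<beta> y y = 2 * n \<Longrightarrow>
       int (card {z\<in>{0..p}. p dvd \<beta> y (W z)}) = 1 + Legendre (- 2 * det G * n) p"
proof -
  obtain e f g v \<delta> where e0: "\<not> vdvd p e" and ee: "p dvd \<beta> e e" and ff: "p dvd \<beta> f f"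
    and ef: "p dvd \<beta> e f - 1" and ge: "p dvd \<beta> g e" and gf: "p dvd \<beta> g f" and v: "v = \<beta> g g"
    and v0: "\<not> p dvd v" and \<delta>: "\<not> p dvd \<delta>" "p dvd v + \<delta> ^ 2 * det G"
    and zero: "\<And>x. p dvd \<beta> x e \<Longrightarrow> p dvd \<beta> x f \<Longrightarrow> p dvd \<beta> x g \<Longrightarrow> vdvd p x"
    using hyperbolic_basis by blast
  note comm = beta_commute[of f e] beta_commute[of e g] beta_commute[of f g]
  obtain h where "[2 * h = 1] (mod p)" using inverse_mod_prime[OF p(1) not_dvd_2] .
  then have h: "p dvd 2 * h - 1" by (simp add: cong_iff_dvd_diff)
  obtain vi where "[v * vi = 1] (mod p)" using inverse_mod_prime[OF p(1) v0] .
  then have vi: "p dvd v * vi - 1" by (simp add: cong_iff_dvd_diff)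
  define W where "W z = (if z = p then e else (- h * v * z ^ 2) *s e + f + z *s g)" for z
  have We: "p dvd \<beta> (W z) e - (if z = p then 0 else 1)" for z
  proof (cases "z = p")
    case False
    show ?thesis
      by (rule dvd_lincomb[OF ee ef ge dvd_0_right dvd_0_right dvd_0_right,
            where ?x1.0 = "- h * v * z ^ 2" and ?x2.0 = "1" and ?x3.0 = "z" and ?x4.0 = "0" and ?x5.0 = "0" and ?x6.0 = "0"])
        (use False in \<open>simp add: W_def bform_linear comm\<close>)
  qed (simp add: W_def ee)
  have Wg: "p dvd \<beta> (W z) g - (if z = p then 0 else v * z)" for z
  proof (cases "z = p")
    case False
    show ?thesis
      by (rule dvd_lincomb[OF ge gf dvd_0_right dvd_0_right dvd_0_right dvd_0_right,
            where ?x1.0 = "- h * v * z ^ 2" and ?x2.0 = "1" and ?x3.0 = "0" and ?x4.0 = "0" and ?x5.0 = "0" and ?x6.0 = "0"])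
        (use False in \<open>simp add: W_def bform_linear comm v\<close>)
  qed (simp add: W_def ge comm)
  have p1: "\<not> p dvd 1" using p by (simp add: prime_int_iff)
  have W0: "\<not> vdvd p (W z)" for z
  proof (cases "z = p")
    case False
    show ?thesis
    proof
      assume "vdvd p (W z)"
      then have "p dvd \<beta> (W z) e" using bform_vdvd[of p "W z" G e] beta_commute by simp
      then show False using We[of z] p1 False by (auto dest: int_dvd_diffD1)
    qed
  qed (simp add: W_def e0)
  have WW: "p dvd \<beta> (W z) (W z)" for z
  proof (cases "z = p")
    case False
    show ?thesis
      by (rule dvd_lincomb[OF ee ef ge ff gf h, where ?x1.0 = "(h * v * z ^ 2) ^ 2" and ?x2.0 = "- 2 * h * v * z ^ 2"
            and ?x3.0 = "- 2 * h * v * z ^ 2 * z" and ?x4.0 = 1 and ?x5.0 = "2 * z" and ?x6.0 = "- v * z ^ 2"])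
        (use False in \<open>simp add: W_def bform_linear comm v power2_eq_square algebra_simps\<close>)
  qed (simp add: W_def ee)
  \<comment> \<open>The coefficients of y in the basis e, f, g: \<open>e\<close> and
    \<open>f\<close> are dual to each other, and \<open>vi\<close> inverts the norm \<open>v\<close>
    of \<open>g\<close>.\<close>
  have coords: "vdvd p (y - (\<beta> y f *s e + \<beta> y e *s f + (\<beta> y g * vi) *s g))" for y
  proof (rule zero)
    let ?r = "y - (\<beta> y f *s e + \<beta> y e *s f + (\<beta> y g * vi) *s g)"
    show "p dvd \<beta> ?r e"
      by (rule dvd_lincomb[OF ee ef ge dvd_0_right dvd_0_right dvd_0_right,
            where ?x1.0 = "- \<beta> y f" and ?x2.0 = "- \<beta> y e" and ?x3.0 = "- \<beta> y g * vi" and ?x4.0 = "0" and ?x5.0 = "0" and ?x6.0 = "0"])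
        (simp add: bform_linear comm algebra_simps)
    show "p dvd \<beta> ?r f"
      by (rule dvd_lincomb[OF ff ef gf dvd_0_right dvd_0_right dvd_0_right,
            where ?x1.0 = "- \<beta> y e" and ?x2.0 = "- \<beta> y f" and ?x3.0 = "- \<beta> y g * vi" and ?x4.0 = "0" and ?x5.0 = "0" and ?x6.0 = "0"])
        (simp add: bform_linear comm algebra_simps)
    show "p dvd \<beta> ?r g"
      by (rule dvd_lincomb[OF vi ge gf dvd_0_right dvd_0_right dvd_0_right,
            where ?x1.0 = "- \<beta> y g" and ?x2.0 = "- \<beta> y f" and ?x3.0 = "- \<beta> y e" and ?x4.0 = "0" and ?x5.0 = "0" and ?x6.0 = "0"])
        (simp add: bform_linear comm v algebra_simps)
  qed
  have norm: "p dvd \<beta> y y - (2 * \<beta> y e * \<beta> y f + vi * \<beta> y g ^ 2)" for y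
  proof -
    have "p dvd \<beta> y (y - (\<beta> y f *s e + \<beta> y e *s f + (\<beta> y g * vi) *s g))"
      by (rule bform_vdvd[OF coords])
    then show ?thesis by (simp add: bform_linear power2_eq_square algebra_simps)
  qed
  have lines: "\<exists>z\<in>{0..p}. \<exists>c. vdvd p (w - c *s W z)" if w: "\<not> vdvd p w" "p dvd \<beta> w w" for w
  proof (cases "p dvd \<beta> w e")
    case True
    have "p dvd \<beta> w (W p)" using True by (simp add: W_def)
    then have "\<exists>c. vdvd p (w - c *s W p)"
      using w W0 WW by (intro isotropic_parallel)
    then show ?thesis using p_pos by (intro bexI[of _ p]) auto
  next
    case False
    obtain ai where "[\<beta> w e * ai = 1] (mod p)" using inverse_mod_prime[OF p(1) False] .
    then have ai: "p dvd \<beta> w e * ai - 1" by (simp add: cong_iff_dvd_diff)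
    define z where "z = (\<beta> w g * vi * ai) mod p"
    have z: "z \<in> {0..<p}" using p_pos by (simp add: z_def)
    then have zp: "z \<noteq> p" by auto
    have zc: "p dvd z - \<beta> w g * vi * ai" unfolding z_def by (metis mod_eq_dvd_iff mod_mod_trivial)
    have "\<beta> w (W z) = - h * v * z ^ 2 * \<beta> w e + \<beta> w f + z * \<beta> w g"
      using zp by (simp add: W_def bform_linear)
    moreover have "p dvd - h * v * z ^ 2 * \<beta> w e + \<beta> w f + z * \<beta> w g"
    proof -
      have n: "p dvd 2 * \<beta> w e * \<beta> w f + vi * \<beta> w g ^ 2"
        using norm[of w] w(2) by (metis int_dvd_diffD1)
      define A where "A = \<beta> w e"
      define B where "B = \<beta> w f"
      define D where "D = \<beta> w g"
      note fold = A_def[symmetric] B_def[symmetric] D_def[symmetric]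
      \<comment> \<open>Modulo p this is - 1/v times the square of v z A - D, and \<open>z\<close>
        was chosen to make that difference vanish.\<close>
      have "p dvd 2 * A * (- h * v * z ^ 2 * A + B + z * D)"
      proof -
        define Y where "Y = z * A - D * vi"
        have "Y = (z - D * vi * ai) * A + (A * ai - 1) * (D * vi)" by (simp add: Y_def algebra_simps)
        then have Y: "p dvd Y" using zc ai unfolding fold by simp
        show ?thesis
          by (rule dvd_lincomb[OF n[unfolded fold] h Y vi dvd_0_right dvd_0_right,
                where ?x1.0 = 1 and ?x2.0 = "- v * (z * A) ^ 2" and ?x3.0 = "2 * D - v * (z * A + D * vi)"
                  and ?x4.0 = "- vi * D ^ 2"])
            (simp add: Y_def power2_eq_square algebra_simps)
      qed
      then show ?thesis using False not_dvd_2 p unfolding fold by (simp add: prime_dvd_mult_iff)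
    qed
    ultimately have "p dvd \<beta> w (W z)" by simp
    then have "\<exists>c. vdvd p (w - c *s W z)"
      using w W0 WW by (intro isotropic_parallel)
    then show ?thesis using z by (intro bexI[of _ z]) auto
  qed
  have uniq: "z = z'" if z: "z \<in> {0..p}" "z' \<in> {0..p}" and par: "vdvd p (W z - c *s W z')" for z z' c
  proof -
    have 1: "p dvd \<beta> (W z) x - c * \<beta> (W z') x" for x
      using bform_vdvd[OF par, of G x] by (simp add: beta_commute[of x] bform_linear)
    have c0: "\<not> p dvd c"
    proof
      assume "p dvd c"
      then have "vdvd p (c *s W z')" by (simp add: vdvd_def)
      then have "vdvd p (W z)" using vdvd_diff[OF par, of "- (c *s W z')"] by (simp add: vdvd_def)
      then show False using W0 by blast
    qed
    \<comment> \<open>The coefficient of \<open>W z\<close> along \<open>f\<close>: 0 at infinity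
      and 1 elsewhere. Comparing it separates infinity from the rest and gives c = 1 modulo p on the
      affine part.\<close>
    define \<epsilon> where "\<epsilon> z = (if z = p then 0 else 1::int)" for z
    have "p dvd \<epsilon> z - c * \<epsilon> z'"
    proof -
      note W1 = We[of z, folded \<epsilon>_def] and W2 = We[of z', folded \<epsilon>_def]
      show ?thesis
        by (rule dvd_lincomb[OF 1[of e] W1 W2 dvd_0_right dvd_0_right dvd_0_right,
              where ?x1.0 = 1 and ?x2.0 = "- 1" and ?x3.0 = c]) (simp add: algebra_simps)
    qed
    then have eps: "\<epsilon> z = \<epsilon> z'" "z \<noteq> p \<Longrightarrow> p dvd 1 - c"
      using c0 p1 by (auto simp: \<epsilon>_def split: if_splits)
    show ?thesis
    proof (cases "z = p")
      case True
      then show ?thesis using eps by (auto simp: \<epsilon>_def split: if_splits)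
    next
      case False
      then have z'p: "z' \<noteq> p" using eps by (auto simp: \<epsilon>_def split: if_splits)
      note W1 = Wg[of z, simplified if_not_P[OF False]] and W2 = Wg[of z', simplified if_not_P[OF z'p]]
      have "p dvd v * (z - z')"
        by (rule dvd_lincomb[OF 1[of g] W1 W2 eps(2)[OF False] dvd_0_right dvd_0_right,
              where ?x1.0 = 1 and ?x2.0 = "- 1" and ?x3.0 = c and ?x4.0 = "- v * z'"]) (simp add: algebra_simps)
      then have "p dvd z - z'" using v0 p by (simp add: prime_dvd_mult_iff)
      then show ?thesis using eq_if_dvd_diff[of p z z'] z False z'p by auto
    qed
  qed
  have count: "int (card {z\<in>{0..p}. p dvd \<beta> y (W z)}) = 1 + Legendre (- 2 * det G * n) p"
    if y: "\<not> vdvd p y" and n: "\<beta> y y = 2 * n" for y n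
  proof -
    define A where "A = \<beta> y e"
    define B where "B = \<beta> y f"
    define D where "D = \<beta> y g"
    have yW: "\<beta> y (W z) = (- (h * v) * A) * z ^ 2 + D * z + B" if "z \<noteq> p" for z
      using that by (simp add: W_def bform_linear A_def B_def D_def algebra_simps)
    have nABD: "p dvd 2 * n - (2 * A * B + vi * D ^ 2)"
      using norm[of y] n by (simp add: A_def B_def D_def)
    \<comment> \<open>As 2 h is 1 modulo p, the discriminant is D^2 + 2 v A B. By the norm formula
      this is 2 v n, and v is - \<delta>^2 det G.\<close>
    have cong: "[D ^ 2 - 4 * (- (h * v) * A) * B = (- 2 * det G * n) * \<delta> ^ 2] (mod p)"
    proof -
      have "p dvd D ^ 2 - 4 * (- (h * v) * A) * B - (- 2 * det G * n) * \<delta> ^ 2"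
        by (rule dvd_lincomb[OF \<delta>(2) nABD vi h dvd_0_right dvd_0_right,
              where ?x1.0 = "2 * n" and ?x2.0 = "- v" and ?x3.0 = "- (D ^ 2)" and ?x4.0 = "2 * v * A * B"])
          (simp add: power2_eq_square algebra_simps)
      then show ?thesis by (simp add: cong_iff_dvd_diff)
    qed
    have Leg: "Legendre (D ^ 2 - 4 * (- (h * v) * A) * B) p = Legendre (- 2 * det G * n) p"
      by (simp only: Legendre_cong[OF cong] Legendre_mult_square[OF p(1) \<delta>(1)])
    have "{0..p} = insert p {0..<p}" using p_pos by auto
    then have "{z\<in>{0..p}. p dvd \<beta> y (W z)} =
        {z\<in>{0..<p}. p dvd (- (h * v) * A) * z ^ 2 + D * z + B} \<union> (if p dvd A then {p} else {})"
      using yW by (auto simp: W_def A_def)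
    then have "card {z\<in>{0..p}. p dvd \<beta> y (W z)} =
        card {z\<in>{0..<p}. p dvd (- (h * v) * A) * z ^ 2 + D * z + B} + (if p dvd A then 1 else 0)"
    proof -
      let ?S = "{z\<in>{0..<p}. p dvd (- (h * v) * A) * z ^ 2 + D * z + B}"
      have "finite ?S" "p \<notin> ?S" by (rule finite_subset[of _ "{0..<p}"]) auto
      then show ?thesis
        using \<open>{z\<in>{0..p}. p dvd \<beta> y (W z)} = ?S \<union> (if p dvd A then {p} else {})\<close> by simp
    qed
    \<comment> \<open>The point at infinity is a root exactly when the leading coefficient vanishes.
      It then makes up for the root that the polynomial loses with its degree.\<close>
    moreover have "int (card {z\<in>{0..<p}. p dvd (- (h * v) * A) * z ^ 2 + D * z + B}) =
       1 + Legendre (- 2 * det G * n) p - (if p dvd A then 1 else 0)"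
    proof (cases "p dvd A")
      case False
      have "\<not> p dvd h" using h p1 by (metis int_dvd_diffD1 dvd_mult)
      then have "\<not> p dvd - (h * v) * A" using False v0 p by (simp add: prime_dvd_mult_iff)
      from card_quadratic_roots[OF p this, of D B] show ?thesis using False Leg by simp
    next
      case True
      have "p dvd (- (h * v) * A) * z ^ 2 + D * z + B \<longleftrightarrow> p dvd D * z + B" for z
      proof -
        have "p dvd (- (h * v) * A) * z ^ 2" using True by simp
        then show ?thesis by (simp only: add.assoc dvd_add_right_iff)
      qed
      then have eq: "{z\<in>{0..<p}. p dvd (- (h * v) * A) * z ^ 2 + D * z + B} = {z\<in>{0..<p}. p dvd D * z + B}"
        by simp
      have D2: "[D ^ 2 = D ^ 2 - 4 * (- (h * v) * A) * B] (mod p)"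
        using True by (simp add: cong_iff_dvd_diff)
      show ?thesis
      proof (cases "p dvd D")
        case D: True
        have "\<not> p dvd B" using zero[of y] y True D by (auto simp: A_def B_def D_def)
        then have "\<not> p dvd D * z + B" for z using D by (simp add: dvd_add_right_iff)
        then have e0: "{z\<in>{0..<p}. p dvd D * z + B} = {}" by simp
        have "Legendre (D ^ 2) p = 0"
          using D by (simp add: Legendre_def cong_0_iff power2_eq_square)
        then show ?thesis unfolding eq e0 using True Leg Legendre_cong[OF D2] by simp
      next
        case D: False
        have "Legendre (D ^ 2) p = 1"
        proof -
          have "\<not> p dvd D ^ 2" using D p by (simp add: prime_dvd_power_iff)
          moreover have "QuadRes p (D ^ 2)" unfolding QuadRes_def by (intro exI[of _ D]) simp
          ultimately show ?thesis by (simp add: Legendre_def cong_0_iff)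
        qed
        then show ?thesis unfolding eq using True Leg Legendre_cong[OF D2] card_linear_roots[OF p(1) D, of B] by simp
      qed
    qed
    ultimately show ?thesis by simp
  qed
  show ?thesis using that[of W] W0 WW lines uniq count by blast
qed

end

section \<open>Reduced bases, and a bound for the entries of a Gram matrix in terms of its
  determinant\<close>

subsection \<open>Reduction of ternary forms\<close>

lemma round_multiple:
  fixes D u :: rat
  assumes "D > 0"
  obtains y :: int where "\<bar>D * of_int y + u\<bar> \<le> D / 2"
proof -
  define y where "y = round (- u / D)"
  have "\<bar>of_int y - (- u / D)\<bar> \<le> 1 / 2" unfolding y_def by (rule of_int_round_abs_le)
  then have "D * \<bar>of_int y - (- u / D)\<bar> \<le> D * (1 / 2)" using assms by (intro mult_left_mono) auto
  also have "D * \<bar>of_int y - (- u / D)\<bar> = \<bar>D * of_int y + u\<bar>"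
  proof -
    have "D * \<bar>of_int y - (- u / D)\<bar> = \<bar>D * (of_int y - (- u / D))\<bar>" using assms by (simp add: abs_mult)
    also have "D * (of_int y - (- u / D)) = D * of_int y + u" using assms by (simp add: field_simps)
    finally show ?thesis .
  qed
  finally show ?thesis using that by simp
qed

text \<open>
  The inequality \<open>abc \<le> 3 d\<close> for a Minkowski-reduced form with diagonal \<open>a, b, c\<close>, by completing squares
  along the flag \<open>e\<^sub>1, e\<^sub>2, e\<^sub>3\<close>.
\<close>

lemma reduced_product_bound:
  fixes a b c r s t :: rat
  assumes a: "a > 0" and ab: "a \<le> b" and bc: "b \<le> c"
    and r: "\<bar>2 * r\<bar> \<le> a" and D: "a * b - r ^ 2 > 0"
    and min: "\<And>x y :: int. c \<le> c + of_int x ^ 2 * a + of_int y ^ 2 * b + 2 * of_int x * s + 2 * of_int y * t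
       + 2 * of_int x * of_int y * r"
  defines "\<Delta> \<equiv> a * b * c + 2 * r * s * t - a * t ^ 2 - b * s ^ 2 - c * r ^ 2"
  shows "a * b * c \<le> 3 * \<Delta>"
proof -
  let ?D = "a * b - r ^ 2"
  \<comment> \<open>\<open>y\<close> is rounded first because the second square in the identity
    below does not involve \<open>x\<close>; then \<open>x\<close> is rounded for this
    \<open>y\<close>.\<close>
  obtain y :: int where y: "\<bar>?D * of_int y + (a * t - r * s)\<bar> \<le> ?D / 2" using round_multiple[OF D] .
  obtain x :: int where x: "\<bar>a * of_int x + (r * of_int y + s)\<bar> \<le> a / 2" using round_multiple[OF a] .
  let ?Q = "c + of_int x ^ 2 * a + of_int y ^ 2 * b + 2 * of_int x * s + 2 * of_int y * t + 2 * of_int x * of_int y * r"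
  have id: "a * ?D * ?Q = ?D * (a * of_int x + (r * of_int y + s)) ^ 2 + (?D * of_int y + (a * t - r * s)) ^ 2 + a * \<Delta>"
    by (simp add: \<Delta>_def power2_eq_square algebra_simps)
  have sx: "(a * of_int x + (r * of_int y + s)) ^ 2 \<le> (a / 2) ^ 2"
    using x by (metis abs_ge_zero power2_abs power_mono)
  have sy: "(?D * of_int y + (a * t - r * s)) ^ 2 \<le> (?D / 2) ^ 2"
    using y by (metis abs_ge_zero power2_abs power_mono)
  have "a * ?D * c \<le> a * ?D * ?Q" using min[of x y] a D by (intro mult_left_mono) auto
  also have "\<dots> \<le> ?D * (a / 2) ^ 2 + (?D / 2) ^ 2 + a * \<Delta>"
    unfolding id using sx sy D by (intro add_mono mult_left_mono order_refl) auto
  finally have 1: "a * ?D * c \<le> ?D * (a / 2) ^ 2 + (?D / 2) ^ 2 + a * \<Delta>" .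
  have "?D \<le> a * b" by simp
  then have "?D * ?D \<le> ?D * (a * b)" using D by (intro mult_left_mono) auto
  moreover have "?D * (a / 2) ^ 2 + (?D / 2) ^ 2 = ?D * (a * a) / 4 + ?D * ?D / 4"
    by (simp add: power2_eq_square)
  moreover have "a * (?D * (a / 4 + b / 4)) = ?D * (a * a) / 4 + ?D * (a * b) / 4"
    by (simp add: field_simps)
  ultimately have "?D * (a / 2) ^ 2 + (?D / 2) ^ 2 \<le> a * (?D * (a / 4 + b / 4))" by simp
  also have "\<dots> \<le> a * (?D * (c / 2))"
    using a D ab bc by (intro mult_left_mono) auto
  finally have "a * (?D * c) \<le> a * (2 * \<Delta>)" using 1 by (simp add: algebra_simps)
  then have 2: "?D * c \<le> 2 * \<Delta>" using a by (simp only: mult_le_cancel_left_pos)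
  have "(2 * r) ^ 2 \<le> a ^ 2" using r by (metis abs_ge_zero power2_abs power_mono)
  also have "a ^ 2 \<le> a * b" using a ab by (simp add: power2_eq_square)
  finally have "a * b * (3 / 4) \<le> ?D" by (simp add: power2_eq_square)
  then have "a * b * (3 / 4) * c \<le> ?D * c" using a ab bc by (intro mult_right_mono) auto
  moreover have "a * b * (3 / 4) * c = (3 / 4) * (a * b * c)" by simp
  \<comment> \<open>This is abc <= (8/3) \<Delta>; the constant 3 rounds it up.\<close>
  ultimately have "(3 / 4) * (a * b * c) \<le> 2 * \<Delta>" using 2 by (metis order_trans)
  moreover have "a * b * c \<ge> 0" using a ab bc by simp
  ultimately show ?thesis by linarith
qed

lemma det_sym_3:
  fixes N :: "rat ^ 3 ^ 3"
  assumes "transpose N = N"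
  shows "det N = N$1$1 * N$2$2 * N$3$3 + 2 * N$1$2 * N$1$3 * N$2$3 - N$1$1 * N$2$3 ^ 2 - N$2$2 * N$1$3 ^ 2
    - N$3$3 * N$1$2 ^ 2"
proof -
  have s: "N $ i $ j = N $ j $ i" for i j
    using arg_cong[OF assms, of "\<lambda>G. G $ j $ i"] by (simp add: transpose_def)
  show ?thesis unfolding det_3 s[of 2 1] s[of 3 1] s[of 3 2]
    by (simp add: power2_eq_square algebra_simps)
qed

lemma gram_diag: "gram N U $ i $ i = quad N (U *v axis i 1)"
proof -
  have "gram N U $ i $ i = quad (gram N U) (axis i 1)" by (simp add: quad_def bilin_axis)
  then show ?thesis by (simp only: quad_gram)
qed

lemma transpose_vector_axis:
  "transpose (vector [c1, c2, c3] :: rat ^ 3 ^ 3) *v axis 1 1 = c1"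
  "transpose (vector [c1, c2, c3] :: rat ^ 3 ^ 3) *v axis 2 1 = c2"
  "transpose (vector [c1, c2, c3] :: rat ^ 3 ^ 3) *v axis 3 1 = c3"
  by (simp_all only: vec_eq_iff matrix_axis) (simp_all add: transpose_def)

lemma int_mat_columns:
  assumes "c1 \<in> std_lattice" "c2 \<in> std_lattice" "c3 \<in> std_lattice"
  shows "int_mat (transpose (vector [c1, c2, c3]))"
  using assms by (auto simp: int_mat_def transpose_def std_lattice_def forall_3)

lemma ternary_gram_unimodular:
  assumes "ternary_lattice N" "int_mat U" "det U ^ 2 = 1"
  shows "isometric (gram N U) N" "ternary_lattice (gram N U)"
proof -
  have d: "det (gram N U) = det N" using assms by (simp add: det_gram)
  have s: "space_isometry (gram N U) N ((*v) U)"
    using ternary_minors_pos(3)[OF assms(1)] d by (intro matrix_space_isometry) auto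
  have im: "(*v) U ` std_lattice = std_lattice" by (rule int_mat_unimodular_image) fact+
  show "isometric (gram N U) N" using s im by (auto simp: isometric_def lattice_isometry_def)
  have "U *v x \<noteq> 0" if "x \<noteq> 0" for x
    using that injD[OF space_isometry_inj[OF s], of x 0] by auto
  moreover have "quad (gram N U) ` std_lattice = quad N ` std_lattice"
  proof -
    have "quad (gram N U) ` std_lattice = quad N ` ((*v) U ` std_lattice)" by (simp add: quad_gram image_image)
    then show ?thesis by (simp only: im)
  qed
  ultimately show "ternary_lattice (gram N U)"
    using assms(1) by (simp add: ternary_lattice_def transpose_gram quad_gram)
qed

text \<open>Descent on the weighted trace 3a + 2b + c of the diagonal, a nonnegative integer. The
  decreasing weights make every exchange of diagonal entries in the wrong order profitable, so a
  minimum has a <= b <= c. Minimality under adding multiples of earlier basis vectors gives the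
  hypotheses of \<open>reduced_product_bound\<close>. Since a and b are at least 1, the product
  bound controls c, and Cauchy-Schwarz controls the other entries.\<close>

lemma reduced_gram:
  assumes N: "ternary_lattice N"
  obtains U where "int_mat U" "det U ^ 2 = 1" "\<And>i j. \<bar>gram N U $ i $ j\<bar> \<le> 3 * det N"
proof -
  define wt where "wt U = 3 * gram N U $ 1 $ 1 + 2 * gram N U $ 2 $ 2 + gram N U $ 3 $ 3" for U
  define S where "S = {U. int_mat U \<and> det U ^ 2 = 1}"
  have wt: "\<exists>k::nat. wt U = of_nat k" if "U \<in> S" for U
  proof -
    have t: "ternary_lattice (gram N U)" using that N by (auto simp: S_def intro: ternary_gram_unimodular)
    have "gram N U $ i $ i \<ge> 0" for i
    proof -
      have "gram N U $ i $ i = quad (gram N U) (axis i 1)" by (simp add: quad_def bilin_axis)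
      also have "\<dots> \<ge> 0" using ternary_pos[OF t, of "axis i 1"] by (simp add: axis_eq_0_iff)
      finally show ?thesis .
    qed
    then have "wt U \<ge> 0" by (simp add: wt_def)
    moreover have "wt U \<in> \<int>" using gram_diag_int[OF t] by (auto simp: wt_def)
    ultimately show ?thesis by (metis Ints_cases of_int_0_le_iff of_nat_nat of_int_of_nat_eq)
  qed
  have "mat 1 \<in> S" by (simp add: S_def det_I, simp add: int_mat_def mat_def)
  then obtain U where U: "U \<in> S" and Umin: "\<And>V. V \<in> S \<Longrightarrow> nat \<lfloor>wt U\<rfloor> \<le> nat \<lfloor>wt V\<rfloor>"
    using ex_has_least_nat[of "\<lambda>U. U \<in> S" _ "\<lambda>U. nat \<lfloor>wt U\<rfloor>"] by blast
  have min: "wt U \<le> wt V" if V: "V \<in> S" for V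
    using Umin[OF V] wt[OF U] wt[OF V] by (metis floor_of_nat nat_int of_nat_le_iff)
  define N' where "N' = gram N U"
  have t: "ternary_lattice N'" using U N by (auto simp: S_def N'_def intro: ternary_gram_unimodular)
  have d: "det N' = det N" using U by (simp add: N'_def det_gram S_def)
  note sy = gram_sym[OF t, of 2 1] gram_sym[OF t, of 3 1] gram_sym[OF t, of 3 2]
  have step: "3 * N' $ 1 $ 1 + 2 * N' $ 2 $ 2 + N' $ 3 $ 3 \<le> 3 * quad N' c1 + 2 * quad N' c2 + quad N' c3"
    if c: "c1 \<in> std_lattice" "c2 \<in> std_lattice" "c3 \<in> std_lattice"
      "det (vector [c1, c2, c3] :: rat ^ 3 ^ 3) ^ 2 = 1" for c1 c2 c3
  proof -
    let ?V = "transpose (vector [c1, c2, c3])"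
    have "U ** ?V \<in> S" using U c int_mat_columns[OF c(1-3)]
      by (simp add: S_def int_mat_mult det_mul det_transpose power_mult_distrib)
    from min[OF this] show ?thesis
      by (simp only: wt_def gram_gram[symmetric] N'_def[symmetric] gram_diag[of N' ?V] transpose_vector_axis)
  qed
  have ax: "quad N' (axis i 1) = N' $ i $ i" for i by (simp add: quad_def bilin_axis)
  have detax: "det (vector [axis 2 1, axis 1 1, axis 3 1] :: rat ^ 3 ^ 3) ^ 2 = 1"
      "det (vector [axis 1 1, axis 3 1, axis 2 1] :: rat ^ 3 ^ 3) ^ 2 = 1"
      "\<And>x. det (vector [axis 1 1, axis 2 1 + x *s axis 1 1, axis 3 1] :: rat ^ 3 ^ 3) ^ 2 = 1"
      "\<And>x y. det (vector [axis 1 1, axis 2 1, axis 3 1 + x *s axis 1 1 + y *s axis 2 1] :: rat ^ 3 ^ 3) ^ 2 = 1"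
    by (simp_all add: det_3 axis_def)
  have ab: "N' $ 1 $ 1 \<le> N' $ 2 $ 2"
    using step[OF _ _ _ detax(1)] by (simp add: ax)
  have bc: "N' $ 2 $ 2 \<le> N' $ 3 $ 3"
    using step[OF _ _ _ detax(2)] by (simp add: ax)
  have q2: "N' $ 2 $ 2 \<le> N' $ 2 $ 2 + 2 * x * N' $ 1 $ 2 + x ^ 2 * N' $ 1 $ 1" if "x \<in> \<int>" for x
  proof -
    have "quad N' (axis 2 1 + x *s axis 1 1) = N' $ 2 $ 2 + 2 * x * N' $ 1 $ 2 + x ^ 2 * N' $ 1 $ 1"
      by (simp add: quad_def bilin_linear bilin_axis sy power2_eq_square algebra_simps)
    then show ?thesis
      using step[OF _ _ _ detax(3)[of x]] that by (simp add: ax std_lattice_add std_lattice_scale)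
  qed
  have q3: "N' $ 3 $ 3 \<le> N' $ 3 $ 3 + of_int x ^ 2 * N' $ 1 $ 1 + of_int y ^ 2 * N' $ 2 $ 2 + 2 * of_int x * N' $ 1 $ 3
      + 2 * of_int y * N' $ 2 $ 3 + 2 * of_int x * of_int y * N' $ 1 $ 2" for x y :: int
  proof -
    let ?v = "axis 3 1 + of_int x *s axis 1 1 + of_int y *s axis 2 1"
    have "quad N' ?v = N' $ 3 $ 3 + of_int x ^ 2 * N' $ 1 $ 1 + of_int y ^ 2 * N' $ 2 $ 2 + 2 * of_int x * N' $ 1 $ 3
      + 2 * of_int y * N' $ 2 $ 3 + 2 * of_int x * of_int y * N' $ 1 $ 2"
      by (simp add: quad_def bilin_linear bilin_axis sy power2_eq_square algebra_simps)
    moreover have "?v \<in> std_lattice" by (intro std_lattice_add std_lattice_scale) auto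
    ultimately show ?thesis
      using step[OF _ _ _ detax(4)[of "of_int x" "of_int y"]] by (simp add: ax)
  qed
  note pos = ternary_minors_pos[OF t]
  have r: "\<bar>2 * N' $ 1 $ 2\<bar> \<le> N' $ 1 $ 1" using q2[of 1] q2[of "-1"] by auto
  have prod: "N' $ 1 $ 1 * N' $ 2 $ 2 * N' $ 3 $ 3 \<le> 3 * det N"
    using reduced_product_bound[OF pos(1) ab bc r pos(2) q3] det_sym_3[OF ternary_sym[OF t]] d by simp
  obtain a where "N' $ 1 $ 1 = of_int a" using gram_diag_int[OF t] by (auto elim: Ints_cases)
  then have "N' $ 1 $ 1 \<ge> 1" using pos(1) by simp
  then have "1 * 1 * N' $ 3 $ 3 \<le> N' $ 1 $ 1 * N' $ 2 $ 2 * N' $ 3 $ 3"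
    using ab bc by (intro mult_mono) auto
  then have c: "N' $ 3 $ 3 \<le> 3 * det N" using prod by simp
  have diag: "0 \<le> N' $ i $ i \<and> N' $ i $ i \<le> N' $ 3 $ 3" for i
    using exhaust_3[of i] pos(1) ab bc by auto
  have "\<bar>N' $ i $ j\<bar> \<le> N' $ 3 $ 3" for i j
  proof -
    have "N' $ i $ j ^ 2 \<le> N' $ i $ i * N' $ j $ j"
      using ternary_cauchy_schwarz[OF t, of "axis i 1" "axis j 1"] by (simp add: ax bilin_axis)
    also have "\<dots> \<le> N' $ 3 $ 3 * N' $ 3 $ 3" using diag[of i] diag[of j] by (intro mult_mono) auto
    finally have "\<bar>N' $ i $ j\<bar> ^ 2 \<le> N' $ 3 $ 3 ^ 2" by (simp add: power2_eq_square)
    then show ?thesis using diag[of 3] by (metis power2_le_imp_le)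
  qed
  then have "\<bar>gram N U $ i $ j\<bar> \<le> 3 * det N" for i j using c unfolding N'_def by (meson order_trans)
  then show ?thesis using that[of U] U by (simp add: S_def)
qed

lemma finite_half_integral_bounded:
  "finite {N :: rat ^ 3 ^ 3. \<forall>i j. 2 * N $ i $ j \<in> \<int> \<and> \<bar>N $ i $ j\<bar> \<le> C}" (is "finite ?S")
proof -
  define I where "I = (\<lambda>k. of_int k / 2 :: rat) ` {- \<lceil>2 * C\<rceil>..\<lceil>2 * C\<rceil>}"
  define f where "f = (\<lambda>(g :: 3 \<times> 3 \<Rightarrow> rat). (\<chi> i j. g (i, j)) :: rat ^ 3 ^ 3)"
  have "N \<in> f ` (Pi\<^sub>E UNIV (\<lambda>_. I))" if N: "N \<in> ?S" for N
  proof (rule image_eqI[of _ _ "\<lambda>(i, j). N $ i $ j"])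
    show "N = f (\<lambda>(i, j). N $ i $ j)" by (simp add: f_def vec_eq_iff)
    have "N $ i $ j \<in> I" for i j
    proof -
      have *: "2 * N $ i $ j \<in> \<int>" "\<bar>N $ i $ j\<bar> \<le> C" using N by auto
      then obtain k where k: "2 * N $ i $ j = of_int k" by (auto elim: Ints_cases)
      have "\<bar>of_int k\<bar> \<le> 2 * C" unfolding k[symmetric] using *(2) by (simp add: abs_mult)
      also have "2 * C \<le> of_int \<lceil>2 * C\<rceil>" by (rule le_of_int_ceiling)
      finally have "of_int \<bar>k\<bar> \<le> (of_int \<lceil>2 * C\<rceil> :: rat)" by simp
      then have "\<bar>k\<bar> \<le> \<lceil>2 * C\<rceil>" by (simp only: of_int_le_iff)
      then show ?thesis unfolding I_def using k by (intro image_eqI[of _ _ k]) auto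
    qed
    then show "(\<lambda>(i, j). N $ i $ j) \<in> Pi\<^sub>E UNIV (\<lambda>_. I)" by auto
  qed
  then have "?S \<subseteq> f ` (Pi\<^sub>E UNIV (\<lambda>_. I))" by blast
  moreover have "finite (Pi\<^sub>E (UNIV :: (3 \<times> 3) set) (\<lambda>_. I))" by (intro finite_PiE) (auto simp: I_def)
  ultimately show ?thesis by (meson finite_imageI finite_subset)
qed

section \<open>Convergence of products of reversible Markov operators to the stationary mean\<close>

subsection \<open>Lazy random walks\<close>

text \<open>The weight 1/2 for staying put excludes periodicity and allows walks along different
  primes to be concatenated without losing a positive lower bound (\<open>walk_ge\<close>).\<close>

definition lazy_step :: "('p \<Rightarrow> 'c \<Rightarrow> 'c \<Rightarrow> real) \<Rightarrow> ('p \<Rightarrow> real) \<Rightarrow> 'c set \<Rightarrow> 'p \<Rightarrow> ('c \<Rightarrow> real) \<Rightarrow> 'c \<Rightarrow> real" where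
  "lazy_step T d X p g C = (g C + (\<Sum>D\<in>X. T p C D * g D) / d p) / 2"

locale reversible_walk =
  fixes T :: "'p \<Rightarrow> 'c \<Rightarrow> 'c \<Rightarrow> real" and d :: "'p \<Rightarrow> real" and X :: "'c set" and P :: "'p set"
    and \<mu> :: "'c \<Rightarrow> real"
  assumes finX: "finite X"
    and mu_pos: "\<And>C. C \<in> X \<Longrightarrow> \<mu> C > 0"
    and T_nonneg: "\<And>p C D. p \<in> P \<Longrightarrow> C \<in> X \<Longrightarrow> D \<in> X \<Longrightarrow> T p C D \<ge> 0"
    and row_sum: "\<And>p C. p \<in> P \<Longrightarrow> C \<in> X \<Longrightarrow> (\<Sum>D\<in>X. T p C D) = d p"
    and d_pos: "\<And>p. p \<in> P \<Longrightarrow> d p > 0"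
    and reversible: "\<And>p C D. p \<in> P \<Longrightarrow> C \<in> X \<Longrightarrow> D \<in> X \<Longrightarrow> \<mu> C * T p C D = \<mu> D * T p D C"
begin

abbreviation "step \<equiv> lazy_step T d X"

definition walk :: "'p list \<Rightarrow> ('c \<Rightarrow> real) \<Rightarrow> 'c \<Rightarrow> real" where
  "walk ps g = foldr step ps g"

lemma walk_simps [simp]:
  "walk [] g = g" "walk (p # ps) g = step p (walk ps g)" "walk (ps @ qs) g = walk ps (walk qs g)"
  by (simp_all add: walk_def)

text \<open>Reversibility says that \<open>T p\<close> is self-adjoint for the weights \<mu>; moved
  to the constant function 1 it becomes the row sum \<open>d p\<close>.\<close>

lemma sum_apply_reversible:
  assumes "p \<in> P"
  shows "(\<Sum>C\<in>X. \<mu> C * (\<Sum>D\<in>X. T p C D * g D)) = d p * (\<Sum>C\<in>X. \<mu> C * g C)"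
proof -
  have "(\<Sum>C\<in>X. \<mu> C * (\<Sum>D\<in>X. T p C D * g D)) = (\<Sum>C\<in>X. \<Sum>D\<in>X. \<mu> D * T p D C * g D)"
    unfolding sum_distrib_left mult.assoc[symmetric]
    by (intro sum.cong refl) (simp add: reversible[OF assms])
  also have "\<dots> = (\<Sum>D\<in>X. \<mu> D * g D * (\<Sum>C\<in>X. T p D C))"
    by (subst sum.swap) (simp add: sum_distrib_left algebra_simps)
  also have "\<dots> = (\<Sum>D\<in>X. \<mu> D * g D * d p)"
    by (intro sum.cong refl) (simp add: row_sum[OF assms])
  finally show ?thesis by (simp add: sum_distrib_left mult.commute)
qed

lemma step_mean:
  assumes "p \<in> P"
  shows "(\<Sum>C\<in>X. \<mu> C * step p g C) = (\<Sum>C\<in>X. \<mu> C * g C)"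
proof -
  have "(\<Sum>C\<in>X. \<mu> C * step p g C) =
        ((\<Sum>C\<in>X. \<mu> C * g C) + (\<Sum>C\<in>X. \<mu> C * (\<Sum>D\<in>X. T p C D * g D)) / d p) / 2"
    by (simp add: lazy_step_def sum.distrib sum_divide_distrib[symmetric] distrib_left add_divide_distrib)
  also have "\<dots> = (\<Sum>C\<in>X. \<mu> C * g C)"
    unfolding sum_apply_reversible[OF assms] using d_pos[OF assms] by simp
  finally show ?thesis .
qed

lemma walk_mean: "set ps \<subseteq> P \<Longrightarrow> (\<Sum>C\<in>X. \<mu> C * walk ps g C) = (\<Sum>C\<in>X. \<mu> C * g C)"
  by (induction ps) (auto simp: step_mean)

lemma step_affine:
  assumes "p \<in> P" "C \<in> X" "\<And>D. D \<in> X \<Longrightarrow> g D = a + c * h D"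
  shows "step p g C = a + c * step p h C"
proof -
  have "(\<Sum>D\<in>X. T p C D * g D) = (\<Sum>D\<in>X. T p C D) * a + c * (\<Sum>D\<in>X. T p C D * h D)"
    by (simp add: assms(3) sum_distrib_left sum_distrib_right sum.distrib[symmetric] algebra_simps)
  then show ?thesis using assms d_pos[OF assms(1)]
    by (simp add: lazy_step_def row_sum field_simps)
qed

lemma walk_affine:
  assumes "set ps \<subseteq> P" "C \<in> X"
  shows "walk ps (\<lambda>D. a + c * h D) C = a + c * walk ps h C"
  using assms by (induction ps arbitrary: C) (auto simp: step_affine)

lemma step_ge_half:
  assumes "p \<in> P" "C \<in> X" "\<And>D. D \<in> X \<Longrightarrow> g D \<ge> 0"
  shows "step p g C \<ge> g C / 2"
proof -
  have "(\<Sum>D\<in>X. T p C D * g D) \<ge> 0"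
    using assms by (intro sum_nonneg mult_nonneg_nonneg T_nonneg) auto
  then show ?thesis using d_pos[OF assms(1)] by (simp add: lazy_step_def)
qed

text \<open>Staying put at every step has weight \<open>(1 / 2) ^ length ps\<close>, and all other
  contributions are nonnegative.\<close>

lemma walk_ge:
  assumes "set ps \<subseteq> P" "C \<in> X" "\<And>D. D \<in> X \<Longrightarrow> g D \<ge> 0"
  shows "walk ps g C \<ge> (1 / 2) ^ length ps * g C"
  using assms(1,2)
proof (induction ps arbitrary: C)
  case (Cons p ps)
  have "walk ps g D \<ge> 0" if "D \<in> X" for D
  proof -
    have "0 \<le> (1 / 2) ^ length ps * g D" using assms(3)[OF that] by simp
    also have "\<dots> \<le> walk ps g D" using Cons.prems by (intro Cons.IH that) auto
    finally show ?thesis .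
  qed
  then have "step p (walk ps g) C \<ge> walk ps g C / 2"
    using Cons.prems by (intro step_ge_half) auto
  moreover have "walk ps g C \<ge> (1 / 2) ^ length ps * g C" using Cons by auto
  ultimately show ?case by simp
qed simp

lemma walk_nonneg:
  assumes "set ps \<subseteq> P" "C \<in> X" "\<And>D. D \<in> X \<Longrightarrow> g D \<ge> 0"
  shows "walk ps g C \<ge> 0"
proof -
  have "0 \<le> (1 / 2) ^ length ps * g C" using assms by simp
  also have "\<dots> \<le> walk ps g C" by (rule walk_ge[OF assms])
  finally show ?thesis .
qed

definition edges :: "('c \<times> 'c) set" where
  "edges = {(C, D). C \<in> X \<and> D \<in> X \<and> (\<exists>p\<in>P. T p C D > 0)}"

text \<open>Induction along a path, from its end: a further first edge from C to B at the prime p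
  costs the factor \<open>T p C B / d p / 2\<close>, the weight with which the lazy step takes
  it.\<close>

lemma walk_reach:
  assumes "(C, D) \<in> edges\<^sup>*" "D \<in> X"
  shows "C \<in> X \<and> (\<exists>ps \<epsilon>. set ps \<subseteq> P \<and> \<epsilon> > 0 \<and>
    (\<forall>g. (\<forall>B\<in>X. g B \<ge> 0) \<longrightarrow> walk ps g C \<ge> \<epsilon> * g D))"
  using assms
proof (induction rule: converse_rtrancl_induct)
  case base
  have "walk [] g D \<ge> 1 * g D" for g by simp
  then show ?case using base by (metis empty_set empty_subsetI zero_less_one)
next
  case (step C B)
  then obtain ps \<epsilon> where ps: "set ps \<subseteq> P" "\<epsilon> > 0" "\<And>g. (\<forall>B\<in>X. g B \<ge> 0) \<Longrightarrow> walk ps g B \<ge> \<epsilon> * g D"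
    by blast
  obtain p where p: "p \<in> P" "T p C B > 0" "C \<in> X" "B \<in> X" using step by (auto simp: edges_def)
  have "walk (p # ps) g C \<ge> (T p C B / d p / 2 * \<epsilon>) * g D" if g: "\<forall>B\<in>X. g B \<ge> 0" for g
  proof -
    have nn: "walk ps g A \<ge> 0" if "A \<in> X" for A using walk_nonneg[OF ps(1) that] g by auto
    have "T p C B * walk ps g B \<le> (\<Sum>D\<in>X. T p C D * walk ps g D)"
      using p nn by (intro member_le_sum mult_nonneg_nonneg T_nonneg finX) auto
    then have "step p (walk ps g) C \<ge> T p C B * walk ps g B / d p / 2"
      using nn[OF p(3)] d_pos[OF p(1)] by (simp add: lazy_step_def divide_right_mono add_increasing)
    moreover have "T p C B * (\<epsilon> * g D) / d p / 2 \<le> T p C B * walk ps g B / d p / 2"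
      using ps(3)[OF g] p d_pos[OF p(1)] by (intro divide_right_mono mult_left_mono) auto
    ultimately show ?thesis by simp
  qed
  moreover have "T p C B / d p / 2 * \<epsilon> > 0" using p ps d_pos by simp
  moreover have "set (p # ps) \<subseteq> P" using p ps by auto
  ultimately show ?case using p by blast
qed

text \<open>The lists that connect the individual pairs are concatenated into one list that serves
  all pairs. While the portion made for another pair runs, the walk may stay put, at the cost of a
  power of 1/2.\<close>

lemma walk_uniform:
  assumes "\<And>C D. C \<in> X \<Longrightarrow> D \<in> X \<Longrightarrow> (C, D) \<in> edges\<^sup>*"
  obtains ps \<epsilon> where "set ps \<subseteq> P" "\<epsilon> > 0"
    "\<And>g C D. (\<forall>B\<in>X. g B \<ge> 0) \<Longrightarrow> C \<in> X \<Longrightarrow> D \<in> X \<Longrightarrow> walk ps g C \<ge> \<epsilon> * g D"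
proof -
  have "finite A \<Longrightarrow> A \<subseteq> X \<times> X \<Longrightarrow> \<exists>ps \<epsilon>. set ps \<subseteq> P \<and> \<epsilon> > 0 \<and>
    (\<forall>g. (\<forall>B\<in>X. g B \<ge> 0) \<longrightarrow> (\<forall>(C, D)\<in>A. walk ps g C \<ge> \<epsilon> * g D))" for A
  proof (induction A rule: finite_induct)
    case empty
    have "set [] \<subseteq> P \<and> (1::real) > 0" by simp
    then show ?case by blast
  next
    case (insert CD A)
    obtain C D where CD: "CD = (C, D)" "C \<in> X" "D \<in> X" using insert by auto
    have "\<exists>ps \<epsilon>. set ps \<subseteq> P \<and> \<epsilon> > 0 \<and>
      (\<forall>g. (\<forall>B\<in>X. g B \<ge> 0) \<longrightarrow> (\<forall>(C, D)\<in>A. walk ps g C \<ge> \<epsilon> * g D))"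
      using insert.prems by (intro insert.IH) auto
    then obtain ps \<epsilon> where ps: "set ps \<subseteq> P" "\<epsilon> > 0"
      "\<forall>g. (\<forall>B\<in>X. g B \<ge> 0) \<longrightarrow> (\<forall>(C, D)\<in>A. walk ps g C \<ge> \<epsilon> * g D)" by (elim exE conjE)
    obtain qs \<delta> where qs: "set qs \<subseteq> P" "\<delta> > 0" "\<And>g. (\<forall>B\<in>X. g B \<ge> 0) \<Longrightarrow> walk qs g C \<ge> \<delta> * g D"
      using walk_reach[OF assms[OF CD(2,3)] CD(3)] by blast
    \<comment> \<open>The old pairs wait during \<open>qs\<close>, the new pair waits during
      \<open>ps\<close>.\<close>
    define \<eta> where "\<eta> = min (\<epsilon> * (1 / 2) ^ length qs) ((1 / 2) ^ length ps * \<delta>)"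
    have "walk (ps @ qs) g C' \<ge> \<eta> * g D'" if g: "\<forall>B\<in>X. g B \<ge> 0" and mem: "(C', D') \<in> insert CD A" for g C' D'
    proof -
      have D': "D' \<in> X" using mem insert.prems CD by auto
      have nn: "\<forall>B\<in>X. walk qs g B \<ge> 0" using walk_nonneg[OF qs(1)] g by auto
      show ?thesis
      proof (cases "(C', D') = CD")
        case True
        have "(1 / 2) ^ length ps * (\<delta> * g D) \<le> (1 / 2) ^ length ps * walk qs g C"
          using qs(3)[OF g] by (intro mult_left_mono) auto
        also have "\<dots> \<le> walk ps (walk qs g) C" using walk_ge[OF ps(1) CD(2)] nn by auto
        finally have "(1 / 2) ^ length ps * \<delta> * g D \<le> walk (ps @ qs) g C" by simp
        moreover have "\<eta> * g D \<le> (1 / 2) ^ length ps * \<delta> * g D"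
          using g CD by (intro mult_right_mono) (auto simp: \<eta>_def)
        ultimately show ?thesis using True CD by auto
      next
        case False
        then have "\<epsilon> * walk qs g D' \<le> walk ps (walk qs g) C'"
          using ps(3)[rule_format, OF nn[rule_format]] mem by auto
        moreover have "\<epsilon> * ((1 / 2) ^ length qs * g D') \<le> \<epsilon> * walk qs g D'"
          using walk_ge[OF qs(1) D'] g ps(2) by (intro mult_left_mono) auto
        moreover have "\<eta> * g D' \<le> \<epsilon> * (1 / 2) ^ length qs * g D'"
          using g D' by (intro mult_right_mono) (auto simp: \<eta>_def)
        ultimately show ?thesis by simp
      qed
    qed
    moreover have "\<eta> > 0" using ps qs by (simp add: \<eta>_def)
    moreover have "set (ps @ qs) \<subseteq> P" using ps qs by auto
    ultimately show ?case by blast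
  qed
  from this[OF finite_cartesian_product[OF finX finX] order_refl]
  obtain ps \<epsilon> where "set ps \<subseteq> P" "\<epsilon> > 0"
    "\<forall>g. (\<forall>B\<in>X. g B \<ge> 0) \<longrightarrow> (\<forall>(C, D)\<in>X \<times> X. walk ps g C \<ge> \<epsilon> * g D)" by (elim exE conjE)
  then show ?thesis by (intro that[of ps \<epsilon>]) auto
qed

text \<open>Doeblin's argument. After subtracting \<open>a\<close>, every value of the walked
  function is at least \<epsilon> times the excess of the maximum over \<open>a\<close>, and the
  maximum does not grow. The oscillation therefore shrinks by the factor 1 - \<epsilon>.\<close>

lemma walk_contract:
  assumes "C0 \<in> X" "\<And>C D. C \<in> X \<Longrightarrow> D \<in> X \<Longrightarrow> (C, D) \<in> edges\<^sup>*"
  obtains ps r where "set ps \<subseteq> P" "0 \<le> r" "r < 1"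
    "\<And>g a b. (\<forall>C\<in>X. a \<le> g C \<and> g C \<le> b) \<Longrightarrow>
       \<exists>a' b'. (\<forall>C\<in>X. a' \<le> walk ps g C \<and> walk ps g C \<le> b') \<and> b' - a' \<le> r * (b - a)"
proof -
  obtain ps \<epsilon> where ps: "set ps \<subseteq> P" "\<epsilon> > 0"
    "\<And>g C D. (\<forall>B\<in>X. g B \<ge> 0) \<Longrightarrow> C \<in> X \<Longrightarrow> D \<in> X \<Longrightarrow> walk ps g C \<ge> \<epsilon> * g D"
    using walk_uniform[OF assms(2)] by blast
  have one: "walk ps (\<lambda>D. 1 + 0 * g D) C = 1" if "C \<in> X" for C and g :: "'c \<Rightarrow> real"
    using walk_affine[OF ps(1) that, of 1 0 g] by simp
  have "\<epsilon> \<le> 1" using ps(3)[of "\<lambda>_. 1" C0 C0] one[OF assms(1)] assms(1) by simp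
  moreover have "\<exists>a' b'. (\<forall>C\<in>X. a' \<le> walk ps g C \<and> walk ps g C \<le> b') \<and> b' - a' \<le> (1 - \<epsilon>) * (b - a)"
    if ab: "\<forall>C\<in>X. a \<le> g C \<and> g C \<le> b" for g a b
  proof -
    define m where "m = Max (g ` X)"
    have ne: "g ` X \<noteq> {}" "finite (g ` X)" using assms(1) finX by auto
    obtain D where D: "D \<in> X" "g D = m" using Max_in[OF ne(2,1)] by (auto simp: m_def)
    have m: "g C \<le> m" if "C \<in> X" for C using that ne by (simp add: m_def)
    have mb: "m \<le> b" using D ab by auto
    have am: "a \<le> m" using D ab by auto
    have lower: "a + \<epsilon> * (m - a) \<le> walk ps g C" if C: "C \<in> X" for C
    proof -
      have "\<epsilon> * (- a + 1 * g D) \<le> walk ps (\<lambda>C. - a + 1 * g C) C"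
        using ab by (intro ps(3)[OF _ C D(1)]) auto
      then show ?thesis unfolding walk_affine[OF ps(1) C] D(2) by (simp add: algebra_simps)
    qed
    have upper: "walk ps g C \<le> m" if C: "C \<in> X" for C
    proof -
      have "0 \<le> walk ps (\<lambda>C. m + (-1) * g C) C"
        using m by (intro walk_nonneg ps(1) C) auto
      then show ?thesis unfolding walk_affine[OF ps(1) C] by simp
    qed
    have "m - (a + \<epsilon> * (m - a)) = (1 - \<epsilon>) * (m - a)" by (simp add: algebra_simps)
    also have "\<dots> \<le> (1 - \<epsilon>) * (b - a)" using mb \<open>\<epsilon> \<le> 1\<close> by (intro mult_left_mono) auto
    finally show ?thesis using lower upper by blast
  qed
  ultimately show ?thesis using that[of ps "1 - \<epsilon>"] ps by auto
qed

text \<open>\<open>D g\<close> compares the value at \<open>C0\<close> with the weighted mean. The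
  walk leaves it unchanged, since \<open>W\<close> fixes the value at \<open>C0\<close> and
  reversibility fixes the mean. It is also bounded by the oscillation, which decays geometrically
  under repetition of the contracting list.\<close>

theorem walk_invariant_value:
  assumes C0: "C0 \<in> X" and conn: "\<And>C D. C \<in> X \<Longrightarrow> D \<in> X \<Longrightarrow> (C, D) \<in> edges\<^sup>*"
    and W: "\<And>g p. g \<in> W \<Longrightarrow> p \<in> P \<Longrightarrow> step p g \<in> W \<and> step p g C0 = g C0"
    and g: "g \<in> W"
  shows "g C0 * (\<Sum>C\<in>X. \<mu> C) = (\<Sum>C\<in>X. \<mu> C * g C)"
proof -
  define m where "m = (\<Sum>C\<in>X. \<mu> C)"
  have mpos: "m > 0" unfolding m_def using C0 mu_pos finX by (intro sum_pos) auto
  define D where "D g = \<bar>g C0 * m - (\<Sum>C\<in>X. \<mu> C * g C)\<bar>" for g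
  have D: "D g \<le> m * (b - a)" if ab: "\<forall>C\<in>X. a \<le> g C \<and> g C \<le> b" for g a b
  proof -
    have 1: "(\<Sum>C\<in>X. \<mu> C * a) \<le> (\<Sum>C\<in>X. \<mu> C * g C)" "(\<Sum>C\<in>X. \<mu> C * g C) \<le> (\<Sum>C\<in>X. \<mu> C * b)"
      using ab mu_pos by (auto intro!: sum_mono mult_left_mono simp: less_imp_le)
    have 2: "a * m \<le> g C0 * m" "g C0 * m \<le> b * m" using ab C0 mpos by auto
    have "(\<Sum>C\<in>X. \<mu> C * a) = a * m" "(\<Sum>C\<in>X. \<mu> C * b) = b * m"
      by (simp_all add: m_def sum_distrib_left mult.commute)
    with 1 2 show ?thesis unfolding D_def by (simp add: algebra_simps abs_le_iff)
  qed
  obtain ps r where ps: "set ps \<subseteq> P" "0 \<le> r" "r < 1"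
    "\<And>g a b. (\<forall>C\<in>X. a \<le> g C \<and> g C \<le> b) \<Longrightarrow>
       \<exists>a' b'. (\<forall>C\<in>X. a' \<le> walk ps g C \<and> walk ps g C \<le> b') \<and> b' - a' \<le> r * (b - a)"
    using walk_contract[OF C0 conn] by blast
  have W': "set qs \<subseteq> P \<Longrightarrow> g \<in> W \<Longrightarrow> walk qs g \<in> W \<and> walk qs g C0 = g C0" for qs g
    by (induction qs) (use W in auto)
  define G where "G k = (walk ps ^^ k) g" for k
  have G: "G k \<in> W" "D (G k) = D g" for k
    by (induction k) (use W'[OF ps(1)] walk_mean[OF ps(1)] g in \<open>auto simp: G_def D_def\<close>)
  define a where "a = Min (g ` X)"
  define b where "b = Max (g ` X)"
  have ab: "\<forall>C\<in>X. a \<le> g C \<and> g C \<le> b" using finX by (auto simp: a_def b_def)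
  have osc: "\<exists>a' b'. (\<forall>C\<in>X. a' \<le> G k C \<and> G k C \<le> b') \<and> b' - a' \<le> r ^ k * (b - a)" for k
  proof (induction k)
    case 0
    then show ?case using ab by (auto simp: G_def)
  next
    case (Suc k)
    then obtain a' b' where *: "\<forall>C\<in>X. a' \<le> G k C \<and> G k C \<le> b'" "b' - a' \<le> r ^ k * (b - a)" by blast
    obtain a'' b'' where **: "\<forall>C\<in>X. a'' \<le> walk ps (G k) C \<and> walk ps (G k) C \<le> b''" "b'' - a'' \<le> r * (b' - a')"
      using ps(4)[OF *(1)] by blast
    have "r * (b' - a') \<le> r * (r ^ k * (b - a))" using * ps by (intro mult_left_mono) auto
    then show ?case using ** by (intro exI[of _ a''] exI[of _ b'']) (auto simp: G_def)
  qed
  have bound: "D g \<le> m * (r ^ k * (b - a))" for k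
  proof -
    obtain a' b' where *: "\<forall>C\<in>X. a' \<le> G k C \<and> G k C \<le> b'" "b' - a' \<le> r ^ k * (b - a)" using osc by blast
    have "D g \<le> m * (b' - a')" using D[OF *(1)] G(2)[of k] by simp
    also have "\<dots> \<le> m * (r ^ k * (b - a))" using * mpos by (intro mult_left_mono) auto
    finally show ?thesis .
  qed
  have "(\<lambda>k. m * (r ^ k * (b - a))) \<longlonglongrightarrow> m * (0 * (b - a))"
    using ps by (intro tendsto_intros LIMSEQ_power_zero) auto
  then have "D g \<le> m * (0 * (b - a))" using bound by (intro LIMSEQ_le_const) auto
  then show ?thesis by (simp add: D_def m_def)
qed

end

section \<open>The integral form 2B and its determinant\<close>

subsection \<open>Integral Gram matrices\<close>

text \<open>The Gram matrix of 2B, whose entries are integers for a ternary lattice, so that the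
  floor is exact. Then \<open>bform (gint N) x x\<close> is twice Q, and the determinant is twice
  \<open>four_disc N\<close>.\<close>

definition gint :: "rat ^ 3 ^ 3 \<Rightarrow> int ^ 3 ^ 3" where
  "gint N = (\<chi> i j. \<lfloor>2 * N $ i $ j\<rfloor>)"

definition rvec :: "int ^ 3 \<Rightarrow> rat ^ 3" where
  "rvec x = (\<chi> i. of_int (x $ i))"

lemma rvec_nth [simp]: "rvec x $ i = of_int (x $ i)"
  by (simp add: rvec_def)

lemma rvec_std [simp]: "rvec x \<in> std_lattice"
  by (simp add: std_lattice_def)

lemma std_lattice_rvec: "x \<in> std_lattice \<Longrightarrow> \<exists>z. x = rvec z"
proof -
  assume "x \<in> std_lattice"
  then have "\<forall>i. \<exists>z. x $ i = of_int z" by (auto simp: std_lattice_def elim: Ints_cases)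
  then obtain f where "\<forall>i. x $ i = of_int (f i)" by metis
  then have "x = rvec (\<chi> i. f i)" by (simp add: vec_eq_iff)
  then show ?thesis by blast
qed

lemma rvec_linear: "rvec (x + y) = rvec x + rvec y" "rvec (x - y) = rvec x - rvec y"
  "rvec (c *s x) = of_int c *s rvec x" "rvec 0 = 0"
  by (simp_all add: vec_eq_iff)

lemma rvec_inj: "rvec x = rvec y \<longleftrightarrow> x = y"
  by (simp add: vec_eq_iff)

lemma gint_entry:
  assumes "ternary_lattice N"
  shows "of_int (gint N $ i $ j) = 2 * N $ i $ j"
  using two_gram_int[OF assms, of i j] by (auto simp: gint_def elim: Ints_cases)

lemma gint_sym: "ternary_lattice N \<Longrightarrow> transpose (gint N) = gint N"
  using gram_sym[of N] by (simp add: gint_def transpose_def vec_eq_iff)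

lemma bform_gint:
  assumes "ternary_lattice N"
  shows "of_int (bform (gint N) x y) = 2 * bilin N (rvec x) (rvec y)"
  by (simp add: bform_expand bilin_def sum_distrib_left gint_entry[OF assms] mult_ac)

lemma bform_gint_quad:
  assumes "ternary_lattice N"
  shows "of_int (bform (gint N) x x) = 2 * quad N (rvec x)"
  by (simp add: bform_gint[OF assms] quad_def)

lemma det_gint:
  assumes "ternary_lattice N"
  shows "of_int (det (gint N)) = 8 * det N"
  unfolding det_3 by (simp add: gint_entry[OF assms])

lemma det_gint_four_disc:
  assumes "ternary_lattice N"
  shows "det (gint N) = 2 * four_disc N"
proof -
  have "(of_int (det (gint N)) :: rat) = of_int (2 * four_disc N)"
    by (simp add: det_gint[OF assms] four_disc_eq[OF assms])
  then show ?thesis by (simp only: of_int_eq_iff)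
qed

lemma det_gint_pos: "ternary_lattice N \<Longrightarrow> det (gint N) > 0"
  using det_gint[of N] ternary_minors_pos(3)[of N] by (metis of_int_0_less_iff zero_less_mult_iff zero_less_numeral)

section \<open>Rational matrices acting on q-adic vectors, and truncation of q-adic
  isometries\<close>

subsection \<open>Local isometries\<close>

text \<open>Reduction of a q-adic vector modulo \<open>q ^ k\<close>, as an integer vector.
  Identities between q-adic vectors are proved as congruences between their levels.\<close>

definition level :: "(nat \<Rightarrow> int) ^ 3 \<Rightarrow> nat \<Rightarrow> int ^ 3" where
  "level x k = (\<chi> i. (x $ i) k)"

lemma level_nth [simp]: "level x k $ i = (x $ i) k"
  by (simp add: level_def)

lemma padic_add: "(a \<oplus>\<^bsub>padic_int q\<^esub> b) k = (a k + b k) mod int q ^ k"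
  by (simp add: padic_int_def)

lemma padic_mult: "(a \<otimes>\<^bsub>padic_int q\<^esub> b) k = (a k * b k) mod int q ^ k"
  by (simp add: padic_int_def)

lemma padic_mod: "a \<in> carrier (padic_int q) \<Longrightarrow> a k mod int q ^ k = a k"
  by (rule padic_memD(1))

lemma padic_finsum:
  assumes "q > 0" "finite A" "\<And>i. i \<in> A \<Longrightarrow> f i \<in> carrier (padic_int q)"
  shows "(\<Oplus>\<^bsub>padic_int q\<^esub>i\<in>A. f i) k = (\<Sum>i\<in>A. f i k) mod int q ^ k"
proof -
  interpret Ring.cring "padic_int q" by (rule padic_int_cring[OF assms(1)])
  show ?thesis using assms(2,3)
  proof (induction A rule: finite_induct)
    case empty
    have "\<zero>\<^bsub>padic_int q\<^esub> k = 0" by (simp add: padic_int_def)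
    then show ?case by simp
  next
    case (insert x A)
    then have "(\<Oplus>\<^bsub>padic_int q\<^esub>i\<in>insert x A. f i) = f x \<oplus>\<^bsub>padic_int q\<^esub> (\<Oplus>\<^bsub>padic_int q\<^esub>i\<in>A. f i)"
      by (intro finsum_insert) auto
    then show ?case using insert by (simp add: padic_add mod_add_right_eq)
  qed
qed

lemma padic_bilin2_level:
  assumes q: "q > 0" and x: "x \<in> padic_lattice q" and y: "y \<in> padic_lattice q"
  shows "padic_bilin2 q N x y k = bform (gint N) (level x k) (level y k) mod int q ^ k"
proof -
  interpret Ring.cring "padic_int q" by (rule padic_int_cring[OF q])
  have c [simp]: "x $ i \<in> carrier (padic_int q)" "y $ i \<in> carrier (padic_int q)" for i
    using x y by (auto simp: padic_lattice_def)
  note [simp] = padic_of_int_closed[OF q]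
  have "padic_bilin2 q N x y k =
     (\<Sum>i\<in>UNIV. (\<Sum>j\<in>UNIV. gint N $ i $ j * (x $ i) k * (y $ j) k mod int q ^ k) mod int q ^ k) mod int q ^ k"
    unfolding padic_bilin2_def
    by (simp add: padic_finsum[OF q]) (simp add: padic_mult padic_of_int_def gint_def mod_simps)
  also have "\<dots> = bform (gint N) (level x k) (level y k) mod int q ^ k"
    by (simp add: bform_expand mod_sum_eq)
  finally show ?thesis .
qed

lemma padic_lattice_eqI:
  assumes "x \<in> padic_lattice q" "y \<in> padic_lattice q"
    and "\<And>k. vdvd (int q ^ k) (level x k - level y k)"
  shows "x = y"
proof -
  have "(x $ i) k = (y $ i) k" for i k
  proof -
    have "(x $ i) k mod int q ^ k = (y $ i) k mod int q ^ k"
      using assms(3)[of k] by (simp add: vdvd_def mod_eq_dvd_iff)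
    moreover have "x $ i \<in> carrier (padic_int q)" "y $ i \<in> carrier (padic_int q)"
      using assms by (auto simp: padic_lattice_def)
    ultimately show ?thesis by (simp add: padic_mod)
  qed
  then show ?thesis by (simp add: vec_eq_iff fun_eq_iff)
qed

lemma vdvd_add: "vdvd p x \<Longrightarrow> vdvd p y \<Longrightarrow> vdvd p (x + y)"
  by (simp add: vdvd_def)

lemma vdvd_trans: "vdvd p (x - y) \<Longrightarrow> vdvd p (y - z) \<Longrightarrow> vdvd p (x - z)"
  using vdvd_add[of p "x - y" "y - z"] by simp

lemma vdvd_sym: "vdvd p (x - y) \<Longrightarrow> vdvd p (y - x)"
  by (simp add: vdvd_def dvd_diff_commute)

lemma vdvd_matrix: "vdvd p x \<Longrightarrow> vdvd p (A *v x)"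
  by (auto simp: vdvd_def matrix_vector_mult_def intro!: dvd_sum)

lemma vdvd_scalar: "p dvd c \<Longrightarrow> vdvd p (c *s x)"
  by (simp add: vdvd_def)

lemma bform_cong:
  assumes "vdvd m (x - x')" "vdvd m (y - y')" "transpose G = G"
  shows "m dvd bform G x y - bform G x' y'"
proof -
  have c: "bform G x y = bform G y x" for x y
  proof -
    have "G $ i $ j = G $ j $ i" for i j
      using arg_cong[OF assms(3), of "\<lambda>G. G $ j $ i"] by (simp add: transpose_def)
    then show ?thesis unfolding bform_def matrix_vector_mult_def by (simp add: sum_3 algebra_simps)
  qed
  have "bform G x y - bform G x' y' = bform G y (x - x') + bform G x' (y - y')"
    by (simp add: bform_linear c[of y])
  then show ?thesis using bform_vdvd[OF assms(1), of G y] bform_vdvd[OF assms(2), of G x'] by simp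
qed

lemma bform_axis_axis: "bform G (axis i 1) (axis j 1) = G $ i $ j"
  unfolding bform_axis
  by (simp add: matrix_vector_mult_def axis_def if_distrib[of "\<lambda>x. _ * x"] cong: if_cong)

text \<open>The inverse of d in the q-adic integers, given by representatives. Each representative
  is an arbitrary choice modulo \<open>q ^ k\<close>, so successive terms are compatible only as
  congruences (\<open>mod_inverse_seq_Suc\<close>).\<close>

definition mod_inverse_seq :: "nat \<Rightarrow> int \<Rightarrow> nat \<Rightarrow> int" where
  "mod_inverse_seq q d k = (SOME u. [d * u = 1] (mod int q ^ k))"

lemma mod_inverse_seq:
  assumes "prime q" "\<not> int q dvd d"
  shows "[d * mod_inverse_seq q d k = 1] (mod int q ^ k)"
proof -
  have "coprime d (int q)" using assms by (metis coprime_commute prime_imp_coprime prime_nat_int_transfer)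
  then have "coprime d (int q ^ k)" by simp
  then show ?thesis unfolding mod_inverse_seq_def using cong_solve_coprime_int someI_ex by fast
qed

lemma mod_inverse_seq_Suc:
  assumes "prime q" "\<not> int q dvd d"
  shows "[mod_inverse_seq q d (Suc k) = mod_inverse_seq q d k] (mod int q ^ k)"
proof -
  let ?u = "mod_inverse_seq q d"
  have 1: "[d * ?u (Suc k) = 1] (mod int q ^ k)"
    using mod_inverse_seq[OF assms, of "Suc k"] by (rule cong_dvd_modulus) simp
  have "[?u (Suc k) = (d * ?u k) * ?u (Suc k)] (mod int q ^ k)"
    using cong_scalar_right[OF mod_inverse_seq[OF assms, of k], of "?u (Suc k)"] by (simp add: cong_sym)
  also have "(d * ?u k) * ?u (Suc k) = (d * ?u (Suc k)) * ?u k" by (simp add: mult_ac)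
  also have "[\<dots> = ?u k] (mod int q ^ k)"
    using cong_scalar_right[OF 1, of "?u k"] by simp
  finally show ?thesis .
qed

text \<open>The action of the rational matrix \<open>Z / d\<close> on \<open>\<int>\<^sub>q\<^sup>3\<close>.\<close>

definition padic_apply :: "nat \<Rightarrow> int \<Rightarrow> int ^ 3 ^ 3 \<Rightarrow> (nat \<Rightarrow> int) ^ 3 \<Rightarrow> (nat \<Rightarrow> int) ^ 3" where
  "padic_apply q d Z x = (\<chi> i. (\<lambda>k. (mod_inverse_seq q d k * (Z *v level x k) $ i) mod int q ^ k))"

context
  fixes q :: nat and d :: int
  assumes q: "prime q" and d: "\<not> int q dvd d"
begin

lemma q_pos: "q > 0" using q by (simp add: prime_gt_0_nat)

lemma padic_apply_level:
  "vdvd (int q ^ k) (level (padic_apply q d Z x) k - mod_inverse_seq q d k *s (Z *v level x k))"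
proof -
  have "int q ^ k dvd a mod int q ^ k - a" for a :: int by (simp add: mod_eq_dvd_iff[symmetric])
  then show ?thesis by (simp add: vdvd_def padic_apply_def)
qed

lemma padic_apply_level_mult:
  "vdvd (int q ^ k) (d *s level (padic_apply q d Z x) k - Z *v level x k)"
proof -
  let ?u = "mod_inverse_seq q d k"
  have "vdvd (int q ^ k) (d *s (level (padic_apply q d Z x) k - ?u *s (Z *v level x k)))"
    by (intro vdvd_scale padic_apply_level)
  moreover have "vdvd (int q ^ k) ((d * ?u - 1) *s (Z *v level x k))"
    using mod_inverse_seq[OF q d, of k] by (intro vdvd_scalar) (simp add: cong_iff_dvd_diff)
  ultimately have "vdvd (int q ^ k) (d *s (level (padic_apply q d Z x) k - ?u *s (Z *v level x k)) +
      (d * ?u - 1) *s (Z *v level x k))" by (rule vdvd_add)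
  moreover have "d *s (level (padic_apply q d Z x) k - ?u *s (Z *v level x k)) +
      (d * ?u - 1) *s (Z *v level x k) = d *s level (padic_apply q d Z x) k - Z *v level x k"
    by (simp add: vec_eq_iff algebra_simps)
  ultimately show ?thesis by (simp only:)
qed

lemma vdvd_cancel: "vdvd (int q ^ k) (d *s x) \<Longrightarrow> vdvd (int q ^ k) x"
proof -
  assume *: "vdvd (int q ^ k) (d *s x)"
  have "coprime (int q ^ k) d"
    using q d by (metis coprime_power_left_iff prime_imp_coprime prime_nat_int_transfer)
  then show ?thesis using * by (simp add: vdvd_def coprime_dvd_mult_right_iff)
qed

lemma padic_apply_closed:
  assumes "x \<in> padic_lattice q"
  shows "padic_apply q d Z x \<in> padic_lattice q"
  unfolding padic_lattice_def
proof (intro CollectI allI)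
  fix i
  have x: "x $ j \<in> carrier (padic_int q)" for j using assms by (simp add: padic_lattice_def)
  show "padic_apply q d Z x $ i \<in> carrier (padic_int q)"
  proof (rule padic_memI[OF q_pos, where b = "\<lambda>k. mod_inverse_seq q d k * (Z *v level x k) $ i"])
    fix k
    have "vdvd (int q ^ k) (level x (Suc k) - level x k)"
      using padic_memD(2)[OF x] by (simp add: vdvd_def mod_eq_dvd_iff)
    then have "vdvd (int q ^ k) (Z *v (level x (Suc k) - level x k))" by (rule vdvd_matrix)
    then have "[(Z *v level x (Suc k)) $ i = (Z *v level x k) $ i] (mod int q ^ k)"
      by (simp add: vdvd_def matrix_vector_mult_diff_distrib cong_iff_dvd_diff)
    from cong_mult[OF mod_inverse_seq_Suc[OF q d, of k] this]
    show "mod_inverse_seq q d (Suc k) * (Z *v level x (Suc k)) $ i mod int q ^ k =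
          mod_inverse_seq q d k * (Z *v level x k) $ i mod int q ^ k"
      by (simp add: cong_def)
  qed (simp add: padic_apply_def)
qed

text \<open>As d is prime to q, the vector \<open>Z x / d\<close> is the only y with d y = Z x.
  Identities for \<open>padic_apply\<close> can thus be checked without mentioning the inverse of
  d.\<close>

lemma padic_apply_eqI:
  assumes "x \<in> padic_lattice q" "y \<in> padic_lattice q"
    and "\<And>k. vdvd (int q ^ k) (d *s level y k - Z *v level x k)"
  shows "padic_apply q d Z x = y"
proof (rule padic_lattice_eqI[OF padic_apply_closed[OF assms(1)] assms(2)])
  fix k
  have "vdvd (int q ^ k) (d *s level (padic_apply q d Z x) k - d *s level y k)"
    using padic_apply_level_mult assms(3)[THEN vdvd_sym] by (rule vdvd_trans)
  then have "vdvd (int q ^ k) (d *s (level (padic_apply q d Z x) k - level y k))"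
    by (simp only: vector_ssub_ldistrib)
  then show "vdvd (int q ^ k) (level (padic_apply q d Z x) k - level y k)" by (rule vdvd_cancel)
qed

end

lemma padic_add_closed: "q > 0 \<Longrightarrow> x \<in> padic_lattice q \<Longrightarrow> y \<in> padic_lattice q \<Longrightarrow>
    (\<chi> i. x $ i \<oplus>\<^bsub>padic_int q\<^esub> y $ i) \<in> padic_lattice q"
  using cring.cring_simprules(1)[OF padic_int_cring[of q]] by (simp add: padic_lattice_def)

lemma padic_scale_closed: "q > 0 \<Longrightarrow> c \<in> carrier (padic_int q) \<Longrightarrow> y \<in> padic_lattice q \<Longrightarrow>
    (\<chi> i. c \<otimes>\<^bsub>padic_int q\<^esub> y $ i) \<in> padic_lattice q"
  using cring.cring_simprules(5)[OF padic_int_cring[of q]] by (simp add: padic_lattice_def)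

lemma level_add: "vdvd (int q ^ k) (level (\<chi> i. x $ i \<oplus>\<^bsub>padic_int q\<^esub> y $ i) k - (level x k + level y k))"
proof -
  have "int q ^ k dvd a mod int q ^ k - a" for a :: int by (simp add: mod_eq_dvd_iff[symmetric])
  then show ?thesis by (simp add: vdvd_def padic_add)
qed

lemma level_scale: "vdvd (int q ^ k) (level (\<chi> i. c \<otimes>\<^bsub>padic_int q\<^esub> x $ i) k - c k *s level x k)"
proof -
  have "int q ^ k dvd a mod int q ^ k - a" for a :: int by (simp add: mod_eq_dvd_iff[symmetric])
  then show ?thesis by (simp add: vdvd_def padic_mult)
qed

lemma padic_apply_inverse:
  assumes q: "prime q" "\<not> int q dvd d" "\<not> int q dvd d'" and Z: "Z' ** Z = mat (d * d')"
    and x: "x \<in> padic_lattice q"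
  shows "padic_apply q d' Z' (padic_apply q d Z x) = x"
proof (rule padic_apply_eqI[OF q(1,3) padic_apply_closed[OF q(1,2) x] x])
  fix k
  let ?y = "level (padic_apply q d Z x) k"
  have "vdvd (int q ^ k) (Z' *v (d *s ?y - Z *v level x k))"
    by (intro vdvd_matrix padic_apply_level_mult[OF q(1,2)])
  moreover have "Z' *v (Z *v level x k) = (d * d') *s level x k"
    unfolding matrix_vector_mul_assoc Z
    by (simp add: vec_eq_iff matrix_vector_mult_def mat_def if_distrib[of "\<lambda>x. x * _"] cong: if_cong)
  ultimately have "vdvd (int q ^ k) (d *s (Z' *v ?y - d' *s level x k))"
    by (simp add: matrix_vector_mult_diff_distrib int_matrix_scale vector_ssub_ldistrib vector_smult_assoc)
  then show "vdvd (int q ^ k) (d' *s level x k - Z' *v ?y)"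
    using vdvd_cancel[OF q(1,2)] vdvd_sym by blast
qed

text \<open>The map \<open>Z / d\<close> has the q-adic inverse \<open>Z' / d'\<close>, and since d
  is a unit at q the scaled isometry relation may be divided by \<open>d ^ 2\<close> at every
  level.\<close>

lemma padic_isometricI:
  assumes q: "prime q" "\<not> int q dvd d" "\<not> int q dvd d'"
    and inv: "Z' ** Z = mat (d * d')" "Z ** Z' = mat (d * d')"
    and sym: "transpose (gint N) = gint N"
    and iso: "\<And>x y. bform (gint N) (Z *v x) (Z *v y) = d ^ 2 * bform (gint M) x y"
  shows "padic_isometric q M N"
  unfolding padic_isometric_def
proof (intro exI[of _ "padic_apply q d Z"] conjI ballI)
  note q0 = q_pos[OF q(1,2)]
  note cl = padic_apply_closed[OF q(1,2)]
  note lm = padic_apply_level_mult[OF q(1,2)]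
  show "bij_betw (padic_apply q d Z) (padic_lattice q) (padic_lattice q)"
    by (rule bij_betw_byWitness[where f' = "padic_apply q d' Z'"])
      (use cl padic_apply_closed[OF q(1,3)] padic_apply_inverse[OF q inv(1)]
        padic_apply_inverse[OF q(1,3,2), of Z Z'] inv(2) in \<open>auto simp: mult.commute\<close>)
  fix x assume x: "x \<in> padic_lattice q"
  {
    fix y assume y: "y \<in> padic_lattice q"
    show "padic_apply q d Z (\<chi> i. x $ i \<oplus>\<^bsub>padic_int q\<^esub> y $ i) =
      (\<chi> i. padic_apply q d Z x $ i \<oplus>\<^bsub>padic_int q\<^esub> padic_apply q d Z y $ i)" (is "_ = ?s")
    proof (rule padic_apply_eqI[OF q(1,2)])
      fix k
      let ?x = "level (padic_apply q d Z x) k" and ?y = "level (padic_apply q d Z y) k"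
      have "vdvd (int q ^ k) (d *s (level ?s k - (?x + ?y)))" by (intro vdvd_scale level_add)
      moreover have "vdvd (int q ^ k) (d *s ?x - Z *v level x k + (d *s ?y - Z *v level y k))"
        by (intro vdvd_add lm)
      moreover have "vdvd (int q ^ k) (Z *v (level x k + level y k - level (\<chi> i. x $ i \<oplus>\<^bsub>padic_int q\<^esub> y $ i) k))"
        by (rule vdvd_matrix[OF vdvd_sym[OF level_add]])
      ultimately have "vdvd (int q ^ k) (d *s (level ?s k - (?x + ?y)) + (d *s ?x - Z *v level x k + (d *s ?y - Z *v level y k))
         + Z *v (level x k + level y k - level (\<chi> i. x $ i \<oplus>\<^bsub>padic_int q\<^esub> y $ i) k))"
        by (rule vdvd_add[OF vdvd_add])
      then show "vdvd (int q ^ k) (d *s level ?s k - Z *v level (\<chi> i. x $ i \<oplus>\<^bsub>padic_int q\<^esub> y $ i) k)"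
        by (simp add: matrix_vector_mult_diff_distrib matrix_vector_right_distrib vector_ssub_ldistrib
            vector_add_ldistrib algebra_simps)
    qed (intro padic_add_closed cl x y q0)+
    show "padic_bilin2 q N (padic_apply q d Z x) (padic_apply q d Z y) = padic_bilin2 q M x y"
    proof
      fix k
      let ?x = "level (padic_apply q d Z x) k" and ?y = "level (padic_apply q d Z y) k"
      have "int q ^ k dvd bform (gint N) (d *s ?x) (d *s ?y) - bform (gint N) (Z *v level x k) (Z *v level y k)"
        by (intro bform_cong lm sym)
      then have "int q ^ k dvd d ^ 2 * (bform (gint N) ?x ?y - bform (gint M) (level x k) (level y k))"
        by (simp add: iso bform_linear power2_eq_square algebra_simps)
      moreover have "coprime (int q ^ k) (d ^ 2)"
        using q by (metis coprime_power_left_iff coprime_power_right_iff prime_imp_coprime prime_nat_int_transfer)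
      ultimately have "int q ^ k dvd bform (gint N) ?x ?y - bform (gint M) (level x k) (level y k)"
        by (simp add: coprime_dvd_mult_right_iff)
      then show "padic_bilin2 q N (padic_apply q d Z x) (padic_apply q d Z y) k = padic_bilin2 q M x y k"
        by (simp add: padic_bilin2_level[OF q0] cl x y mod_eq_dvd_iff)
    qed
  }
next
  note q0 = q_pos[OF q(1,2)]
  note cl = padic_apply_closed[OF q(1,2)]
  fix c x assume c: "c \<in> carrier (padic_int q)" and x: "x \<in> padic_lattice q"
  show "padic_apply q d Z (\<chi> i. c \<otimes>\<^bsub>padic_int q\<^esub> x $ i) = (\<chi> i. c \<otimes>\<^bsub>padic_int q\<^esub> padic_apply q d Z x $ i)"
    (is "_ = ?s")
  proof (rule padic_apply_eqI[OF q(1,2)])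
    fix k
    let ?x = "level (padic_apply q d Z x) k"
    have "vdvd (int q ^ k) (d *s (level ?s k - c k *s ?x))" by (intro vdvd_scale level_scale)
    moreover have "vdvd (int q ^ k) (c k *s (d *s ?x - Z *v level x k))"
      by (intro vdvd_scale padic_apply_level_mult[OF q(1,2)])
    moreover have "vdvd (int q ^ k) (Z *v (c k *s level x k - level (\<chi> i. c \<otimes>\<^bsub>padic_int q\<^esub> x $ i) k))"
      by (rule vdvd_matrix[OF vdvd_sym[OF level_scale]])
    ultimately have "vdvd (int q ^ k) (d *s (level ?s k - c k *s ?x) + c k *s (d *s ?x - Z *v level x k)
       + Z *v (c k *s level x k - level (\<chi> i. c \<otimes>\<^bsub>padic_int q\<^esub> x $ i) k))"
      by (rule vdvd_add[OF vdvd_add])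
    then show "vdvd (int q ^ k) (d *s level ?s k - Z *v level (\<chi> i. c \<otimes>\<^bsub>padic_int q\<^esub> x $ i) k)"
      by (simp add: matrix_vector_mult_diff_distrib int_matrix_scale[symmetric] vector_ssub_ldistrib vector_smult_assoc mult.commute)
  qed (intro padic_scale_closed cl x c q0)+
qed

lemma padic_isometric_trans:
  assumes "padic_isometric q M N" "padic_isometric q N P"
  shows "padic_isometric q M P"
proof -
  obtain \<sigma> where s: "bij_betw \<sigma> (padic_lattice q) (padic_lattice q)"
       "\<forall>x\<in>padic_lattice q. \<forall>y\<in>padic_lattice q.
          \<sigma> (\<chi> i. x $ i \<oplus>\<^bsub>padic_int q\<^esub> y $ i) = (\<chi> i. \<sigma> x $ i \<oplus>\<^bsub>padic_int q\<^esub> \<sigma> y $ i)"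
       "\<forall>c\<in>carrier (padic_int q). \<forall>x\<in>padic_lattice q.
          \<sigma> (\<chi> i. c \<otimes>\<^bsub>padic_int q\<^esub> x $ i) = (\<chi> i. c \<otimes>\<^bsub>padic_int q\<^esub> \<sigma> x $ i)"
       "\<forall>x\<in>padic_lattice q. \<forall>y\<in>padic_lattice q. padic_bilin2 q N (\<sigma> x) (\<sigma> y) = padic_bilin2 q M x y"
    using assms(1) unfolding padic_isometric_def by (elim exE conjE)
  obtain \<tau> where t: "bij_betw \<tau> (padic_lattice q) (padic_lattice q)"
       "\<forall>x\<in>padic_lattice q. \<forall>y\<in>padic_lattice q.
          \<tau> (\<chi> i. x $ i \<oplus>\<^bsub>padic_int q\<^esub> y $ i) = (\<chi> i. \<tau> x $ i \<oplus>\<^bsub>padic_int q\<^esub> \<tau> y $ i)"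
       "\<forall>c\<in>carrier (padic_int q). \<forall>x\<in>padic_lattice q.
          \<tau> (\<chi> i. c \<otimes>\<^bsub>padic_int q\<^esub> x $ i) = (\<chi> i. c \<otimes>\<^bsub>padic_int q\<^esub> \<tau> x $ i)"
       "\<forall>x\<in>padic_lattice q. \<forall>y\<in>padic_lattice q. padic_bilin2 q P (\<tau> x) (\<tau> y) = padic_bilin2 q N x y"
    using assms(2) unfolding padic_isometric_def by (elim exE conjE)
  have c: "\<sigma> x \<in> padic_lattice q" if "x \<in> padic_lattice q" for x
    using bij_betw_imp_surj_on[OF s(1)] that by (metis imageI)
  show ?thesis unfolding padic_isometric_def
  proof (intro exI[of _ "\<tau> \<circ> \<sigma>"] conjI ballI)
    show "bij_betw (\<tau> \<circ> \<sigma>) (padic_lattice q) (padic_lattice q)" by (rule bij_betw_trans[OF s(1) t(1)])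
  next
    fix x y assume xy: "x \<in> padic_lattice q" "y \<in> padic_lattice q"
    show "(\<tau> \<circ> \<sigma>) (\<chi> i. x $ i \<oplus>\<^bsub>padic_int q\<^esub> y $ i) = (\<chi> i. (\<tau> \<circ> \<sigma>) x $ i \<oplus>\<^bsub>padic_int q\<^esub> (\<tau> \<circ> \<sigma>) y $ i)"
      unfolding o_def s(2)[rule_format, OF xy] by (rule t(2)[rule_format, OF c[OF xy(1)] c[OF xy(2)]])
    show "padic_bilin2 q P ((\<tau> \<circ> \<sigma>) x) ((\<tau> \<circ> \<sigma>) y) = padic_bilin2 q M x y"
      unfolding o_def t(4)[rule_format, OF c[OF xy(1)] c[OF xy(2)]] by (rule s(4)[rule_format, OF xy])
  next
    fix a x assume ax: "a \<in> carrier (padic_int q)" "x \<in> padic_lattice q"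
    show "(\<tau> \<circ> \<sigma>) (\<chi> i. a \<otimes>\<^bsub>padic_int q\<^esub> x $ i) = (\<chi> i. a \<otimes>\<^bsub>padic_int q\<^esub> (\<tau> \<circ> \<sigma>) x $ i)"
      unfolding o_def s(3)[rule_format, OF ax] by (rule t(3)[rule_format, OF ax(1) c[OF ax(2)]])
  qed
qed

text \<open>The vectors are the level k truncations of the images of the standard basis in the first
  part and of its preimages in the second. Apart from transitivity, a q-adic isometry is exploited
  only through these congruences.\<close>

lemma padic_isometric_approx:
  assumes q: "prime q" and iso: "padic_isometric q M N"
  shows "\<exists>X. \<forall>i j. int q ^ k dvd bform (gint N) (X i) (X j) - gint M $ i $ j"
    and "\<exists>Y. \<forall>i j. int q ^ k dvd bform (gint M) (Y i) (Y j) - gint N $ i $ j"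
proof -
  have q0: "q > 0" using q prime_gt_0_nat by blast
  interpret Ring.cring "padic_int q" by (rule padic_int_cring[OF q0])
  obtain \<sigma> where s: "bij_betw \<sigma> (padic_lattice q) (padic_lattice q)"
       "\<And>x y. x\<in>padic_lattice q \<Longrightarrow> y\<in>padic_lattice q \<Longrightarrow>
          padic_bilin2 q N (\<sigma> x) (\<sigma> y) = padic_bilin2 q M x y"
    using iso unfolding padic_isometric_def by (elim exE conjE) (rule that, assumption, simp)
  have cl: "\<sigma> x \<in> padic_lattice q" if "x \<in> padic_lattice q" for x using s(1) that by (auto simp: bij_betw_def)
  define e :: "3 \<Rightarrow> (nat \<Rightarrow> int) ^ 3" where
    "e j = (\<chi> i. if i = j then \<one>\<^bsub>padic_int q\<^esub> else \<zero>\<^bsub>padic_int q\<^esub>)" for j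
  have e: "e j \<in> padic_lattice q" for j by (simp add: e_def padic_lattice_def)
  have le: "bform G (level (e i) k) (level (e j) k) mod int q ^ k = G $ i $ j mod int q ^ k" for G i j
  proof -
    have "level (e j) k = (1 mod int q ^ k) *s axis j 1" for j
      by (simp add: vec_eq_iff e_def axis_def padic_int_def)
    then have "bform G (level (e i) k) (level (e j) k) = (1 mod int q ^ k) * ((1 mod int q ^ k) * G $ i $ j)"
      by (simp add: bform_linear bform_axis_axis)
    then show ?thesis by (simp add: mod_mult_left_eq mod_mult_right_eq mod_simps)
  qed
  show "\<exists>X. \<forall>i j. int q ^ k dvd bform (gint N) (X i) (X j) - gint M $ i $ j"
  proof (intro exI[of _ "\<lambda>i. level (\<sigma> (e i)) k"] allI)
    fix i j
    have "padic_bilin2 q N (\<sigma> (e i)) (\<sigma> (e j)) k = padic_bilin2 q M (e i) (e j) k" using s(2)[OF e e] by simp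
    then show "int q ^ k dvd bform (gint N) (level (\<sigma> (e i)) k) (level (\<sigma> (e j)) k) - gint M $ i $ j"
      by (simp add: padic_bilin2_level[OF q0] e cl le mod_eq_dvd_iff)
  qed
  have "\<forall>i. \<exists>y\<in>padic_lattice q. \<sigma> y = e i" using s(1) e by (metis bij_betw_def imageE)
  then obtain f where f: "\<And>i. f i \<in> padic_lattice q" "\<And>i. \<sigma> (f i) = e i" by metis
  show "\<exists>Y. \<forall>i j. int q ^ k dvd bform (gint M) (Y i) (Y j) - gint N $ i $ j"
  proof (intro exI[of _ "\<lambda>i. level (f i) k"] allI)
    fix i j
    have "padic_bilin2 q N (\<sigma> (f i)) (\<sigma> (f j)) k = padic_bilin2 q M (f i) (f j) k" using s(2)[OF f(1) f(1)] by simp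
    then show "int q ^ k dvd bform (gint M) (level (f i) k) (level (f j) k) - gint N $ i $ j"
      by (simp add: padic_bilin2_level[OF q0] e f le mod_eq_dvd_iff dvd_diff_commute)
  qed
qed

lemma det_cong:
  fixes A B :: "int ^ 3 ^ 3"
  assumes "\<And>i j. [A $ i $ j = B $ i $ j] (mod m)"
  shows "[det A = det B] (mod m)"
  unfolding det_3 by (intro cong_add cong_diff cong_mult assms)

text \<open>If \<open>R\<close> has the rows \<open>X i\<close>, then
  \<open>det R ^ 2 * det G\<close> is congruent to \<open>det H\<close> modulo m.\<close>

lemma approx_det_dvd:
  fixes X :: "3 \<Rightarrow> int ^ 3"
  assumes "\<And>i j. m dvd bform G (X i) (X j) - H $ i $ j" "m dvd det G"
  shows "m dvd det H"
proof -
  define R :: "int ^ 3 ^ 3" where "R = (\<chi> i. X i)"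
  have "[det (\<chi> i j. bform G (R $ i) (R $ j)) = det H] (mod m)"
    using assms(1) by (intro det_cong) (simp add: R_def cong_iff_dvd_diff)
  then have "[det R ^ 2 * det G = det H] (mod m)" by (simp only: gram_det)
  moreover have "m dvd det R ^ 2 * det G" using assms(2) by simp
  ultimately show ?thesis using cong_dvd_iff by blast
qed

lemma dvd_if_prime_powers_dvd:
  fixes a b :: int
  assumes "a > 0" "b > 0" "\<And>q k. prime q \<Longrightarrow> int q ^ k dvd a \<Longrightarrow> int q ^ k dvd b"
  shows "a dvd b"
proof (rule multiplicity_le_imp_dvd)
  fix p :: int assume p: "prime p"
  then obtain q where q: "p = int q" "prime q" by (metis prime_int_nat_transfer prime_ge_0_int int_nat_eq nat_0_le)
  have "p ^ multiplicity p a dvd a" by (rule multiplicity_dvd)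
  then have "p ^ multiplicity p a dvd b" using assms(3)[of q] q by simp
  then show "multiplicity p a \<le> multiplicity p b"
    using p assms(2) by (intro multiplicity_geI) auto
qed (use assms in auto)

section \<open>Determinant and finiteness of the genus, and a criterion for membership by rational
  isometries\<close>

subsection \<open>The genus\<close>

lemma genus_ternary: "N \<in> genus M \<Longrightarrow> ternary_lattice N"
  by (simp add: genus_def)

text \<open>By \<open>approx_det_dvd\<close> in both directions the same prime powers divide the two
  integral determinants, and both are positive.\<close>

lemma genus_det:
  assumes M: "ternary_lattice M" and N: "N \<in> genus M"
  shows "det N = det M"
proof -
  note tN = genus_ternary[OF N]
  have iso: "padic_isometric q M N" if "prime q" for q using N that by (simp add: genus_def)
  have "det (gint N) dvd det (gint M)"
  proof (rule dvd_if_prime_powers_dvd[OF det_gint_pos[OF tN] det_gint_pos[OF M]])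
    fix q k assume q: "prime q" and "int q ^ k dvd det (gint N)"
    then show "int q ^ k dvd det (gint M)"
      using padic_isometric_approx(1)[OF q iso[OF q], of k] approx_det_dvd by blast
  qed
  moreover have "det (gint M) dvd det (gint N)"
  proof (rule dvd_if_prime_powers_dvd[OF det_gint_pos[OF M] det_gint_pos[OF tN]])
    fix q k assume q: "prime q" and "int q ^ k dvd det (gint M)"
    then show "int q ^ k dvd det (gint N)"
      using padic_isometric_approx(2)[OF q iso[OF q], of k] approx_det_dvd by blast
  qed
  ultimately have "det (gint N) = det (gint M)"
    using det_gint_pos[OF M] det_gint_pos[OF tN] zdvd_antisym_nonneg by fastforce
  then have "8 * det N = 8 * det M" using det_gint[OF M] det_gint[OF tN] by metis
  then show ?thesis by simp
qed

lemma int_mat_of_int: "int_mat A \<Longrightarrow> \<exists>Z :: int ^ 3 ^ 3. \<forall>i j. A $ i $ j = of_int (Z $ i $ j)"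
proof -
  assume "int_mat A"
  then have "\<forall>i j. \<exists>z. A $ i $ j = of_int z" unfolding int_mat_def by (metis Ints_cases)
  then obtain f where "\<forall>i j. A $ i $ j = of_int (f i j)" by metis
  then show ?thesis by (intro exI[of _ "\<chi> i j. f i j"]) simp
qed

lemma rvec_matrix:
  assumes "\<forall>i j. A $ i $ j = of_int (Z $ i $ j)"
  shows "A *v rvec x = rvec (Z *v x)"
  using assms by (simp add: vec_eq_iff matrix_vector_mult_def)

text \<open>
  Since the determinants agree, the inverse of a \<open>q\<close>-integral rational isometry is \<open>q\<close>-integral as well.
\<close>

lemma padic_isometric_of_rational:
  assumes q: "prime q" and M: "ternary_lattice M" and N: "ternary_lattice N" and det: "det M = det N"
    and \<sigma>: "space_isometry M N \<sigma>" and d: "\<not> int q dvd d" "\<And>x. x \<in> std_lattice \<Longrightarrow> of_int d *s \<sigma> x \<in> std_lattice"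
  shows "padic_isometric q M N"
proof -
  have d0: "d \<noteq> 0" using d by auto
  obtain A where A: "\<sigma> = (*v) A" "gram N A = M" using space_isometry_matrix[OF \<sigma>] .
  define B :: "rat ^ 3 ^ 3" where "B = (\<chi> i j. of_int d * A $ i $ j)"
  have Bv: "B *v x = of_int d *s \<sigma> x" for x
    by (simp add: A B_def vec_eq_iff matrix_vector_mult_def sum_distrib_left mult.assoc)
  have B: "int_mat B" using d(2) by (simp add: int_mat_iff Bv)
  obtain Z where Z: "\<forall>i j. B $ i $ j = of_int (Z $ i $ j)" using int_mat_of_int[OF B] by blast
  have "det A ^ 2 = 1" using det_gram[of N A] A det ternary_minors_pos(3)[OF N] by simp
  moreover have detB: "det B = of_int d ^ 3 * det A"
    by (simp add: det_3 B_def power3_eq_cube algebra_simps)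
  ultimately have "det B ^ 2 = (of_int (d ^ 3)) ^ 2" by (simp add: power_mult_distrib)
  then have detB': "det B = of_int (d ^ 3) \<or> det B = - of_int (d ^ 3)" by (simp only: power2_eq_iff)
  define D where "D = det Z"
  have D: "det B = of_int D" unfolding D_def det_3 by (simp add: Z)
  then have D': "D = d ^ 3 \<or> D = - (d ^ 3)"
    using detB' by (metis of_int_eq_iff of_int_minus)
  have "\<exists>x. Z *v x = D *s b" for b
  proof -
    obtain y where y: "y \<in> std_lattice" "B *v y = det B *s rvec b" using int_mat_solve[OF B, of "rvec b"] by auto
    obtain x where "y = rvec x" using std_lattice_rvec[OF y(1)] by blast
    with y(2) have "rvec (Z *v x) = rvec (D *s b)" by (simp add: rvec_matrix[OF Z] D rvec_linear)
    then show ?thesis by (auto simp: rvec_inj)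
  qed
  then obtain f where f: "\<And>b. Z *v f b = D *s b" by metis
  \<comment> \<open>\<open>D\<close> is d^3 up to sign. The sign \<open>s\<close> is chosen such
    that \<open>Z ** Z'\<close> is d * d^2, so \<open>Z' / d ^ 2\<close> is the inverse of
    \<open>Z / d\<close>.\<close>
  define s where "s = (if D = d ^ 3 then 1 else - 1 :: int)"
  define Z' :: "int ^ 3 ^ 3" where "Z' = (\<chi> i j. s * f (axis j 1) $ i)"
  have sD: "s * D = d * d ^ 2" using D' by (auto simp: s_def power3_eq_cube power2_eq_square)
  have ZZ': "Z ** Z' = mat (d * d ^ 2)"
  proof -
    have "(Z ** Z') $ i $ j = s * (Z *v f (axis j 1)) $ i" for i j
      by (simp add: matrix_matrix_mult_def matrix_vector_mult_def Z'_def sum_distrib_left mult_ac)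
    then show ?thesis by (simp add: vec_eq_iff f mat_def axis_def sD[symmetric])
  qed
  have D0: "D \<noteq> 0" using D' d0 by auto
  have inj: "x = y" if "Z *v x = Z *v y" for x y :: "int ^ 3"
  proof -
    have "B *v rvec x = B *v rvec y" using that by (simp add: rvec_matrix[OF Z])
    then have "\<sigma> (rvec x) = \<sigma> (rvec y)" using d0 by (simp add: Bv)
    then show ?thesis using space_isometry_inj[OF \<sigma>] by (simp add: inj_eq rvec_inj)
  qed
  have "(Z' ** Z) *v x = (d * d ^ 2) *s x" for x
  proof (rule inj)
    have "Z *v ((Z' ** Z) *v x) = (Z ** Z') *v (Z *v x)" by (simp only: matrix_vector_mul_assoc matrix_mul_assoc)
    also have "\<dots> = (d * d ^ 2) *s (Z *v x)"
      unfolding ZZ' by (simp add: vec_eq_iff matrix_vector_mult_def mat_def if_distrib[of "\<lambda>x. x * _"] cong: if_cong)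
    finally show "Z *v ((Z' ** Z) *v x) = Z *v ((d * d ^ 2) *s x)" by (simp add: int_matrix_scale)
  qed
  then have Z'Z: "Z' ** Z = mat (d * d ^ 2)"
    by (subst matrix_eq) (simp add: vec_eq_iff matrix_vector_mult_def mat_def if_distrib[of "\<lambda>x. x * _"] cong: if_cong)
  show ?thesis
  proof (rule padic_isometricI[OF q d(1) _ Z'Z ZZ' gint_sym[OF N]])
    show "\<not> int q dvd d ^ 2" using q d(1) by (simp add: prime_dvd_power_iff)
    fix x y
    have "(of_int (bform (gint N) (Z *v x) (Z *v y)) :: rat) = 2 * bilin N (B *v rvec x) (B *v rvec y)"
      by (simp add: bform_gint[OF N] rvec_matrix[OF Z])
    also have "\<dots> = of_int d ^ 2 * (2 * bilin M (rvec x) (rvec y))"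
      by (simp add: Bv bilin_linear space_isometry_bilin[OF \<sigma>] power2_eq_square)
    also have "\<dots> = of_int (d ^ 2 * bform (gint M) x y)" by (simp add: bform_gint[OF M])
    finally show "bform (gint N) (Z *v x) (Z *v y) = d ^ 2 * bform (gint M) x y" by (simp only: of_int_eq_iff)
  qed
qed

text \<open>Only rational isometries have to be exhibited, and different primes q may use different
  ones as long as the denominator is prime to q. Such an isometry sends a vector whose value is
  prime to q to one with value multiplied by d^2, so primitivity at q survives. Positivity is pulled
  back through any one of them.\<close>

theorem genus_transfer:
  assumes M: "ternary_lattice M" and N: "N \<in> genus M"
    and sym: "transpose N' = N'" and int: "\<And>x. x \<in> std_lattice \<Longrightarrow> quad N' x \<in> \<int>"
    and det: "det N' = det N"
    and loc: "\<And>q. prime q \<Longrightarrow> \<exists>\<sigma> d. space_isometry N N' \<sigma> \<and> \<not> int q dvd d \<and> (\<forall>x\<in>std_lattice. of_int d *s \<sigma> x \<in> std_lattice)"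
  shows "N' \<in> genus M"
proof -
  note tN = genus_ternary[OF N]
  obtain \<sigma>\<^sub>0 where s0: "space_isometry N N' \<sigma>\<^sub>0" using loc[OF two_is_prime_nat] by blast
  have "ternary_lattice N'"
    unfolding ternary_lattice_iff
  proof (intro conjI ballI allI impI sym)
    fix x :: "rat ^ 3" assume "x \<noteq> 0"
    then have "finv \<sigma>\<^sub>0 x \<noteq> 0"
      using space_isometry_inv_simps(1)[OF s0, of x] space_isometry_scale[OF s0, of 0 0] by auto
    then show "quad N' x > 0"
      using ternary_pos[OF tN] space_isometry_quad[OF space_isometry_inv[OF s0]] by metis
  next
    fix q :: nat assume q: "prime q"
    obtain \<sigma> d where s: "space_isometry N N' \<sigma>" and d: "\<not> int q dvd d" "\<forall>x\<in>std_lattice. of_int d *s \<sigma> x \<in> std_lattice"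
      using loc[OF q] by blast
    obtain x where x: "x \<in> std_lattice" "quad N x \<notin> range (\<lambda>k. of_int (int q * k))"
      using tN q unfolding ternary_lattice_iff by blast
    obtain z where z: "quad N x = of_int z" using quad_Ints[OF tN x(1)] by (auto elim: Ints_cases)
    have "\<not> int q dvd z" using x(2) z by (auto elim!: dvdE)
    then have "\<not> int q dvd d ^ 2 * z" using q d(1) by (simp add: prime_dvd_mult_iff prime_dvd_power_iff)
    moreover have "quad N' (of_int d *s \<sigma> x) = of_int (d ^ 2 * z)"
      using space_isometry_quad[OF s, of x] z by (simp add: quad_def bilin_linear power2_eq_square)
    ultimately have "quad N' (of_int d *s \<sigma> x) \<notin> range (\<lambda>k. of_int (int q * k))"
      by (auto simp del: of_int_mult of_int_power simp: of_int_eq_iff)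
    then show "\<exists>x\<in>std_lattice. quad N' x \<notin> range (\<lambda>k. of_int (int q * k))" using d(2) x(1) by blast
  qed (rule int)
  moreover have "\<exists>\<sigma>. space_isometry M N' \<sigma>"
    using N s0 space_isometry_comp[of M N _ N' \<sigma>\<^sub>0] unfolding genus_def by blast
  moreover have "padic_isometric q M N'" if q: "prime q" for q
  proof (rule padic_isometric_trans[of q M N])
    show "padic_isometric q M N" using N q by (simp add: genus_def)
    show "padic_isometric q N N'"
      using loc[OF q] padic_isometric_of_rational[OF q tN \<open>ternary_lattice N'\<close> det[symmetric]] by blast
  qed
  ultimately show ?thesis by (simp add: genus_def)
qed

lemma genus_self:
  assumes M: "ternary_lattice M"
  shows "M \<in> genus M"
proof -
  have "padic_isometric q M M" if q: "prime q" for q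
    by (rule padic_isometric_of_rational[OF q M M refl space_isometry_id, of 1])
      (use q in \<open>auto simp: prime_nat_iff\<close>)
  then show ?thesis using M space_isometry_id by (auto simp: genus_def)
qed

lemma genus_isometric:
  assumes M: "ternary_lattice M" and N: "N \<in> genus M" and U: "int_mat U" "det U ^ 2 = 1"
  shows "gram N U \<in> genus M"
proof -
  note tN = genus_ternary[OF N]
  obtain \<sigma> where s: "lattice_isometry N (gram N U) \<sigma>"
    using isometric_sym[OF ternary_gram_unimodular(1)[OF tN U]] by (auto simp: isometric_def)
  show ?thesis
  proof (rule genus_transfer[OF M N])
    fix q :: nat assume "prime q"
    then show "\<exists>\<sigma> d. space_isometry N (gram N U) \<sigma> \<and> \<not> int q dvd d \<and> (\<forall>x\<in>std_lattice. of_int d *s \<sigma> x \<in> std_lattice)"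
      using s by (intro exI[of _ \<sigma>] exI[of _ 1]) (auto simp: lattice_isometry_def prime_nat_iff)
  qed (use ternary_gram_unimodular(2)[OF tN U] U in \<open>auto simp: ternary_sym quad_Ints det_gram\<close>)
qed

definition genus_rel :: "rat ^ 3 ^ 3 \<Rightarrow> ((rat ^ 3 ^ 3) \<times> (rat ^ 3 ^ 3)) set" where
  "genus_rel M = {(N, N'). N \<in> genus M \<and> N' \<in> genus M \<and> isometric N N'}"

lemma genus_classes_eq: "genus_classes M = genus M // genus_rel M"
  by (simp add: genus_classes_def genus_rel_def)

lemma genus_rel_equiv: "equiv (genus M) (genus_rel M)"
proof (rule equivI)
  show "genus_rel M \<subseteq> genus M \<times> genus M" by (auto simp: genus_rel_def)
  show "refl_on (genus M) (genus_rel M)" by (auto simp: refl_on_def genus_rel_def isometric_refl)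
  show "sym (genus_rel M)" by (auto simp: sym_def genus_rel_def isometric_sym)
  show "trans (genus_rel M)" by (auto simp: trans_def genus_rel_def intro: isometric_trans)
qed

text \<open>Each class contains a reduced form. Its entries are half-integers bounded by
  \<open>3 * det M\<close>, because the determinant is constant on the genus.\<close>

theorem finite_genus_classes:
  assumes M: "ternary_lattice M"
  shows "finite (genus_classes M)"
proof -
  let ?R = "{N :: rat ^ 3 ^ 3. \<forall>i j. 2 * N $ i $ j \<in> \<int> \<and> \<bar>N $ i $ j\<bar> \<le> 3 * det M}"
  have "C \<in> (\<lambda>N. genus_rel M `` {N}) ` ?R" if C: "C \<in> genus_classes M" for C
  proof -
    obtain N where N: "N \<in> genus M" "C = genus_rel M `` {N}"
      using C unfolding genus_classes_eq by (rule quotientE)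
    note tN = genus_ternary[OF N(1)]
    obtain U where U: "int_mat U" "det U ^ 2 = 1" "\<And>i j. \<bar>gram N U $ i $ j\<bar> \<le> 3 * det N"
      using reduced_gram[OF tN] by blast
    note t = ternary_gram_unimodular[OF tN U(1,2)]
    have "(gram N U, N) \<in> genus_rel M"
      using N(1) t(1) genus_isometric[OF M N(1) U(1,2)] by (simp add: genus_rel_def)
    then have "C = genus_rel M `` {gram N U}"
      using N(2) equiv_class_eq[OF genus_rel_equiv] by metis
    moreover have "gram N U \<in> ?R" using two_gram_int[OF t(2)] U(3) genus_det[OF M N(1)] by auto
    ultimately show ?thesis by blast
  qed
  then have "genus_classes M \<subseteq> (\<lambda>N. genus_rel M `` {N}) ` ?R" by blast
  then show ?thesis using finite_half_integral_bounded finite_surj by blast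
qed

lemma class_rep:
  assumes "C \<in> genus_classes M"
  shows "class_rep C \<in> genus M" "C = genus_rel M `` {class_rep C}"
proof -
  have C: "C \<in> genus M // genus_rel M" using assms by (simp add: genus_classes_eq)
  have "C \<noteq> {}" using in_quotient_imp_non_empty[OF genus_rel_equiv C] .
  then have r: "class_rep C \<in> C" unfolding class_rep_def by (metis ex_in_conv someI_ex)
  then show "class_rep C \<in> genus M" using in_quotient_imp_subset[OF genus_rel_equiv C] by blast
  obtain N where N: "C = genus_rel M `` {N}" using C by (rule quotientE)
  then have "(N, class_rep C) \<in> genus_rel M" using r by blast
  then show "C = genus_rel M `` {class_rep C}" using equiv_class_eq[OF genus_rel_equiv] N by metis
qed

lemma class_rep_isometric:
  assumes "N \<in> genus M"
  shows "isometric (class_rep (genus_rel M `` {N})) N"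
proof -
  have C: "genus_rel M `` {N} \<in> genus_classes M" using assms by (simp add: genus_classes_eq quotientI)
  have "N \<in> genus_rel M `` {N}" using assms by (simp add: genus_rel_def isometric_refl)
  then have "(class_rep (genus_rel M `` {N}), N) \<in> genus_rel M" using class_rep(2)[OF C] by blast
  then show ?thesis unfolding genus_rel_def by blast
qed

lemma genus_class_eq_iff:
  assumes "N \<in> genus M" "N' \<in> genus M"
  shows "genus_rel M `` {N} = genus_rel M `` {N'} \<longleftrightarrow> isometric N N'"
  using eq_equiv_class_iff[OF genus_rel_equiv assms] assms by (simp add: genus_rel_def)

section \<open>The rational numbers integral at a prime, and approximation at several primes\<close>

subsection \<open>Local integrality of rational numbers\<close>

text \<open>The localisation of the integers at q inside the rationals. It replaces the q-adic
  integers wherever vectors and isometries are rational.\<close>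

definition pint :: "nat \<Rightarrow> rat set" where
  "pint q = {x. \<exists>d. \<not> int q dvd d \<and> of_int d * x \<in> \<int>}"

lemma pint_Ints: "prime q \<Longrightarrow> x \<in> \<int> \<Longrightarrow> x \<in> pint q"
  unfolding pint_def by (intro CollectI exI[of _ 1]) (auto simp: prime_nat_iff)

lemma pint_add:
  assumes "prime q" "x \<in> pint q" "y \<in> pint q"
  shows "x + y \<in> pint q"
proof -
  obtain c d where c: "\<not> int q dvd c" "of_int c * x \<in> \<int>" and d: "\<not> int q dvd d" "of_int d * y \<in> \<int>"
    using assms by (auto simp: pint_def)
  have "of_int (c * d) * (x + y) = of_int d * (of_int c * x) + of_int c * (of_int d * y)"
    by (simp add: algebra_simps)
  also have "\<dots> \<in> \<int>" by (intro Ints_add Ints_mult[OF Ints_of_int] c d)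
  finally show ?thesis using c d assms(1) unfolding pint_def
    by (intro CollectI exI[of _ "c * d"]) (simp add: prime_dvd_mult_iff)
qed

lemma pint_mult:
  assumes "prime q" "x \<in> pint q" "y \<in> pint q"
  shows "x * y \<in> pint q"
proof -
  obtain c d where c: "\<not> int q dvd c" "of_int c * x \<in> \<int>" and d: "\<not> int q dvd d" "of_int d * y \<in> \<int>"
    using assms by (auto simp: pint_def)
  have "of_int (c * d) * (x * y) = (of_int c * x) * (of_int d * y)"
    by (simp add: algebra_simps)
  also have "\<dots> \<in> \<int>" by (rule Ints_mult[OF c(2) d(2)])
  finally show ?thesis using c d assms(1) unfolding pint_def
    by (intro CollectI exI[of _ "c * d"]) (simp add: prime_dvd_mult_iff)
qed

lemma pint_minus: "x \<in> pint q \<Longrightarrow> - x \<in> pint q"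
  by (auto simp: pint_def)

lemma pint_diff: "prime q \<Longrightarrow> x \<in> pint q \<Longrightarrow> y \<in> pint q \<Longrightarrow> x - y \<in> pint q"
  using pint_add[of q x "- y"] pint_minus[of y q] by simp

lemma pint_iff_denominator:
  assumes q: "prime q"
  shows "x \<in> pint q \<longleftrightarrow> \<not> int q dvd snd (quotient_of x)"
proof -
  obtain a b where ab: "quotient_of x = (a, b)" by (cases "quotient_of x")
  have x: "x = of_int a / of_int b" and b: "b > 0" and co: "coprime a b"
    using ab quotient_of_div quotient_of_denom_pos quotient_of_coprime by auto
  show ?thesis
  proof
    assume "x \<in> pint q"
    then obtain d where d: "\<not> int q dvd d" "of_int d * x \<in> \<int>" by (auto simp: pint_def)
    then obtain k where "of_int d * x = of_int k" by (auto elim: Ints_cases)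
    then have "(of_int (d * a) :: rat) = of_int (k * b)" using b by (simp add: x field_simps)
    then have "d * a = k * b" by (simp only: of_int_eq_iff)
    then have "b dvd d" using co by (metis coprime_commute coprime_dvd_mult_left_iff dvd_triv_right)
    then show "\<not> int q dvd snd (quotient_of x)" using d ab by (auto dest: dvd_trans)
  next
    assume "\<not> int q dvd snd (quotient_of x)"
    moreover have "of_int b * x \<in> \<int>" using b by (simp add: x)
    ultimately show "x \<in> pint q" unfolding pint_def using ab by auto
  qed
qed

text \<open>In lowest terms q does not divide both numerator and denominator.\<close>

lemma pint_valuation:
  assumes q: "prime q" and x: "x \<notin> pint q"
  shows "1 / x \<in> pint q"
proof -
  obtain a b where ab: "quotient_of x = (a, b)" by (cases "quotient_of x")
  have xe: "x = of_int a / of_int b" and b: "b > 0" and co: "coprime a b"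
    using ab quotient_of_div quotient_of_denom_pos quotient_of_coprime by auto
  have "int q dvd b" using x ab by (simp add: pint_iff_denominator[OF q])
  then have "\<not> int q dvd a" using co q
    by (metis coprime_common_divisor not_prime_unit prime_nat_int_transfer)
  moreover have "of_int a * (1 / x) \<in> \<int>" using b by (cases "a = 0") (simp_all add: xe)
  ultimately show ?thesis unfolding pint_def by blast
qed

lemma pint_unit:
  assumes q: "prime q" and z: "(z - 1) / of_nat q \<in> pint q"
  shows "1 / z \<in> pint q"
proof -
  obtain d where d: "\<not> int q dvd d" "of_int d * ((z - 1) / of_nat q) \<in> \<int>" using z by (auto simp: pint_def)
  then obtain k where "of_int d * ((z - 1) / of_nat q) = of_int k" by (auto elim: Ints_cases)
  then have e: "of_int d * z = of_int (d + int q * k)" using q by (simp add: field_simps prime_gt_0_nat)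
  have nd: "\<not> int q dvd d + int q * k" using d(1) by (simp add: dvd_add_left_iff)
  have "z \<noteq> 0" using e nd by (auto simp del: of_int_add of_int_mult)
  then have "of_int (d + int q * k) * (1 / z) = of_int d" unfolding e[symmetric] by simp
  then show ?thesis unfolding pint_def using nd by (metis (mono_tags, lifting) Ints_of_int mem_Collect_eq)
qed

lemma rat_p_part:
  assumes p: "prime p"
  obtains j where "of_nat p ^ j * x \<in> pint p"
proof -
  obtain a b where ab: "quotient_of x = (a, b)" by (cases "quotient_of x")
  have xe: "x = of_int a / of_int b" and b: "b > 0"
    using ab quotient_of_div quotient_of_denom_pos by auto
  obtain c where c: "b = int p ^ multiplicity (int p) b * c" "\<not> int p dvd c"
    using multiplicity_decompose'[of b "int p"] b p by (metis less_irrefl not_prime_unit prime_nat_int_transfer)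
  let ?j = "multiplicity (int p) b"
  have "of_int b = (of_nat p :: rat) ^ ?j * of_int c" by (subst c(1)) simp
  moreover have "c \<noteq> 0" using c b by auto
  ultimately have "of_int c * (of_nat p ^ ?j * x) = of_int a"
    using b p by (simp add: xe field_simps prime_gt_0_nat)
  then have "of_nat p ^ ?j * x \<in> pint p" unfolding pint_def using c(2) by (metis (mono_tags, lifting) Ints_of_int mem_Collect_eq)
  then show ?thesis using that by blast
qed

lemma rat_not_divisible:
  assumes p: "prime p" and r: "r \<noteq> 0"
  obtains k where "r / of_nat p ^ k \<notin> pint p"
proof -
  obtain j where j: "of_nat p ^ j * (1 / r) \<in> pint p" using rat_p_part[OF p] .
  have "r / of_nat p ^ (j + 1) \<notin> pint p"
  proof
    assume "r / of_nat p ^ (j + 1) \<in> pint p"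
    then have "of_nat p ^ j * (1 / r) * (r / of_nat p ^ (j + 1)) \<in> pint p" by (intro pint_mult p j)
    then have "1 / of_nat p \<in> pint p" using r p by (simp add: prime_gt_0_nat)
    then obtain d k where d: "\<not> int p dvd d" "of_int d * (1 / of_nat p) = (of_int k :: rat)"
      by (auto simp: pint_def elim: Ints_cases)
    then have "(of_int d :: rat) = of_int (int p * k)" using p by (simp add: field_simps prime_gt_0_nat)
    then have "d = int p * k" by (simp only: of_int_eq_iff)
    then show False using d(1) by simp
  qed
  then show ?thesis using that by blast
qed

text \<open>The witness is u z + (1 - u) v with an integer u that is 1 modulo p^(K + j) and
  divisible by m d. Here p^j and d clear the denominator of z - v at p and away from p, and m is the
  product of S, which supplies the divisibility by each q.\<close>

lemma rat_weak_approximation: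
  assumes p: "prime p" and S: "finite S" "\<forall>q\<in>S. prime q" "p \<notin> S" and v: "v \<in> \<int>"
  obtains a where "(a - z) / of_nat p ^ K \<in> pint p" "\<And>q. q \<in> S \<Longrightarrow> (a - v) / of_nat q \<in> pint q"
proof -
  obtain j where j: "of_nat p ^ j * (z - v) \<in> pint p" using rat_p_part[OF p] .
  then obtain d where d: "\<not> int p dvd d" "of_int d * (of_nat p ^ j * (z - v)) \<in> \<int>" by (auto simp: pint_def)
  define m where "m = (\<Prod>q\<in>S. int q)"
  have pm: "\<not> int p dvd m"
  proof
    assume "int p dvd m"
    then obtain q where "q \<in> S" "int p dvd int q"
      using p S(1) prime_dvd_prod_iff[of S "int p" int] unfolding m_def by auto
    then show False using S p primes_dvd_imp_eq[of p q] by auto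
  qed
  have "coprime (m * d) (int p ^ (K + j))"
    using pm d(1) p by (metis coprime_commute coprime_mult_left_iff coprime_power_right_iff prime_imp_coprime prime_nat_int_transfer)
  then obtain s where s: "[m * d * s = 1] (mod int p ^ (K + j))" using cong_solve_coprime_int by blast
  define u where "u = m * d * s"
  define a where "a = of_int u * z + (1 - of_int u) * v"
  have "(a - z) / of_nat p ^ K \<in> pint p"
  proof -
    obtain t where t: "u - 1 = int p ^ (K + j) * t" using s by (auto simp: u_def cong_iff_dvd_diff elim: dvdE)
    have "(of_int u - 1 :: rat) = of_int (u - 1)" by simp
    also have "\<dots> = of_nat p ^ K * (of_nat p ^ j * of_int t)" unfolding t by (simp add: power_add)
    finally have u1: "(of_int u - 1 :: rat) = of_nat p ^ K * (of_nat p ^ j * of_int t)" .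
    have "a - z = (of_int u - 1) * (z - v)" by (simp add: a_def algebra_simps)
    then have "(a - z) / of_nat p ^ K = of_int t * (of_nat p ^ j * (z - v))"
      using p by (simp add: u1 prime_gt_0_nat)
    also have "\<dots> \<in> pint p" by (rule pint_mult[OF p pint_Ints[OF p Ints_of_int] j])
    finally show ?thesis .
  qed
  moreover have "(a - v) / of_nat q \<in> pint q" if q: "q \<in> S" for q
  proof -
    have pq: "prime q" using S q by blast
    obtain m' where m': "m = int q * m'" unfolding m_def using dvd_prodI[OF S(1) q, of int] by (auto elim: dvdE)
    have "a - v = of_int u * (z - v)" by (simp add: a_def algebra_simps)
    then have "of_nat p ^ j * ((a - v) / of_nat q) = of_int (m' * s) * (of_int d * (of_nat p ^ j * (z - v)))"
      using pq by (simp add: u_def m' prime_gt_0_nat)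
    also have "\<dots> \<in> \<int>" by (rule Ints_mult[OF Ints_of_int d(2)])
    finally have "of_int (int p ^ j) * ((a - v) / of_nat q) \<in> \<int>" by simp
    moreover have "\<not> int q dvd int p ^ j"
      using p pq S(3) q by (metis int_dvd_int_iff prime_dvd_power primes_dvd_imp_eq of_nat_power)
    ultimately show ?thesis unfolding pint_def by blast
  qed
  ultimately show ?thesis using that by blast
qed

definition pvec :: "nat \<Rightarrow> rat ^ 3 \<Rightarrow> bool" where
  "pvec q x \<longleftrightarrow> (\<forall>i. x $ i \<in> pint q)"

definition locally_integral :: "nat \<Rightarrow> (rat ^ 3 \<Rightarrow> rat ^ 3) \<Rightarrow> bool" where
  "locally_integral q \<sigma> \<longleftrightarrow> (\<forall>x. pvec q x \<longrightarrow> pvec q (\<sigma> x))"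

lemma pvec_add: "prime q \<Longrightarrow> pvec q x \<Longrightarrow> pvec q y \<Longrightarrow> pvec q (x + y)"
  by (simp add: pvec_def pint_add)

lemma pvec_diff: "prime q \<Longrightarrow> pvec q x \<Longrightarrow> pvec q y \<Longrightarrow> pvec q (x - y)"
  by (simp add: pvec_def pint_diff)

lemma pvec_scale: "prime q \<Longrightarrow> c \<in> pint q \<Longrightarrow> pvec q x \<Longrightarrow> pvec q (c *s x)"
  by (simp add: pvec_def pint_mult)

lemma pvec_std: "prime q \<Longrightarrow> x \<in> std_lattice \<Longrightarrow> pvec q x"
  by (simp add: pvec_def std_lattice_def pint_Ints)

lemma pint_sum: "prime q \<Longrightarrow> (\<And>i. i \<in> A \<Longrightarrow> f i \<in> pint q) \<Longrightarrow> (\<Sum>i\<in>A. f i) \<in> pint q"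
  by (induction A rule: infinite_finite_induct) (auto intro: pint_add pint_Ints)

lemma two_bilin_pint:
  assumes M: "ternary_lattice M" and q: "prime q" and "pvec q x" "pvec q y"
  shows "2 * bilin M x y \<in> pint q"
proof -
  have "2 * bilin M x y = (\<Sum>i\<in>UNIV. \<Sum>j\<in>UNIV. (2 * M $ i $ j) * x $ i * y $ j)"
    by (simp add: bilin_def sum_distrib_left mult.assoc)
  also have "\<dots> \<in> pint q"
    using assms(3,4) by (intro pint_sum q pint_mult[OF q] pint_Ints[OF q two_gram_int[OF M]]) (auto simp: pvec_def)
  finally show ?thesis .
qed

text \<open>Off-diagonal entries may be half-integers, but grouped in symmetric pairs only
  \<open>2 * M $ i $ j\<close> appears; the prime 2 is thereby included.\<close>

lemma quad_pint:
  assumes M: "ternary_lattice M" and q: "prime q" and x: "pvec q x"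
  shows "quad M x \<in> pint q"
proof -
  have *: "M $ i $ j * x $ i * x $ j + M $ j $ i * x $ j * x $ i \<in> pint q" for i j
  proof -
    have "M $ i $ j * x $ i * x $ j + M $ j $ i * x $ j * x $ i = (2 * M $ i $ j) * x $ i * x $ j"
      by (simp add: gram_sym[OF M, of j i])
    also have "\<dots> \<in> pint q"
      using x by (intro pint_mult[OF q] pint_Ints[OF q two_gram_int[OF M]]) (auto simp: pvec_def)
    finally show ?thesis .
  qed
  have d: "M $ i $ i * x $ i * x $ i \<in> pint q" for i
    using x by (intro pint_mult[OF q] pint_Ints[OF q gram_diag_int[OF M]]) (auto simp: pvec_def)
  have "quad M x = (M $ 1 $ 1 * x $ 1 * x $ 1 + M $ 2 $ 2 * x $ 2 * x $ 2 + M $ 3 $ 3 * x $ 3 * x $ 3)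
     + (M $ 1 $ 2 * x $ 1 * x $ 2 + M $ 2 $ 1 * x $ 2 * x $ 1)
     + (M $ 1 $ 3 * x $ 1 * x $ 3 + M $ 3 $ 1 * x $ 3 * x $ 1)
     + (M $ 2 $ 3 * x $ 2 * x $ 3 + M $ 3 $ 2 * x $ 3 * x $ 2)"
    by (simp add: quad_expand)
  also have "\<dots> \<in> pint q" by (intro pint_add q * d)
  finally show ?thesis .
qed

section \<open>Isometry and local integrality of reflections\<close>

subsection \<open>Reflections\<close>

text \<open>For \<open>quad M a = 0\<close> the quotient is 0 and the map is the identity, so it is
  an isometry for every \<open>a\<close>.\<close>

definition reflect :: "rat ^ 3 ^ 3 \<Rightarrow> rat ^ 3 \<Rightarrow> rat ^ 3 \<Rightarrow> rat ^ 3" where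
  "reflect M a x = x - (2 * bilin M x a / quad M a) *s a"

lemma reflect_space_isometry:
  assumes "transpose M = M"
  shows "space_isometry M M (reflect M a)"
proof -
  note comm = bilin_commute[OF assms]
  have add: "reflect M a (x + y) = reflect M a x + reflect M a y" for x y
    by (simp add: reflect_def bilin_linear vec_eq_iff add_divide_distrib algebra_simps)
  have scale: "reflect M a (c *s x) = c *s reflect M a x" for c x
    by (simp add: reflect_def bilin_linear vec_eq_iff algebra_simps)
  have "reflect M a (reflect M a x) = x" for x
  proof (cases "quad M a = 0")
    case False
    have "bilin M (reflect M a x) a = - bilin M x a"
      using False by (simp add: reflect_def bilin_linear quad_def)
    then show ?thesis unfolding reflect_def[of M a "reflect M a x"]
      by (simp add: reflect_def vec_eq_iff)
  qed (simp add: reflect_def)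
  then have "bij (reflect M a)" by (intro o_bij[of "reflect M a"]) (auto simp: o_def)
  moreover have "bilin M (reflect M a x) (reflect M a y) = bilin M x y" for x y
  proof (cases "quad M a = 0")
    case False
    then show ?thesis using comm[of a y]
      by (simp add: reflect_def bilin_linear quad_def field_simps)
  qed (simp add: reflect_def)
  ultimately show ?thesis
    by (simp add: space_isometry_def Vector_Spaces.linear_iff vec.vector_space_axioms add scale)
qed

text \<open>Since Q(v) = 1, the value Q(a) is 1 modulo q and hence a unit at q, while 2 B(x, a) is
  integral there. Because it is Q and not 2B that has the value 1, this covers q = 2.\<close>

lemma reflect_locally_integral:
  assumes M: "ternary_lattice M" and q: "prime q" and v: "v \<in> std_lattice" "quad M v = 1"
    and a: "\<And>i. (a $ i - v $ i) / of_nat q \<in> pint q"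
  shows "locally_integral q (reflect M a)"
  unfolding locally_integral_def
proof (intro allI impI)
  fix x assume x: "pvec q x"
  define b where "b = (1 / of_nat q) *s (a - v)"
  have b: "pvec q b" using a by (simp add: b_def pvec_def)
  have ab: "a = v + of_nat q *s b" using q by (simp add: b_def vec_eq_iff prime_gt_0_nat)
  have pv: "pvec q v" by (rule pvec_std[OF q v(1)])
  have pa: "pvec q a" unfolding ab using q by (intro pvec_add pvec_scale pv b pint_Ints) auto
  have "quad M a - 1 = of_nat q * (2 * bilin M v b + of_nat q * quad M b)"
    using v(2) bilin_commute[OF ternary_sym[OF M], of b v] by (simp add: ab quad_def bilin_linear algebra_simps)
  then have "(quad M a - 1) / of_nat q = 2 * bilin M v b + of_nat q * quad M b"
    using q by (simp add: prime_gt_0_nat)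
  also have "\<dots> \<in> pint q"
    using q by (intro pint_add pint_mult two_bilin_pint[OF M] quad_pint[OF M] pv b pint_Ints) auto
  finally have "1 / quad M a \<in> pint q" by (rule pint_unit[OF q])
  then have "2 * bilin M x a * (1 / quad M a) \<in> pint q"
    by (intro pint_mult two_bilin_pint[OF M] q x pa)
  then show "pvec q (reflect M a x)"
    unfolding reflect_def by (intro pvec_diff pvec_scale q x pa) simp
qed

section \<open>The p-adic topology for sequences of rational numbers, along a filter\<close>

subsection \<open>Bounded and null sequences\<close>

text \<open>\<open>bdd\<close>, \<open>nul\<close> and \<open>away\<close> express that a rational
  sequence is bounded, tends to 0, or stays away from 0 in the p-adic absolute value. The filter is
  a parameter so that passing to a subsequence amounts to restricting it.\<close>

definition bdd :: "nat \<Rightarrow> nat filter \<Rightarrow> (nat \<Rightarrow> rat) \<Rightarrow> bool" where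
  "bdd p F x \<longleftrightarrow> (\<exists>c. \<forall>\<^sub>F n in F. of_nat p ^ c * x n \<in> pint p)"

definition nul :: "nat \<Rightarrow> nat filter \<Rightarrow> (nat \<Rightarrow> rat) \<Rightarrow> bool" where
  "nul p F x \<longleftrightarrow> (\<forall>k. \<forall>\<^sub>F n in F. x n / of_nat p ^ k \<in> pint p)"

definition away :: "nat \<Rightarrow> nat filter \<Rightarrow> (nat \<Rightarrow> rat) \<Rightarrow> bool" where
  "away p F x \<longleftrightarrow> (\<exists>k. \<forall>\<^sub>F n in F. x n / of_nat p ^ k \<notin> pint p)"

lemma bdd_mono: "bdd p F x \<Longrightarrow> F' \<le> F \<Longrightarrow> bdd p F' x"
  by (auto simp: bdd_def dest: filter_leD)

lemma nul_mono: "nul p F x \<Longrightarrow> F' \<le> F \<Longrightarrow> nul p F' x"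
  by (auto simp: nul_def dest: filter_leD)

context
  fixes p :: nat
  assumes p: "prime p"
begin

lemma pint_power: "of_nat p ^ k \<in> pint p"
  using p by (intro pint_Ints) auto

lemma bdd_const: "bdd p F (\<lambda>n. c)"
  using rat_p_part[OF p, of c] unfolding bdd_def by (metis eventually_const_iff always_eventually)

lemma bdd_pint: "(\<And>n. x n \<in> pint p) \<Longrightarrow> bdd p F x"
  unfolding bdd_def by (intro exI[of _ 0]) auto

lemma bdd_add:
  assumes "bdd p F x" "bdd p F y"
  shows "bdd p F (\<lambda>n. x n + y n)"
proof -
  obtain c d where cd: "\<forall>\<^sub>F n in F. of_nat p ^ c * x n \<in> pint p" "\<forall>\<^sub>F n in F. of_nat p ^ d * y n \<in> pint p"
    using assms by (auto simp: bdd_def)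
  have "\<forall>\<^sub>F n in F. of_nat p ^ (c + d) * (x n + y n) \<in> pint p"
    using cd
  proof eventually_elim
    case (elim n)
    have "of_nat p ^ d * (of_nat p ^ c * x n) + of_nat p ^ c * (of_nat p ^ d * y n) \<in> pint p"
      by (intro pint_add pint_mult p pint_power elim)
    then show ?case by (simp add: power_add algebra_simps)
  qed
  then show ?thesis by (auto simp: bdd_def)
qed

lemma bdd_mult:
  assumes "bdd p F x" "bdd p F y"
  shows "bdd p F (\<lambda>n. x n * y n)"
proof -
  obtain c d where cd: "\<forall>\<^sub>F n in F. of_nat p ^ c * x n \<in> pint p" "\<forall>\<^sub>F n in F. of_nat p ^ d * y n \<in> pint p"
    using assms by (auto simp: bdd_def)
  have "\<forall>\<^sub>F n in F. of_nat p ^ (c + d) * (x n * y n) \<in> pint p"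
    using cd
  proof eventually_elim
    case (elim n)
    have "(of_nat p ^ c * x n) * (of_nat p ^ d * y n) \<in> pint p"
      by (intro pint_mult p elim)
    then show ?case by (simp add: power_add algebra_simps)
  qed
  then show ?thesis by (auto simp: bdd_def)
qed

lemma bdd_diff: "bdd p F x \<Longrightarrow> bdd p F y \<Longrightarrow> bdd p F (\<lambda>n. x n - y n)"
  using bdd_add[of F x "\<lambda>n. (-1) * y n"] bdd_mult[OF bdd_const[of F "-1"], of y] by simp

lemma bdd_sum: "(\<And>i. i \<in> A \<Longrightarrow> bdd p F (\<lambda>n. f i n)) \<Longrightarrow> bdd p F (\<lambda>n. \<Sum>i\<in>A. f i n)"
  by (induction A rule: infinite_finite_induct) (auto intro: bdd_add bdd_const)

lemma nul_add:
  assumes "nul p F x" "nul p F y"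
  shows "nul p F (\<lambda>n. x n + y n)"
  unfolding nul_def
proof
  fix k
  have "\<forall>\<^sub>F n in F. x n / of_nat p ^ k \<in> pint p" "\<forall>\<^sub>F n in F. y n / of_nat p ^ k \<in> pint p"
    using assms by (auto simp: nul_def)
  then show "\<forall>\<^sub>F n in F. (x n + y n) / of_nat p ^ k \<in> pint p"
    by eventually_elim (auto simp: add_divide_distrib intro: pint_add p)
qed

lemma nul_mult_bdd:
  assumes "nul p F x" "bdd p F y"
  shows "nul p F (\<lambda>n. x n * y n)"
  unfolding nul_def
proof
  fix k
  obtain c where c: "\<forall>\<^sub>F n in F. of_nat p ^ c * y n \<in> pint p" using assms(2) by (auto simp: bdd_def)
  have "\<forall>\<^sub>F n in F. x n / of_nat p ^ (k + c) \<in> pint p" using assms(1) by (auto simp: nul_def)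
  with c show "\<forall>\<^sub>F n in F. x n * y n / of_nat p ^ k \<in> pint p"
  proof eventually_elim
    case (elim n)
    have "(x n / of_nat p ^ (k + c)) * (of_nat p ^ c * y n) \<in> pint p" by (intro pint_mult p elim)
    moreover have "(x n / of_nat p ^ (k + c)) * (of_nat p ^ c * y n) = x n * y n / of_nat p ^ k"
      using p by (simp add: power_add prime_gt_0_nat)
    ultimately show ?case by (simp only:)
  qed
qed

lemma nul_bdd_mult: "bdd p F x \<Longrightarrow> nul p F y \<Longrightarrow> nul p F (\<lambda>n. x n * y n)"
  using nul_mult_bdd[of F y x] by (simp add: mult.commute)

lemma nul_zero: "nul p F (\<lambda>n. 0)"
  using pint_Ints[OF p, of 0] by (simp add: nul_def)

lemma nul_diff: "nul p F x \<Longrightarrow> nul p F y \<Longrightarrow> nul p F (\<lambda>n. x n - y n)"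
  using nul_add[of F x "\<lambda>n. (-1) * y n"] nul_bdd_mult[OF bdd_const[of F "-1"], of y] by simp

lemma nul_sum: "(\<And>i. i \<in> A \<Longrightarrow> nul p F (\<lambda>n. f i n)) \<Longrightarrow> nul p F (\<lambda>n. \<Sum>i\<in>A. f i n)"
  by (induction A rule: infinite_finite_induct) (auto intro: nul_add nul_zero)

lemma nul_imp_bdd: "nul p F x \<Longrightarrow> bdd p F x"
proof -
  assume "nul p F x"
  then have "\<forall>\<^sub>F n in F. x n / of_nat p ^ 0 \<in> pint p" unfolding nul_def by blast
  then show ?thesis unfolding bdd_def by (intro exI[of _ 0]) simp
qed

lemma nul_sequentially:
  assumes "F \<le> sequentially" "\<And>n. x n / of_nat p ^ n \<in> pint p"
  shows "nul p F x"
proof -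
  have "\<forall>\<^sub>F n in sequentially. x n / of_nat p ^ k \<in> pint p" for k
  proof (rule eventually_sequentiallyI)
    fix n assume "k \<le> n"
    then have "x n / of_nat p ^ k = (x n / of_nat p ^ n) * of_nat p ^ (n - k)"
      using p by (simp add: power_diff prime_gt_0_nat)
    also have "\<dots> \<in> pint p" by (intro pint_mult[OF p] assms(2) pint_power)
    finally show "x n / of_nat p ^ k \<in> pint p" .
  qed
  then have "nul p sequentially x" by (simp add: nul_def)
  then show ?thesis using assms(1) by (rule nul_mono)
qed

text \<open>Fix k such that p^k does not divide r. When the sum is close to r, then
  \<open>x n\<close> and \<open>y n\<close> are not both divisible by p^k, and \<open>A\<close>
  collects the indices at which \<open>x n\<close> is not. One of the two restricted filters may be
  trivial; the choice is left to the user.\<close>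

lemma away_dichotomy:
  assumes r: "r \<noteq> 0" and n: "nul p F (\<lambda>n. x n + y n - r)"
  obtains A where "away p (inf F (principal A)) x" "away p (inf F (principal (- A))) y"
proof -
  obtain k where k: "r / of_nat p ^ k \<notin> pint p" using rat_not_divisible[OF p r] .
  define A where "A = {n. x n / of_nat p ^ k \<notin> pint p}"
  have ev: "\<forall>\<^sub>F n in F. (x n + y n - r) / of_nat p ^ k \<in> pint p" using n by (simp add: nul_def)
  have "y n / of_nat p ^ k \<notin> pint p" if "(x n + y n - r) / of_nat p ^ k \<in> pint p" "n \<notin> A" for n
  proof
    assume 1: "y n / of_nat p ^ k \<in> pint p"
    have 2: "x n / of_nat p ^ k \<in> pint p" using that(2) by (auto simp: A_def)
    have "x n / of_nat p ^ k + y n / of_nat p ^ k - (x n + y n - r) / of_nat p ^ k \<in> pint p"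
      by (intro pint_diff pint_add p 1 2 that(1))
    then show False using k by (simp add: diff_divide_distrib add_divide_distrib)
  qed
  then have "\<forall>\<^sub>F n in inf F (principal (- A)). y n / of_nat p ^ k \<notin> pint p"
    unfolding eventually_inf_principal using ev by (auto elim!: eventually_mono)
  moreover have "\<forall>\<^sub>F n in inf F (principal A). x n / of_nat p ^ k \<notin> pint p"
    unfolding eventually_inf_principal by (auto simp: A_def)
  ultimately show ?thesis using that[of A] by (auto simp: away_def)
qed

lemma away_const: "r \<noteq> 0 \<Longrightarrow> away p F (\<lambda>n. r)"
  using rat_not_divisible[OF p, of r] unfolding away_def by (metis always_eventually)

lemma away_cong:
  assumes "away p F x" "nul p F (\<lambda>n. y n - x n)"
  shows "away p F y"
proof -
  obtain k where k: "\<forall>\<^sub>F n in F. x n / of_nat p ^ k \<notin> pint p" using assms(1) by (auto simp: away_def)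
  have "\<forall>\<^sub>F n in F. (y n - x n) / of_nat p ^ k \<in> pint p" using assms(2) by (simp add: nul_def)
  with k have "\<forall>\<^sub>F n in F. y n / of_nat p ^ k \<notin> pint p"
  proof eventually_elim
    case (elim n)
    show ?case
    proof
      assume "y n / of_nat p ^ k \<in> pint p"
      then have "y n / of_nat p ^ k - (y n - x n) / of_nat p ^ k \<in> pint p" by (intro pint_diff p elim)
      then show False using elim by (simp add: diff_divide_distrib)
    qed
  qed
  then show ?thesis by (auto simp: away_def)
qed

lemma away_inverse_bdd:
  assumes "away p F x"
  shows "bdd p F (\<lambda>n. 1 / x n)"
proof -
  obtain k where k: "\<forall>\<^sub>F n in F. x n / of_nat p ^ k \<notin> pint p" using assms by (auto simp: away_def)
  then have "\<forall>\<^sub>F n in F. of_nat p ^ k * (1 / x n) \<in> pint p"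
    by eventually_elim (use pint_valuation[OF p] in fastforce)
  then show ?thesis by (auto simp: bdd_def)
qed

lemma away_nonzero: "away p F x \<Longrightarrow> \<forall>\<^sub>F n in F. x n \<noteq> 0"
  unfolding away_def using pint_Ints[OF p, of 0] by (auto elim!: eventually_mono)

definition bddv :: "nat filter \<Rightarrow> (nat \<Rightarrow> rat ^ 3) \<Rightarrow> bool" where
  "bddv F v \<longleftrightarrow> (\<forall>i. bdd p F (\<lambda>n. v n $ i))"

definition nulv :: "nat filter \<Rightarrow> (nat \<Rightarrow> rat ^ 3) \<Rightarrow> bool" where
  "nulv F v \<longleftrightarrow> (\<forall>i. nul p F (\<lambda>n. v n $ i))"

lemma bddv_add: "bddv F v \<Longrightarrow> bddv F w \<Longrightarrow> bddv F (\<lambda>n. v n + w n)"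
  by (simp add: bddv_def bdd_add)

lemma bddv_diff: "bddv F v \<Longrightarrow> bddv F w \<Longrightarrow> bddv F (\<lambda>n. v n - w n)"
  by (simp add: bddv_def bdd_diff)

lemma bddv_scale: "bdd p F c \<Longrightarrow> bddv F w \<Longrightarrow> bddv F (\<lambda>n. c n *s w n)"
  by (simp add: bddv_def bdd_mult)

lemma nulv_add: "nulv F v \<Longrightarrow> nulv F w \<Longrightarrow> nulv F (\<lambda>n. v n + w n)"
  by (simp add: nulv_def nul_add)

lemma nulv_scale_bdd: "bdd p F c \<Longrightarrow> nulv F w \<Longrightarrow> nulv F (\<lambda>n. c n *s w n)"
  by (simp add: nulv_def nul_bdd_mult)

lemma nulv_scale_nul: "nul p F c \<Longrightarrow> bddv F w \<Longrightarrow> nulv F (\<lambda>n. c n *s w n)"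
  by (simp add: nulv_def bddv_def nul_mult_bdd)

lemma nulv_imp_bddv: "nulv F v \<Longrightarrow> bddv F v"
  by (simp add: nulv_def bddv_def nul_imp_bdd)

lemma nulv_eventually:
  assumes "\<forall>\<^sub>F n in F. v n = w n" "nulv F w"
  shows "nulv F v"
  unfolding nulv_def nul_def
proof (intro allI)
  fix i k
  have "\<forall>\<^sub>F n in F. w n $ i / of_nat p ^ k \<in> pint p" using assms(2) by (simp add: nulv_def nul_def)
  with assms(1) show "\<forall>\<^sub>F n in F. v n $ i / of_nat p ^ k \<in> pint p" by eventually_elim simp
qed

lemma bilin_bdd: "bddv F v \<Longrightarrow> bddv F w \<Longrightarrow> bdd p F (\<lambda>n. bilin M (v n) (w n))"
  unfolding bilin_def by (intro bdd_sum bdd_mult bdd_const) (auto simp: bddv_def)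

lemma bilin_nul_right: "bddv F v \<Longrightarrow> nulv F w \<Longrightarrow> nul p F (\<lambda>n. bilin M (v n) (w n))"
  unfolding bilin_def by (intro nul_sum nul_bdd_mult bdd_mult bdd_const) (auto simp: bddv_def nulv_def)

lemma bilin_nul_left: "nulv F v \<Longrightarrow> bddv F w \<Longrightarrow> nul p F (\<lambda>n. bilin M (v n) (w n))"
  unfolding bilin_def by (intro nul_sum nul_mult_bdd nul_bdd_mult bdd_const) (auto simp: bddv_def nulv_def)

end

section \<open>Making a rational isometry integral at one more prime\<close>

subsection \<open>Approximating local isometries by rational ones\<close>

text \<open>Gram-Schmidt. Orthogonality allows the basis vectors to be adjusted one at a time: the
  reflection that corrects \<open>e i\<close> is in a vector almost orthogonal to the images already
  placed.\<close>

lemma orthogonal_basis_exists: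
  assumes N: "ternary_lattice N"
  obtains e :: "3 \<Rightarrow> rat ^ 3" and c where "\<And>i. e i \<noteq> 0" "\<And>i j. i \<noteq> j \<Longrightarrow> bilin N (e i) (e j) = 0"
    "\<And>j. axis j 1 = (\<Sum>i\<in>UNIV. c j i *s e i)"
proof -
  define e1 :: "rat ^ 3" where "e1 = axis 1 1"
  define k21 where "k21 = bilin N (axis 2 1) e1 / quad N e1"
  define e2 where "e2 = axis 2 1 - k21 *s e1"
  define k31 where "k31 = bilin N (axis 3 1) e1 / quad N e1"
  define k32 where "k32 = bilin N (axis 3 1) e2 / quad N e2"
  define e3 where "e3 = axis 3 1 - k31 *s e1 - k32 *s e2"
  have "e1 $ 1 = 1" "e2 $ 2 = 1" "e3 $ 3 = 1" by (simp_all add: e1_def e2_def e3_def axis_def)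
  then have nz: "e1 \<noteq> 0" "e2 \<noteq> 0" "e3 \<noteq> 0" by (metis zero_index zero_neq_one)+
  then have q: "quad N e1 \<noteq> 0" "quad N e2 \<noteq> 0" using ternary_quad_eq_0[OF N] by auto
  note comm = bilin_commute[OF ternary_sym[OF N]]
  have o21: "bilin N e2 e1 = 0" using q by (simp add: e2_def bilin_linear k21_def quad_def[symmetric])
  have o12: "bilin N e1 e2 = 0" using o21 comm by metis
  have o31: "bilin N e3 e1 = 0" using q by (simp add: e3_def bilin_linear k31_def o21 quad_def[symmetric])
  have o32: "bilin N e3 e2 = 0" using q by (simp add: e3_def bilin_linear k32_def o12 quad_def[symmetric])
  have o13: "bilin N e1 e3 = 0" "bilin N e2 e3 = 0" using o31 o32 comm by metis+
  define e :: "3 \<Rightarrow> rat ^ 3" where "e i = (if i = 1 then e1 else if i = 2 then e2 else e3)" for i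
  define c :: "3 \<Rightarrow> 3 \<Rightarrow> rat" where
    "c j i = (if j = i then 1 else if j = 2 \<and> i = 1 then k21 else if j = 3 \<and> i = 1 then k31
       else if j = 3 \<and> i = 2 then k32 else 0)" for j i
  show ?thesis
  proof (rule that[of e c])
    show "e i \<noteq> 0" for i using nz by (simp add: e_def)
    show "bilin N (e i) (e j) = 0" if "i \<noteq> j" for i j
      using that exhaust_3[of i] exhaust_3[of j] o12 o21 o31 o32 o13 by (auto simp: e_def)
    have "axis 1 1 = (\<Sum>i\<in>UNIV. c 1 i *s e i)"
      by (simp add: sum_3 c_def e_def e1_def)
    moreover have "axis 2 1 = (\<Sum>i\<in>UNIV. c 2 i *s e i)"
      by (simp add: sum_3 c_def e_def e2_def vec_eq_iff)
    moreover have "axis 3 1 = (\<Sum>i\<in>UNIV. c 3 i *s e i)"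
      by (simp add: sum_3 c_def e_def e3_def vec_eq_iff)
    ultimately show "axis j 1 = (\<Sum>i\<in>UNIV. c j i *s e i)" for j
      using exhaust_3[of j] by auto
  qed
qed

lemma space_isometry_sum:
  assumes "space_isometry N M \<sigma>"
  shows "\<sigma> (\<Sum>i\<in>A. c i *s e i) = (\<Sum>i\<in>A. c i *s \<sigma> (e i))"
proof -
  have "\<sigma> 0 = 0" using space_isometry_scale[OF assms, of 0 0] by simp
  then show ?thesis
    by (induction A rule: infinite_finite_induct)
      (simp_all add: space_isometry_add[OF assms] space_isometry_scale[OF assms])
qed

text \<open>
  \<open>v\<^sub>0\<close> with \<open>Q(v\<^sub>0) = 1\<close> defines a reflection of the lattice \<open>M\<close>, so a reflection in a vector congruent to
  \<open>v\<^sub>0\<close> modulo the primes of \<open>S\<close> does not destroy the integrality already achieved at \<open>S\<close>.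
\<close>

locale approximation =
  fixes p :: nat and S :: "nat set" and M N :: "rat ^ 3 ^ 3" and v0 :: "rat ^ 3"
    and X :: "nat \<Rightarrow> 3 \<Rightarrow> int ^ 3" and e :: "3 \<Rightarrow> rat ^ 3" and c :: "3 \<Rightarrow> 3 \<Rightarrow> rat"
  assumes p: "prime p" and S: "finite S" "\<forall>q\<in>S. prime q" "p \<notin> S"
    and M: "ternary_lattice M" and N: "ternary_lattice N"
    and v0: "v0 \<in> std_lattice" "quad M v0 = 1"
    and X: "\<And>n i j. int p ^ n dvd bform (gint M) (X n i) (X n j) - gint N $ i $ j"
    and e: "\<And>i. e i \<noteq> 0" "\<And>i j. i \<noteq> j \<Longrightarrow> bilin N (e i) (e j) = 0"
      "\<And>j. axis j 1 = (\<Sum>i\<in>UNIV. c j i *s e i)"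
begin

text \<open>The linear extension of the integral vectors \<open>X n i\<close>, only approximately an
  isometry from N to M. The rational isometries are steered towards it.\<close>

definition XX :: "nat \<Rightarrow> rat ^ 3 \<Rightarrow> rat ^ 3" where
  "XX n x = (\<Sum>i\<in>UNIV. x $ i *s rvec (X n i))"

lemma XX_bddv: "bddv p F (\<lambda>n. XX n x)"
proof -
  have 1: "bdd p F (\<lambda>n. of_int (X n j $ i))" for i j by (rule bdd_pint[OF p]) (simp add: pint_Ints[OF p])
  have "XX n x $ i = (\<Sum>j\<in>UNIV. x $ j * of_int (X n j $ i))" for n i by (simp add: XX_def)
  then show ?thesis unfolding bddv_def[OF p]
    by (simp only:) (intro allI bdd_sum[OF p] bdd_mult[OF p] bdd_const[OF p] 1)
qed

lemma XX_axis: "XX n (axis j 1) = rvec (X n j)"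
  by (simp add: XX_def vec_eq_iff axis_def if_distrib[of "\<lambda>x. x * _"] cong: if_cong)

lemma XX_almost_isometry:
  assumes "F \<le> sequentially"
  shows "nul p F (\<lambda>n. bilin M (XX n x) (XX n y) - bilin N x y)"
proof -
  have entry: "nul p F (\<lambda>n. 2 * bilin M (rvec (X n i)) (rvec (X n j)) - 2 * N $ i $ j)" for i j
  proof (rule nul_sequentially[OF p assms])
    fix n
    obtain k where k: "bform (gint M) (X n i) (X n j) - gint N $ i $ j = int p ^ n * k" using X by (blast elim: dvdE)
    have "2 * bilin M (rvec (X n i)) (rvec (X n j)) - 2 * N $ i $ j =
        of_int (bform (gint M) (X n i) (X n j) - gint N $ i $ j)"
      by (simp add: bform_gint[OF M] gint_entry[OF N])
    also have "\<dots> / of_nat p ^ n = of_int k" using p by (simp add: k prime_gt_0_nat)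
    finally show "(2 * bilin M (rvec (X n i)) (rvec (X n j)) - 2 * N $ i $ j) / of_nat p ^ n \<in> pint p"
      by (simp add: pint_Ints[OF p])
  qed
  have "bilin M (XX n x) (XX n y) - bilin N x y =
     (\<Sum>i\<in>UNIV. \<Sum>j\<in>UNIV. (2 * bilin M (rvec (X n i)) (rvec (X n j)) - 2 * N $ i $ j) * (x $ i * y $ j / 2))" for n
    by (simp add: XX_def bilin_def[of N] sum_3 bilin_linear algebra_simps)
  then show ?thesis
    by (simp only:) (intro nul_sum[OF p] nul_mult_bdd[OF p] entry bdd_const[OF p])
qed

text \<open>\<open>J\<close> records the basis vectors on which \<open>T\<close> already approaches
  \<open>XX\<close>. Integrality at S is demanded for every index, the p-adic conditions only along
  \<open>F\<close>, which is restricted as the construction proceeds.\<close>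

definition state :: "nat filter \<Rightarrow> (nat \<Rightarrow> rat ^ 3 \<Rightarrow> rat ^ 3) \<Rightarrow> 3 set \<Rightarrow> bool" where
  "state F T J \<longleftrightarrow> F \<noteq> bot \<and> F \<le> sequentially \<and> (\<forall>n. space_isometry N M (T n)) \<and>
     (\<forall>n. \<forall>q\<in>S. locally_integral q (T n)) \<and> (\<forall>v. bddv p F (\<lambda>n. T n v)) \<and>
     (\<forall>j\<in>J. nulv p F (\<lambda>n. T n (e j) - XX n (e j)))"

lemma state_mono: "state F T J \<Longrightarrow> F' \<le> F \<Longrightarrow> F' \<noteq> bot \<Longrightarrow> state F' T J"
  unfolding state_def bddv_def[OF p] nulv_def[OF p] by (meson bdd_mono nul_mono order_trans)

lemma reflection_vector_exists:
  "\<exists>a. (\<forall>i. (a $ i - z $ i) / of_nat p ^ K \<in> pint p) \<and> (\<forall>q\<in>S. \<forall>i. (a $ i - v0 $ i) / of_nat q \<in> pint q)"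
proof -
  have "\<exists>a. (a - z $ i) / of_nat p ^ K \<in> pint p \<and> (\<forall>q\<in>S. (a - v0 $ i) / of_nat q \<in> pint q)" for i
  proof -
    have "v0 $ i \<in> \<int>" using v0 by (simp add: std_lattice_def)
    then show ?thesis using rat_weak_approximation[OF p S, of "v0 $ i" "z $ i" K] by metis
  qed
  then obtain f where "\<And>i. (f i - z $ i) / of_nat p ^ K \<in> pint p \<and> (\<forall>q\<in>S. (f i - v0 $ i) / of_nat q \<in> pint q)"
    by metis
  then show ?thesis by (intro exI[of _ "\<chi> i. f i"]) auto
qed

text \<open>
  A reflection in a vector close to \<open>T e\<^sub>i - \<epsilon> X e\<^sub>i\<close> moves \<open>T e\<^sub>i\<close> close to \<open>\<epsilon> X e\<^sub>i\<close>, and almost fixes the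
  \<open>T e\<^sub>j\<close> already adjusted, because these are almost orthogonal to that vector.
\<close>

lemma reflection_step:
  assumes st: "state F T J" and i: "i \<notin> J" and eps: "\<epsilon> ^ 2 = 1"
    and good: "away p F (\<lambda>n. quad M (T n (e i) - \<epsilon> *s XX n (e i)))"
  obtains T' where "state F T' J" "nulv p F (\<lambda>n. T' n (e i) - \<epsilon> *s XX n (e i))"
proof -
  have F: "F \<le> sequentially" and T: "\<And>n. space_isometry N M (T n)"
    and Tint: "\<And>n q. q \<in> S \<Longrightarrow> locally_integral q (T n)" and Tbdd: "\<And>v. bddv p F (\<lambda>n. T n v)"
    and TJ: "\<And>j. j \<in> J \<Longrightarrow> nulv p F (\<lambda>n. T n (e j) - XX n (e j))"
    using st by (auto simp: state_def)
  define x where "x n = T n (e i)" for n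
  define y where "y n = \<epsilon> *s XX n (e i)" for n
  define b where "b n = x n - y n" for n
  have "\<forall>n. \<exists>a. (\<forall>i. (a $ i - b n $ i) / of_nat p ^ n \<in> pint p) \<and>
      (\<forall>q\<in>S. \<forall>i. (a $ i - v0 $ i) / of_nat q \<in> pint q)"
    using reflection_vector_exists by blast
  then obtain a where a: "\<And>n i. (a n $ i - b n $ i) / of_nat p ^ n \<in> pint p"
      "\<And>n q i. q \<in> S \<Longrightarrow> (a n $ i - v0 $ i) / of_nat q \<in> pint q" by metis
  define \<delta> where "\<delta> n = a n - b n" for n
  note comm = bilin_commute[OF ternary_sym[OF M]]
  have delta: "nulv p F \<delta>"
    unfolding nulv_def[OF p] \<delta>_def by (intro allI nul_sequentially[OF p F]) (simp add: a)
  have xb: "bddv p F x" unfolding x_def by (rule Tbdd)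
  have yb: "bddv p F y" unfolding y_def by (intro bddv_scale[OF p] bdd_const[OF p] XX_bddv)
  have bb: "bddv p F b" unfolding b_def by (intro bddv_diff[OF p] xb yb)
  have a_eq: "a n = b n + \<delta> n" for n by (simp add: \<delta>_def)
  have ab: "bddv p F a" unfolding a_eq[abs_def] by (intro bddv_add[OF p] bb nulv_imp_bddv[OF p] delta)
  \<comment> \<open>Both norms are close to \<open>quad N (e i)\<close>; for \<open>y\<close> this
    uses that \<epsilon>^2 = 1.\<close>
  have Qxy: "nul p F (\<lambda>n. quad M (x n) - quad M (y n))"
  proof -
    have "quad M (x n) - quad M (y n) = - 1 * (bilin M (XX n (e i)) (XX n (e i)) - bilin N (e i) (e i))" for n
      using eps space_isometry_bilin[OF T, of n "e i" "e i"]
      by (simp add: x_def y_def quad_def bilin_linear power2_eq_square mult.assoc[symmetric])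
    then show ?thesis by (simp only:) (intro nul_bdd_mult[OF p] bdd_const[OF p] XX_almost_isometry[OF F])
  qed
  have Qa: "nul p F (\<lambda>n. quad M (a n) - quad M (b n))"
  proof -
    have "quad M (a n) - quad M (b n) = 2 * bilin M (b n) (\<delta> n) + bilin M (\<delta> n) (\<delta> n)" for n
      by (simp add: a_eq quad_def bilin_linear comm[of "\<delta> n" "b n"])
    then show ?thesis
      by (simp only:) (intro nul_add[OF p] nul_bdd_mult[OF p] bdd_const[OF p] bilin_nul_right[OF p] bb delta
          nulv_imp_bddv[OF p])
  qed
  have "away p F (\<lambda>n. quad M (b n))" using good by (simp add: b_def x_def y_def)
  then have away_a: "away p F (\<lambda>n. quad M (a n))" using Qa by (rule away_cong[OF p])
  note inva = away_inverse_bdd[OF p away_a]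
  \<comment> \<open>If \<open>a n\<close> were exactly x - y and the norms of x and y agreed, then 2
    B(x, a) = Q(a) and the reflection would send x to x - a = y. The sequence \<eta> measures the
    deviation.\<close>
  define \<eta> where "\<eta> n = 2 * bilin M (x n) (a n) - quad M (a n)" for n
  have eta: "nul p F \<eta>"
  proof -
    have "\<eta> = (\<lambda>n. (quad M (x n) - quad M (y n)) + 2 * bilin M (x n) (\<delta> n) - (quad M (a n) - quad M (b n)))"
      by (simp add: fun_eq_iff \<eta>_def a_eq b_def quad_def bilin_linear comm[of "y _" "x _"])
    then show ?thesis
      by (simp only:) (intro nul_add[OF p] nul_diff[OF p] Qxy Qa nul_bdd_mult[OF p] bdd_const[OF p]
          bilin_nul_right[OF p] xb delta)
  qed
  define T' where "T' n v = reflect M (a n) (T n v)" for n v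
  have diff: "T' n v - T n v = (2 * bilin M (T n v) (a n) * (1 / quad M (a n))) *s (- 1 *s a n)" for n v
    by (simp add: T'_def reflect_def vec_eq_iff)
  have na: "bddv p F (\<lambda>n. - 1 *s a n)" by (intro bddv_scale[OF p] bdd_const[OF p] ab)
  have T'bdd: "bddv p F (\<lambda>n. T' n v)" for v
  proof -
    have "T' n v = T n v + (2 * bilin M (T n v) (a n) * (1 / quad M (a n))) *s (- 1 *s a n)" for n
      using diff[of n v] by (simp add: algebra_simps)
    then show ?thesis
      by (simp only:) (intro bddv_add[OF p] bddv_scale[OF p] bdd_mult[OF p] bdd_const[OF p] bilin_bdd[OF p] inva ab na Tbdd)
  qed
  have keep: "nulv p F (\<lambda>n. T' n (e j) - XX n (e j))" if j: "j \<in> J" for j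
  proof -
    have ij: "j \<noteq> i" using i j by blast
    have orth: "nul p F (\<lambda>n. bilin M (T n (e j)) (a n))"
    proof -
      have "bilin M (T n (e j)) (a n) = bilin M (T n (e j)) (\<delta> n)
          - \<epsilon> * (bilin M (T n (e j) - XX n (e j)) (XX n (e i)) + (bilin M (XX n (e j)) (XX n (e i)) - bilin N (e j) (e i)))" for n
        using space_isometry_bilin[OF T, of n "e j" "e i"] e(2)[OF ij]
        by (simp add: a_eq b_def x_def y_def bilin_linear algebra_simps)
      then show ?thesis
        by (simp only:) (intro nul_diff[OF p] nul_add[OF p] nul_bdd_mult[OF p] bdd_const[OF p] bilin_nul_right[OF p]
            bilin_nul_left[OF p] XX_almost_isometry[OF F] XX_bddv Tbdd TJ j delta)
    qed
    have "T' n (e j) - XX n (e j) = (T n (e j) - XX n (e j)) +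
        (bilin M (T n (e j)) (a n) * (2 * (1 / quad M (a n)))) *s (- 1 *s a n)" for n
      using diff[of n "e j"] by (simp add: vec_eq_iff algebra_simps)
    then show ?thesis
      by (simp only:) (intro nulv_add[OF p] nulv_scale_nul[OF p] nul_mult_bdd[OF p] bdd_mult[OF p] orth bdd_const[OF p] inva na TJ j)
  qed
  have "\<forall>\<^sub>F n in F. quad M (a n) \<noteq> 0" by (rule away_nonzero[OF p away_a])
  then have "\<forall>\<^sub>F n in F. T' n (e i) - y n = - 1 *s \<delta> n + (\<eta> n * (1 / quad M (a n))) *s (- 1 *s a n)"
  proof eventually_elim
    case (elim n)
    have "2 * bilin M (x n) (a n) / quad M (a n) = 1 + \<eta> n / quad M (a n)"
      using elim by (simp add: \<eta>_def field_simps)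
    then have "T' n (e i) = x n - (1 + \<eta> n / quad M (a n)) *s a n"
      by (simp add: T'_def reflect_def x_def)
    then show ?case by (simp add: vec_eq_iff a_eq b_def algebra_simps)
  qed
  moreover have "nulv p F (\<lambda>n. - 1 *s \<delta> n + (\<eta> n * (1 / quad M (a n))) *s (- 1 *s a n))"
    by (intro nulv_add[OF p] nulv_scale_bdd[OF p] nulv_scale_nul[OF p] nul_mult_bdd[OF p] eta inva na delta bdd_const[OF p])
  ultimately have new: "nulv p F (\<lambda>n. T' n (e i) - y n)"
    by (rule nulv_eventually[OF p])
  have "state F T' J"
    unfolding state_def
  proof (intro conjI allI ballI)
    show "space_isometry N M (T' n)" for n
      unfolding T'_def[abs_def] by (rule space_isometry_comp[OF T reflect_space_isometry[OF ternary_sym[OF M]]])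
    show "locally_integral q (T' n)" if q: "q \<in> S" for n q
      using Tint[OF q, of n] reflect_locally_integral[OF M _ v0 a(2)[OF q], of n] S(2) q
      unfolding locally_integral_def T'_def by blast
  qed (use st F T'bdd keep in \<open>auto simp: state_def\<close>)
  then show ?thesis using that new by (simp add: y_def)
qed

text \<open>With x = T e_i and y = XX e_i, the sum Q(x - y) + Q(x + y) tends to 4 Q(e_i), which is
  not 0, so along a suitable restriction one of the summands stays away from 0. In the first case x
  is reflected to y. In the second it is reflected to a vector close to -y, and a further reflection
  in a vector close to -2y, of norm close to 4 Q(e_i), leads to y.\<close>

lemma state_extend:
  assumes st: "state F T J" and i: "i \<notin> J"
  obtains F' T' where "state F' T' (insert i J)"
proof -
  have F: "F \<le> sequentially" "F \<noteq> bot" and T: "\<And>n. space_isometry N M (T n)" using st by (auto simp: state_def)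
  have Qe: "4 * quad N (e i) \<noteq> 0" using e(1) ternary_quad_eq_0[OF N] by simp
  let ?x = "\<lambda>n. T n (e i)" and ?y = "\<lambda>n. XX n (e i)"
  have "quad M (?x n - 1 *s ?y n) + quad M (?x n - (- 1) *s ?y n) - 4 * quad N (e i) =
     2 * (bilin M (?y n) (?y n) - bilin N (e i) (e i))" for n
    using space_isometry_bilin[OF T, of n "e i" "e i"]
    by (simp add: quad_def bilin_linear algebra_simps)
  then have "nul p F (\<lambda>n. quad M (?x n - 1 *s ?y n) + quad M (?x n - (- 1) *s ?y n) - 4 * quad N (e i))"
    by (simp only:) (intro nul_bdd_mult[OF p] bdd_const[OF p] XX_almost_isometry F)
  then obtain A where A: "away p (inf F (principal A)) (\<lambda>n. quad M (?x n - 1 *s ?y n))"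
      "away p (inf F (principal (- A))) (\<lambda>n. quad M (?x n - (- 1) *s ?y n))"
    by (rule away_dichotomy[OF p Qe])
  have "inf F (principal A) \<noteq> bot \<or> inf F (principal (- A)) \<noteq> bot"
  proof (rule ccontr)
    assume "\<not> ?thesis"
    then have "eventually (\<lambda>n. n \<in> A \<longrightarrow> False) F" "eventually (\<lambda>n. n \<in> - A \<longrightarrow> False) F"
      unfolding eventually_inf_principal[symmetric] by (simp_all add: trivial_limit_def)
    then have "eventually (\<lambda>n. False) F" by eventually_elim auto
    then show False using F by (simp add: trivial_limit_def)
  qed
  then show ?thesis
  proof
    assume nb: "inf F (principal A) \<noteq> bot"
    have "state (inf F (principal A)) T J" by (rule state_mono[OF st _ nb]) simp
    from reflection_step[OF this i _ A(1)] obtain T' where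
      "state (inf F (principal A)) T' J" "nulv p (inf F (principal A)) (\<lambda>n. T' n (e i) - 1 *s ?y n)" by auto
    then have "state (inf F (principal A)) T' (insert i J)" by (simp add: state_def)
    then show ?thesis by (rule that)
  next
    let ?F = "inf F (principal (- A))"
    assume nb: "?F \<noteq> bot"
    have Fs: "?F \<le> sequentially" using F(1) by (simp add: le_infI1)
    have "state ?F T J" by (rule state_mono[OF st _ nb]) simp
    from reflection_step[OF this i _ A(2)] obtain T' where
      T': "state ?F T' J" "nulv p ?F (\<lambda>n. T' n (e i) - (- 1) *s ?y n)" by auto
    have T'b: "bddv p ?F (\<lambda>n. T' n (e i))" using T'(1) by (simp add: state_def)
    define d where "d n = T' n (e i) - (- 1) *s ?y n" for n
    have d: "nulv p ?F d" using T'(2) by (simp add: d_def[abs_def])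
    have "quad M (T' n (e i) - 1 *s ?y n) - 4 * quad N (e i) =
       4 * (bilin M (?y n) (?y n) - bilin N (e i) (e i)) - 2 * bilin M d' (?y n) - 2 * bilin M (?y n) d' + bilin M d' d'"
      if "d' = d n" for n d'
    proof -
      have t: "T' n (e i) = d' - ?y n" by (simp add: that d_def)
      show ?thesis unfolding t quad_def bilin_linear by (simp add: algebra_simps)
    qed
    then have "quad M (T' n (e i) - 1 *s ?y n) - 4 * quad N (e i) =
       4 * (bilin M (?y n) (?y n) - bilin N (e i) (e i)) - 2 * bilin M (d n) (?y n) - 2 * bilin M (?y n) (d n) + bilin M (d n) (d n)" for n
      by blast
    then have "nul p ?F (\<lambda>n. quad M (T' n (e i) - 1 *s ?y n) - 4 * quad N (e i))"
      by (simp only:) (intro nul_add[OF p] nul_diff[OF p] nul_bdd_mult[OF p] bdd_const[OF p] XX_almost_isometry Fs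
          bilin_nul_left[OF p] bilin_nul_right[OF p] d XX_bddv nulv_imp_bddv[OF p])
    from away_cong[OF p away_const[OF p Qe] this] have aw: "away p ?F (\<lambda>n. quad M (T' n (e i) - 1 *s ?y n))" .
    from reflection_step[OF T'(1) i _ aw] obtain T'' where
      "state ?F T'' J" "nulv p ?F (\<lambda>n. T'' n (e i) - 1 *s ?y n)" by auto
    then have "state ?F T'' (insert i J)" by (simp add: state_def)
    then show ?thesis by (rule that)
  qed
qed

text \<open>Once all three orthogonal vectors are matched, \<open>T n\<close> differs from the
  integral matrix with columns \<open>X n j\<close> by a p-adically small one. As \<open>F\<close>
  is not trivial, some index n gives an isometry integral at p.\<close>

lemma approximation_step:
  assumes T: "space_isometry N M \<tau>" and int: "\<And>q. q \<in> S \<Longrightarrow> locally_integral q \<tau>"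
  shows "\<exists>\<sigma>. space_isometry N M \<sigma> \<and> (\<forall>q\<in>insert p S. locally_integral q \<sigma>)"
proof -
  have "state sequentially (\<lambda>n. \<tau>) {}"
    using T int by (auto simp: state_def bddv_def[OF p] bdd_const[OF p])
  then obtain F1 T1 where "state F1 T1 {1}" using state_extend[of sequentially "\<lambda>n. \<tau>" "{}" 1] by auto
  then obtain F2 T2 where "state F2 T2 {2, 1}" using state_extend[of F1 T1 "{1}" 2] by auto
  then obtain F T where st: "state F T {3, 2, 1}" using state_extend[of F2 T2 "{2, 1}" 3] by auto
  have iso: "\<And>n. space_isometry N M (T n)" and F: "F \<noteq> bot" using st by (auto simp: state_def)
  have close: "nulv p F (\<lambda>n. T n (e j) - XX n (e j))" for j
    using st exhaust_3[of j] by (auto simp: state_def)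
  have XXsum: "XX n (\<Sum>i\<in>UNIV. f i *s e i) = (\<Sum>i\<in>UNIV. f i *s XX n (e i))" for n and f :: "3 \<Rightarrow> rat"
    by (simp add: XX_def sum_3 vec_eq_iff algebra_simps)
  have "nulv p F (\<lambda>n. T n (axis j 1) - rvec (X n j))" for j
  proof -
    have "T n (axis j 1) - rvec (X n j) = (\<Sum>i\<in>UNIV. c j i *s (T n (e i) - XX n (e i)))" for n
      unfolding XX_axis[symmetric] e(3)[of j] space_isometry_sum[OF iso] XXsum
      by (simp add: sum_subtractf[symmetric] vector_ssub_ldistrib)
    then have "(T n (axis j 1) - rvec (X n j)) $ k = (\<Sum>i\<in>UNIV. c j i * (T n (e i) - XX n (e i)) $ k)" for n k
      by simp
    then show ?thesis unfolding nulv_def[OF p]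
      by (simp only:) (intro allI nul_sum[OF p] nul_bdd_mult[OF p] bdd_const[OF p] close[unfolded nulv_def[OF p], rule_format])
  qed
  \<comment> \<open>Exponent 0 suffices: the columns only have to agree up to a vector integral at
    p.\<close>
  then have "\<forall>\<^sub>F n in F. \<forall>j k. (T n (axis j 1) - rvec (X n j)) $ k / of_nat p ^ 0 \<in> pint p"
    unfolding nulv_def[OF p] nul_def by (intro eventually_all_finite) blast
  then obtain n where n: "\<And>j k. (T n (axis j 1) - rvec (X n j)) $ k \<in> pint p"
    using eventually_happens'[OF F] by fastforce
  have col: "pvec p (T n (axis j 1))" for j
  proof -
    have "T n (axis j 1) = (T n (axis j 1) - rvec (X n j)) + rvec (X n j)" by simp
    moreover have "pvec p (T n (axis j 1) - rvec (X n j))" using n by (simp add: pvec_def)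
    ultimately show ?thesis using pvec_add[OF p _ pvec_std[OF p rvec_std]] by metis
  qed
  have "locally_integral p (T n)"
    unfolding locally_integral_def
  proof (intro allI impI)
    fix x assume "pvec p x"
    then show "pvec p (T n x)"
      by (subst space_isometry_expand[OF iso]) (intro pvec_add[OF p] pvec_scale[OF p] col, auto simp: pvec_def)
  qed
  then show ?thesis using st iso by (auto simp: state_def)
qed

end

text \<open>Induction on S, starting from the rational isometry contained in the definition of the
  genus. The second part of \<open>padic_isometric_approx\<close> is used because the maps go from N
  to M.\<close>

theorem weak_approximation:
  assumes M: "ternary_lattice M" and v0: "v0 \<in> std_lattice" "quad M v0 = 1" and N: "N \<in> genus M"
    and S: "finite S" "\<forall>q\<in>S. prime q"
  shows "\<exists>\<sigma>. space_isometry N M \<sigma> \<and> (\<forall>q\<in>S. locally_integral q \<sigma>)"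
  using S
proof (induction S rule: finite_induct)
  case empty
  obtain \<sigma> where "space_isometry M N \<sigma>" using N by (auto simp: genus_def)
  then show ?case using space_isometry_inv by blast
next
  case (insert p S)
  note tN = genus_ternary[OF N]
  obtain \<tau> where t: "space_isometry N M \<tau>" "\<forall>q\<in>S. locally_integral q \<tau>" using insert by auto
  have p: "prime p" using insert by simp
  have "padic_isometric p M N" using N p by (simp add: genus_def)
  then have "\<forall>n. \<exists>Y. \<forall>i j. int p ^ n dvd bform (gint M) (Y i) (Y j) - gint N $ i $ j"
    using padic_isometric_approx(2)[OF p] by blast
  then obtain X where X: "\<And>n i j. int p ^ n dvd bform (gint M) (X n i) (X n j) - gint N $ i $ j" by metis
  obtain e :: "3 \<Rightarrow> rat ^ 3" and c where e: "\<And>i. e i \<noteq> 0" "\<And>i j. i \<noteq> j \<Longrightarrow> bilin N (e i) (e j) = 0"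
    "\<And>j. axis j 1 = (\<Sum>i\<in>UNIV. c j i *s e i)"
    using orthogonal_basis_exists[OF tN] by blast
  have S: "finite S" "\<forall>q\<in>S. prime q" "p \<notin> S" using insert by auto
  interpret approximation p S M N v0 X e c
    by unfold_locales (fact p S M tN v0 X e)+
  show ?case using approximation_step[OF t(1)] t(2) by blast
qed

lemma common_denominator:
  assumes "space_isometry N M \<sigma>" "\<forall>q\<in>S. prime q" "\<forall>q\<in>S. locally_integral q \<sigma>"
  obtains d :: int where "d > 0" "\<And>q. q \<in> S \<Longrightarrow> \<not> int q dvd d"
    "\<And>x. x \<in> std_lattice \<Longrightarrow> of_int d *s \<sigma> x \<in> std_lattice"
proof -
  define f where "f i j = snd (quotient_of (\<sigma> (axis j 1) $ i))" for i j
  define d where "d = (\<Prod>i\<in>UNIV. \<Prod>j\<in>UNIV. f i j)"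
  have f: "f i j > 0" "of_int (f i j) * \<sigma> (axis j 1) $ i \<in> \<int>" for i j
  proof -
    obtain a b where ab: "quotient_of (\<sigma> (axis j 1) $ i) = (a, b)" by (cases "quotient_of (\<sigma> (axis j 1) $ i)")
    then show "f i j > 0" "of_int (f i j) * \<sigma> (axis j 1) $ i \<in> \<int>"
      using quotient_of_div[OF ab] quotient_of_denom_pos[OF ab] by (auto simp: f_def)
  qed
  have d0: "d > 0" unfolding d_def by (intro prod_pos) (auto simp: f)
  have "\<not> int q dvd d" if q: "q \<in> S" for q
  proof
    have pq: "prime q" using q assms(2) by blast
    assume "int q dvd d"
    then obtain i j where "int q dvd f i j" unfolding d_def using pq by (auto simp: prime_dvd_prod_iff)
    moreover have "pvec q (\<sigma> (axis j 1))"
      using assms(3) q pvec_std[OF pq std_lattice_axis] by (auto simp: locally_integral_def)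
    ultimately show False by (simp add: pvec_def f_def pint_iff_denominator[OF pq])
  qed
  moreover have "of_int d *s \<sigma> x \<in> std_lattice" if x: "x \<in> std_lattice" for x
  proof -
    have col: "of_int d *s \<sigma> (axis j 1) \<in> std_lattice" for j
    proof -
      have "of_int d * \<sigma> (axis j 1) $ i \<in> \<int>" for i
      proof -
        have "f i j dvd d" unfolding d_def
          by (rule dvd_trans[OF dvd_prodI[of UNIV j "f i"] dvd_prodI[of UNIV i "\<lambda>i. \<Prod>j\<in>UNIV. f i j"]]) auto
        then obtain k where "d = k * f i j" by (metis dvdE mult.commute)
        then have "of_int d * \<sigma> (axis j 1) $ i = of_int k * (of_int (f i j) * \<sigma> (axis j 1) $ i)" by simp
        also have "\<dots> \<in> \<int>" by (rule Ints_mult[OF Ints_of_int f(2)])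
        finally show ?thesis .
      qed
      then show ?thesis by (simp add: std_lattice_def)
    qed
    have xi: "x $ i \<in> \<int>" for i using x by (simp add: std_lattice_def)
    have "x $ 1 *s (of_int d *s \<sigma> (axis 1 1)) + x $ 2 *s (of_int d *s \<sigma> (axis 2 1)) + x $ 3 *s (of_int d *s \<sigma> (axis 3 1)) \<in> std_lattice"
      by (rule std_lattice_add[OF std_lattice_add[OF std_lattice_scale[OF xi col] std_lattice_scale[OF xi col]]
            std_lattice_scale[OF xi col]])
    moreover have "of_int d *s \<sigma> x = x $ 1 *s (of_int d *s \<sigma> (axis 1 1)) + x $ 2 *s (of_int d *s \<sigma> (axis 2 1)) + x $ 3 *s (of_int d *s \<sigma> (axis 3 1))"
      unfolding space_isometry_expand[OF assms(1), of x] by (simp add: vec_eq_iff algebra_simps)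
    ultimately show ?thesis by (simp only:)
  qed
  ultimately show ?thesis using that d0 by blast
qed

section \<open>Kneser neighbours at a prime outside S\<close>

subsection \<open>Neighbours\<close>

text \<open>For admissible w this is Kneser's neighbour Z w/p + {z : p divides \<beta> z w}, with
  \<beta> the form of \<open>gint N\<close>; see \<open>nbr_pairing\<close> and \<open>nbrI\<close>.
  The description by congruences for u = p x shows directly that vectors of the neighbour pair
  integrally.\<close>

definition nbr :: "nat \<Rightarrow> rat ^ 3 ^ 3 \<Rightarrow> int ^ 3 \<Rightarrow> (rat ^ 3) set" where
  "nbr p N w = {x. \<exists>u. of_nat p *s x = rvec u \<and> int p ^ 2 dvd bform (gint N) u u \<and> int p ^ 2 dvd bform (gint N) u w}"

lemma vdvd_obtain: "vdvd m w \<Longrightarrow> \<exists>f. w = m *s f"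
  by (intro exI[of _ "\<chi> i. w $ i div m"]) (simp add: vec_eq_iff vdvd_def)

definition admissible :: "nat \<Rightarrow> rat ^ 3 ^ 3 \<Rightarrow> int ^ 3 \<Rightarrow> bool" where
  "admissible p N w \<longleftrightarrow> \<not> vdvd (int p) w \<and> int p ^ 2 dvd bform (gint N) w w"

definition nbrs :: "nat \<Rightarrow> rat ^ 3 ^ 3 \<Rightarrow> (rat ^ 3) set set" where
  "nbrs p N = nbr p N ` {w. admissible p N w}"

text \<open>The congruence determines the i-th coordinate modulo p from the others, with
  \<open>k\<close> the inverse of \<open>l $ i\<close>. Accordingly \<open>C\<close> multiplies the
  i-th basis vector by p and corrects the other two by multiples of it.\<close>

lemma congruence_sublattice:
  fixes l :: "int ^ 3"
  assumes p: "prime p" and l: "\<not> int p dvd l $ i"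
  obtains C where "int_mat C" "det C = of_nat p"
    "\<And>z. rvec z \<in> (*v) C ` std_lattice \<longleftrightarrow> int p dvd (\<Sum>j\<in>UNIV. l $ j * z $ j)"
proof -
  have pp: "prime (int p)" using p by simp
  obtain k where "[l $ i * k = 1] (mod int p)" using inverse_mod_prime[OF pp l] .
  then obtain t where t: "l $ i * k = 1 + int p * t" by (metis cong_iff_lin cong_sym)
  define C :: "rat ^ 3 ^ 3" where
    "C = (\<chi> r s. if r = i then (if s = i then of_nat p else - of_int (k * l $ s)) else if r = s then 1 else 0)"
  have Cr: "(C *v x) $ r = x $ r" if "r \<noteq> i" for x r
    using that by (simp add: C_def matrix_vector_mult_def if_distrib[of "\<lambda>x. x * _"] cong: if_cong)
  have Ci: "(C *v x) $ i = of_nat p * x $ i - (\<Sum>s\<in>UNIV - {i}. of_int (k * l $ s) * x $ s)" for x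
  proof -
    have "(C *v x) $ i = (\<Sum>s\<in>UNIV. C $ i $ s * x $ s)" by (simp add: matrix_vector_mult_def)
    also have "\<dots> = C $ i $ i * x $ i + (\<Sum>s\<in>UNIV - {i}. C $ i $ s * x $ s)"
      by (rule sum.remove) auto
    also have "(\<Sum>s\<in>UNIV - {i}. C $ i $ s * x $ s) = - (\<Sum>s\<in>UNIV - {i}. of_int (k * l $ s) * x $ s)"
      unfolding sum_negf[symmetric] by (intro sum.cong) (auto simp: C_def)
    finally show ?thesis by (simp add: C_def)
  qed
  have "int_mat C" by (auto simp: int_mat_def C_def)
  moreover have "det C = of_nat p"
    using exhaust_3[of i] by (auto simp: det_3 C_def)
  moreover have "rvec z \<in> (*v) C ` std_lattice \<longleftrightarrow> int p dvd (\<Sum>j\<in>UNIV. l $ j * z $ j)" for z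
  proof -
    define R where "R = (\<Sum>s\<in>UNIV - {i}. l $ s * z $ s)"
    have split: "(\<Sum>j\<in>UNIV. l $ j * z $ j) = l $ i * z $ i + R"
      unfolding R_def by (rule sum.remove) auto
    have iff: "int p dvd l $ i * z $ i + R \<longleftrightarrow> int p dvd z $ i + k * R"
    proof -
      have kp: "\<not> int p dvd k"
      proof
        assume "int p dvd k"
        then have "int p dvd 1 + int p * t" unfolding t[symmetric] by simp
        then have "int p dvd 1" by (simp add: dvd_add_left_iff)
        then show False using pp by (simp add: prime_int_iff)
      qed
      have "int p dvd l $ i * z $ i + R \<longleftrightarrow> int p dvd k * (l $ i * z $ i + R)"
        using kp pp by (simp add: prime_dvd_mult_iff)
      also have "k * (l $ i * z $ i + R) = (l $ i * k) * z $ i + k * R" by (simp add: algebra_simps)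
      also have "\<dots> = (z $ i + k * R) + int p * (t * z $ i)" unfolding t by (simp add: algebra_simps)
      finally show ?thesis by (simp add: dvd_add_left_iff)
    qed
    have R: "(\<Sum>s\<in>UNIV - {i}. of_int (k * l $ s) * of_int (z $ s)) = (of_int (k * R) :: rat)"
      by (simp add: R_def sum_distrib_left mult.assoc)
    show ?thesis
    proof
      assume "rvec z \<in> (*v) C ` std_lattice"
      then obtain x where x: "x \<in> std_lattice" "rvec z = C *v x" by blast
      obtain a where a: "x = rvec a" using std_lattice_rvec[OF x(1)] by blast
      have r: "x $ s = of_int (z $ s)" if "s \<noteq> i" for s using Cr[OF that, of x] x(2) by (metis rvec_nth)
      have "(of_int (z $ i) :: rat) = of_nat p * x $ i - (\<Sum>s\<in>UNIV - {i}. of_int (k * l $ s) * of_int (z $ s))"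
        using Ci[of x] x(2) r by (metis (no_types, lifting) DiffE insertCI rvec_nth sum.cong)
      then have "(of_int (z $ i) :: rat) = of_int (int p * a $ i - k * R)" unfolding R a by simp
      then have "z $ i + k * R = int p * a $ i" by (simp only: of_int_eq_iff)
      then show "int p dvd (\<Sum>j\<in>UNIV. l $ j * z $ j)" unfolding split iff by simp
    next
      assume "int p dvd (\<Sum>j\<in>UNIV. l $ j * z $ j)"
      then obtain b where b: "z $ i + k * R = int p * b" unfolding split iff by (rule dvdE)
      define x where "x = rvec (\<chi> s. if s = i then b else z $ s)"
      have "(C *v x) $ r = rvec z $ r" for r
      proof (cases "r = i")
        case True
        have "(C *v x) $ i = of_nat p * of_int b - (\<Sum>s\<in>UNIV - {i}. of_int (k * l $ s) * of_int (z $ s))"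
          unfolding Ci by (simp add: x_def)
        also have "\<dots> = of_int (int p * b - k * R)" unfolding R by simp
        also have "int p * b - k * R = z $ i" using b by simp
        finally show ?thesis using True by simp
      qed (simp add: Cr x_def)
      then have "rvec z = C *v x" by (simp add: vec_eq_iff)
      then show "rvec z \<in> (*v) C ` std_lattice" by (auto simp: x_def)
    qed
  qed
  ultimately show ?thesis using that by blast
qed

text \<open>The m-th basis vector is replaced by k w / p, where k inverts \<open>w $ m\<close>
  modulo p. Its m-th coordinate 1/p + t is shifted by the integer t to 1/p, which makes the
  determinant visible.\<close>

lemma adjoin_fraction:
  fixes w :: "int ^ 3"
  assumes p: "prime p" and w: "\<not> int p dvd w $ m"
  obtains D where "det D = 1 / of_nat p"
    "(*v) D ` std_lattice = {x. \<exists>c z. of_nat p *s x = rvec (c *s w + int p *s z)}"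
proof -
  have pp: "prime (int p)" and p0: "p > 0" using p prime_gt_0_nat by auto
  obtain k where "[w $ m * k = 1] (mod int p)" using inverse_mod_prime[OF pp w] .
  then obtain t where t: "w $ m * k = 1 + int p * t" by (metis cong_iff_lin cong_sym)
  define D :: "rat ^ 3 ^ 3" where
    "D = (\<chi> r s. if s = m then (if r = m then 1 / of_nat p else of_int (k * w $ r) / of_nat p) else if r = s then 1 else 0)"
  have Dr: "(D *v x) $ r = (if r = m then x $ m / of_nat p else of_int (k * w $ r) / of_nat p * x $ m + x $ r)" for x r
  proof -
    have "(D *v x) $ r = D $ r $ m * x $ m + (\<Sum>s\<in>UNIV - {m}. D $ r $ s * x $ s)"
      unfolding matrix_vector_mult_def by (simp add: sum.remove[of UNIV m])
    also have "(\<Sum>s\<in>UNIV - {m}. D $ r $ s * x $ s) = (\<Sum>s\<in>UNIV - {m}. if s = r then x $ r else 0)"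
      by (intro sum.cong) (auto simp: D_def)
    also have "\<dots> = (if r = m then 0 else x $ r)" by simp
    finally show ?thesis by (simp add: D_def)
  qed
  have "det D = 1 / of_nat p"
    using exhaust_3[of m] by (auto simp: det_3 D_def)
  moreover have "(*v) D ` std_lattice = {x. \<exists>c z. of_nat p *s x = rvec (c *s w + int p *s z)}" (is "_ = ?R")
  proof
    show "(*v) D ` std_lattice \<subseteq> ?R"
    proof
      fix y assume "y \<in> (*v) D ` std_lattice"
      then obtain x where x: "x \<in> std_lattice" "y = D *v x" by blast
      obtain a where a: "x = rvec a" using std_lattice_rvec[OF x(1)] by blast
      have "of_nat p *s y = rvec ((k * a $ m) *s w + int p *s (\<chi> r. if r = m then - t * a $ m else a $ r))"
      proof -
        have "(of_nat p *s y) $ r = rvec ((k * a $ m) *s w + int p *s (\<chi> r. if r = m then - t * a $ m else a $ r)) $ r" for r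
        proof (cases "r = m")
          case True
          have "k * a $ m * w $ m + int p * (- t * a $ m) = (w $ m * k) * a $ m - int p * t * a $ m" by (simp add: algebra_simps)
          also have "\<dots> = a $ m" unfolding t by (simp add: algebra_simps)
          finally show ?thesis using True p0 by (simp add: x(2) Dr a del: of_int_add of_int_mult of_int_diff of_int_minus)
        next
          case False
          then show ?thesis using p0 by (simp add: x(2) Dr a field_simps)
        qed
        then show ?thesis by (simp add: vec_eq_iff)
      qed
      then show "y \<in> ?R" by blast
    qed
    show "?R \<subseteq> (*v) D ` std_lattice"
    proof
      fix y assume "y \<in> ?R"
      then obtain c z where y: "of_nat p *s y = rvec (c *s w + int p *s z)" by blast
      have y': "of_nat p * y $ r = of_int (c * w $ r + int p * z $ r)" for r
        using arg_cong[OF y, of "\<lambda>v. v $ r"] by simp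
      define a :: "int ^ 3" where
        "a = (\<chi> r. if r = m then c * w $ m + int p * z $ m else z $ r + w $ r * (- c * t - k * z $ m))"
      have "(D *v rvec a) $ r = y $ r" for r
      proof (cases "r = m")
        case True
        then show ?thesis using y'[of m] p0 by (simp add: Dr a_def field_simps)
      next
        case False
        have "of_nat p * (D *v rvec a) $ r = of_int (k * w $ r * (c * w $ m + int p * z $ m) + int p * (z $ r + w $ r * (- c * t - k * z $ m)))"
        proof -
          have "of_nat p * (D *v rvec a) $ r = of_int (k * w $ r) * of_int (a $ m) + of_nat p * of_int (a $ r)"
            using False p0 by (simp add: Dr distrib_left)
          also have "\<dots> = of_int (k * w $ r * a $ m + int p * a $ r)" by simp
          finally show ?thesis using False by (simp only: a_def vec_lambda_beta simp_thms if_True if_False)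
        qed
        also have "k * w $ r * (c * w $ m + int p * z $ m) + int p * (z $ r + w $ r * (- c * t - k * z $ m))
            = c * w $ r * (w $ m * k - int p * t) + int p * z $ r" by (simp add: algebra_simps)
        also have "\<dots> = c * w $ r + int p * z $ r" unfolding t by simp
        finally have "of_nat p * (D *v rvec a) $ r = of_nat p * y $ r" unfolding y' .
        then show ?thesis using p0 by (simp only: mult_cancel_left of_nat_eq_0_iff) simp
      qed
      then have "y = D *v rvec a" by (simp add: vec_eq_iff)
      then show "y \<in> (*v) D ` std_lattice" using rvec_std by (rule image_eqI)
    qed
  qed
  ultimately show ?thesis using that by blast
qed

lemma bad_primes_genus:
  assumes "ternary_lattice M" "N \<in> genus M"
  shows "four_disc N = four_disc M" "bad_primes N = bad_primes M"
  using genus_det[OF assms] by (simp_all add: four_disc_def bad_primes_def)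

lemma good_prime_form_gint:
  assumes N: "ternary_lattice N" and p: "prime p" "p \<notin> bad_primes N"
  shows "good_prime_form (gint N) (int p)"
proof
  show "transpose (gint N) = gint N" by (rule gint_sym[OF N])
  show "prime (int p)" using p by simp
  have "p \<noteq> 2" "\<not> int p dvd four_disc N" using p by (auto simp: bad_primes_def)
  then show "odd (int p)" using p(1) by (metis even_of_nat primes_dvd_imp_eq two_is_prime_nat)
  then have "\<not> int p dvd 2" using odd_prime_not_dvd_2[of "int p"] p by simp
  then show "\<not> int p dvd det (gint N)"
    using p \<open>\<not> int p dvd four_disc N\<close> by (simp add: det_gint_four_disc[OF N] prime_dvd_mult_iff)
qed

locale good_prime =
  fixes M N :: "rat ^ 3 ^ 3" and p :: nat
  assumes M: "ternary_lattice M" and N: "N \<in> genus M" and prime_p: "prime p" and good: "p \<notin> bad_primes M"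
begin

lemma tN: "ternary_lattice N" by (rule genus_ternary[OF N])

sublocale good_prime_form "gint N" "int p"
  by (rule good_prime_form_gint[OF tN prime_p]) (simp add: bad_primes_genus[OF M N] good)

lemma p0: "p > 0" using prime_p prime_gt_0_nat by blast

text \<open>Modulo p both u and w are isotropic and they are orthogonal, hence u = c w + p z.
  Pairing with w modulo p^2 then forces p to divide \<beta> z w.\<close>

lemma nbr_pairing:
  assumes w: "admissible p N w" and x: "of_nat p *s x = rvec u" "x \<in> nbr p N w"
  obtains c z where "u = c *s w + int p *s z" "int p dvd \<beta> z w"
proof -
  obtain u' where u': "of_nat p *s x = rvec u'" "int p ^ 2 dvd \<beta> u' u'" "int p ^ 2 dvd \<beta> u' w"
    using x(2) by (auto simp: nbr_def)
  have "u' = u" using u'(1) x(1) by (simp add: rvec_inj)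
  then have u: "int p ^ 2 dvd \<beta> u u" "int p ^ 2 dvd \<beta> u w" using u' by auto
  have d: "int p dvd a" if "int p ^ 2 dvd a" for a using that by (auto simp: power2_eq_square dest: dvd_mult_left)
  have ww: "int p ^ 2 dvd \<beta> w w" using w by (simp add: admissible_def)
  obtain c where c: "vdvd (int p) (u - c *s w)"
    using isotropic_parallel[of w u] w u d ww by (auto simp: admissible_def)
  define z where "z = (\<chi> i. (u - c *s w) $ i div int p)"
  have uz: "u = c *s w + int p *s z" using c by (simp add: vec_eq_iff z_def vdvd_def)
  have "int p * \<beta> z w = \<beta> u w - c * \<beta> w w" by (simp add: uz bform_linear)
  then have "int p ^ 2 dvd int p * \<beta> z w" using u(2) ww by simp
  then have "int p dvd \<beta> z w" using p0 by (simp add: power2_eq_square)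
  then show ?thesis using that uz by blast
qed

lemma nbrI:
  assumes w: "admissible p N w" and "of_nat p *s x = rvec (c *s w + int p *s z)" "int p dvd \<beta> z w"
  shows "x \<in> nbr p N w"
proof -
  obtain k where k: "\<beta> z w = int p * k" using assms(3) by (rule dvdE)
  obtain s where s: "\<beta> w w = int p ^ 2 * s" using w by (auto simp: admissible_def elim: dvdE)
  let ?u = "c *s w + int p *s z"
  have "\<beta> ?u ?u = int p ^ 2 * (c ^ 2 * s + 2 * c * k + \<beta> z z)"
    using beta_commute[of w z] by (simp add: bform_linear s k power2_eq_square algebra_simps)
  moreover have "\<beta> ?u w = int p ^ 2 * (c * s + k)"
    by (simp add: bform_linear s k power2_eq_square algebra_simps)
  ultimately show ?thesis unfolding nbr_def using assms(2) by (metis (mono_tags, lifting) dvd_triv_left mem_Collect_eq)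
qed

lemma nbr_bilin:
  assumes w: "admissible p N w" and x: "x \<in> nbr p N w" "of_nat p *s x = rvec u"
    and y: "y \<in> nbr p N w" "of_nat p *s y = rvec u'"
  shows "int p ^ 2 dvd \<beta> u u'"
proof -
  obtain c z where u: "u = c *s w + int p *s z" "int p dvd \<beta> z w" using nbr_pairing[OF w x(2,1)] .
  obtain c' z' where u': "u' = c' *s w + int p *s z'" "int p dvd \<beta> z' w" using nbr_pairing[OF w y(2,1)] .
  obtain k where k: "\<beta> z w = int p * k" using u(2) by (rule dvdE)
  obtain k' where k': "\<beta> z' w = int p * k'" using u'(2) by (rule dvdE)
  obtain s where s: "\<beta> w w = int p ^ 2 * s" using w by (auto simp: admissible_def elim: dvdE)
  have "\<beta> u u' = int p ^ 2 * (c * c' * s + c' * k + c * k' + \<beta> z z')"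
    using beta_commute[of w z'] by (simp add: u(1) u'(1) bform_linear s k k' power2_eq_square algebra_simps)
  then show ?thesis by simp
qed

lemma nbr_obtain: "x \<in> nbr p N w \<Longrightarrow> \<exists>u. of_nat p *s x = rvec u"
  by (auto simp: nbr_def)

lemma nbr_std_iff: "rvec z \<in> nbr p N w \<longleftrightarrow> int p dvd \<beta> z w"
proof -
  have "of_nat p *s rvec z = rvec u \<longleftrightarrow> u = int p *s z" for u
    using rvec_linear(3)[of "int p" z] by (auto simp: rvec_inj)
  then show ?thesis using p0 by (auto simp: nbr_def bform_linear power2_eq_square)
qed

lemma nbr_mem_self: "admissible p N w \<Longrightarrow> of_nat p *s x = rvec w \<Longrightarrow> x \<in> nbr p N w"
  by (auto simp: nbr_def admissible_def)

lemma divide_p: "\<exists>x. of_nat p *s x = rvec w"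
  using p0 by (intro exI[of _ "(1 / of_nat p) *s rvec w"]) (simp add: vec_eq_iff)

lemma nbr_subset:
  assumes w: "admissible p N w" and x: "x \<in> nbr p N w" "of_nat p *s x = rvec u"
  shows "nbr p N w \<subseteq> nbr p N u"
proof
  fix y assume y: "y \<in> nbr p N w"
  then obtain u' where u': "of_nat p *s y = rvec u'" using nbr_obtain by blast
  have "int p ^ 2 dvd \<beta> u' u'" "int p ^ 2 dvd \<beta> u' u"
    using nbr_bilin[OF w y u'] y u' x by blast+
  then show "y \<in> nbr p N u" using u' by (auto simp: nbr_def)
qed

text \<open>Every vector u of p times the neighbour that is not divisible by p can replace w: each
  of u/p and w/p lies in the neighbour defined by the other.\<close>

lemma nbr_eq:
  assumes w: "admissible p N w" and x: "x \<in> nbr p N w" "of_nat p *s x = rvec u" and u: "\<not> vdvd (int p) u"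
  shows "admissible p N u" "nbr p N u = nbr p N w"
proof -
  show a: "admissible p N u" using nbr_bilin[OF w x x] u by (simp add: admissible_def)
  obtain y where y: "of_nat p *s y = rvec w" using divide_p by blast
  have "y \<in> nbr p N w" by (rule nbr_mem_self[OF w y])
  then have "y \<in> nbr p N u" using nbr_subset[OF w x] by blast
  then have "nbr p N u \<subseteq> nbr p N w" using nbr_subset[OF a _ y] by blast
  then show "nbr p N u = nbr p N w" using nbr_subset[OF w x] by blast
qed

text \<open>If w = c w' + p z, the norms of w and w' being divisible by p^2 forces p to divide 2 c
  \<beta> z w'; p is odd, and c is prime to p because w is not divisible by p. Neighbours thus
  correspond to isotropic lines modulo p.\<close>

lemma nbr_eq_iff:
  assumes w: "admissible p N w" and w': "admissible p N w'"
  shows "nbr p N w = nbr p N w' \<longleftrightarrow> (\<exists>c. vdvd (int p) (w - c *s w'))"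
proof
  obtain y where y: "of_nat p *s y = rvec w" using divide_p by blast
  {
    assume "nbr p N w = nbr p N w'"
    then have "y \<in> nbr p N w'" using nbr_mem_self[OF w y] by simp
    then obtain c z where "w = c *s w' + int p *s z" using nbr_pairing[OF w' y] by blast
    then have "vdvd (int p) (w - c *s w')" by (simp add: vdvd_def)
    then show "\<exists>c. vdvd (int p) (w - c *s w')" by blast
  }
  assume "\<exists>c. vdvd (int p) (w - c *s w')"
  then obtain c where c: "vdvd (int p) (w - c *s w')" by blast
  define z where "z = (\<chi> i. (w - c *s w') $ i div int p)"
  have wz: "w = c *s w' + int p *s z" using c by (simp add: vec_eq_iff z_def vdvd_def)
  have nc: "\<not> int p dvd c" using w unfolding wz admissible_def vdvd_def by auto
  have "int p ^ 2 dvd c ^ 2 * \<beta> w' w' + 2 * c * int p * \<beta> z w' + int p ^ 2 * \<beta> z z"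
    using w beta_commute[of w' z] by (simp add: admissible_def wz bform_linear power2_eq_square algebra_simps)
  moreover have "int p ^ 2 dvd \<beta> w' w'" using w' by (simp add: admissible_def)
  ultimately have "int p ^ 2 dvd 2 * c * int p * \<beta> z w'"
    by (metis dvd_add_left_iff dvd_add_right_iff dvd_mult dvd_triv_left)
  then have "int p dvd 2 * c * \<beta> z w'" using p0 by (simp add: power2_eq_square mult_ac)
  then have "int p dvd \<beta> z w'" using nc not_dvd_2 p(1) by (simp add: prime_dvd_mult_iff)
  then have "y \<in> nbr p N w'" using nbrI[OF w', of y c z] y wz by simp
  then show "nbr p N w = nbr p N w'" using nbr_eq(2)[OF w' _ y] w by (simp add: admissible_def)
qed

text \<open>First the sublattice of index p on which p divides \<beta> z w, then the adjunction of
  w/p; the determinants p and 1/p cancel. The coordinates \<open>w'\<close> of w in the sublattice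
  are again not all divisible by p.\<close>

lemma nbr_basis:
  assumes w: "admissible p N w"
  obtains B where "det B = 1" "(*v) B ` std_lattice = nbr p N w"
proof -
  define l where "l = gint N *v w"
  have bl: "\<beta> z w = (\<Sum>j\<in>UNIV. l $ j * z $ j)" for z
    by (simp add: bform_def l_def mult.commute)
  have "\<not> vdvd (int p) l" using w vdvd_solve[OF p(1) disc, of w] by (auto simp: l_def admissible_def)
  then obtain i where "\<not> int p dvd l $ i" by (auto simp: vdvd_def)
  then obtain C where C: "int_mat C" "det C = of_nat p"
      "\<And>z. rvec z \<in> (*v) C ` std_lattice \<longleftrightarrow> int p dvd \<beta> z w"
    using congruence_sublattice[OF prime_p, of l i] unfolding bl[symmetric] by blast
  have "int p dvd \<beta> w w" using w by (auto simp: admissible_def power2_eq_square dest: dvd_mult_left)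
  then have "rvec w \<in> (*v) C ` std_lattice" using C(3) by blast
  then obtain w' where w': "rvec w = C *v rvec w'" using std_lattice_rvec by blast
  have "\<not> vdvd (int p) w'"
  proof
    assume "vdvd (int p) w'"
    then obtain f where "w' = int p *s f" using vdvd_obtain by blast
    then have "rvec w = of_nat p *s (C *v rvec f)"
      unfolding w' by (simp add: rvec_linear vector_scalar_commute)
    moreover obtain y where "C *v rvec f = rvec y" using std_lattice_rvec[OF int_mat_std[OF C(1)]] by force
    ultimately have "rvec w = rvec (int p *s y)" by (simp add: rvec_linear)
    then have "w = int p *s y" by (simp only: rvec_inj)
    then show False using w by (simp add: admissible_def vdvd_def)
  qed
  then obtain m where "\<not> int p dvd w' $ m" by (auto simp: vdvd_def)
  then obtain D where D: "det D = 1 / of_nat p"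
      "(*v) D ` std_lattice = {x. \<exists>c z. of_nat p *s x = rvec (c *s w' + int p *s z)}"
    using adjoin_fraction[OF prime_p] by blast
  have "det (C ** D) = 1" using C(2) D(1) p0 by (simp add: det_mul)
  moreover have "(*v) (C ** D) ` std_lattice = nbr p N w"
  proof -
    have "(*v) (C ** D) ` std_lattice = (*v) C ` ((*v) D ` std_lattice)"
      by (simp add: image_image matrix_vector_mul_assoc)
    also have "\<dots> = nbr p N w"
    proof
      show "(*v) C ` ((*v) D ` std_lattice) \<subseteq> nbr p N w"
      proof
        fix y assume "y \<in> (*v) C ` ((*v) D ` std_lattice)"
        then obtain x where y: "y = C *v x" and x: "x \<in> (*v) D ` std_lattice" by blast
        from x obtain c z where x: "of_nat p *s x = rvec (c *s w' + int p *s z)" unfolding D(2) by blast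
        obtain z' where z': "C *v rvec z = rvec z'" using std_lattice_rvec[OF int_mat_std[OF C(1)]] by force
        have "of_nat p *s y = C *v rvec (c *s w' + int p *s z)" unfolding y x[symmetric] by (simp add: vector_scalar_commute)
        also have "\<dots> = rvec (c *s w + int p *s z')"
          by (simp add: rvec_linear matrix_vector_right_distrib vector_scalar_commute w' z')
        finally have "of_nat p *s y = rvec (c *s w + int p *s z')" .
        moreover have "int p dvd \<beta> z' w" using C(3)[of z'] z' by (metis imageI rvec_std)
        ultimately show "y \<in> nbr p N w" by (rule nbrI[OF w])
      qed
      show "nbr p N w \<subseteq> (*v) C ` ((*v) D ` std_lattice)"
      proof
        fix y assume y: "y \<in> nbr p N w"
        then obtain u where u: "of_nat p *s y = rvec u" using nbr_obtain by blast
        obtain c z where cz: "u = c *s w + int p *s z" "int p dvd \<beta> z w" using nbr_pairing[OF w u y] .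
        then have "rvec z \<in> (*v) C ` std_lattice" using C(3) by blast
        then obtain z' where z': "rvec z = C *v rvec z'" using std_lattice_rvec by blast
        define x where "x = (1 / of_nat p) *s rvec (c *s w' + int p *s z')"
        have px: "of_nat p *s x = rvec (c *s w' + int p *s z')" using p0 by (simp add: x_def vec_eq_iff)
        have "of_nat p *s (C *v x) = rvec u"
          unfolding vector_scalar_commute[symmetric] px
          by (simp add: cz(1) rvec_linear matrix_vector_right_distrib vector_scalar_commute w' z')
        then have "of_nat p *s y = of_nat p *s (C *v x)" using u by simp
        then have "y = C *v x" using p0 by (simp only: vector_mul_lcancel) simp
        moreover have "x \<in> (*v) D ` std_lattice" unfolding D(2) using px by blast
        ultimately show "y \<in> (*v) C ` ((*v) D ` std_lattice)" by blast
      qed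
    qed
    finally show ?thesis .
  qed
  ultimately show ?thesis using that by blast
qed

lemma nbr_quad_int:
  assumes w: "admissible p N w" and x: "x \<in> nbr p N w"
  shows "quad N x \<in> \<int>"
proof -
  obtain u where u: "of_nat p *s x = rvec u" using nbr_obtain x by blast
  have "quad N (rvec u) \<in> \<int>" by (rule quad_Ints[OF tN rvec_std])
  then obtain k where k: "quad N (rvec u) = of_int k" by (auto elim: Ints_cases)
  have "(of_int (\<beta> u u) :: rat) = of_int (2 * k)" by (simp add: bform_gint_quad[OF tN] k)
  then have "\<beta> u u = 2 * k" by (simp only: of_int_eq_iff)
  then have "int p ^ 2 dvd 2 * k" using nbr_bilin[OF w x u x u] by simp
  moreover have "coprime (int p ^ 2) 2"
    using not_dvd_2 p(1) by (metis coprime_power_left_iff prime_imp_coprime)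
  ultimately have "int p ^ 2 dvd k" by (simp add: coprime_dvd_mult_right_iff)
  then obtain s where s: "k = int p ^ 2 * s" by (rule dvdE)
  have "of_nat p ^ 2 * quad N x = quad N (of_nat p *s x)" by (simp add: quad_def bilin_linear power2_eq_square)
  also have "\<dots> = of_nat p ^ 2 * of_int s" by (simp add: u k s)
  finally have "quad N x = of_int s" using p0 by simp
  then show ?thesis by simp
qed

text \<open>
  Locally at \<open>p\<close> the neighbour is the image of the lattice under the reflection in \<open>v = w + p t\<close> with
  \<open>p \<nmid> 2B(t, w)\<close>, so that \<open>Q(v)\<close> is \<open>p\<close> times a unit.
\<close>

lemma nbr_reflection:
  assumes w: "admissible p N w"
  obtains v d where "\<not> int p dvd d" "\<And>x. x \<in> std_lattice \<Longrightarrow> of_int d *s reflect N v x \<in> nbr p N w"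
proof -
  obtain t where t: "int p dvd \<beta> t w - 1" using dual_vector w by (auto simp: admissible_def)
  obtain t' where t': "\<beta> t w = 1 + int p * t'" using t by (metis dvdE diff_add_cancel add.commute)
  obtain s where s: "\<beta> w w = int p ^ 2 * s" using w by (auto simp: admissible_def elim: dvdE)
  define v where "v = w + int p *s t"
  \<comment> \<open>The cofactor of p in \<beta> v v. It is 2 modulo p, hence a unit at p, and
    multiplication by it clears the denominator that is left in the reflection.\<close>
  define d where "d = int p * s + 2 * (1 + int p * t') + int p * \<beta> t t"
  have vv: "\<beta> v v = int p * d"
    using beta_commute[of w t] by (simp add: v_def d_def bform_linear s t' power2_eq_square algebra_simps)
  have d: "\<not> int p dvd d"
  proof
    assume "int p dvd d"
    moreover have "d = 2 + int p * (s + 2 * t' + \<beta> t t)" by (simp add: d_def algebra_simps)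
    ultimately have "int p dvd 2" by (simp add: dvd_add_left_iff)
    then show False using not_dvd_2 by simp
  qed
  have "of_int d *s reflect N (rvec v) x \<in> nbr p N w" if x: "x \<in> std_lattice" for x
  proof -
    obtain a where a: "x = rvec a" using std_lattice_rvec[OF x] by blast
    define u where "u = (int p * d) *s a - (2 * \<beta> a v) *s v"
    have q: "2 * quad N (rvec v) = of_nat p * of_int d"
      using bform_gint_quad[OF tN, of v] by (simp add: vv)
    have b: "2 * bilin N x (rvec v) = of_int (\<beta> a v)" by (simp add: bform_gint[OF tN] a)
    have pd: "of_nat p * of_int d \<noteq> (0::rat)" using d p0 by auto
    have "2 * bilin N x (rvec v) / quad N (rvec v) = 2 * of_int (\<beta> a v) / (of_nat p * of_int d)"
      unfolding b q[symmetric] by simp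
    then have "of_nat p *s (of_int d *s reflect N (rvec v) x) = rvec u"
      using pd by (simp add: reflect_def u_def a vec_eq_iff field_simps)
    moreover have "\<beta> u u = int p ^ 2 * (d ^ 2 * \<beta> a a)"
      using beta_commute[of v a] by (simp add: u_def bform_linear vv power2_eq_square algebra_simps)
    moreover have "\<beta> u w = int p ^ 2 * (\<beta> a w * (s + \<beta> t t) - 2 * \<beta> a w * s - 2 * \<beta> a t * (int p * s + 1 + int p * t'))"
    proof -
      have "\<beta> v w = int p ^ 2 * s + int p * (1 + int p * t')" by (simp add: v_def bform_linear s t')
      moreover have "\<beta> a v = \<beta> a w + int p * \<beta> a t" by (simp add: v_def bform_linear)
      ultimately show ?thesis
        by (simp add: u_def bform_linear d_def power2_eq_square algebra_simps)
    qed
    ultimately show ?thesis unfolding nbr_def by (metis (mono_tags, lifting) dvd_triv_left mem_Collect_eq)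
  qed
  then show ?thesis using that d by blast
qed

text \<open>For a prime q other than p, multiplication by p moves the lattice into the neighbour. At
  q = p the reflection of \<open>nbr_reflection\<close> does so up to a factor prime to p. Together
  these are the local data for \<open>genus_transfer\<close>.\<close>

theorem nbr_isometry:
  assumes w: "admissible p N w"
  obtains N' \<sigma> where "N' \<in> genus M" "space_isometry N' N \<sigma>" "\<sigma> ` std_lattice = nbr p N w"
proof -
  obtain B where B: "det B = 1" "(*v) B ` std_lattice = nbr p N w" using nbr_basis[OF w] .
  define N' where "N' = gram N B"
  have det: "det N' = det N" by (simp add: N'_def det_gram B)
  have s: "space_isometry N' N ((*v) B)"
    using ternary_minors_pos(3)[OF tN] by (intro matrix_space_isometry) (auto simp: N'_def det[unfolded N'_def])
  note inv = space_isometry_inv[OF s] and inv_simps = space_isometry_inv_simps[OF s]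
  have pull: "finv ((*v) B) y \<in> std_lattice" if "y \<in> nbr p N w" for y
    using that B(2) inv_simps(2) by (metis imageE)
  have "N' \<in> genus M"
  proof (rule genus_transfer[OF M N _ _ det])
    show "transpose N' = N'" unfolding N'_def by (rule transpose_gram[OF ternary_sym[OF tN]])
    show "quad N' x \<in> \<int>" if "x \<in> std_lattice" for x
      using nbr_quad_int[OF w, of "B *v x"] that B(2) by (auto simp: N'_def quad_gram)
    fix q :: nat assume q: "prime q"
    show "\<exists>\<sigma> d. space_isometry N N' \<sigma> \<and> \<not> int q dvd d \<and> (\<forall>x\<in>std_lattice. of_int d *s \<sigma> x \<in> std_lattice)"
    proof (cases "q = p")
      case False
      have "\<not> int q dvd int p" using False q prime_p primes_dvd_imp_eq[of q p] by auto
      moreover have "of_int (int p) *s finv ((*v) B) x \<in> std_lattice" if x: "x \<in> std_lattice" for x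
      proof -
        obtain a where a: "x = rvec a" using std_lattice_rvec[OF x] by blast
        have "rvec (int p *s a) \<in> nbr p N w" unfolding nbr_std_iff by (simp add: bform_linear)
        then have "finv ((*v) B) (rvec (int p *s a)) \<in> std_lattice" by (rule pull)
        then show ?thesis by (simp add: a rvec_linear space_isometry_scale[OF inv])
      qed
      ultimately show ?thesis using inv by blast
    next
      case True
      obtain v d where v: "\<not> int p dvd d" "\<And>x. x \<in> std_lattice \<Longrightarrow> of_int d *s reflect N v x \<in> nbr p N w"
        using nbr_reflection[OF w] by blast
      let ?\<sigma> = "\<lambda>x. finv ((*v) B) (reflect N v x)"
      have "space_isometry N N' ?\<sigma>"
        by (rule space_isometry_comp[OF reflect_space_isometry[OF ternary_sym[OF tN]] inv])
      moreover have "of_int d *s ?\<sigma> x \<in> std_lattice" if "x \<in> std_lattice" for x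
        using pull[OF v(2)[OF that]] by (simp add: space_isometry_scale[OF inv])
      ultimately show ?thesis using v(1) True by blast
    qed
  qed
  then show ?thesis using that s B(2) by blast
qed

text \<open>A vector \<open>x0\<close> whose image is not integral gives w = p \<sigma> x0.
  Integrality of N' then places the whole image in \<open>nbr p N w\<close>, and the inclusion is an
  equality because the determinants agree.\<close>

lemma isometric_lattice_is_nbr:
  assumes N': "N' \<in> genus M" and s: "space_isometry N' N \<sigma>"
    and p_int: "\<And>x. x \<in> std_lattice \<Longrightarrow> of_nat p *s \<sigma> x \<in> std_lattice"
    and not_int: "\<not> \<sigma> ` std_lattice \<subseteq> std_lattice"
  shows "\<sigma> ` std_lattice \<in> nbrs p N"
proof -
  note tN' = genus_ternary[OF N']
  obtain x0 where x0: "x0 \<in> std_lattice" "\<sigma> x0 \<notin> std_lattice" using not_int by blast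
  obtain w where w: "of_nat p *s \<sigma> x0 = rvec w" using std_lattice_rvec[OF p_int[OF x0(1)]] by blast
  have pair: "int p ^ 2 dvd \<beta> u u'" if x: "x \<in> std_lattice" "of_nat p *s \<sigma> x = rvec u"
    and y: "y \<in> std_lattice" "of_nat p *s \<sigma> y = rvec u'" for x y u u'
  proof -
    obtain a b where ab: "x = rvec a" "y = rvec b" using std_lattice_rvec x y by blast
    have "(of_int (\<beta> u u') :: rat) = of_nat p ^ 2 * (2 * bilin N' x y)"
      unfolding bform_gint[OF tN] x(2)[symmetric] y(2)[symmetric]
      by (simp add: bilin_linear space_isometry_bilin[OF s] power2_eq_square)
    also have "2 * bilin N' x y = of_int (bform (gint N') a b)" by (simp add: bform_gint[OF tN'] ab)
    finally have "(of_int (\<beta> u u') :: rat) = of_int (int p ^ 2 * bform (gint N') a b)" by simp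
    then have "\<beta> u u' = int p ^ 2 * bform (gint N') a b" by (simp only: of_int_eq_iff)
    then show ?thesis by simp
  qed
  have "\<not> vdvd (int p) w"
  proof
    assume "vdvd (int p) w"
    then obtain f where "w = int p *s f" using vdvd_obtain by blast
    then have "of_nat p *s \<sigma> x0 = of_nat p *s rvec f" using w by (simp add: rvec_linear)
    then have "\<sigma> x0 = rvec f" using p0 by (simp only: vector_mul_lcancel) simp
    then show False using x0(2) by simp
  qed
  then have adm: "admissible p N w" using pair[OF x0(1) w x0(1) w] by (simp add: admissible_def)
  have sub: "\<sigma> x \<in> nbr p N w" if x: "x \<in> std_lattice" for x
  proof -
    obtain u where u: "of_nat p *s \<sigma> x = rvec u" using std_lattice_rvec[OF p_int[OF x]] by blast
    show ?thesis using u pair[OF x u x u] pair[OF x u x0(1) w] by (auto simp: nbr_def)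
  qed
  obtain N'' \<tau> where t: "N'' \<in> genus M" "space_isometry N'' N \<tau>" "\<tau> ` std_lattice = nbr p N w"
    using nbr_isometry[OF adm] .
  note ti = space_isometry_inv_simps[OF t(2)]
  have "(\<lambda>x. finv \<tau> (\<sigma> x)) ` std_lattice = std_lattice"
  proof (rule isometry_into_imp_onto[OF space_isometry_comp[OF s space_isometry_inv[OF t(2)]]])
    show "det N' = det N''" using genus_det[OF M] N' t(1) by simp
    show "det N'' \<noteq> 0" using ternary_minors_pos(3)[OF genus_ternary[OF t(1)]] by simp
    show "finv \<tau> (\<sigma> x) \<in> std_lattice" if "x \<in> std_lattice" for x
      using sub[OF that] t(3) ti(2) by (metis imageE)
  qed
  then have "\<tau> ` (\<lambda>x. finv \<tau> (\<sigma> x)) ` std_lattice = nbr p N w" using t(3) by simp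
  then have "\<sigma> ` std_lattice = nbr p N w" by (simp add: image_image ti(1))
  then show ?thesis using adm by (auto simp: nbrs_def)
qed

lemma nbr_properties:
  assumes "L \<in> nbrs p N"
  shows "\<And>x. x \<in> L \<Longrightarrow> of_nat p *s x \<in> std_lattice" "\<And>x. x \<in> std_lattice \<Longrightarrow> of_nat p *s x \<in> L"
    "\<not> L \<subseteq> std_lattice" "\<not> std_lattice \<subseteq> L"
proof -
  obtain w where w: "admissible p N w" "L = nbr p N w" using assms by (auto simp: nbrs_def)
  show "of_nat p *s x \<in> std_lattice" if "x \<in> L" for x using that w nbr_obtain[of x w] by auto
  show "of_nat p *s x \<in> L" if x: "x \<in> std_lattice" for x
  proof -
    obtain a where a: "x = rvec a" using std_lattice_rvec[OF x] by blast
    have "rvec (int p *s a) \<in> nbr p N w" unfolding nbr_std_iff by (simp add: bform_linear)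
    then show ?thesis by (simp add: w a rvec_linear)
  qed
  show "\<not> L \<subseteq> std_lattice"
  proof
    assume L: "L \<subseteq> std_lattice"
    obtain y where y: "of_nat p *s y = rvec w" using divide_p by blast
    have "y \<in> std_lattice" using nbr_mem_self[OF w(1) y] L w(2) by blast
    then obtain z where "y = rvec z" using std_lattice_rvec by blast
    then have "rvec w = rvec (int p *s z)" using y by (simp add: rvec_linear)
    then have "w = int p *s z" by (simp only: rvec_inj)
    then show False using w(1) by (simp add: admissible_def vdvd_def)
  qed
  show "\<not> std_lattice \<subseteq> L"
  proof
    assume L: "std_lattice \<subseteq> L"
    obtain t where t: "int p dvd \<beta> t w - 1" using dual_vector w by (auto simp: admissible_def)
    have "int p dvd \<beta> t w" using L w(2) nbr_std_iff rvec_std by blast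
    then have "int p dvd 1" using t by (metis int_dvd_diffD1)
    then show False using p(1) by (simp add: prime_int_iff)
  qed
qed

text \<open>Each representative \<open>W z\<close> of an isotropic line is lifted to an admissible
  vector \<open>V z\<close>. The lift is congruent to it modulo p, so it changes neither the line
  nor the condition that p divides \<beta> y (W z).\<close>

theorem nbr_lines:
  "\<exists>W. bij_betw (\<lambda>z. nbr p N (W z)) {0..int p} (nbrs p N) \<and>
    (\<forall>y n. \<not> vdvd (int p) y \<longrightarrow> \<beta> y y = 2 * n \<longrightarrow>
       int (card {z\<in>{0..int p}. int p dvd \<beta> y (W z)}) = 1 + Legendre (- four_disc M * n) (int p))"
proof -
  obtain W where W: "\<And>z. z \<in> {0..int p} \<Longrightarrow> \<not> vdvd (int p) (W z) \<and> int p dvd \<beta> (W z) (W z)"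
    "\<And>w. \<not> vdvd (int p) w \<Longrightarrow> int p dvd \<beta> w w \<Longrightarrow> \<exists>z\<in>{0..int p}. \<exists>c. vdvd (int p) (w - c *s W z)"
    "\<And>z z' c. z \<in> {0..int p} \<Longrightarrow> z' \<in> {0..int p} \<Longrightarrow> vdvd (int p) (W z - c *s W z') \<Longrightarrow> z = z'"
    "\<And>y n. \<not> vdvd (int p) y \<Longrightarrow> \<beta> y y = 2 * n \<Longrightarrow>
       int (card {z\<in>{0..int p}. int p dvd \<beta> y (W z)}) = 1 + Legendre (- 2 * det (gint N) * n) (int p)"
    using isotropic_lines by blast
  have "\<exists>w'. vdvd (int p) (w' - W z) \<and> admissible p N w'" if "z \<in> {0..int p}" for z
    using isotropic_lift[of "W z"] W(1)[OF that] unfolding admissible_def by metis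
  then obtain V where V: "\<And>z. z \<in> {0..int p} \<Longrightarrow> vdvd (int p) (V z - W z) \<and> admissible p N (V z)" by metis
  have adm: "admissible p N (V z)" if "z \<in> {0..int p}" for z using V that by blast
  have transfer: "vdvd (int p) (w - c *s W z) \<longleftrightarrow> vdvd (int p) (w - c *s V z)" if "z \<in> {0..int p}" for w c z
  proof -
    have "vdvd (int p) (c *s V z - c *s W z)"
      using vdvd_scale[of "int p" "V z - W z" c] V[OF that] by (simp add: vector_ssub_ldistrib)
    then show ?thesis using vdvd_trans vdvd_sym by blast
  qed
  have "bij_betw (\<lambda>z. nbr p N (V z)) {0..int p} (nbrs p N)"
    unfolding bij_betw_def
  proof
    show "inj_on (\<lambda>z. nbr p N (V z)) {0..int p}"
    proof (rule inj_onI)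
      fix z z' assume z: "z \<in> {0..int p}" "z' \<in> {0..int p}" "nbr p N (V z) = nbr p N (V z')"
      then obtain c where "vdvd (int p) (V z - c *s V z')" using nbr_eq_iff[OF adm adm] by blast
      then have "vdvd (int p) (V z - c *s W z')" using transfer[OF z(2)] by blast
      then have "vdvd (int p) (W z - c *s W z')"
        using V[OF z(1)] vdvd_trans[of "int p" "W z" "V z"] vdvd_sym by blast
      then show "z = z'" using W(3) z by blast
    qed
    show "(\<lambda>z. nbr p N (V z)) ` {0..int p} = nbrs p N"
    proof
      show "(\<lambda>z. nbr p N (V z)) ` {0..int p} \<subseteq> nbrs p N" using adm by (auto simp: nbrs_def)
      show "nbrs p N \<subseteq> (\<lambda>z. nbr p N (V z)) ` {0..int p}"
      proof
        fix L assume "L \<in> nbrs p N"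
        then obtain w where w: "admissible p N w" "L = nbr p N w" by (auto simp: nbrs_def)
        have "int p dvd \<beta> w w" using w(1) by (auto simp: admissible_def power2_eq_square dest: dvd_mult_left)
        then obtain z c where z: "z \<in> {0..int p}" "vdvd (int p) (w - c *s W z)"
          using W(2)[of w] w(1) by (auto simp: admissible_def)
        then have "vdvd (int p) (w - c *s V z)" using transfer by blast
        then have "L = nbr p N (V z)" using nbr_eq_iff[OF w(1) adm[OF z(1)]] w(2) by blast
        then show "L \<in> (\<lambda>z. nbr p N (V z)) ` {0..int p}" using z(1) by blast
      qed
    qed
  qed
  moreover have "int (card {z\<in>{0..int p}. int p dvd \<beta> y (V z)}) = 1 + Legendre (- four_disc M * n) (int p)"
    if y: "\<not> vdvd (int p) y" "\<beta> y y = 2 * n" for y n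
  proof -
    have "int p dvd \<beta> y (V z) \<longleftrightarrow> int p dvd \<beta> y (W z)" if "z \<in> {0..int p}" for z
    proof -
      have "int p dvd \<beta> y (V z) - \<beta> y (W z)"
        using bform_vdvd[of "int p" "V z - W z" "gint N" y] V[OF that] by (simp add: bform_linear)
      then show ?thesis by (metis int_dvd_diffD int_dvd_diffD1)
    qed
    then have eq: "{z\<in>{0..int p}. int p dvd \<beta> y (V z)} = {z\<in>{0..int p}. int p dvd \<beta> y (W z)}" by auto
    \<comment> \<open>The determinant of \<open>gint N\<close> is twice \<open>four_disc N\<close>,
      so the two factors 2 combine to a square.\<close>
    have eq2: "- 2 * det (gint N) * n = (- four_disc M * n) * 2 ^ 2"
      by (simp add: det_gint_four_disc[OF tN] bad_primes_genus(1)[OF M N])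
    show ?thesis unfolding eq W(4)[OF y] eq2 Legendre_mult_square[OF p(1) not_dvd_2] ..
  qed
  ultimately show ?thesis by blast
qed

end

section \<open>Counting the vectors of norm m^2 in all neighbours of a lattice\<close>

subsection \<open>The Hecke relation\<close>

definition lattice_rep :: "rat ^ 3 ^ 3 \<Rightarrow> (rat ^ 3) set \<Rightarrow> int \<Rightarrow> nat" where
  "lattice_rep N L n = card {x \<in> L. quad N x = of_int n}"

lemma quad_scale: "quad N (c *s x) = c ^ 2 * quad N x"
  by (simp add: quad_def bilin_linear power2_eq_square)

context good_prime
begin

lemma scaled_vectors:
  "bij_betw (\<lambda>x. of_nat p *s x) {x. of_nat p *s x \<in> std_lattice \<and> quad N x = of_int n}
     {x \<in> std_lattice. quad N x = of_int (int p ^ 2 * n)}"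
proof (rule bij_betw_byWitness[where f' = "\<lambda>x. (1 / of_nat p) *s x"])
  show "(\<lambda>x. of_nat p *s x) ` {x. of_nat p *s x \<in> std_lattice \<and> quad N x = of_int n}
      \<subseteq> {x \<in> std_lattice. quad N x = of_int (int p ^ 2 * n)}"
    by (auto simp: quad_scale)
  show "(\<lambda>x. (1 / of_nat p) *s x) ` {x \<in> std_lattice. quad N x = of_int (int p ^ 2 * n)}
      \<subseteq> {x. of_nat p *s x \<in> std_lattice \<and> quad N x = of_int n}"
    using p0 by (auto simp: quad_scale vector_smult_assoc power2_eq_square)
qed (use p0 in \<open>auto simp: vector_smult_assoc\<close>)

lemma card_nbrs: "finite (nbrs p N)" "card (nbrs p N) = p + 1"
proof -
  obtain W where W: "bij_betw (\<lambda>z. nbr p N (W z)) {0..int p} (nbrs p N)"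
    "\<And>y n. \<not> vdvd (int p) y \<Longrightarrow> \<beta> y y = 2 * n \<Longrightarrow>
       int (card {z\<in>{0..int p}. int p dvd \<beta> y (W z)}) = 1 + Legendre (- four_disc M * n) (int p)"
    using nbr_lines by blast
  show "finite (nbrs p N)" using bij_betw_finite[OF W(1)] by simp
  show "card (nbrs p N) = p + 1" using bij_betw_same_card[OF W(1)] by simp
qed

lemma card_nbrs_containing_std:
  assumes y: "\<beta> y y = 2 * n"
  shows "int (card {L \<in> nbrs p N. rvec y \<in> L}) =
    (if vdvd (int p) y then int p + 1 else 1 + Legendre (- four_disc M * n) (int p))"
proof -
  obtain W where W: "bij_betw (\<lambda>z. nbr p N (W z)) {0..int p} (nbrs p N)"
    "\<And>y n. \<not> vdvd (int p) y \<Longrightarrow> \<beta> y y = 2 * n \<Longrightarrow>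
       int (card {z\<in>{0..int p}. int p dvd \<beta> y (W z)}) = 1 + Legendre (- four_disc M * n) (int p)"
    using nbr_lines by blast
  have im: "nbrs p N = (\<lambda>z. nbr p N (W z)) ` {0..int p}" and inj: "inj_on (\<lambda>z. nbr p N (W z)) {0..int p}"
    using W(1) by (auto simp: bij_betw_def)
  have "{L \<in> nbrs p N. rvec y \<in> L} = (\<lambda>z. nbr p N (W z)) ` {z\<in>{0..int p}. int p dvd \<beta> y (W z)}"
    unfolding im by (auto simp: nbr_std_iff)
  moreover have "inj_on (\<lambda>z. nbr p N (W z)) {z\<in>{0..int p}. int p dvd \<beta> y (W z)}"
    by (rule inj_on_subset[OF inj]) auto
  ultimately have c: "card {L \<in> nbrs p N. rvec y \<in> L} = card {z\<in>{0..int p}. int p dvd \<beta> y (W z)}"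
    by (simp add: card_image)
  show ?thesis
  proof (cases "vdvd (int p) y")
    case True
    have "int p dvd \<beta> y z" for z using bform_vdvd[OF True, of "gint N" z] beta_commute by simp
    then have "{z\<in>{0..int p}. int p dvd \<beta> y (W z)} = {0..int p}" by auto
    then show ?thesis using True c by simp
  next
    case False
    then show ?thesis using W(2)[OF False y] c by simp
  qed
qed

text \<open>The vector w = p x is not divisible by p and has norm divisible by p^2, and a neighbour
  containing x is the one defined by w.\<close>

lemma card_nbrs_containing_nonstd:
  assumes x: "of_nat p *s x \<in> std_lattice" "x \<notin> std_lattice" "quad N x = of_int n"
  shows "card {L \<in> nbrs p N. x \<in> L} = 1"
proof -
  obtain w where w: "of_nat p *s x = rvec w" using std_lattice_rvec[OF x(1)] by blast
  have nw: "\<not> vdvd (int p) w"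
  proof
    assume "vdvd (int p) w"
    then obtain f where "w = int p *s f" using vdvd_obtain by blast
    then have "of_nat p *s x = of_nat p *s rvec f" using w by (simp add: rvec_linear)
    then have "x = rvec f" using p0 by (simp only: vector_mul_lcancel) simp
    then show False using x(2) by simp
  qed
  have "(of_int (\<beta> w w) :: rat) = of_int (int p ^ 2 * (2 * n))"
    by (simp add: bform_gint_quad[OF tN] w[symmetric] quad_scale x(3))
  then have "\<beta> w w = int p ^ 2 * (2 * n)" by (simp only: of_int_eq_iff)
  then have adm: "admissible p N w" using nw by (simp add: admissible_def)
  have "{L \<in> nbrs p N. x \<in> L} = {nbr p N w}"
  proof (intro equalityI subsetI)
    fix L assume "L \<in> {L \<in> nbrs p N. x \<in> L}"
    then obtain v where v: "admissible p N v" "L = nbr p N v" "x \<in> L" by (auto simp: nbrs_def)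
    then have "nbr p N w = nbr p N v" using nbr_eq(2)[OF v(1) _ w nw] by simp
    then show "L \<in> {nbr p N w}" using v by simp
  next
    fix L assume "L \<in> {nbr p N w}"
    then show "L \<in> {L \<in> nbrs p N. x \<in> L}" using adm nbr_mem_self[OF adm w] by (auto simp: nbrs_def)
  qed
  then show ?thesis by simp
qed

text \<open>Count pairs of a neighbour and a vector x of norm m^2 in it. Scaling by p identifies all
  possible x with the r(p^2 m^2) vectors counted by \<open>Y\<close>. The non-integral ones lie in
  exactly one neighbour, so the correction term comes from the integral ones in \<open>R\<close>,
  which contribute their number of neighbours minus 1.\<close>

theorem hecke_relation:
  fixes m :: nat
  shows "int (\<Sum>L\<in>nbrs p N. lattice_rep N L (int m ^ 2)) =
    int (rep_num (int p ^ 2 * int m ^ 2) N) +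
    (if p dvd m then int p * int (rep_num (int (m div p) ^ 2) N)
     else Legendre (- four_disc M) (int p) * int (rep_num (int m ^ 2) N))"
proof -
  define n where "n = int m ^ 2"
  define Y where "Y = {x. of_nat p *s x \<in> std_lattice \<and> quad N x = of_int n}"
  define R where "R = {x \<in> std_lattice. quad N x = of_int n}"
  define cnt where "cnt x = card {L \<in> nbrs p N. x \<in> L}" for x
  note bij = scaled_vectors[of n, folded Y_def]
  have finY: "finite Y" using bij_betw_finite[OF bij] finite_rep[OF tN] by blast
  have cardY: "card Y = rep_num (int p ^ 2 * n) N" using bij_betw_same_card[OF bij] by (simp add: rep_num_def)
  have cardR: "card R = rep_num n N" by (simp add: R_def rep_num_def)
  have RY: "R \<subseteq> Y" by (auto simp: R_def Y_def std_lattice_scale)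
  have finR: "finite R" using finY RY finite_subset by blast
  have "(\<Sum>L\<in>nbrs p N. lattice_rep N L n) = (\<Sum>L\<in>nbrs p N. \<Sum>x\<in>Y. if x \<in> L then 1 else 0)"
  proof (rule sum.cong[OF refl])
    fix L assume "L \<in> nbrs p N"
    then have "{x \<in> L. quad N x = of_int n} = {x \<in> Y. x \<in> L}"
      using nbr_properties(1) by (auto simp: Y_def)
    then show "lattice_rep N L n = (\<Sum>x\<in>Y. if x \<in> L then 1 else 0)"
      using finY by (simp add: lattice_rep_def sum.If_cases Int_def)
  qed
  also have "\<dots> = (\<Sum>x\<in>Y. \<Sum>L\<in>nbrs p N. if x \<in> L then 1 else 0)" by (rule sum.swap)
  also have "\<dots> = (\<Sum>x\<in>Y. cnt x)"
    using card_nbrs(1) by (intro sum.cong) (auto simp: cnt_def sum.If_cases Int_def)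
  also have "\<dots> = (\<Sum>x\<in>Y - R. cnt x) + (\<Sum>x\<in>R. cnt x)"
    using sum.subset_diff[OF RY finY, of cnt] by simp
  also have "(\<Sum>x\<in>Y - R. cnt x) = (\<Sum>x\<in>Y - R. 1)"
    unfolding cnt_def by (intro sum.cong card_nbrs_containing_nonstd) (auto simp: Y_def R_def)
  also have "\<dots> = card Y - card R" using card_Diff_subset[OF finR RY] by simp
  finally have 1: "int (\<Sum>L\<in>nbrs p N. lattice_rep N L n) = int (card Y) - int (card R) + (\<Sum>x\<in>R. int (cnt x))"
    using card_mono[OF finY RY] by simp
  have cnt: "int (cnt (rvec y)) = (if vdvd (int p) y then int p + 1 else 1 + Legendre (- four_disc M * n) (int p))"
    if "rvec y \<in> R" for y
  proof -
    have "(of_int (\<beta> y y) :: rat) = of_int (2 * n)" using that by (simp add: bform_gint_quad[OF tN] R_def)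
    then have "\<beta> y y = 2 * n" by (simp only: of_int_eq_iff)
    then show ?thesis unfolding cnt_def by (rule card_nbrs_containing_std)
  qed
  show ?thesis
  proof (cases "p dvd m")
    case False
    then have pm: "\<not> int p dvd int m" by simp
    have Leg: "Legendre (- four_disc M * n) (int p) = Legendre (- four_disc M) (int p)"
      unfolding n_def by (rule Legendre_mult_square[OF p(1) pm])
    have "int (cnt x) = 1 + Legendre (- four_disc M) (int p)" if x: "x \<in> R" for x
    proof -
      obtain y where y: "x = rvec y" using x std_lattice_rvec by (auto simp: R_def)
      have "\<not> vdvd (int p) y"
      proof
        assume "vdvd (int p) y"
        then have "int p dvd \<beta> y y" by (rule bform_vdvd)
        moreover have "(of_int (\<beta> y y) :: rat) = of_int (2 * n)" using x y by (simp add: bform_gint_quad[OF tN] R_def)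
        then have "\<beta> y y = 2 * n" by (simp only: of_int_eq_iff)
        ultimately have "int p dvd 2 * int m ^ 2" by (simp add: n_def)
        then show False using pm not_dvd_2 p(1) by (simp only: prime_dvd_mult_iff prime_dvd_power_iff) (auto simp: prime_dvd_power_iff)
      qed
      then show ?thesis using cnt[of y] x y Leg by simp
    qed
    then have "(\<Sum>x\<in>R. int (cnt x)) = int (card R) * (1 + Legendre (- four_disc M) (int p))" by simp
    then show ?thesis using 1 False by (simp add: cardY cardR n_def algebra_simps)
  next
    case True
    have "int p dvd - four_disc M * n" using True by (simp add: n_def power2_eq_square)
    then have Leg: "Legendre (- four_disc M * n) (int p) = 0" by (simp add: Legendre_def cong_0_iff)
    define Rp where "Rp = {x \<in> R. (1 / of_nat p) *s x \<in> std_lattice}"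
    have div: "vdvd (int p) y \<longleftrightarrow> (1 / of_nat p) *s rvec y \<in> std_lattice" for y
    proof
      assume "vdvd (int p) y"
      then obtain f where "y = int p *s f" using vdvd_obtain by blast
      then have "(1 / of_nat p) *s rvec y = rvec f" using p0 by (simp add: rvec_linear vector_smult_assoc)
      then show "(1 / of_nat p) *s rvec y \<in> std_lattice" by simp
    next
      assume "(1 / of_nat p) *s rvec y \<in> std_lattice"
      then obtain f where "(1 / of_nat p) *s rvec y = rvec f" using std_lattice_rvec by blast
      then have "of_nat p *s ((1 / of_nat p) *s rvec y) = rvec (int p *s f)" by (simp add: rvec_linear)
      then have "rvec y = rvec (int p *s f)" using p0 by (simp add: vector_smult_assoc)
      then have "y = int p *s f" by (simp only: rvec_inj)
      then show "vdvd (int p) y" by (simp add: vdvd_def)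
    qed
    \<comment> \<open>A vector divisible by p lies in all p + 1 neighbours. For the others the
      Legendre symbol is 0, because p divides m, and one neighbour remains.\<close>
    have "int (cnt x) = 1 + (if x \<in> Rp then int p else 0)" if x: "x \<in> R" for x
    proof -
      obtain y where y: "x = rvec y" using x std_lattice_rvec by (auto simp: R_def)
      show ?thesis using cnt[of y] x y Leg div[of y] by (simp add: Rp_def)
    qed
    then have "(\<Sum>x\<in>R. int (cnt x)) = (\<Sum>x\<in>R. 1 + (if x \<in> Rp then int p else 0))" by (intro sum.cong) auto
    also have "\<dots> = int (card R) + int p * int (card Rp)"
    proof -
      have "R \<inter> {x. x \<in> Rp} = Rp" by (auto simp: Rp_def)
      then show ?thesis using finR by (simp add: sum.distrib sum.If_cases)
    qed
    also have "card Rp = rep_num (int (m div p) ^ 2) N"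
    proof -
      have "int m = int p * int (m div p)" using True by (metis dvd_mult_div_cancel of_nat_mult)
      then have nn: "n = int p ^ 2 * int (m div p) ^ 2" by (simp add: n_def power_mult_distrib)
      have "bij_betw (\<lambda>x. (1 / of_nat p) *s x) Rp {x \<in> std_lattice. quad N x = of_int (int (m div p) ^ 2)}"
      proof (rule bij_betw_byWitness[where f' = "\<lambda>x. of_nat p *s x"])
        show "(\<lambda>x. (1 / of_nat p) *s x) ` Rp \<subseteq> {x \<in> std_lattice. quad N x = of_int (int (m div p) ^ 2)}"
          using p0 by (auto simp: Rp_def R_def quad_scale nn power2_eq_square)
        show "(\<lambda>x. of_nat p *s x) ` {x \<in> std_lattice. quad N x = of_int (int (m div p) ^ 2)} \<subseteq> Rp"
          using p0 by (auto simp: Rp_def R_def quad_scale nn vector_smult_assoc std_lattice_scale)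
      qed (use p0 in \<open>auto simp: vector_smult_assoc\<close>)
      then show ?thesis unfolding rep_num_def by (rule bij_betw_same_card)
    qed
    finally show ?thesis using 1 True by (simp add: cardY cardR n_def)
  qed
qed

end

section \<open>From neighbouring lattices to a matrix indexed by isometry classes\<close>

subsection \<open>The neighbour operator on classes\<close>

text \<open>Isometries are counted instead of neighbours because inversion exchanges N and N'; the
  reversibility of the walk follows from this.\<close>

definition nbr_isometries :: "nat \<Rightarrow> rat ^ 3 ^ 3 \<Rightarrow> rat ^ 3 ^ 3 \<Rightarrow> (rat ^ 3 \<Rightarrow> rat ^ 3) set" where
  "nbr_isometries p N N' = {\<sigma>. space_isometry N' N \<sigma> \<and> \<sigma> ` std_lattice \<in> nbrs p N}"

text \<open>The number of p-neighbours of \<open>class_rep C\<close> that belong to the class D: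
  each of them is the image of the lattice of D under as many isometries as that lattice has
  automorphisms (\<open>card_isometries_onto\<close>).\<close>

definition nbr_matrix :: "nat \<Rightarrow> (rat ^ 3 ^ 3) set \<Rightarrow> (rat ^ 3 ^ 3) set \<Rightarrow> real" where
  "nbr_matrix p C D = real (card (nbr_isometries p (class_rep C) (class_rep D))) / real (isom_order (class_rep D))"

lemma good_primeI:
  "ternary_lattice M \<Longrightarrow> N \<in> genus M \<Longrightarrow> prime p \<Longrightarrow> p \<notin> bad_primes M \<Longrightarrow> good_prime M N p"
  by (simp add: good_prime_def)

text \<open>A neighbour contains p times the standard lattice but not the standard lattice itself.
  Read through the inverse, these are the hypotheses of
  \<open>isometric_lattice_is_nbr\<close>.\<close>

lemma nbr_isometries_inverse:
  assumes M: "ternary_lattice M" and p: "prime p" "p \<notin> bad_primes M" and N: "N \<in> genus M" and N': "N' \<in> genus M"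
    and s: "\<sigma> \<in> nbr_isometries p N N'"
  shows "finv \<sigma> \<in> nbr_isometries p N' N"
proof -
  interpret a: good_prime M N p by (rule good_primeI) fact+
  interpret b: good_prime M N' p by (rule good_primeI) fact+
  have iso: "space_isometry N' N \<sigma>" and nb: "\<sigma> ` std_lattice \<in> nbrs p N" using s by (auto simp: nbr_isometries_def)
  note inv = space_isometry_inv[OF iso] and simps = space_isometry_inv_simps[OF iso]
  have "finv \<sigma> ` std_lattice \<in> nbrs p N'"
  proof (rule b.isometric_lattice_is_nbr[OF N inv])
    fix x :: "rat ^ 3" assume "x \<in> std_lattice"
    then have "of_nat p *s x \<in> \<sigma> ` std_lattice" by (rule a.nbr_properties(2)[OF nb])
    then have "finv \<sigma> (of_nat p *s x) \<in> std_lattice" using simps(2) by auto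
    then show "of_nat p *s finv \<sigma> x \<in> std_lattice" by (simp add: space_isometry_scale[OF inv])
  next
    show "\<not> finv \<sigma> ` std_lattice \<subseteq> std_lattice"
    proof
      assume *: "finv \<sigma> ` std_lattice \<subseteq> std_lattice"
      have "std_lattice \<subseteq> \<sigma> ` std_lattice"
      proof
        fix x :: "rat ^ 3" assume "x \<in> std_lattice"
        then have "finv \<sigma> x \<in> std_lattice" using * by blast
        then show "x \<in> \<sigma> ` std_lattice" using simps(1)[of x] by (metis imageI)
      qed
      then show False using a.nbr_properties(4)[OF nb] by blast
    qed
  qed
  then show ?thesis using inv by (simp add: nbr_isometries_def)
qed

lemma card_nbr_isometries_sym:
  assumes M: "ternary_lattice M" and p: "prime p" "p \<notin> bad_primes M" and N: "N \<in> genus M" and N': "N' \<in> genus M"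
  shows "card (nbr_isometries p N N') = card (nbr_isometries p N' N)"
proof -
  have bij: "bij \<sigma>" if "\<sigma> \<in> nbr_isometries p N N'" for \<sigma> N N'
    using that by (simp add: nbr_isometries_def space_isometry_def)
  have "bij_betw finv (nbr_isometries p N N') (nbr_isometries p N' N)"
    by (rule bij_betw_byWitness[where f' = finv])
      (use nbr_isometries_inverse[OF M p N N'] nbr_isometries_inverse[OF M p N' N] bij in \<open>auto simp: inv_inv_eq\<close>)
  then show ?thesis by (rule bij_betw_same_card)
qed

context good_prime
begin

lemma finite_nbr_isometries: "finite (nbr_isometries p N N')"
proof (rule finite_subset[OF _ finite_bounded_isometries[OF tN, of "of_nat p" N']])
  show "nbr_isometries p N N' \<subseteq> {\<sigma>. space_isometry N' N \<sigma> \<and> (\<forall>x\<in>std_lattice. of_nat p *s \<sigma> x \<in> std_lattice)}"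
    using nbr_properties(1) by (auto simp: nbr_isometries_def)
qed (use p0 in simp)

text \<open>Two isometries with the same image of the lattice differ by an automorphism of
  N'.\<close>

lemma card_isometries_onto:
  assumes N': "ternary_lattice N'" and t: "space_isometry N' N \<tau>" "\<tau> ` std_lattice = L"
  shows "card {\<sigma>. space_isometry N' N \<sigma> \<and> \<sigma> ` std_lattice = L} = isom_order N'"
proof -
  note ti = space_isometry_inv_simps[OF t(1)] and tinv = space_isometry_inv[OF t(1)]
  have "bij_betw (\<lambda>g x. \<tau> (g x)) {g. lattice_isometry N' N' g} {\<sigma>. space_isometry N' N \<sigma> \<and> \<sigma> ` std_lattice = L}"
  proof (rule bij_betw_byWitness[where f' = "\<lambda>\<sigma> x. finv \<tau> (\<sigma> x)"])
    show "(\<lambda>g x. \<tau> (g x)) ` {g. lattice_isometry N' N' g} \<subseteq> {\<sigma>. space_isometry N' N \<sigma> \<and> \<sigma> ` std_lattice = L}"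
    proof safe
      fix g assume g: "lattice_isometry N' N' g"
      show "space_isometry N' N (\<lambda>x. \<tau> (g x))"
        using g by (intro space_isometry_comp[OF _ t(1)]) (simp add: lattice_isometry_def)
      have "(\<lambda>x. \<tau> (g x)) ` std_lattice = L"
        using g t(2) image_image[of \<tau> g std_lattice] by (simp add: lattice_isometry_def)
      then show "\<And>x. x \<in> std_lattice \<Longrightarrow> \<tau> (g x) \<in> L" "\<And>x. x \<in> L \<Longrightarrow> x \<in> (\<lambda>x. \<tau> (g x)) ` std_lattice" by auto
    qed
    show "(\<lambda>\<sigma> x. finv \<tau> (\<sigma> x)) ` {\<sigma>. space_isometry N' N \<sigma> \<and> \<sigma> ` std_lattice = L} \<subseteq> {g. lattice_isometry N' N' g}"
    proof
      fix g assume "g \<in> (\<lambda>\<sigma> x. finv \<tau> (\<sigma> x)) ` {\<sigma>. space_isometry N' N \<sigma> \<and> \<sigma> ` std_lattice = L}"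
      then obtain \<sigma> where s: "space_isometry N' N \<sigma>" "\<sigma> ` std_lattice = L" "g = (\<lambda>x. finv \<tau> (\<sigma> x))" by blast
      have "g ` std_lattice = finv \<tau> ` L" using s image_image[of "finv \<tau>" \<sigma> std_lattice] by simp
      also have "\<dots> = std_lattice" unfolding t(2)[symmetric] by (simp add: image_image ti)
      finally show "g \<in> {g. lattice_isometry N' N' g}"
        using space_isometry_comp[OF s(1) tinv] s(3) by (simp add: lattice_isometry_def)
    qed
  qed (use ti in auto)
  then show ?thesis unfolding isom_order_def by (rule bij_betw_same_card[symmetric])
qed

lemma nbr_class:
  assumes L: "L \<in> nbrs p N"
  obtains D \<tau> where "D \<in> genus_classes M" "space_isometry (class_rep D) N \<tau>" "\<tau> ` std_lattice = L"
proof -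
  obtain w where w: "admissible p N w" "L = nbr p N w" using L by (auto simp: nbrs_def)
  obtain N' \<sigma> where s: "N' \<in> genus M" "space_isometry N' N \<sigma>" "\<sigma> ` std_lattice = nbr p N w"
    using nbr_isometry[OF w(1)] .
  let ?D = "genus_rel M `` {N'}"
  have D: "?D \<in> genus_classes M" using s(1) by (simp add: genus_classes_eq quotientI)
  obtain \<alpha> where a: "space_isometry (class_rep ?D) N' \<alpha>" "\<alpha> ` std_lattice = std_lattice"
    using class_rep_isometric[OF s(1)] unfolding isometric_def lattice_isometry_def by blast
  have "(\<lambda>x. \<sigma> (\<alpha> x)) ` std_lattice = L" using a(2) s(3) w(2) image_image[of \<sigma> \<alpha> std_lattice] by simp
  then show ?thesis using that[OF D space_isometry_comp[OF a(1) s(2)]] by blast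
qed

lemma nbr_class_unique:
  assumes "D \<in> genus_classes M" "space_isometry (class_rep D) N \<sigma>"
    and "D' \<in> genus_classes M" "space_isometry (class_rep D') N \<tau>" "\<sigma> ` std_lattice = \<tau> ` std_lattice"
  shows "D = D'"
proof -
  note ti = space_isometry_inv_simps[OF assms(4)] and tinv = space_isometry_inv[OF assms(4)]
  have "(\<lambda>x. finv \<tau> (\<sigma> x)) ` std_lattice = finv \<tau> ` (\<tau> ` std_lattice)"
    unfolding assms(5)[symmetric] by (simp add: image_image)
  also have "\<dots> = std_lattice" by (simp add: image_image ti)
  finally have "isometric (class_rep D) (class_rep D')"
    using space_isometry_comp[OF assms(2) tinv] by (auto simp: isometric_def lattice_isometry_def)
  then have "genus_rel M `` {class_rep D} = genus_rel M `` {class_rep D'}"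
    using genus_class_eq_iff[OF class_rep(1)[OF assms(1)] class_rep(1)[OF assms(3)]] by blast
  then show ?thesis using class_rep(2)[OF assms(1)] class_rep(2)[OF assms(3)] by simp
qed

text \<open>The neighbours are sorted by class. Division by the order of the automorphism group
  turns the count of isometries back into a count of neighbours.\<close>

lemma sum_over_nbrs:
  fixes F :: "(rat ^ 3 ^ 3) set \<Rightarrow> real" and g :: "(rat ^ 3) set \<Rightarrow> real"
  assumes Fg: "\<And>D \<sigma>. D \<in> genus_classes M \<Longrightarrow> space_isometry (class_rep D) N \<sigma> \<Longrightarrow>
      \<sigma> ` std_lattice \<in> nbrs p N \<Longrightarrow> F D = g (\<sigma> ` std_lattice)"
  shows "(\<Sum>D\<in>genus_classes M. real (card (nbr_isometries p N (class_rep D))) / real (isom_order (class_rep D)) * F D)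
     = (\<Sum>L\<in>nbrs p N. g L)"
proof -
  define I where "I L D = {\<sigma>. space_isometry (class_rep D) N \<sigma> \<and> \<sigma> ` std_lattice = L}" for L D
  have finI: "finite (I L D)" if "L \<in> nbrs p N" for L D
    by (rule finite_subset[OF _ finite_nbr_isometries[of "class_rep D"]]) (use that in \<open>auto simp: I_def nbr_isometries_def\<close>)
  have card: "card (nbr_isometries p N (class_rep D)) = (\<Sum>L\<in>nbrs p N. card (I L D))" for D
  proof -
    have "nbr_isometries p N (class_rep D) = (\<Union>L\<in>nbrs p N. I L D)" by (auto simp: I_def nbr_isometries_def)
    then show ?thesis using card_UN_disjoint[OF card_nbrs(1), of "\<lambda>L. I L D"] finI by (auto simp: I_def)
  qed
  have "(\<Sum>D\<in>genus_classes M. real (card (nbr_isometries p N (class_rep D))) / real (isom_order (class_rep D)) * F D)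
      = (\<Sum>D\<in>genus_classes M. \<Sum>L\<in>nbrs p N. real (card (I L D)) / real (isom_order (class_rep D)) * F D)"
    by (simp add: card sum_distrib_right sum_divide_distrib)
  also have "\<dots> = (\<Sum>L\<in>nbrs p N. \<Sum>D\<in>genus_classes M. real (card (I L D)) / real (isom_order (class_rep D)) * F D)"
    by (rule sum.swap)
  also have "\<dots> = (\<Sum>L\<in>nbrs p N. g L)"
  proof (rule sum.cong[OF refl])
    fix L assume L: "L \<in> nbrs p N"
    obtain D \<tau> where D: "D \<in> genus_classes M" "space_isometry (class_rep D) N \<tau>" "\<tau> ` std_lattice = L"
      using nbr_class[OF L] .
    have tD: "ternary_lattice (class_rep D)" using genus_ternary[OF class_rep(1)[OF D(1)]] .
    have "real (card (I L D')) / real (isom_order (class_rep D')) * F D' = (if D' = D then g L else 0)"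
      if D': "D' \<in> genus_classes M" for D'
    proof (cases "D' = D")
      case True
      have "card (I L D) = isom_order (class_rep D)" unfolding I_def by (rule card_isometries_onto[OF tD D(2,3)])
      moreover have "F D = g L" using Fg[OF D(1,2)] D(3) L by simp
      ultimately show ?thesis using True isom_order_pos[OF tD] by simp
    next
      case False
      then have "I L D' = {}" using nbr_class_unique[OF D' _ D(1,2)] D(3) by (auto simp: I_def)
      then show ?thesis using False by simp
    qed
    then have "(\<Sum>D'\<in>genus_classes M. real (card (I L D')) / real (isom_order (class_rep D')) * F D')
        = (\<Sum>D'\<in>genus_classes M. if D' = D then g L else 0)" by (intro sum.cong) auto
    then show "(\<Sum>D'\<in>genus_classes M. real (card (I L D')) / real (isom_order (class_rep D')) * F D') = g L"
      using D(1) finite_genus_classes[OF M] by simp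
  qed
  finally show ?thesis .
qed

lemma sum_nbrs_rep_num:
  "(\<Sum>D\<in>genus_classes M. real (card (nbr_isometries p N (class_rep D))) / real (isom_order (class_rep D))
      * real (rep_num n (class_rep D))) = real (\<Sum>L\<in>nbrs p N. lattice_rep N L n)"
proof -
  have "real (rep_num n (class_rep D)) = real (lattice_rep N (\<sigma> ` std_lattice) n)"
    if s: "space_isometry (class_rep D) N \<sigma>" for D \<sigma>
  proof -
    have "{x \<in> \<sigma> ` std_lattice. quad N x = of_int n} = \<sigma> ` {x \<in> std_lattice. quad (class_rep D) x = of_int n}"
      by (auto simp: space_isometry_quad[OF s])
    then show ?thesis unfolding rep_num_def lattice_rep_def
      by (simp add: card_image[OF inj_on_subset[OF space_isometry_inj[OF s] subset_UNIV]])
  qed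
  then show ?thesis
    using sum_over_nbrs[of "\<lambda>D. real (rep_num n (class_rep D))" "\<lambda>L. real (lattice_rep N L n)"] by simp
qed

lemma sum_nbrs_one:
  "(\<Sum>D\<in>genus_classes M. real (card (nbr_isometries p N (class_rep D))) / real (isom_order (class_rep D))) = real p + 1"
  using sum_over_nbrs[of "\<lambda>D. 1" "\<lambda>L. 1"] card_nbrs(2) by simp

end

section \<open>Paths of neighbours from rational isometries with denominator prime to S\<close>

subsection \<open>Connectedness of the genus\<close>

definition good_primes :: "rat ^ 3 ^ 3 \<Rightarrow> nat set" where
  "good_primes M = {p. prime p \<and> p \<notin> bad_primes M}"

abbreviation genus_class :: "rat ^ 3 ^ 3 \<Rightarrow> rat ^ 3 ^ 3 \<Rightarrow> (rat ^ 3 ^ 3) set" where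
  "genus_class M N \<equiv> genus_rel M `` {N}"

definition nbr_edges :: "rat ^ 3 ^ 3 \<Rightarrow> ((rat ^ 3 ^ 3) set \<times> (rat ^ 3 ^ 3) set) set" where
  "nbr_edges M = {(C, D). C \<in> genus_classes M \<and> D \<in> genus_classes M \<and> (\<exists>p\<in>good_primes M. nbr_matrix p C D > 0)}"

lemma genus_class_mem: "N \<in> genus M \<Longrightarrow> genus_class M N \<in> genus_classes M"
  by (simp add: genus_classes_eq quotientI)

text \<open>Edges are defined through class representatives, so \<tau> is composed with isometries
  to them, and the result is recognised as a neighbour by
  \<open>isometric_lattice_is_nbr\<close>.\<close>

lemma nbr_edgeI:
  assumes M: "ternary_lattice M" and p: "prime p" "p \<notin> bad_primes M" and N: "N \<in> genus M" and N': "N' \<in> genus M"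
    and t: "space_isometry N' N \<tau>" "\<tau> ` std_lattice \<in> nbrs p N"
  shows "(genus_class M N, genus_class M N') \<in> nbr_edges M"
proof -
  let ?C = "class_rep (genus_class M N)" and ?D = "class_rep (genus_class M N')"
  have C: "?C \<in> genus M" and D: "?D \<in> genus M" using class_rep(1) genus_class_mem N N' by blast+
  interpret a: good_prime M N p by (rule good_primeI) fact+
  interpret b: good_prime M ?C p by (rule good_primeI) fact+
  obtain \<alpha> where a: "space_isometry ?C N \<alpha>" "\<alpha> ` std_lattice = std_lattice"
    using class_rep_isometric[OF N] unfolding isometric_def lattice_isometry_def by blast
  obtain \<gamma> where g: "space_isometry ?D N' \<gamma>" "\<gamma> ` std_lattice = std_lattice"
    using class_rep_isometric[OF N'] unfolding isometric_def lattice_isometry_def by blast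
  define \<sigma> where "\<sigma> x = finv \<alpha> (\<tau> (\<gamma> x))" for x
  note ai = space_isometry_inv_simps[OF a(1)] and ainv = space_isometry_inv[OF a(1)]
  have s: "space_isometry ?D ?C \<sigma>"
    unfolding \<sigma>_def by (rule space_isometry_comp[OF space_isometry_comp[OF g(1) t(1)] ainv])
  have bck: "finv \<alpha> x \<in> std_lattice" if "x \<in> std_lattice" for x using that a(2) ai(2) by (metis imageE)
  have "\<sigma> ` std_lattice \<in> nbrs p ?C"
  proof (rule b.isometric_lattice_is_nbr[OF D s])
    fix x :: "rat ^ 3" assume x: "x \<in> std_lattice"
    then have "\<tau> (\<gamma> x) \<in> \<tau> ` std_lattice" using g(2) by blast
    then have "of_nat p *s \<tau> (\<gamma> x) \<in> std_lattice" by (rule a.nbr_properties(1)[OF t(2)])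
    then have "finv \<alpha> (of_nat p *s \<tau> (\<gamma> x)) \<in> std_lattice" by (rule bck)
    then show "of_nat p *s \<sigma> x \<in> std_lattice" by (simp add: \<sigma>_def space_isometry_scale[OF ainv])
  next
    show "\<not> \<sigma> ` std_lattice \<subseteq> std_lattice"
    proof
      assume *: "\<sigma> ` std_lattice \<subseteq> std_lattice"
      have "\<tau> ` std_lattice \<subseteq> std_lattice"
      proof
        fix y assume "y \<in> \<tau> ` std_lattice"
        then obtain z where z: "z \<in> std_lattice" "y = \<tau> z" by blast
        then obtain x where x: "x \<in> std_lattice" "z = \<gamma> x" using g(2) by blast
        have "\<sigma> x \<in> std_lattice" using * x(1) by blast
        then have "\<alpha> (\<sigma> x) \<in> std_lattice" using a(2) by blast
        then show "y \<in> std_lattice" using z x by (simp add: \<sigma>_def ai(1))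
      qed
      then show False using a.nbr_properties(3)[OF t(2)] by blast
    qed
  qed
  then have "\<sigma> \<in> nbr_isometries p ?C ?D" using s by (simp add: nbr_isometries_def)
  then have "card (nbr_isometries p ?C ?D) > 0" using b.finite_nbr_isometries by (auto simp: card_gt_0_iff)
  then have "nbr_matrix p (genus_class M N) (genus_class M N') > 0"
    using isom_order_pos[OF genus_ternary[OF D]] by (simp add: nbr_matrix_def)
  then show ?thesis using p genus_class_mem[OF N] genus_class_mem[OF N'] by (auto simp: nbr_edges_def good_primes_def)
qed

text \<open>
  If \<open>p\<close> divides \<open>d\<close>, some \<open>p\<close>-neighbour \<open>L\<close> of the lattice satisfies \<open>(d/p) \<sigma>(\<int>\<^sup>3) \<subseteq> L\<close>.
\<close>

lemma path_by_denominator: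
  assumes M: "ternary_lattice M" and N: "N \<in> genus M"
    and "N0 \<in> genus M" "space_isometry N N0 \<sigma>" "d > 0" "\<forall>q\<in>bad_primes M. \<not> q dvd d"
      "\<forall>x\<in>std_lattice. of_nat d *s \<sigma> x \<in> std_lattice"
  shows "(genus_class M N0, genus_class M N) \<in> (nbr_edges M)\<^sup>*"
  using assms(3-)
proof (induction d arbitrary: N0 \<sigma> rule: less_induct)
  case (less d)
  show ?case
  proof (cases "d = 1")
    case True
    have "\<sigma> ` std_lattice = std_lattice"
    proof (rule isometry_into_imp_onto[OF less.prems(2)])
      show "det N = det N0" using genus_det[OF M] N less.prems(1) by simp
      show "det N0 \<noteq> 0" using ternary_minors_pos(3)[OF genus_ternary[OF less.prems(1)]] by simp
      show "\<sigma> x \<in> std_lattice" if "x \<in> std_lattice" for x using bspec[OF less.prems(5) that] True by simp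
    qed
    then have "isometric N N0" using less.prems(2) by (auto simp: isometric_def lattice_isometry_def)
    then have "genus_class M N = genus_class M N0" using genus_class_eq_iff[OF N less.prems(1)] by blast
    then show ?thesis by simp
  next
    case False
    then obtain p where p: "prime p" "p dvd d" using prime_factor_nat by blast
    then obtain d' where d': "d = p * d'" by (auto elim: dvdE)
    have p0: "p > 1" using p prime_gt_1_nat by blast
    have good: "p \<notin> bad_primes M" using less.prems(4) p by blast
    have d'0: "d' > 0" "d' < d" using d' less.prems(3) p0 by (auto intro: Nat.gr0I)
    have d'good: "\<forall>q\<in>bad_primes M. \<not> q dvd d'" using less.prems(4) d' by auto
    show ?thesis
    proof (cases "\<forall>x\<in>std_lattice. of_nat d' *s \<sigma> x \<in> std_lattice")
      case True
      then show ?thesis using less.IH[OF d'0(2) less.prems(1,2) d'0(1) d'good] by blast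
    next
      case False
      \<comment> \<open>The vector d \<sigma> x0 is integral but not divisible by p, so it defines a
        neighbour; this neighbour contains d' \<sigma> x for every lattice vector x. Seen from it,
        the denominator is d'.\<close>
      then obtain x0 where x0: "x0 \<in> std_lattice" "of_nat d' *s \<sigma> x0 \<notin> std_lattice" by blast
      note p_dvd = p and tN' = genus_ternary[OF N]
      interpret good_prime M N0 p by (rule good_primeI) fact+
      have scal: "of_nat p *s (of_nat d' *s \<sigma> x) = of_nat d *s \<sigma> x" for x
        by (simp add: vector_smult_assoc d')
      obtain w where w: "of_nat d *s \<sigma> x0 = rvec w" using std_lattice_rvec bspec[OF less.prems(5) x0(1)] by blast
      have pair: "int p ^ 2 dvd \<beta> u u'" if x: "x \<in> std_lattice" "of_nat d *s \<sigma> x = rvec u"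
        and y: "y \<in> std_lattice" "of_nat d *s \<sigma> y = rvec u'" for x y u u'
      proof -
        obtain a b where ab: "x = rvec a" "y = rvec b" using std_lattice_rvec x y by blast
        have "(of_int (\<beta> u u') :: rat) = of_nat d ^ 2 * (2 * bilin N x y)"
          unfolding bform_gint[OF tN] x(2)[symmetric] y(2)[symmetric]
          by (simp add: bilin_linear space_isometry_bilin[OF less.prems(2)] power2_eq_square)
        also have "2 * bilin N x y = of_int (bform (gint N) a b)" by (simp add: bform_gint[OF tN'] ab)
        finally have "(of_int (\<beta> u u') :: rat) = of_int (int p ^ 2 * (int d' ^ 2 * bform (gint N) a b))"
          by (simp add: d' power_mult_distrib)
        then have "\<beta> u u' = int p ^ 2 * (int d' ^ 2 * bform (gint N) a b)" by (simp only: of_int_eq_iff)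
        then show ?thesis by simp
      qed
      have "\<not> vdvd (int p) w"
      proof
        assume "vdvd (int p) w"
        then obtain f where "w = int p *s f" using vdvd_obtain by blast
        then have "of_nat p *s (of_nat d' *s \<sigma> x0) = of_nat p *s rvec f" unfolding scal w by (simp add: rvec_linear)
        then have "of_nat d' *s \<sigma> x0 = rvec f" using p0 by (simp only: vector_mul_lcancel) simp
        then show False using x0(2) by simp
      qed
      then have adm: "admissible p N0 w" using pair[OF x0(1) w x0(1) w] by (simp add: admissible_def)
      obtain N1 \<tau> where t: "N1 \<in> genus M" "space_isometry N1 N0 \<tau>" "\<tau> ` std_lattice = nbr p N0 w"
        using nbr_isometry[OF adm] .
      note ti = space_isometry_inv_simps[OF t(2)] and tinv = space_isometry_inv[OF t(2)]
      have "(genus_class M N0, genus_class M N1) \<in> nbr_edges M"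
        by (rule nbr_edgeI[OF M p_dvd(1) good less.prems(1) t(1,2)]) (use t(3) adm in \<open>auto simp: nbrs_def\<close>)
      moreover have "(genus_class M N1, genus_class M N) \<in> (nbr_edges M)\<^sup>*"
      proof (rule less.IH[OF d'0(2) t(1) space_isometry_comp[OF less.prems(2) tinv] d'0(1) d'good], intro ballI)
        fix x :: "rat ^ 3" assume x: "x \<in> std_lattice"
        obtain u where u: "of_nat d *s \<sigma> x = rvec u" using std_lattice_rvec bspec[OF less.prems(5) x] by blast
        have "of_nat d' *s \<sigma> x \<in> nbr p N0 w"
          unfolding nbr_def using pair[OF x u x u] pair[OF x u x0(1) w] u scal[of x] by auto
        then have "finv \<tau> (of_nat d' *s \<sigma> x) \<in> std_lattice" using t(3) ti(2) by (metis imageE)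
        then show "of_nat d' *s finv \<tau> (\<sigma> x) \<in> std_lattice" by (simp add: space_isometry_scale[OF tinv])
      qed
      ultimately show ?thesis by (rule converse_rtrancl_into_rtrancl)
    qed
  qed
qed

lemma finite_bad_primes:
  assumes "ternary_lattice M"
  shows "finite (bad_primes M)"
proof -
  have "four_disc M \<noteq> 0" using four_disc_eq[OF assms] ternary_minors_pos(3)[OF assms] by auto
  then have "finite {k. k dvd four_disc M}" by (rule finite_divisors_int)
  then have "finite (int -` {k. k dvd four_disc M})" by (rule finite_vimageI) simp
  then have "finite (insert 2 (int -` {k. k dvd four_disc M}))" by simp
  then show ?thesis by (rule finite_subset[rotated]) (auto simp: bad_primes_def)
qed

text \<open>Weak approximation gives an isometry to M whose denominator has prime factors outside S
  only. Removing them one by one is a path from the class of M, and the symmetry of the edges joins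
  two such paths.\<close>

theorem genus_connected:
  assumes M: "ternary_lattice M" and rep: "represents M 1"
    and C: "C \<in> genus_classes M" and D: "D \<in> genus_classes M"
  shows "(C, D) \<in> (nbr_edges M)\<^sup>*"
proof -
  obtain v where v: "v \<in> std_lattice" "quad M v = 1" using rep by (auto simp: represents_def)
  let ?M = "genus_class M M"
  have to: "(?M, C) \<in> (nbr_edges M)\<^sup>*" if C: "C \<in> genus_classes M" for C
  proof -
    obtain N where N: "N \<in> genus M" "C = genus_class M N" using C unfolding genus_classes_eq by (rule quotientE)
    have bp: "\<forall>q\<in>bad_primes M. prime q" by (simp add: bad_primes_def)
    obtain \<sigma> where s: "space_isometry N M \<sigma>" "\<forall>q\<in>bad_primes M. locally_integral q \<sigma>"
      using weak_approximation[OF M v N(1) finite_bad_primes[OF M] bp] by blast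
    obtain d where d: "d > 0" "\<And>q. q \<in> bad_primes M \<Longrightarrow> \<not> int q dvd d"
      "\<And>x. x \<in> std_lattice \<Longrightarrow> of_int d *s \<sigma> x \<in> std_lattice"
      using common_denominator[OF s(1) bp s(2)] by blast
    have "(?M, genus_class M N) \<in> (nbr_edges M)\<^sup>*"
    proof (rule path_by_denominator[OF M N(1) genus_self[OF M] s(1), of "nat d"])
      show "\<forall>q\<in>bad_primes M. \<not> q dvd nat d" using d(1,2) by (metis int_dvd_int_iff nat_0_le less_imp_le)
      show "\<forall>x\<in>std_lattice. of_nat (nat d) *s \<sigma> x \<in> std_lattice" using d(1,3) by simp
    qed (use d in simp)
    then show ?thesis using N by simp
  qed
  have "sym (nbr_edges M)"
  proof (rule symI)
    fix A B assume "(A, B) \<in> nbr_edges M"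
    then obtain p where AB: "A \<in> genus_classes M" "B \<in> genus_classes M" "p \<in> good_primes M" "nbr_matrix p A B > 0"
      by (auto simp: nbr_edges_def)
    have "card (nbr_isometries p (class_rep A) (class_rep B)) = card (nbr_isometries p (class_rep B) (class_rep A))"
      using AB by (intro card_nbr_isometries_sym[OF M] class_rep(1)) (auto simp: good_primes_def)
    then have "nbr_matrix p B A > 0"
      using AB isom_order_pos[OF genus_ternary[OF class_rep(1)[OF AB(1)]]]
      by (auto simp: nbr_matrix_def zero_less_divide_iff)
    then show "(B, A) \<in> nbr_edges M" using AB by (auto simp: nbr_edges_def)
  qed
  then have "(C, ?M) \<in> (nbr_edges M)\<^sup>*" using to[OF C] by (meson sym_rtrancl symD)
  then show ?thesis using to[OF D] by (rule rtrancl_trans)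
qed

section \<open>The recursion satisfied by the factors h_p and their product\<close>

subsection \<open>The local factors\<close>

definition h_product :: "rat ^ 3 ^ 3 \<Rightarrow> nat \<Rightarrow> rat" where
  "h_product M n = (\<Prod>p\<in>prime_factors n - bad_primes M. h_factor M p (multiplicity p n))"

abbreviation chi :: "rat ^ 3 ^ 3 \<Rightarrow> nat \<Rightarrow> rat" where
  "chi M p \<equiv> of_int (Legendre (- four_disc M) (int p))"

lemma h_factor_0: "prime p \<Longrightarrow> h_factor M p 0 = 1"
  using prime_gt_1_nat[of p] by (simp add: h_factor_def)

lemma h_factor_1: "prime p \<Longrightarrow> h_factor M p 1 = of_nat p + 1 - chi M p"
  using prime_gt_1_nat[of p] by (simp add: h_factor_def field_simps power2_eq_square)

text \<open>As a function of l, \<open>h_factor\<close> is a combination of p^l and 1, the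
  characteristic roots of X^2 - (p + 1) X + p.\<close>

lemma h_factor_Suc_Suc:
  assumes "prime p"
  shows "h_factor M p (Suc (Suc l)) = (of_nat p + 1) * h_factor M p (Suc l) - of_nat p * h_factor M p l"
proof -
  have "(of_nat p :: rat) - 1 \<noteq> 0" using prime_gt_1_nat[OF assms] by simp
  then have "h_factor M p k = (of_nat p ^ (k + 1) - 1 - chi M p * (of_nat p ^ k - 1)) / (of_nat p - 1)" for k
    unfolding h_factor_def by (simp add: diff_divide_distrib right_diff_distrib)
  then show ?thesis by (simp add: diff_divide_distrib[symmetric]) (simp add: algebra_simps)
qed

text \<open>The constant collects the factors at the primes other than p, which do not depend on
  l.\<close>

lemma h_product_split:
  assumes p: "p \<in> good_primes M" and n: "n > 0"
  shows "\<exists>c. \<forall>l. h_product M (p ^ l * (n div p ^ multiplicity p n)) = h_factor M p l * c"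
proof -
  have pp: "prime p" "p \<notin> bad_primes M" using p by (auto simp: good_primes_def)
  define m where "m = n div p ^ multiplicity p n"
  have nm: "n = p ^ multiplicity p n * m" by (simp add: m_def multiplicity_dvd)
  have m0: "m > 0" using n nm by (cases "m = 0") auto
  have pm: "\<not> p dvd m" unfolding m_def using multiplicity_decompose[of n p] n pp(1) by (auto simp: prime_nat_iff)
  define c where "c = h_product M m"
  have "h_product M (p ^ l * m) = h_factor M p l * c" for l
  proof (cases "l = 0")
    case True
    then show ?thesis using pp by (simp add: c_def h_factor_0)
  next
    case False
    have pf: "prime_factors (p ^ l * m) - bad_primes M = insert p (prime_factors m - bad_primes M)"
      using False pp m0 prime_gt_0_nat[OF pp(1)]
      by (auto simp: prime_factors_product prime_factors_power prime_prime_factors)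
    have np: "p \<notin> prime_factors m - bad_primes M" using pm by (auto simp: in_prime_factors_iff)
    have "multiplicity p (p ^ l * m) = l"
      using pp(1) pm m0 by (simp add: prime_elem_multiplicity_mult_distrib not_dvd_imp_multiplicity_0)
    moreover have "multiplicity q (p ^ l * m) = multiplicity q m" if "q \<in> prime_factors m - bad_primes M" for q
    proof -
      have q: "prime q" "q \<noteq> p" using that np by auto
      have "\<not> q dvd p ^ l" using q pp(1) by (metis prime_dvd_power primes_dvd_imp_eq)
      then show ?thesis
        using q pp(1) m0 prime_gt_0_nat[OF pp(1)] by (simp add: prime_elem_multiplicity_mult_distrib not_dvd_imp_multiplicity_0)
    qed
    ultimately show ?thesis
      unfolding h_product_def pf c_def using np by (simp add: prod.insert)
  qed
  then show ?thesis unfolding m_def by blast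
qed

text \<open>This is the Hecke relation with the sum over neighbours replaced by the eigenvalue p +
  1. The case of p prime to n comes from the initial values at exponents 0 and 1.\<close>

theorem h_product_recursion:
  assumes p: "p \<in> good_primes M" and n: "n > 0"
  shows "h_product M (p * n) = (of_nat p + 1) * h_product M n -
    (if p dvd n then of_nat p * h_product M (n div p) else chi M p * h_product M n)"
proof -
  have pp: "prime p" using p by (auto simp: good_primes_def)
  define m where "m = n div p ^ multiplicity p n"
  obtain c where c: "\<And>l. h_product M (p ^ l * m) = h_factor M p l * c"
    using h_product_split[OF p n] unfolding m_def by blast
  define l where "l = multiplicity p n"
  have nm: "n = p ^ l * m" by (simp add: m_def l_def multiplicity_dvd)
  have 1: "h_product M n = h_factor M p l * c" unfolding nm by (rule c)
  have 2: "h_product M (p * n) = h_factor M p (Suc l) * c" using c[of "Suc l"] by (simp add: nm mult.assoc)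
  show ?thesis
  proof (cases "p dvd n")
    case False
    then have "l = 0" by (simp add: l_def not_dvd_imp_multiplicity_0)
    then have "h_product M n = c" "h_product M (p * n) = (of_nat p + 1 - chi M p) * c"
      using 1 2 h_factor_0[OF pp] h_factor_1[OF pp] by simp_all
    then show ?thesis using False by (simp add: algebra_simps)
  next
    case True
    then have "l \<noteq> 0" using n pp by (metis l_def multiplicity_eq_zero_iff not_prime_unit not_gr_zero)
    then obtain k where k: "l = Suc k" using not0_implies_Suc by blast
    have "n div p = p ^ k * m" using nm k prime_gt_0_nat[OF pp] by (simp add: mult.assoc)
    then have 3: "h_product M (n div p) = h_factor M p k * c" using c by simp
    show ?thesis using True 1 2 3 h_factor_Suc_Suc[OF pp, of M k] k by (simp add: algebra_simps)
  qed
qed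

lemma h_product_bad: "prime_factors n \<subseteq> bad_primes M \<Longrightarrow> h_product M n = 1"
  by (auto simp: h_product_def Diff_eq_empty_iff[THEN iffD2])

section \<open>Averages as Hecke eigenvectors, and the equivalence\<close>

subsection \<open>Averages over the genus\<close>

locale genus_walk =
  fixes M :: "rat ^ 3 ^ 3"
  assumes M: "ternary_lattice M" and rep: "represents M 1"
begin

abbreviation "X \<equiv> genus_classes M"

definition mass :: "(rat ^ 3 ^ 3) set \<Rightarrow> real" where
  "mass C = 1 / real (isom_order (class_rep C))"

definition reps :: "nat \<Rightarrow> (rat ^ 3 ^ 3) set \<Rightarrow> real" where
  "reps m C = real (rep_num (int m ^ 2) (class_rep C))"

lemma rep_ternary: "C \<in> X \<Longrightarrow> ternary_lattice (class_rep C)"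
  by (rule genus_ternary[OF class_rep(1)])

lemma good_prime_class: "C \<in> X \<Longrightarrow> p \<in> good_primes M \<Longrightarrow> good_prime M (class_rep C) p"
  using M class_rep(1) by (intro good_primeI) (auto simp: good_primes_def)

sublocale reversible_walk nbr_matrix "\<lambda>p. real p + 1" X "good_primes M" mass
proof
  show "finite X" by (rule finite_genus_classes[OF M])
  show "mass C > 0" if "C \<in> X" for C using isom_order_pos[OF rep_ternary[OF that]] by (simp add: mass_def)
  show "nbr_matrix p C D \<ge> 0" for p C D by (simp add: nbr_matrix_def)
  show "(\<Sum>D\<in>X. nbr_matrix p C D) = real p + 1" if p: "p \<in> good_primes M" and C: "C \<in> X" for p C
  proof -
    interpret good_prime M "class_rep C" p by (rule good_prime_class[OF C p])
    show ?thesis using sum_nbrs_one by (simp add: nbr_matrix_def)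
  qed
  show "real p + 1 > 0" for p by simp
  show "mass C * nbr_matrix p C D = mass D * nbr_matrix p D C"
    if p: "p \<in> good_primes M" and C: "C \<in> X" "D \<in> X" for p C D
  proof -
    have "card (nbr_isometries p (class_rep C) (class_rep D)) = card (nbr_isometries p (class_rep D) (class_rep C))"
      using p C by (intro card_nbr_isometries_sym[OF M] class_rep(1)) (auto simp: good_primes_def)
    then show ?thesis by (simp add: mass_def nbr_matrix_def)
  qed
qed

lemma edges_eq: "edges = nbr_edges M"
  by (auto simp: edges_def nbr_edges_def)

lemma hecke_classes:
  assumes p: "p \<in> good_primes M" and C: "C \<in> X"
  shows "(\<Sum>D\<in>X. nbr_matrix p C D * reps m D) = reps (p * m) C +
    (if p dvd m then real p * reps (m div p) C else of_rat (chi M p) * reps m C)"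
proof -
  interpret good_prime M "class_rep C" p by (rule good_prime_class[OF C p])
  have "(\<Sum>D\<in>X. nbr_matrix p C D * reps m D) = real_of_int (int (\<Sum>L\<in>nbrs p (class_rep C). lattice_rep (class_rep C) L (int m ^ 2)))"
    using sum_nbrs_rep_num[of "int m ^ 2"] by (simp add: nbr_matrix_def reps_def)
  then show ?thesis unfolding hecke_relation by (simp add: reps_def power_mult_distrib)
qed

text \<open>The weighted sum without the normalising factor \<open>1 / genus_mass M\<close>.\<close>

definition avg :: "nat \<Rightarrow> real" where
  "avg m = (\<Sum>C\<in>X. mass C * reps m C)"

text \<open>Self-adjointness moves the neighbour operator to the constants, where it is
  multiplication by p + 1; the Hecke relation evaluates the same sum class by class.\<close>

lemma avg_recursion:
  assumes p: "p \<in> good_primes M"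
  shows "avg (p * m) = (real p + 1) * avg m - (if p dvd m then real p * avg (m div p) else of_rat (chi M p) * avg m)"
proof -
  have "(real p + 1) * avg m = (\<Sum>C\<in>X. mass C * (\<Sum>D\<in>X. nbr_matrix p C D * reps m D))"
    unfolding avg_def by (rule sum_apply_reversible[OF p, symmetric])
  also have "\<dots> = (\<Sum>C\<in>X. mass C * (reps (p * m) C +
      (if p dvd m then real p * reps (m div p) C else of_rat (chi M p) * reps m C)))"
    by (intro sum.cong refl) (simp add: hecke_classes[OF p])
  also have "\<dots> = avg (p * m) + (if p dvd m then real p * avg (m div p) else of_rat (chi M p) * avg m)"
    by (simp add: avg_def distrib_left sum.distrib sum_distrib_left mult.left_commute)
  finally show ?thesis by simp
qed

text \<open>Strong induction on \<open>n2\<close>: when p divides k, the recursion for p k refers to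
  both k and k / p. The induction removes only primes outside S, so \<open>n1\<close> stays
  fixed.\<close>

lemma avg_h_product:
  assumes "n1 > 0" "n2 > 0" "prime_factors n1 \<subseteq> bad_primes M" "\<forall>p\<in>bad_primes M. coprime n2 p"
  shows "avg (n1 * n2) = avg n1 * of_rat (h_product M (n1 * n2))"
  using assms(2,4)
proof (induction n2 rule: less_induct)
  case (less n2)
  show ?case
  proof (cases "n2 = 1")
    case True
    then show ?thesis using h_product_bad[OF assms(3)] by simp
  next
    case False
    then obtain p where p: "prime p" "p dvd n2" using prime_factor_nat by blast
    then obtain k where k: "n2 = p * k" by (auto elim: dvdE)
    have gp: "p \<in> good_primes M"
      using p less.prems(2) coprime_common_divisor_nat[of n2 p p] by (auto simp: good_primes_def)
    have k0: "k > 0" "k < n2" using k less.prems(1) prime_gt_1_nat[OF p(1)] by (auto intro: Nat.gr0I)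
    have kc: "\<forall>q\<in>bad_primes M. coprime k q" using less.prems(2) k by auto
    have IH: "avg (n1 * k) = avg n1 * of_rat (h_product M (n1 * k))" by (rule less.IH[OF k0(2,1) kc])
    have "\<not> p dvd n1"
    proof
      assume "p dvd n1"
      then have "p \<in> prime_factors n1" using p(1) assms(1) by (simp add: in_prime_factors_iff)
      then show False using assms(3) gp by (auto simp: good_primes_def)
    qed
    then have dvd: "p dvd n1 * k \<longleftrightarrow> p dvd k" using p(1) by (simp add: prime_dvd_mult_iff)
    have IH': "avg (n1 * k div p) = avg n1 * of_rat (h_product M (n1 * k div p))" if pk: "p dvd k"
    proof -
      obtain j where j: "k = p * j" using pk by (rule dvdE)
      have j0: "j > 0" "j < k" using j k0 prime_gt_1_nat[OF p(1)] by (auto intro: Nat.gr0I)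
      then have "j < n2" using k0(2) by simp
      have "\<forall>q\<in>bad_primes M. coprime j q" using kc j by auto
      from less.IH[OF \<open>j < n2\<close> j0(1) this] show ?thesis using j prime_gt_0_nat[OF p(1)] by (simp add: mult.left_commute)
    qed
    have nk: "n1 * n2 = p * (n1 * k)" by (simp add: k)
    have pos: "n1 * k > 0" using assms(1) k0 by simp
    show ?thesis
      unfolding nk avg_recursion[OF gp] h_product_recursion[OF gp pos]
      using IH IH' dvd by (simp add: of_rat_diff of_rat_mult of_rat_add algebra_simps)
  qed
qed

lemma mass_sum: "(\<Sum>C\<in>X. mass C) = of_rat (genus_mass M)"
  by (simp add: genus_mass_def mass_def of_rat_sum of_rat_divide)

lemma genus_mass_pos: "genus_mass M > 0"
proof -
  have "genus_class M M \<in> X" by (rule genus_class_mem[OF genus_self[OF M]])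
  then have "(\<Sum>C\<in>X. mass C) > 0" using finX mu_pos by (intro sum_pos) auto
  then show ?thesis by (simp add: mass_sum)
qed

lemma genus_rep_num_avg: "of_rat (genus_rep_num (int m ^ 2) M) * of_rat (genus_mass M) = avg m"
proof -
  have "genus_rep_num (int m ^ 2) M * genus_mass M =
      (\<Sum>C\<in>X. of_nat (rep_num (int m ^ 2) (class_rep C)) / of_nat (isom_order (class_rep C)))"
    using genus_mass_pos by (simp add: genus_rep_num_def)
  from arg_cong[OF this, of "of_rat :: rat \<Rightarrow> real"] show ?thesis
    by (simp add: avg_def mass_def reps_def of_rat_mult of_rat_sum of_rat_divide)
qed

lemma rep_num_eq_genus_iff:
  "of_nat (rep_num (int m ^ 2) M) = genus_rep_num (int m ^ 2) M \<longleftrightarrow>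
   real (rep_num (int m ^ 2) M) * of_rat (genus_mass M) = avg m"
proof -
  have "of_nat (rep_num (int m ^ 2) M) = genus_rep_num (int m ^ 2) M \<longleftrightarrow>
      (of_rat (of_nat (rep_num (int m ^ 2) M)) :: real) = of_rat (genus_rep_num (int m ^ 2) M)"
    by (simp only: of_rat_eq_iff)
  then show ?thesis using genus_mass_pos by (simp add: genus_rep_num_avg[symmetric])
qed

abbreviation "C0 \<equiv> genus_class M M"

lemma C0: "C0 \<in> X" "reps m C0 = real (rep_num (int m ^ 2) M)"
proof -
  show "C0 \<in> X" by (rule genus_class_mem[OF genus_self[OF M]])
  show "reps m C0 = real (rep_num (int m ^ 2) M)"
    unfolding reps_def using rep_num_isometric[OF class_rep_isometric[OF genus_self[OF M]]] by simp
qed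

text \<open>By the Hecke relation this space is stable under all neighbour operators.\<close>

inductive_set hecke_span :: "nat \<Rightarrow> ((rat ^ 3 ^ 3) set \<Rightarrow> real) set" for n1 :: nat where
  base: "k > 0 \<Longrightarrow> \<forall>p\<in>bad_primes M. coprime k p \<Longrightarrow> (\<And>C. C \<in> X \<Longrightarrow> g C = reps (n1 * k) C) \<Longrightarrow> g \<in> hecke_span n1"
| comb: "g \<in> hecke_span n1 \<Longrightarrow> h \<in> hecke_span n1 \<Longrightarrow> (\<And>C. C \<in> X \<Longrightarrow> f C = a * g C + b * h C) \<Longrightarrow> f \<in> hecke_span n1"

text \<open>Strong s-regularity says that on generators the value at \<open>C0\<close> is
  proportional to \<open>h_product\<close>. The recursion of \<open>h_product\<close> then becomes
  the eigenvalue equation with p + 1 at \<open>C0\<close>, which the lazy step turns into invariance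
  of the value. Both claims pass to linear combinations.\<close>

lemma regular_hecke_span:
  assumes reg: "strongly_s_regular M" and n1: "n1 > 0" "prime_factors n1 \<subseteq> bad_primes M"
    and p: "p \<in> good_primes M" and g: "g \<in> hecke_span n1"
  shows "step p g \<in> hecke_span n1 \<and> step p g C0 = g C0"
proof -
  have pp: "prime p" "p \<notin> bad_primes M" using p by (auto simp: good_primes_def)
  have val: "reps (n1 * k) C0 = reps n1 C0 * of_rat (h_product M (n1 * k))"
    if k: "k > 0" "\<forall>q\<in>bad_primes M. coprime k q" for k
  proof -
    have "of_nat (rep_num (int n1 ^ 2 * int k ^ 2) M) = of_nat (rep_num (int n1 ^ 2) M) * h_product M (n1 * k)"
      unfolding h_product_def using n1 k
      by (intro reg[unfolded strongly_s_regular_def, THEN conjunct2, rule_format]) auto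
    from arg_cong[OF this, of "of_rat :: rat \<Rightarrow> real"] show ?thesis
      by (simp add: C0(2) of_rat_mult power_mult_distrib)
  qed
  show ?thesis using g
  proof induction
    case (base k g)
    have pn1: "\<not> p dvd n1"
    proof
      assume "p dvd n1"
      then have "p \<in> prime_factors n1" using pp(1) n1(1) by (simp add: in_prime_factors_iff)
      then show False using n1(2) pp(2) by auto
    qed
    then have dvd: "p dvd n1 * k \<longleftrightarrow> p dvd k" using pp(1) by (simp add: prime_dvd_mult_iff)
    have cop: "\<forall>q\<in>bad_primes M. coprime p q"
      using pp by (metis (no_types, lifting) bad_primes_def mem_Collect_eq primes_coprime)
    have p1: "real p + 1 \<noteq> 0" by linarith
    define a where "a = 1 / (2 * (real p + 1))"
    \<comment> \<open>\<open>k'\<close> and \<open>b\<close> merge the two cases of the Hecke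
      relation: k / p with coefficient p, or k itself with coefficient
      \<open>chi M p\<close>.\<close>
    define k' where "k' = (if p dvd k then k div p else k)"
    define b where "b = (if p dvd k then real p else of_rat (chi M p))"
    have k': "k' > 0" "\<forall>q\<in>bad_primes M. coprime k' q"
    proof -
      have "k' dvd k" by (auto simp: k'_def div_dvd_iff_mult)
      then show "k' > 0" "\<forall>q\<in>bad_primes M. coprime k' q"
        using base(1,2) by (auto intro: Nat.gr0I dest: coprime_divisors[OF _ dvd_refl])
    qed
    have rec: "(\<Sum>D\<in>X. nbr_matrix p C D * g D) = reps (n1 * (p * k)) C + b * reps (n1 * k') C" if C: "C \<in> X" for C
    proof -
      have "(\<Sum>D\<in>X. nbr_matrix p C D * g D) = (\<Sum>D\<in>X. nbr_matrix p C D * reps (n1 * k) D)"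
        using base(3) by (intro sum.cong) auto
      then show ?thesis unfolding hecke_classes[OF p C] dvd b_def k'_def
        by (simp add: mult.left_commute div_mult_swap)
    qed
    have st: "step p g C = 1 / 2 * g C + a * (reps (n1 * (p * k)) C + b * reps (n1 * k') C)" if C: "C \<in> X" for C
      unfolding lazy_step_def rec[OF C] a_def by (simp add: field_simps)
    have pk: "p * k > 0" "\<forall>q\<in>bad_primes M. coprime (p * k) q"
      using base(1,2) cop prime_gt_0_nat[OF pp(1)] by auto
    have g: "g \<in> hecke_span n1" by (rule hecke_span.base[OF base(1,2)]) (use base(3) in auto)
    have f1: "reps (n1 * (p * k)) \<in> hecke_span n1" by (rule hecke_span.base[OF pk]) simp
    have f2: "reps (n1 * k') \<in> hecke_span n1" by (rule hecke_span.base[OF k']) simp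
    have f3: "(\<lambda>C. reps (n1 * (p * k)) C + b * reps (n1 * k') C) \<in> hecke_span n1"
      by (rule hecke_span.comb[OF f1 f2, of _ 1 b]) simp
    have 1: "step p g \<in> hecke_span n1"
      by (rule hecke_span.comb[OF g f3, of _ "1 / 2" a]) (rule st)
    have eigen: "reps (n1 * (p * k)) C0 + b * reps (n1 * k') C0 = (real p + 1) * reps (n1 * k) C0"
    proof -
      have pos: "n1 * k > 0" using n1 base(1) by simp
      have nk: "n1 * (p * k) = p * (n1 * k)" by simp
      have "of_rat (h_product M (n1 * (p * k))) + b * of_rat (h_product M (n1 * k')) =
          (real p + 1) * of_rat (h_product M (n1 * k))"
        unfolding b_def k'_def nk h_product_recursion[OF p pos] dvd
        by (auto simp: of_rat_diff of_rat_mult of_rat_add div_mult_swap)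
      from arg_cong[OF this, of "\<lambda>z. reps n1 C0 * z"] show ?thesis
        unfolding val[OF pk] val[OF k'] val[OF base(1,2)] by (simp add: algebra_simps)
    qed
    have cancel: "1 / (2 * q) * (q * z) = z / 2" if "q \<noteq> 0" for q z :: real using that by simp
    have "step p g C0 = g C0"
      unfolding st[OF C0(1)] base(3)[OF C0(1)] a_def eigen cancel[OF p1] by simp
    with 1 show ?case by blast
  next
    case (comb g h f a b)
    have st: "step p f C = a * step p g C + b * step p h C" if C: "C \<in> X" for C
    proof -
      have "(\<Sum>D\<in>X. nbr_matrix p C D * f D) = (\<Sum>D\<in>X. nbr_matrix p C D * (a * g D + b * h D))"
        using comb(3) by (intro sum.cong) auto
      also have "\<dots> = a * (\<Sum>D\<in>X. nbr_matrix p C D * g D) + b * (\<Sum>D\<in>X. nbr_matrix p C D * h D)"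
        by (simp add: sum_distrib_left sum.distrib algebra_simps)
      finally have "(\<Sum>D\<in>X. nbr_matrix p C D * f D) = \<dots>" .
      then show ?thesis unfolding lazy_step_def comb(3)[OF C] by (simp add: add_divide_distrib distrib_left)
    qed
    have "step p f \<in> hecke_span n1"
      by (rule hecke_span.comb[of "step p g" n1 "step p h" _ a b]) (use comb st in auto)
    moreover have "step p f C0 = f C0" unfolding st[OF C0(1)] comb(3)[OF C0(1)] using comb by simp
    ultimately show ?case by blast
  qed
qed

lemma S_part_decomposition:
  assumes "m > 0"
  obtains n1 n2 where "m = n1 * n2" "prime_factors n1 \<subseteq> bad_primes M" "\<forall>p\<in>bad_primes M. coprime n2 p"
proof -
  have "\<exists>n1 n2. m = n1 * n2 \<and> prime_factors n1 \<subseteq> bad_primes M \<and> (\<forall>p\<in>bad_primes M. coprime n2 p)"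
    using assms
  proof (induction m rule: less_induct)
    case (less m)
    show ?case
    proof (cases "\<exists>p\<in>bad_primes M. p dvd m")
      case False
      have "coprime m p" if "p \<in> bad_primes M" for p
        using False that by (auto simp: bad_primes_def coprime_commute[of m] intro!: prime_imp_coprime)
      then show ?thesis by (intro exI[of _ 1] exI[of _ m]) auto
    next
      case True
      then obtain p where p: "p \<in> bad_primes M" "p dvd m" by blast
      then obtain k where k: "m = p * k" by (auto elim: dvdE)
      have pp: "prime p" using p by (simp add: bad_primes_def)
      have "k < m" "k > 0" using k less.prems prime_gt_1_nat[OF pp] by (auto intro: Nat.gr0I)
      then obtain n1 n2 where n: "k = n1 * n2" "prime_factors n1 \<subseteq> bad_primes M" "\<forall>p\<in>bad_primes M. coprime n2 p"
        using less.IH by blast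
      have "n1 \<noteq> 0" using n(1) \<open>k > 0\<close> by auto
      then have "prime_factors (p * n1) \<subseteq> bad_primes M"
        using n(2) p(1) pp prime_gt_0_nat[OF pp] by (auto simp: prime_factors_product prime_prime_factors)
      then show ?thesis using n k by (intro exI[of _ "p * n1"] exI[of _ n2]) auto
    qed
  qed
  then show ?thesis using that by blast
qed

theorem regular_iff_genus:
  "strongly_s_regular M \<longleftrightarrow> (\<forall>n::int. of_nat (rep_num (n ^ 2) M) = genus_rep_num (n ^ 2) M)"
proof
  assume reg: "strongly_s_regular M"
  show "\<forall>n::int. of_nat (rep_num (n ^ 2) M) = genus_rep_num (n ^ 2) M"
  proof
    fix n :: int
    define m where "m = nat \<bar>n\<bar>"
    have nm: "n ^ 2 = int m ^ 2" by (simp add: m_def)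
    show "of_nat (rep_num (n ^ 2) M) = genus_rep_num (n ^ 2) M"
      unfolding nm rep_num_eq_genus_iff
    proof (cases "m = 0")
      \<comment> \<open>Strong s-regularity speaks of positive n only; for n = 0 every lattice has
        exactly one representation.\<close>
      case True
      have "rep_num 0 N = 1" if "ternary_lattice N" for N
      proof -
        have "{x \<in> std_lattice. quad N x = of_int 0} = {0}" using ternary_quad_eq_0[OF that] by auto
        then show ?thesis by (simp only: rep_num_def) simp
      qed
      then have "reps 0 C = 1" if "C \<in> X" for C using rep_ternary[OF that] by (simp add: reps_def)
      then have "avg 0 = (\<Sum>C\<in>X. mass C)" by (simp add: avg_def)
      then show "real (rep_num (int m ^ 2) M) * of_rat (genus_mass M) = avg m"
        using True C0(2)[of 0] \<open>\<And>C. C \<in> X \<Longrightarrow> reps 0 C = 1\<close>[OF C0(1)] by (simp add: mass_sum)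
    next
      case False
      then obtain n1 n2 where n: "m = n1 * n2" "prime_factors n1 \<subseteq> bad_primes M" "\<forall>p\<in>bad_primes M. coprime n2 p"
        using S_part_decomposition by blast
      have pos: "n1 > 0" "n2 > 0" using n False by auto
      \<comment> \<open>The part \<open>n1\<close> supported on S is fixed along the walk; only the
        part prime to S varies within the span.\<close>
      have "reps m \<in> hecke_span n1" by (rule hecke_span.base[OF pos(2) n(3)]) (simp add: n(1))
      then have "reps m C0 * (\<Sum>C\<in>X. mass C) = (\<Sum>C\<in>X. mass C * reps m C)"
        using walk_invariant_value[OF C0(1), of "hecke_span n1"] regular_hecke_span[OF reg pos(1) n(2)]
          genus_connected[OF M rep] unfolding edges_eq by blast
      then show "real (rep_num (int m ^ 2) M) * of_rat (genus_mass M) = avg m"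
        by (simp add: C0(2) mass_sum avg_def)
    qed
  qed
next
  assume eq: "\<forall>n::int. of_nat (rep_num (n ^ 2) M) = genus_rep_num (n ^ 2) M"
  have eq': "real (rep_num (int m ^ 2) M) * of_rat (genus_mass M) = avg m" for m
    using eq[rule_format, of "int m"] unfolding rep_num_eq_genus_iff .
  show "strongly_s_regular M"
    unfolding strongly_s_regular_def
  proof (intro conjI allI impI)
    show "\<exists>m::int. m > 0 \<and> represents M (m ^ 2)" using rep by (intro exI[of _ 1]) simp
  next
    fix n n1 n2 :: nat
    assume n: "n > 0" "n = n1 * n2" "prime_factors n1 \<subseteq> bad_primes M" "\<forall>p\<in>bad_primes M. coprime n2 p"
    have pos: "n1 > 0" "n2 > 0" using n by auto
    have "real (rep_num (int (n1 * n2) ^ 2) M) * of_rat (genus_mass M) =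
        real (rep_num (int n1 ^ 2) M) * of_rat (genus_mass M) * of_rat (h_product M (n1 * n2))"
      unfolding eq' by (rule avg_h_product[OF pos n(3,4)])
    then have "real (rep_num (int (n1 * n2) ^ 2) M) = real (rep_num (int n1 ^ 2) M) * of_rat (h_product M (n1 * n2))"
      using genus_mass_pos by simp
    then have "(of_rat (of_nat (rep_num (int n1 ^ 2 * int n2 ^ 2) M)) :: real) =
        of_rat (of_nat (rep_num (int n1 ^ 2) M) * h_product M n)"
      by (simp add: of_rat_mult n(2) power_mult_distrib)
    then show "of_nat (rep_num (int n1 ^ 2 * int n2 ^ 2) M) = of_nat (rep_num (int n1 ^ 2) M) *
        (\<Prod>p\<in>prime_factors n - bad_primes M. h_factor M p (multiplicity p n))"
      unfolding of_rat_eq_iff h_product_def .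
  qed
qed

end

theorem theorem4p9:
  fixes M :: "rat ^ 3 ^ 3"
  assumes "ternary_lattice M" and "represents M 1"
  shows "strongly_s_regular M \<longleftrightarrow>
         (\<forall>n::int. of_nat (rep_num (n ^ 2) M) = genus_rep_num (n ^ 2) M)"
proof -
  interpret genus_walk M by unfold_locales fact+
  show ?thesis by (rule regular_iff_genus)
qed

end
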